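(* Let $n\ge 2$ and $r\ge 1$ be integers and let $q\in\mathbb{C}$ with $q\ne 0$ and $q\ne -1$. Assume that $[n]_q\ne 0$, that $[n-2]^!_q\ne 0$, and that $$q\ne \frac{-\lambda\pm\sqrt{-1-2\lambda}}{1+\lambda}$$ for every $\lambda\ne -1$ of the form $\lambda=\cos(2k\pi/m)$ with $k\in\mathbb{Z}$ and $m\in\mathbb{Z}_{\ge 1}$ (both choices of sign being excluded). Let $\delta'\neq 0$ be a complex number. Let $TW_n$ act diagonally on $\mathbf{E}^{\otimes r}$ via $t_i\mapsto\overline{S}_i$, and let the generators $s_i$, $e_i$ ($1\le i\le r-1$) and $p_j$ ($1\le j\le r$) of the partial Brauer algebra $\mathcal{P}\mathfrak{B}_r(n,\delta')$ act on $\mathbf{E}^{\otimes r}$ as $\overline{s}_i$, $\overline{e}_i$, $\delta'\,\overline{p}_j$ respectively. Then this makes $\mathbf{E}^{\otimes r}$ a $(\mathbb{C}[TW_n],\mathcal{P}\mathfrak{B}_r(n,\delta'))$-bimodule which satisfies Schur–Weyl duality: the image of $\mathbb{C}[TW_n]$ in $\mathrm{End}(\mathbf{E}^{\otimes r})$ is equal to the full centralizer of the action of $\mathcal{P}\mathfrak{B}_r(n,\delta')$, and the image of $\mathcal{P}\mathfrak{B}_r(n,\delta')$ in $\mathrm{End}(\mathbf{E}^{\otimes r})$ is equal to the full centralizer of the action of $TW_n$. Finally, the action of $\mathcal{P}\mathfrak{B}_r(n,\delta')$ is faithful if and only if $n>r$.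
   Context: For an integer $k\ge 0$, $[k]_q=1+q+\cdots+q^{k-1}$ (so $[0]_q=0$) and $[k]^!_q=[1]_q[2]_q\cdots[k]_q$ (so $[0]^!_q=1$). $\mathbf{E}$ is a complex vector space with basis $\mathbf{e}_1,\dots,\mathbf{e}_n$, equipped with the nondegenerate symmetric bilinear form $\langle \mathbf{e}_i,\mathbf{e}_j\rangle=\delta_{ij}q^{j-1}$. Put $\boldsymbol{\ell}_0=\mathbf{e}_1+\cdots+\mathbf{e}_n$, $\mathbf{L}=\mathbb{C}\boldsymbol{\ell}_0$ and $\mathbf{F}=\bigoplus_{i=1}^{n-1}\mathbb{C}(q\mathbf{e}_i-\mathbf{e}_{i+1})=\mathbf{L}^\perp$. When $[n]_q\neq 0$, $\mathbf{E}=\mathbf{L}\oplus\mathbf{F}$ is an orthogonal decomposition and the form is nondegenerate on each summand. The twin group $TW_n$ is the group generated by $t_1,\dots,t_{n-1}$ subject to $t_i^2=1$ and $t_it_j=t_jt_i$ if $|i-j|>1$. The assignment $t_i\mapsto \overline{S}_i$ is a representation of $TW_n$ on $\mathbf{E}$, where $$\overline{S}_i\mathbf{e}_i=\tfrac{1}{1+q}\big((1-q)\mathbf{e}_i+2\mathbf{e}_{i+1}\big),\quad \overline{S}_i\mathbf{e}_{i+1}=\tfrac{1}{1+q}\big(2q\,\mathbf{e}_i-(1-q)\mathbf{e}_{i+1}\big),\quad \overline{S}_i\mathbf{e}_j=\mathbf{e}_j\ (j\ne i,i+1).$$ Operators on $\mathbf{E}^{\otimes r}$: let $\mathbf{u}_0=[n]_q^{-1/2}\boldsymbol{\ell}_0$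 (a choice of square root being fixed) and let $\mathbf{u}_1,\dots,\mathbf{u}_{n-1}$ be any orthonormal basis of $\mathbf{F}$, so $\mathbf{u}_0,\dots,\mathbf{u}_{n-1}$ is an orthonormal basis of $\mathbf{E}$. On $u=\mathbf{u}_{k_1}\otimes\cdots\otimes\mathbf{u}_{k_r}$ with $k_\alpha\in\{0,\dots,n-1\}$: $\overline{s}_i(u)$ is $u$ with the factors in positions $i,i+1$ interchanged; $\overline{e}_i(u)$ is $\delta_{k_i,k_{i+1}}$ times the vector obtained from $u$ by replacing the factors in positions $i,i+1$ by $\sum_{k=0}^{n-1}\mathbf{u}_k\otimes\mathbf{u}_k$; $\overline{p}_j(u)$ is $u$ with the factor $\mathbf{u}_{k_j}$ in position $j$ replaced by $\pi(\mathbf{u}_{k_j})$, where $\pi:\mathbf{E}\to\mathbf{L}$ is the orthogonal projection. The partial Brauer algebra $\mathcal{P}\mathfrak{B}_r(\delta,\delta')$ ($\delta,\delta'\in\mathbb{C}$) is the complex algebra with basis all set partitions of $\{1,\dots,r,1',\dots,r'\}$ into blocks of size at most two, drawn as graphs with top vertices $1,\dots,r$ and bottom vertices $1',\dots,r'$, with an edge joining the two vertices of each two-element block. The product is $d_1d_2=\delta^{N_1}\delta'^{N_2}\,d_1\circ d_2$: stack $d_1$ above $d_2$ identifying the bottom row of $d_1$ with the top row of $d_2$; two vertices of the remaining outer rows are joined in $d_1\circ d_2$ iff there is a path between them; $N_1$ is the number of connected components lying entirely in the middle row which are closed loops, and $N_2$ is the number of connected components lying entirely in the middle row which are not loops (isolated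 vertices or paths). It is generated by $s_i=\{\{i,(i+1)'\},\{i+1,i'\}\}\cup\{\{j,j'\}:j\ne i,i+1\}$, $e_i=\{\{i,i+1\},\{i',(i+1)'\}\}\cup\{\{j,j'\}:j\neq i,i+1\}$ for $1\le i\le r-1$, and $p_j=\{\{j\},\{j'\}\}\cup\{\{k,k'\}:k\ne j\}$ for $1\le j\le r$. *)

theory Defs
  imports Complex_Main "HOL-Library.FuncSet" "HOL-Library.Function_Algebras"
    "HOL-Library.Disjoint_Sets" "HOL-Combinatorics.Transposition"
    "HOL-Algebra.Bij" "HOL-Algebra.Module"
begin

section \<open>q-numbers\<close>

definition qint :: "complex \<Rightarrow> nat \<Rightarrow> complex" where
  "qint q k = (\<Sum>i<k. q ^ i)"

definition qfact :: "complex \<Rightarrow> nat \<Rightarrow> complex" where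
  "qfact q k = (\<Prod>i=1..k. qint q i)"


section \<open>Linear algebra in spaces of complex-valued functions\<close>

text \<open>Addition of functions is pointwise. All vector spaces below are
  subspaces of a function space, and operators on them are extensional functions, so that equality
  of operators is equality of functions.\<close>

definition vscale :: "complex \<Rightarrow> ('a \<Rightarrow> complex) \<Rightarrow> 'a \<Rightarrow> complex" (infixr "*\<^sub>v" 75) where
  "c *\<^sub>v x = (\<lambda>i. c * x i)"

global_interpretation cfun: vector_space "(*\<^sub>v)"
  by unfold_locales (auto simp: vscale_def algebra_simps)

definition endo :: "('a \<Rightarrow> complex) set \<Rightarrow> (('a \<Rightarrow> complex) \<Rightarrow> 'a \<Rightarrow> complex) set" where
  "endo V = {T \<in> V \<rightarrow>\<^sub>E V. (\<forall>x\<in>V. \<forall>y\<in>V. T (x + y) = T x + T y) \<and>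
                         (\<forall>c. \<forall>x\<in>V. T (c *\<^sub>v x) = c *\<^sub>v T x)}"

definition GL :: "('a \<Rightarrow> complex) set \<Rightarrow> (('a \<Rightarrow> complex) \<Rightarrow> 'a \<Rightarrow> complex) monoid" where
  "GL V = (BijGroup V)\<lparr>carrier := endo V \<inter> Bij V\<rparr>"

definition centralizer ::
    "('a \<Rightarrow> complex) set \<Rightarrow> (('a \<Rightarrow> complex) \<Rightarrow> 'a \<Rightarrow> complex) set \<Rightarrow>
     (('a \<Rightarrow> complex) \<Rightarrow> 'a \<Rightarrow> complex) set" where
  "centralizer V X = {T \<in> endo V. \<forall>S\<in>X. compose V T S = compose V S T}"

definition is_basis :: "('a \<Rightarrow> complex) set \<Rightarrow> 'i set \<Rightarrow> ('i \<Rightarrow> 'a \<Rightarrow> complex) \<Rightarrow> bool" where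
  "is_basis V I b \<longleftrightarrow> inj_on b I \<and> cfun.independent (b ` I) \<and> cfun.span (b ` I) = V"

text \<open>The operator on \<open>V\<close> with prescribed values on a basis of \<open>V\<close>; meaningful only if
  \<open>is_basis V I b\<close> (see \<open>lin_ext\<close> below).\<close>

definition lin_ext ::
    "('a \<Rightarrow> complex) set \<Rightarrow> 'i set \<Rightarrow> ('i \<Rightarrow> 'a \<Rightarrow> complex) \<Rightarrow> ('i \<Rightarrow> 'a \<Rightarrow> complex) \<Rightarrow>
     ('a \<Rightarrow> complex) \<Rightarrow> 'a \<Rightarrow> complex" where
  "lin_ext V I b f = (THE T. T \<in> endo V \<and> (\<forall>i\<in>I. T (b i) = f i))"

global_interpretation cfun_pair: vector_space_pair "(*\<^sub>v)" "(*\<^sub>v)" ..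

lemma lin_ext:
  assumes b: "is_basis V I b" and f: "\<And>i. i \<in> I \<Longrightarrow> f i \<in> V"
  shows "lin_ext V I b f \<in> endo V" and "i \<in> I \<Longrightarrow> lin_ext V I b f (b i) = f i"
proof -
  have inj: "inj_on b I" and ind: "cfun.independent (b ` I)" and V: "V = cfun.span (b ` I)"
    using b by (auto simp: is_basis_def)
  have sub: "x + y \<in> V" "c *\<^sub>v x \<in> V" if "x \<in> V" "y \<in> V" for x y c
    using that by (auto simp: V cfun.span_add cfun.span_scale)
  define g where "g = f \<circ> the_inv_into I b"
  define L where "L = cfun_pair.construct (b ` I) g"
  have lin: "Vector_Spaces.linear (*\<^sub>v) (*\<^sub>v) L"
    unfolding L_def by (rule cfun_pair.linear_construct[OF ind])
  have Lb: "L (b i) = f i" if "i \<in> I" for i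
    unfolding L_def using cfun_pair.construct_basis[OF ind, of "b i" g] that
    by (simp add: g_def the_inv_into_f_f[OF inj])
  have "g ` b ` I \<subseteq> V"
    using f by (auto simp: g_def the_inv_into_f_f[OF inj])
  then have "cfun.span (g ` b ` I) \<subseteq> V"
    unfolding V by (metis cfun.span_minimal cfun.subspace_span)
  then have LV: "L v \<in> V" if "v \<in> V" for v
    using cfun_pair.construct_in_span[OF ind, of g v] by (auto simp: L_def)
  have ex: "restrict L V \<in> endo V \<and> (\<forall>i\<in>I. restrict L V (b i) = f i)"
  proof -
    have "b i \<in> V" if "i \<in> I" for i
      using that by (auto simp: V cfun.span_base)
    moreover have "L (x + y) = L x + L y" "L (c *\<^sub>v x) = c *\<^sub>v L x" for x y c
      using lin by (auto simp: Vector_Spaces.linear_iff)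
    ultimately show ?thesis
      using LV sub Lb by (auto simp: endo_def)
  qed
  have uni: "T = T'" if T: "T \<in> endo V" "\<forall>i\<in>I. T (b i) = f i"
    and T': "T' \<in> endo V" "\<forall>i\<in>I. T' (b i) = f i" for T T'
  proof (rule extensionalityI[where A = V])
    show "T \<in> extensional V" "T' \<in> extensional V"
      using T T' by (auto simp: endo_def PiE_def)
    fix x assume "x \<in> V"
    then have "x \<in> cfun.span (b ` I)" by (simp add: V)
    then have "x \<in> V \<and> T x = T' x"
    proof (induction rule: cfun.span_induct_alt)
      case base
      have "0 \<in> V" by (simp add: V cfun.span_zero)
      moreover have "T (0 *\<^sub>v 0) = 0 *\<^sub>v T 0" "T' (0 *\<^sub>v 0) = 0 *\<^sub>v T' 0"
        using T T' \<open>0 \<in> V\<close> unfolding endo_def by blast+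
      ultimately show ?case by (metis cfun.scale_zero_left)
    next
      case (step c x y)
      obtain i where i: "i \<in> I" "x = b i" using step by blast
      have x: "x \<in> V" using step by (simp only: V cfun.span_base)
      have y: "y \<in> V" "T y = T' y" using step by blast+
      have cx: "c *\<^sub>v x \<in> V" using sub(2)[OF x x] .
      have *: "S (c *\<^sub>v x + y) = c *\<^sub>v S x + S y" if "S \<in> endo V" for S
      proof -
        have "S (c *\<^sub>v x + y) = S (c *\<^sub>v x) + S y" "S (c *\<^sub>v x) = c *\<^sub>v S x"
          using that x cx y(1) unfolding endo_def by blast+
        then show ?thesis by (simp only:)
      qed
      have "T x = T' x" using T(2) T'(2) i by metis
      then show ?case using sub(1)[OF cx y(1)] y(2) *[OF T(1)] *[OF T'(1)] by (simp only:)
    qed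
    then show "T x = T' x" by simp
  qed
  have *: "lin_ext V I b f = restrict L V"
    unfolding lin_ext_def
  proof (rule the_equality)
    show "restrict L V \<in> endo V \<and> (\<forall>i\<in>I. restrict L V (b i) = f i)" by (rule ex)
    show "T = restrict L V" if "T \<in> endo V \<and> (\<forall>i\<in>I. T (b i) = f i)" for T
      using that ex by (intro uni) blast+
  qed
  show "lin_ext V I b f \<in> endo V" "i \<in> I \<Longrightarrow> lin_ext V I b f (b i) = f i"
    using ex by (simp_all only: *)
qed


section \<open>The space \<open>sp_E n\<close> and its tensor powers\<close>

definition supported :: "'a set \<Rightarrow> ('a \<Rightarrow> complex) set" where
  "supported I = {x. \<forall>i. i \<notin> I \<longrightarrow> x i = 0}"

definition delta :: "'a \<Rightarrow> 'a \<Rightarrow> complex" where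
  "delta i = (\<lambda>j. if j = i then 1 else 0)"

text \<open>The basis vector \<open>e_i\<close> of \<open>sp_E n\<close> is \<open>delta i\<close>, \<open>1 \<le> i \<le> n\<close>.\<close>

definition sp_E :: "nat \<Rightarrow> (nat \<Rightarrow> complex) set" where
  "sp_E n = supported {1..n}"

definition form :: "nat \<Rightarrow> complex \<Rightarrow> (nat \<Rightarrow> complex) \<Rightarrow> (nat \<Rightarrow> complex) \<Rightarrow> complex" where
  "form n q x y = (\<Sum>j=1..n. x j * y j * q ^ (j - 1))"

definition ell0 :: "nat \<Rightarrow> nat \<Rightarrow> complex" where
  "ell0 n = (\<Sum>i=1..n. delta i)"

definition sp_L :: "nat \<Rightarrow> (nat \<Rightarrow> complex) set" where
  "sp_L n = cfun.span {ell0 n}"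

definition sp_F :: "nat \<Rightarrow> complex \<Rightarrow> (nat \<Rightarrow> complex) set" where
  "sp_F n q = cfun.span ((\<lambda>i. q *\<^sub>v delta i - delta (i + 1)) ` {1..<n})"

definition orthonormal_basis ::
    "nat \<Rightarrow> complex \<Rightarrow> (nat \<Rightarrow> complex) set \<Rightarrow> 'i set \<Rightarrow> ('i \<Rightarrow> nat \<Rightarrow> complex) \<Rightarrow> bool" where
  "orthonormal_basis n q W I u \<longleftrightarrow> is_basis W I u \<and>
     (\<forall>i\<in>I. \<forall>j\<in>I. form n q (u i) (u j) = (if i = j then 1 else 0))"

text \<open>The orthogonal projection onto \<open>sp_L n\<close>.\<close>

definition proj :: "nat \<Rightarrow> complex \<Rightarrow> (nat \<Rightarrow> complex) \<Rightarrow> nat \<Rightarrow> complex" where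
  "proj n q x = (THE y. y \<in> sp_L n \<and> (\<forall>z\<in>sp_L n. form n q (x - y) z = 0))"

definition Sbar :: "nat \<Rightarrow> complex \<Rightarrow> nat \<Rightarrow> (nat \<Rightarrow> complex) \<Rightarrow> nat \<Rightarrow> complex" where
  "Sbar n q i = lin_ext (sp_E n) {1..n} delta (\<lambda>j.
     if j = i then (1 / (1 + q)) *\<^sub>v ((1 - q) *\<^sub>v delta i + 2 *\<^sub>v delta (i + 1))
     else if j = i + 1 then (1 / (1 + q)) *\<^sub>v ((2 * q) *\<^sub>v delta i - (1 - q) *\<^sub>v delta (i + 1))
     else delta j)"

text \<open>The \<open>r\<close>-th tensor power of \<open>sp_E n\<close>: a tensor is the family of its coefficients with respect to
  the basis \<open>e_(k 1) \<otimes> \<dots> \<otimes> e_(k r)\<close>, indexed by \<open>k \<in> {1..r} \<rightarrow>\<^sub>E {1..n}\<close>; \<open>ptens n r w\<close> is the pure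
  tensor \<open>w 1 \<otimes> \<dots> \<otimes> w r\<close>.\<close>

definition Tens :: "nat \<Rightarrow> nat \<Rightarrow> ((nat \<Rightarrow> nat) \<Rightarrow> complex) set" where
  "Tens n r = supported ({1..r} \<rightarrow>\<^sub>E {1..n})"

definition ptens :: "nat \<Rightarrow> nat \<Rightarrow> (nat \<Rightarrow> nat \<Rightarrow> complex) \<Rightarrow> (nat \<Rightarrow> nat) \<Rightarrow> complex" where
  "ptens n r w = (\<lambda>k. if k \<in> {1..r} \<rightarrow>\<^sub>E {1..n} then \<Prod>j=1..r. w j (k j) else 0)"

definition tens_op ::
    "nat \<Rightarrow> nat \<Rightarrow> ((nat \<Rightarrow> complex) \<Rightarrow> nat \<Rightarrow> complex) \<Rightarrow>
     ((nat \<Rightarrow> nat) \<Rightarrow> complex) \<Rightarrow> (nat \<Rightarrow> nat) \<Rightarrow> complex" where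
  "tens_op n r T = lin_ext (Tens n r) ({1..r} \<rightarrow>\<^sub>E {1..n})
     (\<lambda>k. ptens n r (\<lambda>j. delta (k j))) (\<lambda>k. ptens n r (\<lambda>j. T (delta (k j))))"

text \<open>The operators given on the basis \<open>u (k 1) \<otimes> \<dots> \<otimes> u (k r)\<close>, \<open>k \<in> {1..r} \<rightarrow>\<^sub>E {0..<n}\<close>, where
  \<open>u 0, \<dots>, u (n - 1)\<close> is a basis of \<open>sp_E n\<close>.\<close>

definition utens ::
    "nat \<Rightarrow> nat \<Rightarrow> (nat \<Rightarrow> nat \<Rightarrow> complex) \<Rightarrow> (nat \<Rightarrow> nat) \<Rightarrow> (nat \<Rightarrow> nat) \<Rightarrow> complex" where
  "utens n r u k = ptens n r (\<lambda>j. u (k j))"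

definition sbar ::
    "nat \<Rightarrow> nat \<Rightarrow> (nat \<Rightarrow> nat \<Rightarrow> complex) \<Rightarrow> nat \<Rightarrow>
     ((nat \<Rightarrow> nat) \<Rightarrow> complex) \<Rightarrow> (nat \<Rightarrow> nat) \<Rightarrow> complex" where
  "sbar n r u i = lin_ext (Tens n r) ({1..r} \<rightarrow>\<^sub>E {0..<n}) (utens n r u)
     (\<lambda>k. utens n r u (k \<circ> transpose i (i + 1)))"

definition ebar ::
    "nat \<Rightarrow> nat \<Rightarrow> (nat \<Rightarrow> nat \<Rightarrow> complex) \<Rightarrow> nat \<Rightarrow>
     ((nat \<Rightarrow> nat) \<Rightarrow> complex) \<Rightarrow> (nat \<Rightarrow> nat) \<Rightarrow> complex" where
  "ebar n r u i = lin_ext (Tens n r) ({1..r} \<rightarrow>\<^sub>E {0..<n}) (utens n r u)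
     (\<lambda>k. (if k i = k (i + 1) then 1 else 0) *\<^sub>v
          (\<Sum>m=0..<n. utens n r u (k(i := m, i + 1 := m))))"

definition pbar ::
    "nat \<Rightarrow> complex \<Rightarrow> nat \<Rightarrow> (nat \<Rightarrow> nat \<Rightarrow> complex) \<Rightarrow> nat \<Rightarrow>
     ((nat \<Rightarrow> nat) \<Rightarrow> complex) \<Rightarrow> (nat \<Rightarrow> nat) \<Rightarrow> complex" where
  "pbar n q r u j = lin_ext (Tens n r) ({1..r} \<rightarrow>\<^sub>E {0..<n}) (utens n r u)
     (\<lambda>k. ptens n r ((\<lambda>a. u (k a))(j := proj n q (u (k j)))))"


section \<open>Groups given by generators and relations; the twin group\<close>

text \<open>Words over \<open>X\<close> are lists of signed letters, \<open>(x, True)\<close> standing for \<open>x\<close> and \<open>(x, False)\<close>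
  for its inverse. The group is the quotient by the congruence generated by free reduction and the
  relations \<open>R\<close>.\<close>

type_synonym 'a word = "('a \<times> bool) list"

definition words :: "'a set \<Rightarrow> 'a word set" where
  "words X = lists (X \<times> UNIV)"

inductive pres_eq :: "'a set \<Rightarrow> ('a word \<times> 'a word) set \<Rightarrow> 'a word \<Rightarrow> 'a word \<Rightarrow> bool" for X R where
  refl: "v \<in> words X \<Longrightarrow> pres_eq X R v v"
| sym: "pres_eq X R v w \<Longrightarrow> pres_eq X R w v"
| trans: "pres_eq X R v w \<Longrightarrow> pres_eq X R w z \<Longrightarrow> pres_eq X R v z"
| mult: "pres_eq X R v w \<Longrightarrow> pres_eq X R v' w' \<Longrightarrow> pres_eq X R (v @ v') (w @ w')"
| cancel: "x \<in> X \<Longrightarrow> pres_eq X R [(x, s), (x, \<not> s)] []"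
| rel: "(v, w) \<in> R \<Longrightarrow> v \<in> words X \<Longrightarrow> w \<in> words X \<Longrightarrow> pres_eq X R v w"

definition pres_rel :: "'a set \<Rightarrow> ('a word \<times> 'a word) set \<Rightarrow> ('a word \<times> 'a word) set" where
  "pres_rel X R = {(v, w). pres_eq X R v w}"

definition presented_group :: "'a set \<Rightarrow> ('a word \<times> 'a word) set \<Rightarrow> 'a word set monoid" where
  "presented_group X R =
     \<lparr>carrier = words X // pres_rel X R,
      mult = (\<lambda>A B. \<Union>v\<in>A. \<Union>w\<in>B. pres_rel X R `` {v @ w}),
      one = pres_rel X R `` {[]}\<rparr>"

lemma pres_eq_words: "pres_eq X R v w \<Longrightarrow> v \<in> words X \<and> w \<in> words X"
  by (induction rule: pres_eq.induct) (auto simp: words_def)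

lemma equiv_pres_rel: "equiv (words X) (pres_rel X R)"
proof (rule equivI)
  show "pres_rel X R \<subseteq> words X \<times> words X"
    by (auto simp: pres_rel_def dest: pres_eq_words)
  show "refl_on (words X) (pres_rel X R)"
    by (auto simp: pres_rel_def refl_on_def intro: pres_eq.refl)
  show "sym (pres_rel X R)"
    by (auto simp: pres_rel_def sym_def intro: pres_eq.sym)
  show "trans (pres_rel X R)"
    unfolding pres_rel_def trans_def by (blast intro: pres_eq.trans)
qed

lemma presented_group_mult_class:
  assumes "v \<in> words X" "w \<in> words X"
  shows "(pres_rel X R `` {v}) \<otimes>\<^bsub>presented_group X R\<^esub> (pres_rel X R `` {w}) =
    pres_rel X R `` {v @ w}"
proof -
  let ?c = "\<lambda>v. pres_rel X R `` {v}"
  have *: "?c (v' @ w') = ?c (v @ w)" if "v' \<in> ?c v" "w' \<in> ?c w" for v' w'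
  proof -
    have "pres_eq X R (v @ w) (v' @ w')"
      using that by (auto simp: pres_rel_def intro: pres_eq.mult)
    then have "(v @ w, v' @ w') \<in> pres_rel X R" by (simp add: pres_rel_def)
    then show ?thesis using equiv_class_eq[OF equiv_pres_rel] by blast
  qed
  have self: "v \<in> ?c v" "w \<in> ?c w"
    using assms equiv_class_self[OF equiv_pres_rel] by blast+
  have "(\<Union>v'\<in>?c v. \<Union>w'\<in>?c w. ?c (v' @ w')) = (\<Union>v'\<in>?c v. \<Union>w'\<in>?c w. ?c (v @ w))"
    by (rule SUP_cong[OF HOL.refl], rule SUP_cong[OF HOL.refl]) (rule *)
  also have "\<dots> = ?c (v @ w)"
    using self by blast
  finally show ?thesis by (simp only: presented_group_def monoid.simps)
qed

lemma group_presented_group: "group (presented_group X R)"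
proof -
  let ?G = "presented_group X R" and ?c = "\<lambda>v. pres_rel X R `` {v}"
  have carrier: "A \<in> carrier ?G \<longleftrightarrow> (\<exists>v\<in>words X. A = ?c v)" for A
    by (auto simp: presented_group_def quotient_def)
  have app: "v @ w \<in> words X" if "v \<in> words X" "w \<in> words X" for v w
    using that by (auto simp: words_def)
  have Nil: "[] \<in> words X" by (simp add: words_def)
  have one: "\<one>\<^bsub>?G\<^esub> = ?c []" by (simp add: presented_group_def)
  note m = presented_group_mult_class
  have inv: "\<exists>w\<in>words X. pres_eq X R (w @ v) []" if "v \<in> words X" for v
    using that
  proof (induction v)
    case Nil
    then show ?case by (intro bexI[of _ "[]"]) (auto simp: words_def intro: pres_eq.refl)
  next
    case (Cons a v)
    obtain x s where a: "a = (x, s)" by (cases a)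
    from Cons have x: "x \<in> X" and v: "v \<in> words X" by (auto simp: words_def a)
    then obtain w where w: "w \<in> words X" "pres_eq X R (w @ v) []" using Cons by blast
    have "pres_eq X R ([(x, \<not> s), (x, s)] @ v) ([] @ v)"
      using pres_eq.cancel[OF x, of R "\<not> s"] v
      by (intro pres_eq.mult) (auto intro: pres_eq.refl)
    then have "pres_eq X R (w @ ([(x, \<not> s), (x, s)] @ v)) (w @ ([] @ v))"
      by (rule pres_eq.mult[OF pres_eq.refl[OF w(1)]])
    then have "pres_eq X R ((w @ [(x, \<not> s)]) @ a # v) []"
      using w(2) by (simp add: a) (blast intro: pres_eq.trans)
    moreover have "w @ [(x, \<not> s)] \<in> words X" using w x by (auto simp: words_def)
    ultimately show ?case by blast
  qed
  show ?thesis
  proof (rule groupI)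
    show "A \<otimes>\<^bsub>?G\<^esub> B \<in> carrier ?G" if AB: "A \<in> carrier ?G" "B \<in> carrier ?G" for A B
    proof -
      obtain v w where "v \<in> words X" "w \<in> words X" "A = ?c v" "B = ?c w"
        using AB unfolding carrier by blast
      then show ?thesis
        using app[of v w] unfolding carrier by (intro bexI[of _ "v @ w"]) (simp_all only: m)
    qed
    show "\<one>\<^bsub>?G\<^esub> \<in> carrier ?G" using Nil unfolding carrier one by blast
    show "A \<otimes>\<^bsub>?G\<^esub> B \<otimes>\<^bsub>?G\<^esub> C = A \<otimes>\<^bsub>?G\<^esub> (B \<otimes>\<^bsub>?G\<^esub> C)"
      if ABC: "A \<in> carrier ?G" "B \<in> carrier ?G" "C \<in> carrier ?G" for A B C
    proof -
      obtain v w z where "v \<in> words X" "w \<in> words X" "z \<in> words X"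
        "A = ?c v" "B = ?c w" "C = ?c z"
        using ABC unfolding carrier by blast
      then show ?thesis using app by (simp only: m append_assoc)
    qed
    show "\<one>\<^bsub>?G\<^esub> \<otimes>\<^bsub>?G\<^esub> A = A" if A: "A \<in> carrier ?G" for A
    proof -
      obtain v where "v \<in> words X" "A = ?c v" using A unfolding carrier by blast
      then show ?thesis using Nil by (simp only: m one append_Nil)
    qed
    show "\<exists>B\<in>carrier ?G. B \<otimes>\<^bsub>?G\<^esub> A = \<one>\<^bsub>?G\<^esub>" if A: "A \<in> carrier ?G" for A
    proof -
      obtain v where v: "v \<in> words X" "A = ?c v" using A unfolding carrier by blast
      obtain w where w: "w \<in> words X" "pres_eq X R (w @ v) []" using inv[OF v(1)] by blast
      have "?c (w @ v) = ?c []"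
        using w(2) by (intro equiv_class_eq[OF equiv_pres_rel]) (simp add: pres_rel_def)
      then have "?c w \<otimes>\<^bsub>?G\<^esub> A = \<one>\<^bsub>?G\<^esub>" using v w by (simp only: m one)
      moreover have "?c w \<in> carrier ?G" using w(1) unfolding carrier by blast
      ultimately show ?thesis by blast
    qed
  qed
qed

definition twin_rels :: "nat \<Rightarrow> (nat word \<times> nat word) set" where
  "twin_rels n =
     {([(i, True), (i, True)], []) | i. i \<in> {1..<n}} \<union>
     {([(i, True), (j, True)], [(j, True), (i, True)]) | i j.
        i \<in> {1..<n} \<and> j \<in> {1..<n} \<and> \<bar>int i - int j\<bar> > 1}"

definition TW :: "nat \<Rightarrow> nat word set monoid" where
  "TW n = presented_group {1..<n} (twin_rels n)"

definition tw_gen :: "nat \<Rightarrow> nat \<Rightarrow> nat word set" where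
  "tw_gen n i = pres_rel {1..<n} (twin_rels n) `` {[(i, True)]}"


section \<open>Algebras, bimodules\<close>

text \<open>The algebra with basis \<open>B\<close> and product \<open>x y = c x y (m x y)\<close> (\<open>c x y\<close> a scalar) of basis
  elements \<open>x\<close>, \<open>y\<close>; its elements are the finitely supported functions on \<open>B\<close>.\<close>

definition basis_algebra ::
    "'b set \<Rightarrow> ('b \<Rightarrow> 'b \<Rightarrow> complex) \<Rightarrow> ('b \<Rightarrow> 'b \<Rightarrow> 'b) \<Rightarrow> 'b \<Rightarrow> (complex, 'b \<Rightarrow> complex) module" where
  "basis_algebra B c m e =
     \<lparr>carrier = {a. finite {x. a x \<noteq> 0} \<and> a \<in> supported B},
      mult = (\<lambda>a b. \<Sum>x | a x \<noteq> 0. \<Sum>y | b y \<noteq> 0. (a x * b y * c x y) *\<^sub>v delta (m x y)),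
      one = delta e,
      zero = 0,
      add = (+),
      smult = (*\<^sub>v)\<rparr>"

definition group_algebra :: "'g monoid \<Rightarrow> (complex, 'g \<Rightarrow> complex) module" where
  "group_algebra G = basis_algebra (carrier G) (\<lambda>_ _. 1) (monoid.mult G) \<one>\<^bsub>G\<^esub>"

definition linear_action ::
    "(complex, 'a) module \<Rightarrow> ('v \<Rightarrow> complex) set \<Rightarrow> ('a \<Rightarrow> ('v \<Rightarrow> complex) \<Rightarrow> 'v \<Rightarrow> complex) \<Rightarrow> bool" where
  "linear_action A V \<phi> \<longleftrightarrow>
     \<phi> \<in> carrier A \<rightarrow> endo V \<and>
     (\<forall>a\<in>carrier A. \<forall>b\<in>carrier A. \<forall>v\<in>V. \<phi> (a \<oplus>\<^bsub>A\<^esub> b) v = \<phi> a v + \<phi> b v) \<and>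
     (\<forall>c. \<forall>a\<in>carrier A. \<forall>v\<in>V. \<phi> (c \<odot>\<^bsub>A\<^esub> a) v = c *\<^sub>v \<phi> a v) \<and>
     (\<forall>v\<in>V. \<phi> \<one>\<^bsub>A\<^esub> v = v)"

text \<open>\<open>\<phi> a v\<close> is the left action \<open>a \<cdot> v\<close>, and \<open>\<rho> b v\<close> is the right action \<open>v \<cdot> b\<close>.\<close>

definition bimodule ::
    "(complex, 'a) module \<Rightarrow> (complex, 'b) module \<Rightarrow> ('v \<Rightarrow> complex) set \<Rightarrow>
     ('a \<Rightarrow> ('v \<Rightarrow> complex) \<Rightarrow> 'v \<Rightarrow> complex) \<Rightarrow> ('b \<Rightarrow> ('v \<Rightarrow> complex) \<Rightarrow> 'v \<Rightarrow> complex) \<Rightarrow> bool" where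
  "bimodule A B V \<phi> \<rho> \<longleftrightarrow>
     linear_action A V \<phi> \<and> linear_action B V \<rho> \<and>
     (\<forall>a\<in>carrier A. \<forall>a'\<in>carrier A. \<forall>v\<in>V. \<phi> (a \<otimes>\<^bsub>A\<^esub> a') v = \<phi> a (\<phi> a' v)) \<and>
     (\<forall>b\<in>carrier B. \<forall>b'\<in>carrier B. \<forall>v\<in>V. \<rho> (b \<otimes>\<^bsub>B\<^esub> b') v = \<rho> b' (\<rho> b v)) \<and>
     (\<forall>a\<in>carrier A. \<forall>b\<in>carrier B. \<forall>v\<in>V. \<rho> b (\<phi> a v) = \<phi> a (\<rho> b v))"

text \<open>Linear extension of a group action to the group algebra.\<close>

definition extend_action ::
    "('v \<Rightarrow> complex) set \<Rightarrow> ('g \<Rightarrow> ('v \<Rightarrow> complex) \<Rightarrow> 'v \<Rightarrow> complex) \<Rightarrow>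
     ('g \<Rightarrow> complex) \<Rightarrow> ('v \<Rightarrow> complex) \<Rightarrow> 'v \<Rightarrow> complex" where
  "extend_action V \<phi> a = (\<lambda>v\<in>V. \<Sum>g | a g \<noteq> 0. a g *\<^sub>v \<phi> g v)"


section \<open>The partial Brauer algebra\<close>

text \<open>\<open>Inl i\<close> is the top vertex \<open>i\<close> and \<open>Inr i\<close> the bottom vertex \<open>i'\<close>.\<close>

type_synonym diagram = "(nat + nat) set set"

definition pb_verts :: "nat \<Rightarrow> (nat + nat) set" where
  "pb_verts r = {1..r} <+> {1..r}"

definition pb_diagrams :: "nat \<Rightarrow> diagram set" where
  "pb_diagrams r = {d. partition_on (pb_verts r) d \<and> (\<forall>b\<in>d. card b \<le> 2)}"

definition pb_edges :: "diagram \<Rightarrow> ((nat + nat) \<times> (nat + nat)) set" where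
  "pb_edges d = {(x, y). x \<noteq> y \<and> {x, y} \<in> d}"

datatype row = Top | Mid | Bot

definition upper :: "nat + nat \<Rightarrow> row \<times> nat" where
  "upper = case_sum (Pair Top) (Pair Mid)"

definition lower :: "nat + nat \<Rightarrow> row \<times> nat" where
  "lower = case_sum (Pair Mid) (Pair Bot)"

definition outer :: "nat + nat \<Rightarrow> row \<times> nat" where
  "outer = case_sum (Pair Top) (Pair Bot)"

definition upper_edges :: "diagram \<Rightarrow> ((row \<times> nat) \<times> (row \<times> nat)) set" where
  "upper_edges d1 = map_prod upper upper ` pb_edges d1"

definition lower_edges :: "diagram \<Rightarrow> ((row \<times> nat) \<times> (row \<times> nat)) set" where
  "lower_edges d2 = map_prod lower lower ` pb_edges d2"

text \<open>Existence of a path in the graph obtained by stacking \<open>d1\<close> above \<open>d2\<close>.\<close>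

definition joined :: "diagram \<Rightarrow> diagram \<Rightarrow> ((row \<times> nat) \<times> (row \<times> nat)) set" where
  "joined d1 d2 = (upper_edges d1 \<union> lower_edges d2)\<^sup>*"

definition pb_comp :: "nat \<Rightarrow> diagram \<Rightarrow> diagram \<Rightarrow> diagram" where
  "pb_comp r d1 d2 = pb_verts r //
     {(x, y). x \<in> pb_verts r \<and> y \<in> pb_verts r \<and> (outer x, outer y) \<in> joined d1 d2}"

definition mid_components :: "nat \<Rightarrow> diagram \<Rightarrow> diagram \<Rightarrow> (row \<times> nat) set set" where
  "mid_components r d1 d2 =
     {C \<in> (\<lambda>i. joined d1 d2 `` {(Mid, i)}) ` {1..r}. C \<subseteq> {Mid} \<times> {1..r}}"

text \<open>In the stacked graph, a vertex of the middle row has at most one edge coming from \<open>d1\<close> and at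
  most one coming from \<open>d2\<close>; these are distinct edges even if they have the same end points (they
  then form a loop on two vertices). So a component in the middle row is a closed loop iff each of
  its vertices has one edge of either kind.\<close>

definition is_loop :: "diagram \<Rightarrow> diagram \<Rightarrow> (row \<times> nat) set \<Rightarrow> bool" where
  "is_loop d1 d2 C \<longleftrightarrow> C \<subseteq> Domain (upper_edges d1) \<inter> Domain (lower_edges d2)"

definition n_loops :: "nat \<Rightarrow> diagram \<Rightarrow> diagram \<Rightarrow> nat" where
  "n_loops r d1 d2 = card {C \<in> mid_components r d1 d2. is_loop d1 d2 C}"

definition n_nonloops :: "nat \<Rightarrow> diagram \<Rightarrow> diagram \<Rightarrow> nat" where
  "n_nonloops r d1 d2 = card {C \<in> mid_components r d1 d2. \<not> is_loop d1 d2 C}"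

definition strands :: "nat set \<Rightarrow> diagram" where
  "strands J = (\<lambda>j. {Inl j, Inr j}) ` J"

definition PB :: "nat \<Rightarrow> complex \<Rightarrow> complex \<Rightarrow> (complex, diagram \<Rightarrow> complex) module" where
  "PB r \<delta> \<delta>' = basis_algebra (pb_diagrams r)
     (\<lambda>d1 d2. \<delta> ^ n_loops r d1 d2 * \<delta>' ^ n_nonloops r d1 d2) (pb_comp r) (strands {1..r})"

definition s_diag :: "nat \<Rightarrow> nat \<Rightarrow> diagram" where
  "s_diag r i = {{Inl i, Inr (i + 1)}, {Inl (i + 1), Inr i}} \<union> strands ({1..r} - {i, i + 1})"

definition e_diag :: "nat \<Rightarrow> nat \<Rightarrow> diagram" where
  "e_diag r i = {{Inl i, Inl (i + 1)}, {Inr i, Inr (i + 1)}} \<union> strands ({1..r} - {i, i + 1})"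

definition p_diag :: "nat \<Rightarrow> nat \<Rightarrow> diagram" where
  "p_diag r j = {{Inl j}, {Inr j}} \<union> strands ({1..r} - {j})"


section \<open>The two actions on the tensor power\<close>

definition tw_rep ::
    "nat \<Rightarrow> complex \<Rightarrow> (nat word set \<Rightarrow> (nat \<Rightarrow> complex) \<Rightarrow> nat \<Rightarrow> complex) \<Rightarrow> bool" where
  "tw_rep n q \<tau> \<longleftrightarrow> \<tau> \<in> hom (TW n) (GL (sp_E n)) \<and> (\<forall>i\<in>{1..<n}. \<tau> (tw_gen n i) = Sbar n q i)"

definition pb_generators_act ::
    "nat \<Rightarrow> complex \<Rightarrow> nat \<Rightarrow> complex \<Rightarrow> (nat \<Rightarrow> nat \<Rightarrow> complex) \<Rightarrow>
     ((diagram \<Rightarrow> complex) \<Rightarrow> ((nat \<Rightarrow> nat) \<Rightarrow> complex) \<Rightarrow> (nat \<Rightarrow> nat) \<Rightarrow> complex) \<Rightarrow> bool" where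
  "pb_generators_act n q r \<delta>' u \<rho> \<longleftrightarrow>
     (\<forall>i\<in>{1..<r}. \<rho> (delta (s_diag r i)) = sbar n r u i) \<and>
     (\<forall>i\<in>{1..<r}. \<rho> (delta (e_diag r i)) = ebar n r u i) \<and>
     (\<forall>j\<in>{1..r}. \<rho> (delta (p_diag r j)) = (\<lambda>x\<in>Tens n r. \<delta>' *\<^sub>v pbar n q r u j x))"

definition tw_diag ::
    "nat \<Rightarrow> nat \<Rightarrow> (nat word set \<Rightarrow> (nat \<Rightarrow> complex) \<Rightarrow> nat \<Rightarrow> complex) \<Rightarrow>
     nat word set \<Rightarrow> ((nat \<Rightarrow> nat) \<Rightarrow> complex) \<Rightarrow> (nat \<Rightarrow> nat) \<Rightarrow> complex" where
  "tw_diag n r \<tau> g = tens_op n r (\<tau> g)"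

definition tw_algebra_act ::
    "nat \<Rightarrow> nat \<Rightarrow> (nat word set \<Rightarrow> (nat \<Rightarrow> complex) \<Rightarrow> nat \<Rightarrow> complex) \<Rightarrow>
     (nat word set \<Rightarrow> complex) \<Rightarrow> ((nat \<Rightarrow> nat) \<Rightarrow> complex) \<Rightarrow> (nat \<Rightarrow> nat) \<Rightarrow> complex" where
  "tw_algebra_act n r \<tau> = extend_action (Tens n r) (tw_diag n r \<tau>)"

text \<open>The bimodule structures on the tensor power that extend the prescribed actions of the
  generators.\<close>

definition tw_pb_bimodule ::
    "nat \<Rightarrow> complex \<Rightarrow> nat \<Rightarrow> complex \<Rightarrow> (nat \<Rightarrow> nat \<Rightarrow> complex) \<Rightarrow>
     (nat word set \<Rightarrow> (nat \<Rightarrow> complex) \<Rightarrow> nat \<Rightarrow> complex) \<Rightarrow>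
     ((diagram \<Rightarrow> complex) \<Rightarrow> ((nat \<Rightarrow> nat) \<Rightarrow> complex) \<Rightarrow> (nat \<Rightarrow> nat) \<Rightarrow> complex) \<Rightarrow> bool" where
  "tw_pb_bimodule n q r \<delta>' u \<tau> \<rho> \<longleftrightarrow>
     tw_rep n q \<tau> \<and> pb_generators_act n q r \<delta>' u \<rho> \<and>
     bimodule (group_algebra (TW n)) (PB r (of_nat n) \<delta>') (Tens n r) (tw_algebra_act n r \<tau>) \<rho>"

end

theory Submission
  imports Defs "HOL-Combinatorics.Permutations"
begin

text \<open>
  In the orthonormal basis \<open>u 0, \<dots>, u (n - 1)\<close> an operator on the tensor power is a matrix whose rows and
  columns are colourings of the \<open>r\<close> positions by \<open>0, \<dots>, n - 1\<close>, the colour \<open>0\<close> standing for the line \<open>sp_L n\<close>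
  and the others for its orthogonal complement \<open>F\<close>. The theorem says that two algebras of such matrices are
  commutants of each other: the image of the group algebra, and the span of the diagram matrices.

  The image of the group is large. A generator of the twin group acts as the reflection in a vector
  \<open>w i\<close> of \<open>F\<close>, so it fixes \<open>u 0\<close> and preserves the form, and such matrices commute with all
  diagrams (\<open>reflection_commutes_diagram\<close>). The product of two consecutive reflections is a rotation of a plane
  whose eigenvalue \<open>z\<close> satisfies \<open>z + 1/z = 4 q / (1 + q)\<^sup>2 - 2\<close>, and the condition on \<open>q\<close> says that
  \<open>z\<close> is not a root of unity (\<open>root_of_unity_excluded\<close>). On the tensor power the rotation has the eigenvalues \<open>z\<^sup>k\<close>,
  where \<open>k\<close> is the total weight. They are distinct, so the spectral projections lie in the algebra generated by the rotation, and
  with them the Lie algebra element \<open>w i \<and> w (i + 1)\<close>, acting as a derivation (\<open>rotation_generator_in_algebra\<close>).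
  Brackets produce the orthogonal Lie algebra of \<open>F\<close>, and the one-parameter groups carry the given reflections to the
  reflections in the basis vectors (\<open>orthogonal_group_in_algebra\<close>).

  What commutes with these elements is a combination of diagrams (\<open>commutant_in_diagram_span\<close>). The proof takes an
  invariant tensor orthogonal to all diagrams and shows that it vanishes: by induction on the number
  of positions all its contractions vanish, and for a traceless invariant tensor a sum of squared norms
  turns out to be nonpositive (\<open>traceless_positivity\<close>). This gives one of the two commutants. The other one follows from a double commutant
  theorem (\<open>double_commutant\<close>) that asks only for enough elements whose conjugate transposes are also in the algebra, and
  the Lie algebra elements and reflections above are of this kind.

  The entry of a diagram matrix at a colouring of its vertices is zero unless colours are constant along edges and \<open>0\<close> at isolated vertices, and
  then it is a power of a square root of \<open>\<delta>'\<close>. Multiplying two such matrices counts the colourings of the middle row of the stacked diagrams; the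
  loops contribute factors \<open>n\<close>, and the other middle components, which have two ends each, factors \<open>\<delta>'\<close> (\<open>diag_mat_mult\<close>). The generators have the
  prescribed operators as their matrices, and every diagram is a product of generators up to a nonzero scalar
  (\<open>all_generated\<close>), so the diagram matrices give the only right action with the prescribed generators.

  For \<open>n > r\<close> the edges of a diagram can be given different nonzero colours, which makes the matrices
  linearly independent by a triangularity argument (\<open>diag_mat_independent\<close>). For \<open>n \<le> r\<close> the antisymmetrizer
  on \<open>n\<close> strands, each projected to the space \<open>F\<close> of dimension \<open>n - 1\<close>, is a vanishing combination of
  diagrams (\<open>diag_mat_dependent\<close>).
\<close>

section \<open>Matrices over a finite index set\<close>

lemma sum_apply: "(\<Sum>i\<in>I. F i) x = (\<Sum>i\<in>I. F i x)"
  for F :: "'i \<Rightarrow> 'a \<Rightarrow> complex"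
  by (induction I rule: infinite_finite_induct) auto

lemma vscale_apply: "(c *\<^sub>v x) i = c * x i"
  by (simp add: vscale_def)

text \<open>Matrices with rows and columns indexed by \<open>K\<close> are functions on pairs, so that the linear
  algebra of function spaces applies to them; an index set may itself consist of functions, as for the
  matrices on a tensor power.\<close>

definition mats :: "'k set \<Rightarrow> ('k \<times> 'k \<Rightarrow> complex) set" where
  "mats K = supported (K \<times> K)"

definition mm :: "'k set \<Rightarrow> ('k \<times> 'k \<Rightarrow> complex) \<Rightarrow> ('k \<times> 'k \<Rightarrow> complex) \<Rightarrow> 'k \<times> 'k \<Rightarrow> complex" where
  "mm K M N = (\<lambda>(k, l). if k \<in> K \<and> l \<in> K then \<Sum>j\<in>K. M (k, j) * N (j, l) else 0)"

definition mone :: "'k set \<Rightarrow> 'k \<times> 'k \<Rightarrow> complex" where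
  "mone K = (\<lambda>(k, l). if k \<in> K \<and> k = l then 1 else 0)"

definition mat_algebra :: "'k set \<Rightarrow> ('k \<times> 'k \<Rightarrow> complex) set \<Rightarrow> bool" where
  "mat_algebra K A \<longleftrightarrow> cfun.subspace A \<and> A \<subseteq> mats K \<and> mone K \<in> A \<and> (\<forall>M\<in>A. \<forall>N\<in>A. mm K M N \<in> A)"

lemma supported_subspace: "cfun.subspace (supported I)"
  by (auto simp: cfun.subspace_def supported_def vscale_def)

lemmas mats_subspace = supported_subspace[of "K \<times> K" for K, folded mats_def]

lemma mats_eqI:
  assumes "M \<in> mats K" "N \<in> mats K" "\<And>k l. k \<in> K \<Longrightarrow> l \<in> K \<Longrightarrow> M (k, l) = N (k, l)"
  shows "M = N"
proof
  fix x show "M x = N x"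
    using assms by (cases x; cases "x \<in> K \<times> K") (auto simp: mats_def supported_def)
qed

lemma mm_apply: "k \<in> K \<Longrightarrow> l \<in> K \<Longrightarrow> mm K M N (k, l) = (\<Sum>j\<in>K. M (k, j) * N (j, l))"
  by (simp add: mm_def)

lemma mone_apply: "k \<in> K \<Longrightarrow> mone K (k, l) = (if k = l then 1 else 0)"
  by (simp add: mone_def)

lemma mm_mats [simp]: "mm K M N \<in> mats K"
  by (auto simp: mats_def supported_def mm_def)

lemma mone_mats [simp]: "mone K \<in> mats K"
  by (auto simp: mats_def supported_def mone_def)

lemma mats_closed:
  "M \<in> mats K \<Longrightarrow> N \<in> mats K \<Longrightarrow> M + N \<in> mats K" "M \<in> mats K \<Longrightarrow> N \<in> mats K \<Longrightarrow> M - N \<in> mats K"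
  "M \<in> mats K \<Longrightarrow> c *\<^sub>v M \<in> mats K" "0 \<in> mats K"
  by (auto simp: mats_def supported_def vscale_def)

lemma mats_sum: "(\<And>i. i \<in> I \<Longrightarrow> F i \<in> mats K) \<Longrightarrow> (\<Sum>i\<in>I. F i) \<in> mats K"
  by (auto simp: mats_def supported_def sum_apply intro!: sum.neutral)

lemma mm_linear:
  "mm K (M + M') N = mm K M N + mm K M' N" "mm K M (N + N') = mm K M N + mm K M N'"
  "mm K (M - M') N = mm K M N - mm K M' N" "mm K M (N - N') = mm K M N - mm K M N'"
  "mm K (c *\<^sub>v M) N = c *\<^sub>v mm K M N" "mm K M (c *\<^sub>v N) = c *\<^sub>v mm K M N"
  "mm K 0 N = 0" "mm K M 0 = 0"
  by (auto simp: mm_def fun_eq_iff vscale_def algebra_simps sum.distrib sum_distrib_left sum_subtractf)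

lemma mm_sum:
  "mm K (\<Sum>i\<in>I. F i) N = (\<Sum>i\<in>I. mm K (F i) N)" "mm K N (\<Sum>i\<in>I. F i) = (\<Sum>i\<in>I. mm K N (F i))"
  by (induction I rule: infinite_finite_induct) (simp_all only: mm_linear sum.infinite sum.empty sum.insert simp_thms)

lemma mm_one:
  assumes "finite K" "M \<in> mats K" shows "mm K (mone K) M = M" "mm K M (mone K) = M"
proof -
  have *: "(\<Sum>j\<in>K. (if k = j then 1 else 0) * M (j, l)) = M (k, l)"
       "(\<Sum>j\<in>K. M (k, j) * (if j = l then 1 else 0)) = M (k, l)" if "k \<in> K" "l \<in> K" for k l
    using that assms(1) by (simp_all add: if_distrib if_distribR cong: if_cong)
  show "mm K (mone K) M = M" "mm K M (mone K) = M"
    using assms * by (auto intro!: mats_eqI[of _ K] simp: mm_apply mone_apply)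
qed

lemma mm_assoc: "mm K (mm K L M) N = mm K L (mm K M N)"
proof (rule mats_eqI[of _ K])
  fix k l assume kl: "k \<in> K" "l \<in> K"
  have "mm K (mm K L M) N (k, l) = (\<Sum>j\<in>K. \<Sum>i\<in>K. L (k, i) * M (i, j) * N (j, l))"
    using kl by (simp add: mm_apply sum_distrib_right)
  also have "\<dots> = (\<Sum>i\<in>K. \<Sum>j\<in>K. L (k, i) * M (i, j) * N (j, l))"
    by (rule sum.swap)
  also have "\<dots> = mm K L (mm K M N) (k, l)"
    using kl by (simp add: mm_apply sum_distrib_left mult.assoc)
  finally show "mm K (mm K L M) N (k, l) = mm K L (mm K M N) (k, l)" .
qed simp_all

section \<open>Tensor products of matrices\<close>

text \<open>The tensor product of one matrix \<open>g j\<close> for each position \<open>j\<close>: rows and columns of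
  the product are the colourings \<open>J \<rightarrow>\<^sub>E C\<close>, which index the basis of the tensor
  power.\<close>

definition tens_mat :: "'p set \<Rightarrow> 'c set \<Rightarrow> ('p \<Rightarrow> 'c \<times> 'c \<Rightarrow> complex) \<Rightarrow> ('p \<Rightarrow> 'c) \<times> ('p \<Rightarrow> 'c) \<Rightarrow> complex" where
  "tens_mat J C g = (\<lambda>(k, l). if k \<in> J \<rightarrow>\<^sub>E C \<and> l \<in> J \<rightarrow>\<^sub>E C then \<Prod>j\<in>J. g j (k j, l j) else 0)"

lemma tens_mat_apply: "k \<in> J \<rightarrow>\<^sub>E C \<Longrightarrow> l \<in> J \<rightarrow>\<^sub>E C \<Longrightarrow> tens_mat J C g (k, l) = (\<Prod>j\<in>J. g j (k j, l j))"
  by (simp add: tens_mat_def)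

lemma tens_mat_mats [simp]: "tens_mat J C g \<in> mats (J \<rightarrow>\<^sub>E C)"
  by (auto simp: mats_def supported_def tens_mat_def)

lemma tens_mat_cong: "(\<And>j a b. j \<in> J \<Longrightarrow> a \<in> C \<Longrightarrow> b \<in> C \<Longrightarrow> g j (a, b) = h j (a, b)) \<Longrightarrow> tens_mat J C g = tens_mat J C h"
  by (rule mats_eqI[of _ "J \<rightarrow>\<^sub>E C"]) (simp_all add: tens_mat_apply PiE_mem[of _ J "\<lambda>_. C"])

lemma tens_mat_mm:
  assumes "finite J" "finite C"
  shows "mm (J \<rightarrow>\<^sub>E C) (tens_mat J C g) (tens_mat J C h) = tens_mat J C (\<lambda>j. mm C (g j) (h j))"
proof (rule mats_eqI[of _ "J \<rightarrow>\<^sub>E C"])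
  fix k l assume kl: "k \<in> J \<rightarrow>\<^sub>E C" "l \<in> J \<rightarrow>\<^sub>E C"
  have "mm (J \<rightarrow>\<^sub>E C) (tens_mat J C g) (tens_mat J C h) (k, l) =
     (\<Sum>i\<in>J \<rightarrow>\<^sub>E C. \<Prod>j\<in>J. g j (k j, i j) * h j (i j, l j))"
    using kl by (simp add: mm_apply tens_mat_apply prod.distrib)
  also have "\<dots> = (\<Prod>j\<in>J. \<Sum>c\<in>C. g j (k j, c) * h j (c, l j))"
    using assms by (simp add: prod_sum_PiE[of J "\<lambda>_. C" "\<lambda>j c. g j (k j, c) * h j (c, l j)"])
  also have "\<dots> = tens_mat J C (\<lambda>j. mm C (g j) (h j)) (k, l)"
    using kl kl[THEN PiE_mem] by (simp add: tens_mat_apply mm_apply)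
  finally show "mm (J \<rightarrow>\<^sub>E C) (tens_mat J C g) (tens_mat J C h) (k, l) = tens_mat J C (\<lambda>j. mm C (g j) (h j)) (k, l)" .
qed simp_all

lemma tens_mat_one:
  assumes "finite J" shows "tens_mat J C (\<lambda>_. mone C) = mone (J \<rightarrow>\<^sub>E C)"
proof (rule mats_eqI[of _ "J \<rightarrow>\<^sub>E C"])
  fix k l assume kl: "k \<in> J \<rightarrow>\<^sub>E C" "l \<in> J \<rightarrow>\<^sub>E C"
  have "tens_mat J C (\<lambda>_. mone C) (k, l) = (\<Prod>j\<in>J. if k j = l j then 1 else 0)"
    using kl kl[THEN PiE_mem] by (simp add: tens_mat_apply mone_apply)
  also have "\<dots> = (if \<forall>j\<in>J. k j = l j then 1 else 0)"
    using assms by (auto simp: prod_zero_iff)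
  also have "(\<forall>j\<in>J. k j = l j) = (k = l)"
    using kl by (auto intro: PiE_ext)
  finally show "tens_mat J C (\<lambda>_. mone C) (k, l) = mone (J \<rightarrow>\<^sub>E C) (k, l)"
    using kl by (simp add: mone_apply)
qed simp_all

text \<open>Multilinearity of the tensor product, in the form of a product of sums multiplied out over all choices
  \<open>\<epsilon>\<close>.\<close>

lemma tens_mat_expand:
  assumes "finite J" "finite C" "finite E"
  shows "tens_mat J C (\<lambda>j. \<Sum>e\<in>E. \<chi> j e *\<^sub>v P e) =
    (\<Sum>\<epsilon>\<in>J \<rightarrow>\<^sub>E E. (\<Prod>j\<in>J. \<chi> j (\<epsilon> j)) *\<^sub>v tens_mat J C (\<lambda>j. P (\<epsilon> j)))"
proof (rule mats_eqI[of _ "J \<rightarrow>\<^sub>E C"])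
  fix k l assume kl: "k \<in> J \<rightarrow>\<^sub>E C" "l \<in> J \<rightarrow>\<^sub>E C"
  have "tens_mat J C (\<lambda>j. \<Sum>e\<in>E. \<chi> j e *\<^sub>v P e) (k, l) = (\<Prod>j\<in>J. \<Sum>e\<in>E. \<chi> j e * P e (k j, l j))"
    using kl by (simp add: tens_mat_apply sum_apply vscale_apply)
  also have "\<dots> = (\<Sum>\<epsilon>\<in>J \<rightarrow>\<^sub>E E. \<Prod>j\<in>J. \<chi> j (\<epsilon> j) * P (\<epsilon> j) (k j, l j))"
    using assms by (intro prod_sum_PiE) auto
  finally show "tens_mat J C (\<lambda>j. \<Sum>e\<in>E. \<chi> j e *\<^sub>v P e) (k, l) =
     (\<Sum>\<epsilon>\<in>J \<rightarrow>\<^sub>E E. (\<Prod>j\<in>J. \<chi> j (\<epsilon> j)) *\<^sub>v tens_mat J C (\<lambda>j. P (\<epsilon> j))) (k, l)"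
    using kl by (simp add: sum_apply vscale_apply tens_mat_apply prod.distrib)
qed (auto intro!: mats_sum mats_closed)

text \<open>The derivation of the tensor power induced by \<open>x\<close>, that is \<open>x\<close> as an element of a
  Lie algebra.\<close>

definition deriv_mat :: "'p set \<Rightarrow> 'c set \<Rightarrow> ('c \<times> 'c \<Rightarrow> complex) \<Rightarrow> ('p \<Rightarrow> 'c) \<times> ('p \<Rightarrow> 'c) \<Rightarrow> complex" where
  "deriv_mat J C x = (\<Sum>j\<in>J. tens_mat J C ((\<lambda>_. mone C)(j := x)))"

lemma deriv_mat_mats [simp]: "deriv_mat J C x \<in> mats (J \<rightarrow>\<^sub>E C)"
  unfolding deriv_mat_def by (intro mats_sum) simp

lemma tens_mat_upd_linear:
  assumes "finite J" "i \<in> J"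
  shows "tens_mat J C (g(i := x + y)) = tens_mat J C (g(i := x)) + tens_mat J C (g(i := y))"
    "tens_mat J C (g(i := c *\<^sub>v x)) = c *\<^sub>v tens_mat J C (g(i := x))"
proof -
  have *: "(\<Prod>j\<in>J. (g(i := z)) j (k j, l j)) = z (k i, l i) * (\<Prod>j\<in>J - {i}. g j (k j, l j))" for z k l
    using assms by (subst prod.remove[of J i]) (auto intro!: prod.cong)
  show "tens_mat J C (g(i := x + y)) = tens_mat J C (g(i := x)) + tens_mat J C (g(i := y))"
    "tens_mat J C (g(i := c *\<^sub>v x)) = c *\<^sub>v tens_mat J C (g(i := x))"
    unfolding tens_mat_def * by (auto simp: fun_eq_iff vscale_def algebra_simps)
qed

lemma deriv_mat_linear:
  assumes "finite J"
  shows "deriv_mat J C (x + y) = deriv_mat J C x + deriv_mat J C y" "deriv_mat J C (c *\<^sub>v x) = c *\<^sub>v deriv_mat J C x"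
  using assms by (simp_all add: deriv_mat_def tens_mat_upd_linear sum.distrib cfun.scale_sum_right)

text \<open>The factors \<open>i \<noteq> j\<close> of the double sum commute, so that only the diagonal survives; the
  derivations thus represent the Lie algebra of matrices.\<close>

lemma deriv_mat_commutator:
  assumes "finite J" "finite C" and x: "x \<in> mats C" and y: "y \<in> mats C"
  shows "mm (J \<rightarrow>\<^sub>E C) (deriv_mat J C x) (deriv_mat J C y) - mm (J \<rightarrow>\<^sub>E C) (deriv_mat J C y) (deriv_mat J C x) =
    deriv_mat J C (mm C x y - mm C y x)"
proof -
  let ?u = "\<lambda>_. mone C"
  define t where "t x y i j = tens_mat J C (\<lambda>m. mm C (if m = i then x else mone C) (if m = j then y else mone C))" for x y i j
  have prod: "mm (J \<rightarrow>\<^sub>E C) (deriv_mat J C x) (deriv_mat J C y) = (\<Sum>i\<in>J. \<Sum>j\<in>J. t x y i j)" for x y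
    unfolding deriv_mat_def mm_sum tens_mat_mm[OF assms(1,2)] t_def fun_upd_def by (rule sum.swap)
  have comm: "t x y i j = t y x j i" if "i \<noteq> j" for i j
    unfolding t_def using that by (intro arg_cong[of _ _ "tens_mat J C"]) (auto simp: fun_eq_iff mm_one[OF assms(2)] x y)
  have diag: "t x y i i = tens_mat J C (?u(i := mm C x y))" "t y x i i = tens_mat J C (?u(i := mm C y x))" for i
    unfolding t_def by (intro arg_cong[of _ _ "tens_mat J C"]; auto simp: fun_eq_iff mm_one[OF assms(2)] x y)+
  have "(\<Sum>i\<in>J. \<Sum>j\<in>J. t x y i j) - (\<Sum>i\<in>J. \<Sum>j\<in>J. t y x i j) =
     (\<Sum>i\<in>J. \<Sum>j\<in>J. t x y i j) - (\<Sum>i\<in>J. \<Sum>j\<in>J. t y x j i)"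
    by (subst (2) sum.swap) simp
  also have "\<dots> = (\<Sum>i\<in>J. \<Sum>j\<in>J. t x y i j - t y x j i)"
    by (simp add: sum_subtractf)
  also have "\<dots> = (\<Sum>i\<in>J. \<Sum>j\<in>J. if j = i then t x y i i - t y x i i else 0)"
    using comm by (intro sum.cong) auto
  also have "\<dots> = (\<Sum>i\<in>J. t x y i i - t y x i i)"
    using assms(1) by (simp only: sum.delta if_True cong: sum.cong)
  also have "\<dots> = deriv_mat J C (mm C x y) - deriv_mat J C (mm C y x)"
    by (simp add: deriv_mat_def diag sum_subtractf)
  also have "\<dots> = deriv_mat J C (mm C x y - mm C y x)"
    using deriv_mat_linear(1)[OF assms(1), of C "mm C x y - mm C y x" "mm C y x"] by simp
  finally show ?thesis by (simp only: prod)
qed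

text \<open>Applying \<open>f - y l\<close> to the sum removes the component \<open>l\<close> and rescales the others by
  nonzero scalars, because the eigenvalues are distinct; induction on the number of components finishes the
  argument. It replaces interpolation polynomials in \<open>f\<close>.\<close>

lemma eigen_components_in_subspace:
  assumes A: "cfun.subspace A"
    and f: "\<And>x y. f (x + y) = f x + f y" "\<And>c x. f (c *\<^sub>v x) = c *\<^sub>v f x"
    and fA: "\<And>x. x \<in> A \<Longrightarrow> f x \<in> A"
    and S: "finite S" and y: "inj_on y S"
    and eig: "\<And>k. k \<in> S \<Longrightarrow> f (z k) = y k *\<^sub>v z k"
    and sum: "(\<Sum>k\<in>S. z k) \<in> A"
    and k: "k \<in> S"
  shows "z k \<in> A"
  using S y eig sum k
proof (induction S arbitrary: z k rule: finite_induct)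
  case (insert l S)
  have f0: "f 0 = 0" using f(2)[of 0 0] by (simp add: cfun.scale_zero_left)
  have fsum: "f (\<Sum>k\<in>S. z k) = (\<Sum>k\<in>S. f (z k))"
    using \<open>finite S\<close>
  proof (induction S rule: finite_induct)
    case empty
    then show ?case by (simp only: sum.empty f0)
  next
    case (insert x S)
    then show ?case by (simp only: sum.insert f simp_thms)
  qed
  have fi: "f (\<Sum>k\<in>insert l S. z k) \<in> A" using insert.prems fA by blast
  \<comment> \<open>The component \<open>l\<close> is removed; the others stay eigenvectors with the same eigenvalues.\<close>
  have *: "(\<Sum>k\<in>S. (y k - y l) *\<^sub>v z k) = f (\<Sum>k\<in>insert l S. z k) - y l *\<^sub>v (\<Sum>k\<in>insert l S. z k)"
  proof -
    have "f (\<Sum>k\<in>insert l S. z k) = y l *\<^sub>v z l + (\<Sum>k\<in>S. y k *\<^sub>v z k)"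
      using insert.hyps insert.prems(2) by (simp add: f fsum)
    then show ?thesis
      using insert.hyps by (simp add: cfun.scale_left_diff_distrib sum_subtractf cfun.scale_right_distrib cfun.scale_sum_right)
  qed
  have inA: "(\<Sum>k\<in>S. (y k - y l) *\<^sub>v z k) \<in> A"
    unfolding * using fi insert.prems(3) A by (intro cfun.subspace_diff cfun.subspace_scale) auto
  have S_in: "z k \<in> A" if "k \<in> S" for k
  proof -
    have "(y k - y l) *\<^sub>v z k \<in> A"
    proof (rule insert.IH[of "\<lambda>k. (y k - y l) *\<^sub>v z k"])
      show "inj_on y S" using insert.prems(1) by simp
      show "f ((y k - y l) *\<^sub>v z k) = y k *\<^sub>v (y k - y l) *\<^sub>v z k" if "k \<in> S" for k
        using insert.prems(2)[of k] that by (simp add: f mult.commute)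
    qed (use that inA in auto)
    then have "(1 / (y k - y l)) *\<^sub>v (y k - y l) *\<^sub>v z k \<in> A" using A by (rule cfun.subspace_scale[rotated])
    moreover have "y k - y l \<noteq> 0" using insert.prems(1) insert.hyps that by (auto simp: inj_on_def)
    ultimately show ?thesis by simp
  qed
  then have "(\<Sum>k\<in>S. z k) \<in> A" using A by (intro cfun.subspace_sum) auto
  then have "(\<Sum>k\<in>insert l S. z k) - (\<Sum>k\<in>S. z k) \<in> A" using insert.prems(3) A by (intro cfun.subspace_diff)
  then have "z l \<in> A" using insert.hyps by simp
  then show ?case using S_in insert.prems(4) by auto
qed simp

section \<open>One-parameter families of tensor powers\<close>

text \<open>A complete system of orthogonal idempotents, labelled by integer weights.\<close>

definition idem_family :: "'c set \<Rightarrow> int set \<Rightarrow> (int \<Rightarrow> 'c \<times> 'c \<Rightarrow> complex) \<Rightarrow> bool" where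
  "idem_family C E P \<longleftrightarrow> finite E \<and> (\<forall>e\<in>E. P e \<in> mats C) \<and>
     (\<forall>e\<in>E. \<forall>f\<in>E. mm C (P e) (P f) = (if e = f then P e else 0)) \<and> (\<Sum>e\<in>E. P e) = mone C"

text \<open>The operator that acts on the joint eigenspace of weights \<open>\<epsilon> 1, \<dots>, \<epsilon> r\<close>
  in the tensor power by the scalar \<open>f \<epsilon>\<close>. Tensor powers of a torus element and
  derivations are both of this form, and both depend on the total weight only.\<close>

definition weight_op :: "'p set \<Rightarrow> 'c set \<Rightarrow> int set \<Rightarrow> (int \<Rightarrow> 'c \<times> 'c \<Rightarrow> complex) \<Rightarrow> (('p \<Rightarrow> int) \<Rightarrow> complex) \<Rightarrow>
    ('p \<Rightarrow> 'c) \<times> ('p \<Rightarrow> 'c) \<Rightarrow> complex" where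
  "weight_op J C E P f = (\<Sum>\<epsilon>\<in>J \<rightarrow>\<^sub>E E. f \<epsilon> *\<^sub>v tens_mat J C (\<lambda>j. P (\<epsilon> j)))"

lemma weight_op_cong: "(\<And>\<epsilon>. \<epsilon> \<in> J \<rightarrow>\<^sub>E E \<Longrightarrow> f \<epsilon> = g \<epsilon>) \<Longrightarrow> weight_op J C E P f = weight_op J C E P g"
  by (simp add: weight_op_def)

lemma weight_op_mm:
  assumes J: "finite J" "finite C" and P: "idem_family C E P"
  shows "mm (J \<rightarrow>\<^sub>E C) (weight_op J C E P f) (weight_op J C E P g) = weight_op J C E P (\<lambda>\<epsilon>. f \<epsilon> * g \<epsilon>)"
proof -
  let ?t = "\<lambda>\<epsilon>. tens_mat J C (\<lambda>j. P (\<epsilon> j))"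
  have E: "finite E" using P by (simp add: idem_family_def)
  have *: "mm (J \<rightarrow>\<^sub>E C) (?t \<epsilon>) (?t \<eta>) = (if \<epsilon> = \<eta> then ?t \<epsilon> else 0)"
    if e: "\<epsilon> \<in> J \<rightarrow>\<^sub>E E" "\<eta> \<in> J \<rightarrow>\<^sub>E E" for \<epsilon> \<eta>
  proof (cases "\<epsilon> = \<eta>")
    case True
    have "mm C (P (\<epsilon> j)) (P (\<epsilon> j)) = P (\<epsilon> j)" if "j \<in> J" for j
      using P PiE_mem[OF e(1) that] by (simp add: idem_family_def)
    then show ?thesis unfolding tens_mat_mm[OF J] True[symmetric] by (auto intro: tens_mat_cong)
  next
    case False
    then obtain j where j: "j \<in> J" "\<epsilon> j \<noteq> \<eta> j" using e by (meson PiE_ext)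
    then have "mm C (P (\<epsilon> j)) (P (\<eta> j)) = 0"
      using P PiE_mem[OF e(1) j(1)] PiE_mem[OF e(2) j(1)] by (simp add: idem_family_def)
    then have "tens_mat J C (\<lambda>j. mm C (P (\<epsilon> j)) (P (\<eta> j))) = 0"
      using j J(1) by (auto simp: tens_mat_def fun_eq_iff prod_zero_iff intro!: bexI[of _ j])
    then show ?thesis unfolding tens_mat_mm[OF J] using False by simp
  qed
  have "mm (J \<rightarrow>\<^sub>E C) (weight_op J C E P f) (weight_op J C E P g) =
    (\<Sum>\<epsilon>\<in>J \<rightarrow>\<^sub>E E. \<Sum>\<eta>\<in>J \<rightarrow>\<^sub>E E. f \<epsilon> *\<^sub>v g \<eta> *\<^sub>v mm (J \<rightarrow>\<^sub>E C) (?t \<epsilon>) (?t \<eta>))"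
    unfolding weight_op_def mm_sum mm_linear cfun.scale_sum_right
    by (rule HOL.trans[OF _ sum.swap]) (intro sum.cong HOL.refl, simp add: mult.commute)
  also have "\<dots> = (\<Sum>\<epsilon>\<in>J \<rightarrow>\<^sub>E E. \<Sum>\<eta>\<in>J \<rightarrow>\<^sub>E E. if \<epsilon> = \<eta> then (f \<epsilon> * g \<epsilon>) *\<^sub>v ?t \<epsilon> else 0)"
    by (intro sum.cong HOL.refl) (simp add: *)
  also have "\<dots> = (\<Sum>\<epsilon>\<in>J \<rightarrow>\<^sub>E E. (f \<epsilon> * g \<epsilon>) *\<^sub>v ?t \<epsilon>)"
    using J E by (intro sum.cong HOL.refl) (simp add: finite_PiE sum.delta)
  finally show ?thesis by (simp add: weight_op_def)
qed

lemma tens_mat_weight_op: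
  assumes J: "finite J" "finite C" and P: "idem_family C E P"
  shows "tens_mat J C (\<lambda>j. \<Sum>e\<in>E. \<chi> j e *\<^sub>v P e) = weight_op J C E P (\<lambda>\<epsilon>. \<Prod>j\<in>J. \<chi> j (\<epsilon> j))"
  unfolding weight_op_def using P J by (intro tens_mat_expand) (auto simp: idem_family_def)

lemma weight_op_one:
  assumes J: "finite J" "finite C" and P: "idem_family C E P"
  shows "weight_op J C E P (\<lambda>_. 1) = mone (J \<rightarrow>\<^sub>E C)"
proof -
  have "tens_mat J C (\<lambda>j. \<Sum>e\<in>E. (\<lambda>_ _. 1) j e *\<^sub>v P e) = weight_op J C E P (\<lambda>_. 1)"
    using tens_mat_weight_op[OF assms, of "\<lambda>_ _. 1"] by simp
  moreover have "(\<Sum>e\<in>E. 1 *\<^sub>v P e) = mone C" using P by (simp add: idem_family_def)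
  ultimately show ?thesis using tens_mat_one[OF J(1), of C] by simp
qed

lemma weight_op_linear:
  "weight_op J C E P (\<lambda>\<epsilon>. f \<epsilon> + g \<epsilon>) = weight_op J C E P f + weight_op J C E P g"
  "weight_op J C E P (\<lambda>\<epsilon>. c * f \<epsilon>) = c *\<^sub>v weight_op J C E P f"
  by (simp_all add: weight_op_def sum.distrib cfun.scale_left_distrib cfun.scale_sum_right)

lemma weight_op_sum: "weight_op J C E P (\<lambda>\<epsilon>. \<Sum>i\<in>I. f i \<epsilon>) = (\<Sum>i\<in>I. weight_op J C E P (f i))"
proof -
  have 0: "weight_op J C E P (\<lambda>\<epsilon>. 0) = 0" by (simp add: weight_op_def)
  show ?thesis
    by (induction I rule: infinite_finite_induct) (simp_all only: weight_op_linear sum.infinite sum.empty sum.insert 0 simp_thms)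
qed

lemma deriv_mat_weight_op:
  assumes J: "finite J" "finite C" and P: "idem_family C E P"
  shows "deriv_mat J C (\<Sum>e\<in>E. of_int e *\<^sub>v P e) = weight_op J C E P (\<lambda>\<epsilon>. of_int (\<Sum>j\<in>J. \<epsilon> j))"
proof -
  have *: "tens_mat J C ((\<lambda>_. mone C)(i := \<Sum>e\<in>E. of_int e *\<^sub>v P e)) = weight_op J C E P (\<lambda>\<epsilon>. of_int (\<epsilon> i))"
    if i: "i \<in> J" for i
  proof -
    define \<chi> where "\<chi> = (\<lambda>j (e::int). if j = i then of_int e else 1 :: complex)"
    have "(\<lambda>_. mone C)(i := \<Sum>e\<in>E. of_int e *\<^sub>v P e) = (\<lambda>j. \<Sum>e\<in>E. \<chi> j e *\<^sub>v P e)"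
      using P by (auto simp: \<chi>_def idem_family_def fun_eq_iff)
    moreover have "(\<Prod>j\<in>J. \<chi> j (\<epsilon> j)) = of_int (\<epsilon> i)" for \<epsilon>
      using i J(1) by (simp add: \<chi>_def prod.delta)
    ultimately show ?thesis using tens_mat_weight_op[OF assms, of \<chi>] by simp
  qed
  show ?thesis by (simp add: deriv_mat_def * weight_op_sum)
qed

text \<open>If the eigenvalues \<open>\<psi> k\<close> separate the total weights, the projection onto every weight
  space is in the algebra, by separation of the eigencomponents of the identity; hence so is every function of
  the total weight. Used with \<open>\<psi> k = z powi k\<close> it passes from a group element to its Lie
  algebra generator, and with \<open>\<psi> k = k\<close> it goes back.\<close>

lemma weight_op_weight_in_algebra:
  assumes A: "mat_algebra (J \<rightarrow>\<^sub>E C) A" and J: "finite J" "finite C" and P: "idem_family C E P"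
    and \<psi>: "inj \<psi>" and in_A: "weight_op J C E P (\<lambda>\<epsilon>. \<psi> (\<Sum>j\<in>J. \<epsilon> j)) \<in> A"
  shows "weight_op J C E P (\<lambda>\<epsilon>. f (\<Sum>j\<in>J. \<epsilon> j)) \<in> A"
proof -
  let ?wt = "\<lambda>\<epsilon>. \<Sum>j\<in>J. \<epsilon> j :: int"
  define Wt where "Wt = ?wt ` (J \<rightarrow>\<^sub>E E)"
  have fin: "finite Wt" using J P by (auto simp: Wt_def idem_family_def finite_PiE)
  \<comment> \<open>The projection onto total weight \<open>k\<close>; these projections sum to the identity.\<close>
  define z where "z k = weight_op J C E P (\<lambda>\<epsilon>. if ?wt \<epsilon> = k then 1 else 0)" for k
  have decomp: "weight_op J C E P (\<lambda>\<epsilon>. g (?wt \<epsilon>)) = (\<Sum>k\<in>Wt. g k *\<^sub>v z k)" for g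
  proof -
    have "weight_op J C E P (\<lambda>\<epsilon>. g (?wt \<epsilon>)) = weight_op J C E P (\<lambda>\<epsilon>. \<Sum>k\<in>Wt. g k * (if ?wt \<epsilon> = k then 1 else 0))"
      by (rule weight_op_cong) (use fin in \<open>auto simp: Wt_def sum.delta' if_distrib cong: if_cong\<close>)
    then show ?thesis by (simp add: weight_op_sum weight_op_linear z_def)
  qed
  have sub: "cfun.subspace A" using A by (simp add: mat_algebra_def)
  have "z k \<in> A" if "k \<in> Wt" for k
  proof (rule eigen_components_in_subspace[OF sub, where f = "mm (J \<rightarrow>\<^sub>E C) (weight_op J C E P (\<lambda>\<epsilon>. \<psi> (?wt \<epsilon>)))" and y = \<psi> and z = z and S = Wt])
    show "mm (J \<rightarrow>\<^sub>E C) (weight_op J C E P (\<lambda>\<epsilon>. \<psi> (?wt \<epsilon>))) (z k) = \<psi> k *\<^sub>v z k" for k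
      unfolding z_def weight_op_mm[OF J P] weight_op_linear(2)[symmetric] by (rule weight_op_cong) auto
    have "(\<Sum>k\<in>Wt. z k) = (\<Sum>k\<in>Wt. 1 *\<^sub>v z k)" by (simp only: cfun.scale_one)
    also have "\<dots> = mone (J \<rightarrow>\<^sub>E C)" unfolding decomp[of "\<lambda>_. 1", symmetric] by (rule weight_op_one[OF J P])
    finally show "(\<Sum>k\<in>Wt. z k) \<in> A" using A by (simp add: mat_algebra_def)
    show "inj_on \<psi> Wt" using \<psi> by (rule inj_on_subset) simp
    show "mm (J \<rightarrow>\<^sub>E C) (weight_op J C E P (\<lambda>\<epsilon>. \<psi> (?wt \<epsilon>))) x \<in> A" if "x \<in> A" for x
      using A in_A that by (simp add: mat_algebra_def)
  qed (use fin that in \<open>simp_all only: mm_linear\<close>)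
  then show ?thesis unfolding decomp by (intro cfun.subspace_sum[OF sub] cfun.subspace_scale[OF sub])
qed

section \<open>Reflections\<close>

text \<open>The rank one matrix \<open>v w\<^sup>T\<close>.\<close>

definition outer1 :: "'c set \<Rightarrow> ('c \<Rightarrow> complex) \<Rightarrow> ('c \<Rightarrow> complex) \<Rightarrow> 'c \<times> 'c \<Rightarrow> complex" where
  "outer1 C v w = (\<lambda>(a, b). if a \<in> C \<and> b \<in> C then v a * w b else 0)"

text \<open>Bilinear, not Hermitian: this is the form whose orthogonal group is represented.\<close>

definition ip :: "'c set \<Rightarrow> ('c \<Rightarrow> complex) \<Rightarrow> ('c \<Rightarrow> complex) \<Rightarrow> complex" where
  "ip C v w = (\<Sum>a\<in>C. v a * w a)"

definition refl_mat :: "'c set \<Rightarrow> ('c \<Rightarrow> complex) \<Rightarrow> 'c \<times> 'c \<Rightarrow> complex" where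
  "refl_mat C w = mone C - 2 *\<^sub>v outer1 C w w"

text \<open>The element \<open>v \<and> w\<close> of the orthogonal Lie algebra.\<close>

definition wedge :: "'c set \<Rightarrow> ('c \<Rightarrow> complex) \<Rightarrow> ('c \<Rightarrow> complex) \<Rightarrow> 'c \<times> 'c \<Rightarrow> complex" where
  "wedge C v w = outer1 C v w - outer1 C w v"

lemma outer1_mats [simp]: "outer1 C v w \<in> mats C"
  by (auto simp: mats_def supported_def outer1_def)

lemma outer1_apply: "a \<in> C \<Longrightarrow> b \<in> C \<Longrightarrow> outer1 C v w (a, b) = v a * w b"
  by (simp add: outer1_def)

lemma refl_mat_mats [simp]: "refl_mat C w \<in> mats C"
  by (simp add: refl_mat_def mats_closed)

lemma wedge_mats [simp]: "wedge C v w \<in> mats C"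
  by (simp add: wedge_def mats_closed)

lemma ip_commute: "ip C v w = ip C w v"
  by (simp add: ip_def mult.commute)

lemma ip_linear: "ip C (v + v') w = ip C v w + ip C v' w" "ip C (c *\<^sub>v v) w = c * ip C v w"
  "ip C w (v + v') = ip C w v + ip C w v'" "ip C w (c *\<^sub>v v) = c * ip C w v"
  "ip C (v - v') w = ip C v w - ip C v' w" "ip C w (v - v') = ip C w v - ip C w v'"
  by (simp_all add: ip_def vscale_def algebra_simps sum.distrib sum_distrib_left sum_subtractf)

lemma outer1_mm: "mm C (outer1 C a b) (outer1 C c d) = ip C b c *\<^sub>v outer1 C a d"
  by (rule mats_eqI[of _ C])
    (auto intro!: mats_closed sum.cong simp: mm_apply outer1_apply ip_def vscale_apply sum_distrib_right)

lemma refl_mat_mm: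
  assumes "finite C"
  shows "mm C (refl_mat C v) (refl_mat C w) =
    mone C - 2 *\<^sub>v outer1 C v v - 2 *\<^sub>v outer1 C w w + (4 * ip C v w) *\<^sub>v outer1 C v w"
  unfolding refl_mat_def mm_linear outer1_mm mm_one[OF assms mone_mats] mm_one[OF assms outer1_mats]
  by (auto simp: fun_eq_iff vscale_def)

lemma refl_mat_refl_mat:
  assumes "finite C" "ip C w w = 1" shows "mm C (refl_mat C w) (refl_mat C w) = mone C"
  unfolding refl_mat_mm[OF assms(1)] assms(2) by (auto simp: fun_eq_iff vscale_def)

text \<open>The bracket of two generators that share a vector contains \<open>a \<and> d\<close> with the coefficient
  \<open>ip C b b\<close>; so generators along a chain of unit vectors yield those for arbitrary pairs in the
  chain.\<close>

lemma wedge_commutator: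
  "mm C (wedge C a b) (wedge C b d) - mm C (wedge C b d) (wedge C a b) =
    ip C b b *\<^sub>v wedge C a d - ip C a b *\<^sub>v wedge C b d - ip C b d *\<^sub>v wedge C a b"
proof -
  have "ip C b a = ip C a b" "ip C d b = ip C b d" "ip C d a = ip C a d" by (simp_all add: ip_commute)
  then show ?thesis
    unfolding wedge_def mm_linear outer1_mm by (auto simp: fun_eq_iff vscale_def algebra_simps)
qed

lemma wedge_linear:
  "wedge C (v + v') w = wedge C v w + wedge C v' w" "wedge C (c *\<^sub>v v) w = c *\<^sub>v wedge C v w"
  "wedge C w (v + v') = wedge C w v + wedge C w v'" "wedge C w (c *\<^sub>v v) = c *\<^sub>v wedge C w v"
  by (auto simp: wedge_def outer1_def fun_eq_iff vscale_def algebra_simps)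

text \<open>The entries of the two rank one idempotents of a rotation, expanded in the coordinates of the two unit
  vectors.\<close>

lemma rotation_entry_expand: fixes \<xi> \<eta> x y x' y' :: complex
  shows "(\<xi>\<^sup>2 - 1) * ((x' - \<xi> * x) * (y' - \<eta> * y)) + (\<eta>\<^sup>2 - 1) * ((x' - \<eta> * x) * (y' - \<xi> * y)) =
          (\<xi>\<^sup>2 + \<eta>\<^sup>2 - 2) * (x' * y') + (- (\<xi>\<^sup>2 - 1) * \<eta> - (\<eta>\<^sup>2 - 1) * \<xi>) * (x' * y) +
          (- (\<xi>\<^sup>2 - 1) * \<xi> - (\<eta>\<^sup>2 - 1) * \<eta>) * (x * y') + ((\<xi>\<^sup>2 + \<eta>\<^sup>2 - 2) * (\<xi> * \<eta>)) * (x * y)"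
proof -
  have "(a - 1) * ((x' - \<xi> * x) * (y' - \<eta> * y)) + (b - 1) * ((x' - \<eta> * x) * (y' - \<xi> * y)) =
          (a + b - 2) * (x' * y') + (- (a - 1) * \<eta> - (b - 1) * \<xi>) * (x' * y) +
          (- (a - 1) * \<xi> - (b - 1) * \<eta>) * (x * y') + ((a + b - 2) * (\<xi> * \<eta>)) * (x * y)" for a b
   by (simp add: ring_distribs)
  then show ?thesis .
qed
lemma rotation_coefficients: fixes \<xi> \<eta> c :: complex
  assumes e: "\<xi> * \<eta> = 1" "2 * c = \<xi> + \<eta>"
  shows "\<xi>\<^sup>2 + \<eta>\<^sup>2 - 2 = - 2 * (2 - 2 * c\<^sup>2)" "- (\<xi>\<^sup>2 - 1) * \<eta> - (\<eta>\<^sup>2 - 1) * \<xi> = 0"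
          "- (\<xi>\<^sup>2 - 1) * \<xi> - (\<eta>\<^sup>2 - 1) * \<eta> = 4 * c * (2 - 2 * c\<^sup>2)"
proof -
  have "4 * c\<^sup>2 = (\<xi> + \<eta>)\<^sup>2" unfolding e(2)[symmetric] by simp
  also have "\<dots> = \<xi>\<^sup>2 + \<eta>\<^sup>2 + 2 * (\<xi> * \<eta>)" by (simp add: power2_eq_square ring_distribs)
  finally have h: "4 * c\<^sup>2 = \<xi>\<^sup>2 + \<eta>\<^sup>2 + 2" unfolding e(1) by simp
  then show 1: "\<xi>\<^sup>2 + \<eta>\<^sup>2 - 2 = - 2 * (2 - 2 * c\<^sup>2)" by simp
  have s: "\<xi>\<^sup>2 * \<eta> = \<xi>" "\<eta>\<^sup>2 * \<xi> = \<eta>"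
    using e(1) by (simp_all add: power2_eq_square mult.assoc mult.commute[of \<eta> \<xi>])
  then show "- (\<xi>\<^sup>2 - 1) * \<eta> - (\<eta>\<^sup>2 - 1) * \<xi> = 0" by (simp add: ring_distribs)
  have h2: "2 * (2 - 2 * c\<^sup>2) = 2 - \<xi>\<^sup>2 - \<eta>\<^sup>2" using h by (simp add: algebra_simps)
  have "4 * c * (2 - 2 * c\<^sup>2) = (2 * c) * (2 * (2 - 2 * c\<^sup>2))" by simp
  also have "\<dots> = (\<xi> + \<eta>) * (2 - \<xi>\<^sup>2 - \<eta>\<^sup>2)" unfolding e(2) h2 by simp
  also have "\<dots> = - (\<xi>\<^sup>2 - 1) * \<xi> - (\<eta>\<^sup>2 - 1) * \<eta>"
    using s by (simp add: ring_distribs mult.commute)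
  finally show "- (\<xi>\<^sup>2 - 1) * \<xi> - (\<eta>\<^sup>2 - 1) * \<eta> = 4 * c * (2 - 2 * c\<^sup>2)" ..
qed
text \<open>The vectors \<open>p = w' - \<xi> w\<close> and \<open>m = w' - inverse \<xi> w\<close> span the two
  isotropic lines of the plane of \<open>w\<close> and \<open>w'\<close>; they are eigenvectors of the product
  of the two reflections, for the eigenvalues \<open>\<xi>\<^sup>2\<close> and \<open>inverse
  (\<xi>\<^sup>2)\<close>. The plane is nondegenerate because \<open>ip C w w'\<close> is not
  \<open>\<plusminus>1\<close>, which makes the spectral projections available, and the matrix with
  eigenvalues \<open>1, -1\<close> on the two lines is a multiple of \<open>w \<and> w'\<close>.\<close>

lemma rotation_idempotents:
  assumes C: "finite C" and w: "ip C w w = 1" "ip C w' w' = 1"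
    and c: "(ip C w w')\<^sup>2 \<noteq> 1" and \<xi>: "\<xi> \<noteq> 0" "\<xi> + inverse \<xi> = 2 * ip C w w'"
  obtains P where "idem_family C {-1, 0, 1} P"
    "mm C (refl_mat C w) (refl_mat C w') = (\<Sum>e\<in>{-1, 0, 1}. (\<xi>\<^sup>2) powi e *\<^sub>v P e)"
    "\<exists>c. c \<noteq> 0 \<and> (\<Sum>e\<in>{-1, 0, 1}. of_int e *\<^sub>v P e) = c *\<^sub>v wedge C w w'"
proof -
  define \<eta> where "\<eta> = inverse \<xi>"
  define c where "c = ip C w w'"
  have eq: "\<xi> * \<eta> = 1" "2 * c = \<xi> + \<eta>" using \<xi> by (simp_all add: \<eta>_def c_def)
  define D where "D = 2 - 2 * c\<^sup>2"
  have D: "D \<noteq> 0" using assms by (auto simp: D_def c_def)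
  \<comment> \<open>The isotropic vectors of the plane; their pairing \<open>D\<close> is nonzero since the plane is nondegenerate.\<close>
  define m p where "m = w' - \<eta> *\<^sub>v w" and "p = w' - \<xi> *\<^sub>v w"
  have ips: "ip C p p = 0" "ip C m m = 0" "ip C p m = D" "ip C m p = D"
  proof -
    have ww: "ip C w w' = c" "ip C w' w = c" by (simp_all add: c_def ip_commute)
    note ex = p_def m_def ip_linear w ww
    have "ip C p p = 1 - \<xi> * (2 * c) + \<xi> * \<xi>" "ip C m m = 1 - \<eta> * (2 * c) + \<eta> * \<eta>"
      "ip C p m = 1 - (\<xi> + \<eta>) * c + \<xi> * \<eta>" "ip C m p = 1 - (\<xi> + \<eta>) * c + \<xi> * \<eta>"
      unfolding ex by (simp_all add: algebra_simps)
    moreover have "1 - \<xi> * (2 * c) + \<xi> * \<xi> = 0" "1 - \<eta> * (2 * c) + \<eta> * \<eta> = 0"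
      unfolding eq(2) using eq(1) by (simp_all add: algebra_simps)
    moreover have "1 - (\<xi> + \<eta>) * c + \<xi> * \<eta> = D"
      unfolding eq(2)[symmetric] eq(1) D_def by (simp add: algebra_simps power2_eq_square)
    ultimately show "ip C p p = 0" "ip C m m = 0" "ip C p m = D" "ip C m p = D" by simp_all
  qed
  define Pp Pm where "Pp = (1 / D) *\<^sub>v outer1 C p m" and "Pm = (1 / D) *\<^sub>v outer1 C m p"
  define P where "P = (\<lambda>e::int. if e = 1 then Pp else if e = - 1 then Pm else mone C - Pp - Pm)"
  have PP: "mm C Pp Pp = Pp" "mm C Pm Pm = Pm" "mm C Pp Pm = 0" "mm C Pm Pp = 0"
    unfolding Pp_def Pm_def mm_linear outer1_mm ips using D by (auto simp: fun_eq_iff vscale_def)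
  have Pmats: "Pp \<in> mats C" "Pm \<in> mats C" by (auto simp: Pp_def Pm_def intro!: mats_closed)
  have "idem_family C {-1, 0, 1} P"
    unfolding idem_family_def
    by (auto simp: P_def mm_linear PP mm_one[OF C] Pmats intro!: mats_closed)
  moreover have "mm C (refl_mat C w) (refl_mat C w') = (\<Sum>e\<in>{-1, 0, 1}. (\<xi>\<^sup>2) powi e *\<^sub>v P e)"
  proof (rule mats_eqI[of _ C])
    fix a b assume ab: "a \<in> C" "b \<in> C"
    have key: "(\<xi>\<^sup>2 - 1) * (p a * m b) + (\<eta>\<^sup>2 - 1) * (m a * p b) =
       D * (- 2 * (w a * w b) - 2 * (w' a * w' b) + 4 * c * (w a * w' b))"
    proof -
      have pm: "p a = w' a - \<xi> * w a" "p b = w' b - \<xi> * w b" "m a = w' a - \<eta> * w a" "m b = w' b - \<eta> * w b"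
        by (simp_all add: p_def m_def vscale_def)
      show ?thesis
        unfolding pm rotation_entry_expand rotation_coefficients[OF eq] D_def eq(1)
        by (simp add: ring_distribs)
    qed
    have inv: "(\<xi>\<^sup>2) powi (-1) = \<eta>\<^sup>2" by (simp add: \<eta>_def power_inverse power_int_minus)
    have "(\<Sum>e\<in>{-1, 0, 1}. (\<xi>\<^sup>2) powi e *\<^sub>v P e) (a, b) =
        \<eta>\<^sup>2 * (m a * p b / D) + (mone C (a, b) - p a * m b / D - m a * p b / D) + \<xi>\<^sup>2 * (p a * m b / D)"
      using ab inv by (simp add: P_def Pp_def Pm_def vscale_apply outer1_apply)
    also have "\<dots> = mone C (a, b) + ((\<xi>\<^sup>2 - 1) * (p a * m b) + (\<eta>\<^sup>2 - 1) * (m a * p b)) / D"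
      by (simp add: add_divide_distrib diff_divide_distrib ring_distribs)
    also have "\<dots> = mone C (a, b) + (- 2 * (w a * w b) - 2 * (w' a * w' b) + 4 * c * (w a * w' b))"
      using D by (simp add: key)
    also have "\<dots> = mm C (refl_mat C w) (refl_mat C w') (a, b)"
      unfolding refl_mat_mm[OF C] using ab by (simp add: vscale_apply outer1_apply c_def)
    finally show "mm C (refl_mat C w) (refl_mat C w') (a, b) = (\<Sum>e\<in>{-1, 0, 1}. (\<xi>\<^sup>2) powi e *\<^sub>v P e) (a, b)" ..
  qed (auto intro!: mats_closed simp: P_def Pmats)
  moreover have "(\<Sum>e\<in>{-1, 0, 1}. of_int e *\<^sub>v P e) = ((\<eta> - \<xi>) / D) *\<^sub>v wedge C w w'"
  proof (rule mats_eqI[of _ C])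
    fix a b assume ab: "a \<in> C" "b \<in> C"
    have "p a * m b - m a * p b = (\<eta> - \<xi>) * (w a * w' b - w' a * w b)"
      by (simp add: p_def m_def vscale_def algebra_simps)
    then show "(\<Sum>e\<in>{-1, 0, 1}. of_int e *\<^sub>v P e) (a, b) = (((\<eta> - \<xi>) / D) *\<^sub>v wedge C w w') (a, b)"
      using ab by (simp add: P_def Pp_def Pm_def wedge_def vscale_apply outer1_apply flip: diff_divide_distrib)
  qed (auto intro!: mats_closed simp: P_def Pmats)
  moreover have "(\<eta> - \<xi>) / D \<noteq> 0"
  proof -
    have "\<eta> \<noteq> \<xi>"
    proof
      assume "\<eta> = \<xi>"
      then have "c = \<xi>" "\<xi> * \<xi> = 1" using eq by simp_all
      then have "c\<^sup>2 = 1" by (simp add: power2_eq_square)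
      then show False using assms by (simp add: c_def)
    qed
    then show ?thesis using D by simp
  qed
  ultimately show ?thesis using that by blast
qed

lemma exists_xi: obtains \<xi> :: complex where "\<xi> \<noteq> 0" "\<xi> + inverse \<xi> = 2 * c"
proof -
  define s where "s = csqrt (c\<^sup>2 - 1)"
  have s: "s\<^sup>2 = c\<^sup>2 - 1" by (simp add: s_def)
  have "(c + s) * (c - s) = c\<^sup>2 - s\<^sup>2" by (simp add: algebra_simps power2_eq_square)
  then have "(c + s) * (c - s) = 1" using s by simp
  then have "c + s \<noteq> 0" "inverse (c + s) = c - s"
    by (auto intro: inverse_unique)
  then show ?thesis by (intro that[of "c + s"]) auto
qed

lemma powi_weight:
  assumes "z \<noteq> (0::complex)" "finite J"
  shows "(\<Prod>j\<in>J. z powi \<epsilon> j) = z powi (\<Sum>j\<in>J. \<epsilon> j)"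
  using assms(2) by (induction J rule: finite_induct) (simp_all add: power_int_add assms(1))

text \<open>The product of the two reflections acts on the tensor power with eigenvalue \<open>(\<xi>\<^sup>2) powi
  k\<close> on the part of total weight \<open>k\<close>. Since \<open>\<xi>\<^sup>2\<close> is not a root of
  unity these eigenvalues differ, and the derivation, whose eigenvalue is a multiple of \<open>k\<close>, is
  recovered.\<close>

lemma rotation_generator_in_algebra:
  assumes A: "mat_algebra (J \<rightarrow>\<^sub>E C) A" and J: "finite J" and C: "finite C"
    and w: "ip C w w = 1" "ip C w' w' = 1" and c: "(ip C w w')\<^sup>2 \<noteq> 1"
    and \<xi>: "\<xi> \<noteq> 0" "\<xi> + inverse \<xi> = 2 * ip C w w'"
    and nroot: "\<And>k::nat. k \<ge> 1 \<Longrightarrow> (\<xi>\<^sup>2) ^ k \<noteq> 1"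
    and in_A: "tens_mat J C (\<lambda>_. refl_mat C w) \<in> A" "tens_mat J C (\<lambda>_. refl_mat C w') \<in> A"
  shows "deriv_mat J C (wedge C w w') \<in> A"
proof -
  obtain P where P: "idem_family C {-1, 0, 1} P"
    and h: "mm C (refl_mat C w) (refl_mat C w') = (\<Sum>e\<in>{-1, 0, 1}. (\<xi>\<^sup>2) powi e *\<^sub>v P e)"
    and ex: "\<exists>d. d \<noteq> 0 \<and> (\<Sum>e\<in>{-1, 0, 1}. of_int e *\<^sub>v P e) = d *\<^sub>v wedge C w w'"
    by (rule rotation_idempotents[OF C w c \<xi>])
  from ex obtain d where d: "d \<noteq> 0" "(\<Sum>e\<in>{-1, 0, 1}. of_int e *\<^sub>v P e) = d *\<^sub>v wedge C w w'"
    by (elim exE conjE)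
  let ?E = "{-1, 0, 1} :: int set"
  have z: "\<xi>\<^sup>2 \<noteq> 0" using \<xi> by simp
  have "tens_mat J C (\<lambda>_. mm C (refl_mat C w) (refl_mat C w')) = weight_op J C ?E P (\<lambda>\<epsilon>. (\<xi>\<^sup>2) powi (\<Sum>j\<in>J. \<epsilon> j))"
    unfolding h tens_mat_weight_op[OF J C P] powi_weight[OF z J] ..
  moreover have "tens_mat J C (\<lambda>_. mm C (refl_mat C w) (refl_mat C w')) \<in> A"
    using A in_A unfolding tens_mat_mm[OF J C, symmetric] by (simp add: mat_algebra_def)
  moreover have "inj (\<lambda>k. (\<xi>\<^sup>2) powi k)"
  proof (rule injI, rule ccontr)
    have *: False if kl: "k < l" "(\<xi>\<^sup>2) powi k = (\<xi>\<^sup>2) powi l" for k l :: int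
    proof -
      have "(\<xi>\<^sup>2) powi (l - k) = 1" using kl z by (simp add: power_int_diff)
      then have "(\<xi>\<^sup>2) ^ nat (l - k) = 1" using kl by (simp add: power_int_def)
      then show False using nroot[of "nat (l - k)"] kl by linarith
    qed
    show False if "(\<xi>\<^sup>2) powi k = (\<xi>\<^sup>2) powi l" "k \<noteq> l" for k l :: int
      using *[of k l] *[of l k] that by (cases "k < l") auto
  qed
  ultimately have "weight_op J C ?E P (\<lambda>\<epsilon>. of_int (\<Sum>j\<in>J. \<epsilon> j)) \<in> A"
    using weight_op_weight_in_algebra[OF A J C P, of "\<lambda>k. (\<xi>\<^sup>2) powi k" of_int] by simp
  then have "d *\<^sub>v deriv_mat J C (wedge C w w') \<in> A"
    unfolding deriv_mat_weight_op[OF J C P, symmetric] d deriv_mat_linear[OF J] .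
  then have "(1 / d) *\<^sub>v d *\<^sub>v deriv_mat J C (wedge C w w') \<in> A"
    using A by (intro cfun.subspace_scale[where c = "1 / d"]) (simp_all add: mat_algebra_def)
  then show ?thesis using d by simp
qed

text \<open>The rotation taking the reflection in \<open>w\<close> to the one in \<open>w'\<close> lies in the
  one-parameter group of \<open>w \<and> w'\<close>; its tensor power is a function of the weight of the
  derivation, and the weights, being integers, need no genericity.\<close>

lemma reflection_transport:
  assumes A: "mat_algebra (J \<rightarrow>\<^sub>E C) A" and J: "finite J" and C: "finite C"
    and w: "ip C w w = 1" "ip C w' w' = 1" and c: "(ip C w w')\<^sup>2 \<noteq> 1"
    and in_A: "tens_mat J C (\<lambda>_. refl_mat C w) \<in> A" "deriv_mat J C (wedge C w w') \<in> A"
  shows "tens_mat J C (\<lambda>_. refl_mat C w') \<in> A"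
proof -
  obtain \<xi> where \<xi>: "\<xi> \<noteq> 0" "\<xi> + inverse \<xi> = 2 * ip C w w'" by (rule exists_xi)
  obtain P where P: "idem_family C {-1, 0, 1} P"
    and h: "mm C (refl_mat C w) (refl_mat C w') = (\<Sum>e\<in>{-1, 0, 1}. (\<xi>\<^sup>2) powi e *\<^sub>v P e)"
    and ex: "\<exists>d. d \<noteq> 0 \<and> (\<Sum>e\<in>{-1, 0, 1}. of_int e *\<^sub>v P e) = d *\<^sub>v wedge C w w'"
    by (rule rotation_idempotents[OF C w c \<xi>])
  from ex obtain d where d: "d \<noteq> 0" "(\<Sum>e\<in>{-1, 0, 1}. of_int e *\<^sub>v P e) = d *\<^sub>v wedge C w w'"
    by (elim exE conjE)
  let ?E = "{-1, 0, 1} :: int set"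
  have z: "\<xi>\<^sup>2 \<noteq> 0" using \<xi> by simp
  have "d *\<^sub>v deriv_mat J C (wedge C w w') \<in> A"
    using A in_A by (intro cfun.subspace_scale) (simp_all add: mat_algebra_def)
  then have "weight_op J C ?E P (\<lambda>\<epsilon>. of_int (\<Sum>j\<in>J. \<epsilon> j)) \<in> A"
    unfolding deriv_mat_weight_op[OF J C P, symmetric] d deriv_mat_linear[OF J] .
  then have "weight_op J C ?E P (\<lambda>\<epsilon>. (\<xi>\<^sup>2) powi (\<Sum>j\<in>J. \<epsilon> j)) \<in> A"
    using weight_op_weight_in_algebra[OF A J C P, of of_int "\<lambda>k. (\<xi>\<^sup>2) powi k"] by (simp add: inj_on_def)
  moreover have "tens_mat J C (\<lambda>_. mm C (refl_mat C w) (refl_mat C w')) = weight_op J C ?E P (\<lambda>\<epsilon>. (\<xi>\<^sup>2) powi (\<Sum>j\<in>J. \<epsilon> j))"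
    unfolding h tens_mat_weight_op[OF J C P] powi_weight[OF z J] ..
  \<comment> \<open>Multiplying the rotation \<open>r r'\<close> by \<open>r\<close> leaves \<open>r'\<close>.\<close>
  ultimately have "mm (J \<rightarrow>\<^sub>E C) (tens_mat J C (\<lambda>_. refl_mat C w)) (tens_mat J C (\<lambda>_. mm C (refl_mat C w) (refl_mat C w'))) \<in> A"
    using A in_A by (simp add: mat_algebra_def)
  then show ?thesis
    unfolding tens_mat_mm[OF J C] mm_assoc[symmetric] refl_mat_refl_mat[OF C w(1)] mm_one[OF C refl_mat_mats] .
qed

text \<open>Lengthening the chain by one step is a bracket, and the two error terms of that bracket are already
  available.\<close>

lemma wedge_chain_in_algebra:
  assumes A: "mat_algebra (J \<rightarrow>\<^sub>E C) A" and J: "finite J" and C: "finite C"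
    and w: "\<And>i. i \<in> {1..m} \<Longrightarrow> ip C (w i) (w i) = 1"
    and step: "\<And>i. 1 \<le> i \<Longrightarrow> i < m \<Longrightarrow> deriv_mat J C (wedge C (w i) (w (Suc i))) \<in> A"
    and ij: "1 \<le> i" "i < j" "j \<le> m"
  shows "deriv_mat J C (wedge C (w i) (w j)) \<in> A"
  using ij(2,3)
proof (induction j)
  case (Suc j)
  have sub: "cfun.subspace A" using A by (simp add: mat_algebra_def)
  have j: "deriv_mat J C (wedge C (w j) (w (Suc j))) \<in> A" using step[of j] Suc.prems ij(1) by simp
  show ?case
  proof (cases "i = j")
    case False
    then have ih: "deriv_mat J C (wedge C (w i) (w j)) \<in> A" using Suc by simp
    have one: "ip C (w j) (w j) = 1" using w[of j] Suc.prems ij(1) by simp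
    let ?m = "mm (J \<rightarrow>\<^sub>E C)" and ?a = "ip C (w i) (w j)" and ?b = "ip C (w j) (w (Suc j))"
    let ?X = "deriv_mat J C (wedge C (w i) (w j))" and ?Y = "deriv_mat J C (wedge C (w j) (w (Suc j)))"
    have "wedge C (w i) (w (Suc j)) =
       (mm C (wedge C (w i) (w j)) (wedge C (w j) (w (Suc j))) - mm C (wedge C (w j) (w (Suc j))) (wedge C (w i) (w j)))
       + (?a *\<^sub>v wedge C (w j) (w (Suc j)) + ?b *\<^sub>v wedge C (w i) (w j))"
      unfolding wedge_commutator one by simp
    then have eq: "deriv_mat J C (wedge C (w i) (w (Suc j))) = (?m ?X ?Y - ?m ?Y ?X) + (?a *\<^sub>v ?Y + ?b *\<^sub>v ?X)"
      by (simp only: deriv_mat_linear[OF J] deriv_mat_commutator[OF J C wedge_mats wedge_mats])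
    have "?m ?X ?Y \<in> A" "?m ?Y ?X \<in> A" using A ih j by (simp_all add: mat_algebra_def)
    then show ?thesis
      unfolding eq using ih j by (intro cfun.subspace_add[OF sub] cfun.subspace_diff[OF sub] cfun.subspace_scale[OF sub])
  qed (use j in simp)
qed simp

lemma wedge_span_in_algebra:
  assumes A: "mat_algebra (J \<rightarrow>\<^sub>E C) A" and J: "finite J"
    and S: "\<And>v w. v \<in> S \<Longrightarrow> w \<in> S \<Longrightarrow> deriv_mat J C (wedge C v w) \<in> A"
    and vw: "v \<in> cfun.span S" "w \<in> cfun.span S"
  shows "deriv_mat J C (wedge C v w) \<in> A"
proof -
  have sub: "cfun.subspace A" using A by (simp add: mat_algebra_def)
  have 0: "wedge C 0 w = 0 *\<^sub>v wedge C 0 w" "wedge C w 0 = 0 *\<^sub>v wedge C w 0" for w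
    by (auto simp: wedge_def outer1_def fun_eq_iff)
  have z: "deriv_mat J C (wedge C 0 w) \<in> A" "deriv_mat J C (wedge C w 0) \<in> A" for w
    by (subst 0, unfold deriv_mat_linear[OF J], simp add: cfun.subspace_0[OF sub])+
  have "deriv_mat J C (wedge C v w) \<in> A" if "v \<in> S" for v
    using vw(2)
  proof (induction rule: cfun.span_induct_alt)
    case base show ?case by (rule z)
  next
    case (step c x y)
    then show ?case using S[OF that step(1)]
      unfolding wedge_linear deriv_mat_linear[OF J] by (intro cfun.subspace_add[OF sub] cfun.subspace_scale[OF sub])
  qed
  note right = this
  show ?thesis using vw(1)
  proof (induction rule: cfun.span_induct_alt)
    case base show ?case by (rule z)
  next
    case (step c x y)
    then show ?case using right[OF step(1)]
      unfolding wedge_linear deriv_mat_linear[OF J] by (intro cfun.subspace_add[OF sub] cfun.subspace_scale[OF sub])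
  qed
qed

lemma ip_delta: "finite C \<Longrightarrow> a \<in> C \<Longrightarrow> ip C w (delta a) = w a"
  by (simp add: ip_def delta_def if_distrib cong: if_cong)

text \<open>The generators along the chain \<open>w 1, \<dots>, w m\<close> give the whole orthogonal Lie algebra of the
  span by brackets and bilinearity. The reflection in \<open>w 1\<close> is then carried to a basis vector
  \<open>delta b\<close> and from there to the others; \<open>b\<close> must avoid \<open>(w 1 b)\<^sup>2 =
  1\<close>, where the plane of the two vectors degenerates.\<close>

lemma orthogonal_group_in_algebra:
  assumes A: "mat_algebra (J \<rightarrow>\<^sub>E C) A" and J: "finite J" and C: "finite C" "B \<subseteq> C"
    and m: "1 \<le> m" and w: "\<And>i. i \<in> {1..m} \<Longrightarrow> ip C (w i) (w i) = 1" "w 1 \<in> supported B"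
    and refl: "\<And>i. i \<in> {1..m} \<Longrightarrow> tens_mat J C (\<lambda>_. refl_mat C (w i)) \<in> A"
    and step: "\<And>i. 1 \<le> i \<Longrightarrow> i < m \<Longrightarrow> deriv_mat J C (wedge C (w i) (w (Suc i))) \<in> A"
    and span: "\<And>a. a \<in> B \<Longrightarrow> delta a \<in> cfun.span (w ` {1..m})"
  shows "a \<in> B \<Longrightarrow> b \<in> B \<Longrightarrow> deriv_mat J C (wedge C (delta a) (delta b)) \<in> A"
    "a \<in> B \<Longrightarrow> tens_mat J C (\<lambda>_. refl_mat C (delta a)) \<in> A"
proof -
  have sub: "cfun.subspace A" using A by (simp add: mat_algebra_def)
  have gens: "deriv_mat J C (wedge C v v') \<in> A" if vv: "v \<in> w ` {1..m}" "v' \<in> w ` {1..m}" for v v'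
  proof -
    obtain i j where ij: "i \<in> {1..m}" "j \<in> {1..m}" "v = w i" "v' = w j" using vv by auto
    have less: "deriv_mat J C (wedge C (w i) (w j)) \<in> A" if "i < j" "i \<in> {1..m}" "j \<in> {1..m}" for i j
      by (rule wedge_chain_in_algebra[where m = m and w = w, OF A J C(1) w(1) step]) (use that in auto)
    have flip: "deriv_mat J C (wedge C (w i) (w j)) = (- 1) *\<^sub>v deriv_mat J C (wedge C (w j) (w i))"
      unfolding deriv_mat_linear(2)[OF J, symmetric]
      by (rule arg_cong[of _ _ "deriv_mat J C"]) (auto simp: wedge_def fun_eq_iff vscale_def)
    have "deriv_mat J C (wedge C (w i) (w i)) = 0 *\<^sub>v deriv_mat J C (wedge C (w i) (w i))"
      unfolding deriv_mat_linear(2)[OF J, symmetric]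
      by (rule arg_cong[of _ _ "deriv_mat J C"]) (auto simp: wedge_def fun_eq_iff vscale_def)
    then have "deriv_mat J C (wedge C (w i) (w i)) \<in> A" using cfun.subspace_0[OF sub] by (metis cfun.scale_zero_left)
    then show ?thesis
    proof (cases i j rule: linorder_cases)
      case greater
      then show ?thesis
        unfolding ij flip using less[of j i] ij by (intro cfun.subspace_scale[OF sub]) auto
    qed (use less[of i j] ij in auto)
  qed
  have all: "deriv_mat J C (wedge C v v') \<in> A" if "v \<in> cfun.span (w ` {1..m})" "v' \<in> cfun.span (w ` {1..m})" for v v'
    by (rule wedge_span_in_algebra[OF A J gens that])
  show "deriv_mat J C (wedge C (delta a) (delta b)) \<in> A" if "a \<in> B" "b \<in> B" for a b
    using all span that by blast
  have w1: "w 1 \<in> cfun.span (w ` {1..m})" using m by (intro cfun.span_base) auto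
  have dd: "ip C (delta a) (delta a) = 1" if "a \<in> B" for a
    using that C by (subst ip_delta) (auto simp: delta_def)
  have from_w: "tens_mat J C (\<lambda>_. refl_mat C (delta b)) \<in> A" if b: "b \<in> B" "(w 1 b)\<^sup>2 \<noteq> 1" for b
  proof (rule reflection_transport[OF A J C(1), where w = "w 1"])
    show "(ip C (w 1) (delta b))\<^sup>2 \<noteq> 1" using b C by (subst ip_delta) auto
  qed (use m w refl dd b all[OF w1 span] in auto)
  show "tens_mat J C (\<lambda>_. refl_mat C (delta a)) \<in> A" if a: "a \<in> B" for a
  proof (cases "\<exists>b\<in>B. (w 1 b)\<^sup>2 \<noteq> 1")
    case True
    then obtain b where b: "b \<in> B" "(w 1 b)\<^sup>2 \<noteq> 1" by blast
    show ?thesis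
    proof (cases "a = b")
      case False
      show ?thesis
      proof (rule reflection_transport[OF A J C(1), where w = "delta b"])
        show "(ip C (delta b) (delta a))\<^sup>2 \<noteq> 1"
          using a C False by (subst ip_delta) (auto simp: delta_def)
      qed (use a b from_w[OF b] dd all span in auto)
    qed (use from_w[OF b] in simp)
  next
    case False
    \<comment> \<open>Then \<open>w 1\<close> has as many coordinates \<open>\<plusminus>1\<close> as there are basis vectors, so there is only one.\<close>
    have "1 = (\<Sum>b\<in>C. w 1 b * w 1 b)" using w(1)[of 1] m by (simp add: ip_def)
    also have "\<dots> = (\<Sum>b\<in>B. w 1 b * w 1 b)"
      using w(2) C by (intro sum.mono_neutral_right) (auto simp: supported_def)
    also have "\<dots> = (\<Sum>b\<in>B. 1)" using False by (intro sum.cong) (auto simp: power2_eq_square)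
    finally have "card B = 1" by (metis of_nat_1 of_nat_eq_iff sum_constant mult.right_neutral)
    then have B: "B = {a}" using a by (metis card_1_singletonE singletonD)
    have "outer1 C (w 1) (w 1) = outer1 C (delta a) (delta a)"
      using w(2) False unfolding B by (auto simp: outer1_def delta_def supported_def fun_eq_iff power2_eq_square)
    then have "refl_mat C (w 1) = refl_mat C (delta a)" by (simp add: refl_mat_def)
    then show ?thesis using refl[of 1] m by simp
  qed
qed

section \<open>Invariants of the orthogonal group\<close>

text \<open>Partial matchings of an arbitrary vertex set: the diagrams without the distinction of two rows, which the
  invariant theory ignores.\<close>

definition matchings :: "'p set \<Rightarrow> 'p set set set" where
  "matchings J = {d. partition_on J d \<and> (\<forall>b\<in>d. card b \<le> 2)}"

text \<open>The colourings that receive a nonzero matrix entry: colours are constant along edges, and an isolated vertex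
  carries the colour \<open>0\<close> of the invariant line.\<close>

definition compat :: "'p set set \<Rightarrow> ('p \<Rightarrow> nat) \<Rightarrow> bool" where
  "compat d \<kappa> \<longleftrightarrow> (\<forall>b\<in>d. (\<forall>x\<in>b. \<forall>y\<in>b. \<kappa> x = \<kappa> y) \<and> (\<forall>x. b = {x} \<longrightarrow> \<kappa> x = 0))"

lemma compat_insert:
  "compat (insert b d) \<kappa> \<longleftrightarrow> (\<forall>x\<in>b. \<forall>y\<in>b. \<kappa> x = \<kappa> y) \<and> (\<forall>x. b = {x} \<longrightarrow> \<kappa> x = 0) \<and> compat d \<kappa>"
  by (auto simp: compat_def)

lemma compat_union: "compat (d \<union> d') \<kappa> \<longleftrightarrow> compat d \<kappa> \<and> compat d' \<kappa>"
  by (auto simp: compat_def)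

lemma compat_cong:
  assumes "\<And>x. x \<in> \<Union>d \<Longrightarrow> \<kappa> x = \<kappa>' x"
  shows "compat d \<kappa> = compat d \<kappa>'"
proof -
  have half: "compat d \<kappa>'" if c: "compat d \<kappa>" and e: "\<And>x. x \<in> \<Union>d \<Longrightarrow> \<kappa> x = \<kappa>' x" for \<kappa> \<kappa>' :: "'a \<Rightarrow> nat"
    unfolding compat_def
  proof (intro ballI conjI allI impI)
    fix b x y assume "b \<in> d" "x \<in> b" "y \<in> b"
    then show "\<kappa>' x = \<kappa>' y" using c e[of x] e[of y] unfolding compat_def by (metis UnionI)
  next
    fix b x assume "b \<in> d" "b = {x}"
    then show "\<kappa>' x = 0" using c e[of x] unfolding compat_def by (metis UnionI insertI1)
  qed
  show ?thesis using half[of \<kappa> \<kappa>'] half[of \<kappa>' \<kappa>] assms by metis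
qed

lemma sum_PiE_split:
  assumes "i \<in> J"
  shows "(\<Sum>\<kappa>\<in>J \<rightarrow>\<^sub>E C. f \<kappa>) = (\<Sum>c\<in>C. \<Sum>\<kappa>\<in>(J - {i}) \<rightarrow>\<^sub>E C. f (\<kappa>(i := c)))"
proof -
  have J: "J = insert i (J - {i})" using assms by auto
  have "(\<Sum>\<kappa>\<in>J \<rightarrow>\<^sub>E C. f \<kappa>) = (\<Sum>\<kappa>\<in>(\<lambda>(y, g). g(i := y)) ` (C \<times> ((J - {i}) \<rightarrow>\<^sub>E C)). f \<kappa>)"
    by (subst J, subst PiE_insert_eq) simp
  also have "\<dots> = (\<Sum>(c, \<kappa>)\<in>C \<times> ((J - {i}) \<rightarrow>\<^sub>E C). f (\<kappa>(i := c)))"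
    by (subst sum.reindex) (auto simp: case_prod_beta intro!: inj_combinator)
  finally show ?thesis by (simp add: sum.cartesian_product)
qed

lemma sum_PiE_split':
  assumes "i \<in> J"
  shows "(\<Sum>\<kappa>\<in>J \<rightarrow>\<^sub>E C. f \<kappa>) = (\<Sum>\<kappa>\<in>(J - {i}) \<rightarrow>\<^sub>E C. \<Sum>c\<in>C. f (\<kappa>(i := c)))"
  unfolding sum_PiE_split[OF assms] by (rule sum.swap)

lemma if_mult: "(if P then x else 0) * z = (if P then x * z else (0::complex))"
  "z * (if P then x else 0) = (if P then z * x else (0::complex))"
  by simp_all

lemma matchings_insert:
  assumes "d \<in> matchings (J - b)" "b \<subseteq> J" "b \<noteq> {}" "card b \<le> 2"
  shows "insert b d \<in> matchings J"
proof -
  have "partition_on ((J - b) \<union> b) (insert b d)"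
  proof (subst partition_on_insert)
    show "disjnt b (\<Union> d)" using assms by (auto simp: matchings_def partition_on_def disjnt_def)
    have "J - b \<union> b - b = J - b" by auto
    then show "partition_on (J - b \<union> b - b) d \<and> b \<subseteq> J - b \<union> b \<and> b \<noteq> {}"
      using assms by (auto simp: matchings_def)
  qed
  moreover have "(J - b) \<union> b = J" using assms by auto
  ultimately show ?thesis using assms by (simp add: matchings_def)
qed

text \<open>A Casimir argument. Write \<open>E a b\<close> for the derivation that replaces one occurrence of the colour
  \<open>a\<close> by \<open>b\<close>; its adjoint for the standard Hermitian form is \<open>E b a\<close>,
  and invariance says that \<open>E a b y = E b a y\<close>. Therefore the sum over \<open>a\<close> of the
  squared norms of \<open>E a b y\<close> is the inner product of \<open>y\<close> with the sum of the
  \<open>E b a (E b a y)\<close>, which for a traceless tensor is minus the number of pairs of positions of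
  colour \<open>b\<close> times \<open>y\<close>. A nonnegative number equals a nonpositive one, and both
  vanish.\<close>

lemma traceless_positivity:
  fixes y :: "('p \<Rightarrow> nat) \<Rightarrow> complex"
  assumes J: "finite J" and b: "b \<in> {1..<n}"
    and inv: "\<And>a \<kappa>. a \<in> {1..<n} \<Longrightarrow> \<kappa> \<in> J \<rightarrow>\<^sub>E {0..<n} \<Longrightarrow>
       (\<Sum>i\<in>J. if \<kappa> i = a then y (\<kappa>(i := b)) else 0) = (\<Sum>i\<in>J. if \<kappa> i = b then y (\<kappa>(i := a)) else 0)"
    and zero: "\<And>\<kappa> i. \<kappa> \<in> J \<rightarrow>\<^sub>E {0..<n} \<Longrightarrow> i \<in> J \<Longrightarrow> \<kappa> i = 0 \<Longrightarrow> y \<kappa> = 0"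
    and trace: "\<And>\<kappa> i j. \<kappa> \<in> J \<rightarrow>\<^sub>E {0..<n} \<Longrightarrow> i \<in> J \<Longrightarrow> j \<in> J \<Longrightarrow> i \<noteq> j \<Longrightarrow>
       (\<Sum>c\<in>{0..<n}. y (\<kappa>(i := c, j := c))) = 0"
    and \<kappa>: "\<kappa> \<in> J \<rightarrow>\<^sub>E {0..<n}" "i \<in> J" "j \<in> J" "i \<noteq> j" "\<kappa> i = b" "\<kappa> j = b"
  shows "y \<kappa> = 0"
proof -
  let ?K = "J \<rightarrow>\<^sub>E {0..<n}"
  define E where "E a c \<kappa> = (\<Sum>i\<in>J. if \<kappa> i = a then y (\<kappa>(i := c)) else 0)" for a c \<kappa>
  define P where "P \<kappa> = card {(i, j). i \<in> J \<and> j \<in> J \<and> i \<noteq> j \<and> \<kappa> i = b \<and> \<kappa> j = b}" for \<kappa> :: "'p \<Rightarrow> nat"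
  have upd: "\<kappa>(i := c) \<in> ?K" if "\<kappa> \<in> ?K" "i \<in> J" "c \<in> {0..<n}" for \<kappa> i c
    using that by (auto simp: PiE_iff extensional_def)
  \<comment> \<open>The adjoint of \<open>E a b\<close> replaces \<open>b\<close> by \<open>a\<close>.\<close>
  have adj: "(\<Sum>\<kappa>\<in>?K. E a b \<kappa> * g \<kappa>) = (\<Sum>\<kappa>\<in>?K. y \<kappa> * (\<Sum>i\<in>J. if \<kappa> i = b then g (\<kappa>(i := a)) else 0))"
    if a: "a \<in> {1..<n}" for a g
  proof -
    have i: "(\<Sum>\<kappa>\<in>?K. (if \<kappa> i = a then y (\<kappa>(i := b)) else 0) * g \<kappa>) =
       (\<Sum>\<kappa>\<in>?K. y \<kappa> * (if \<kappa> i = b then g (\<kappa>(i := a)) else 0))" if i: "i \<in> J" for i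
    proof -
      have "(\<Sum>\<kappa>\<in>?K. (if \<kappa> i = a then y (\<kappa>(i := b)) else 0) * g \<kappa>) =
        (\<Sum>\<kappa>\<in>(J - {i}) \<rightarrow>\<^sub>E {0..<n}. y (\<kappa>(i := b)) * g (\<kappa>(i := a)))"
        using a unfolding sum_PiE_split'[OF i] by (simp add: if_mult)
      also have "\<dots> = (\<Sum>\<kappa>\<in>?K. y \<kappa> * (if \<kappa> i = b then g (\<kappa>(i := a)) else 0))"
        using b unfolding sum_PiE_split'[OF i] by (simp add: if_mult)
      finally show ?thesis .
    qed
    have "(\<Sum>\<kappa>\<in>?K. E a b \<kappa> * g \<kappa>) = (\<Sum>i\<in>J. \<Sum>\<kappa>\<in>?K. (if \<kappa> i = a then y (\<kappa>(i := b)) else 0) * g \<kappa>)"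
      unfolding E_def sum_distrib_right by (rule sum.swap)
    also have "\<dots> = (\<Sum>i\<in>J. \<Sum>\<kappa>\<in>?K. y \<kappa> * (if \<kappa> i = b then g (\<kappa>(i := a)) else 0))"
      by (intro sum.cong HOL.refl i)
    also have "\<dots> = (\<Sum>\<kappa>\<in>?K. y \<kappa> * (\<Sum>i\<in>J. if \<kappa> i = b then g (\<kappa>(i := a)) else 0))"
      unfolding sum_distrib_left by (rule sum.swap)
    finally show ?thesis .
  qed
  \<comment> \<open>A second replacement at the same position is impossible, which leaves pairs of positions; the trace condition evaluates the sum over \<open>a\<close>.\<close>
  have EE: "(\<Sum>a\<in>{1..<n} - {b}. \<Sum>i\<in>J. if \<kappa> i = b then E b a (\<kappa>(i := a)) else 0) = - (of_nat (P \<kappa>) * y \<kappa>)"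
    if \<kappa>: "\<kappa> \<in> ?K" for \<kappa>
  proof -
    have tr: "(\<Sum>a\<in>{1..<n} - {b}. y (\<kappa>(i := a, j := a))) = - y \<kappa>"
      if ij: "i \<in> J" "j \<in> J" "i \<noteq> j" "\<kappa> i = b" "\<kappa> j = b" for i j
    proof -
      obtain S where S: "S = {1..<n} - {b}" by simp
      then have un: "{0..<n} = insert 0 (insert b S)" "finite S" "b \<notin> S" "0 \<notin> S" "0 \<noteq> b" using b by auto
      have "y (\<kappa>(i := 0, j := 0)) = 0"
        by (rule zero[of _ i]) (use ij \<kappa> b upd in auto)
      moreover have "\<kappa>(i := b, j := b) = \<kappa>" using ij by auto
      ultimately have "(\<Sum>c\<in>{0..<n}. y (\<kappa>(i := c, j := c))) = y \<kappa> + (\<Sum>a\<in>{1..<n} - {b}. y (\<kappa>(i := a, j := a)))"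
        using un(2-5) unfolding un(1) S[symmetric] by simp
      then show ?thesis using trace[OF \<kappa> ij(1-3)] by (simp add: eq_neg_iff_add_eq_0 add.commute)
    qed
    have "(\<Sum>a\<in>{1..<n} - {b}. \<Sum>i\<in>J. if \<kappa> i = b then E b a (\<kappa>(i := a)) else 0) =
      (\<Sum>a\<in>{1..<n} - {b}. \<Sum>i\<in>J. \<Sum>j\<in>J. if i \<noteq> j \<and> \<kappa> i = b \<and> \<kappa> j = b then y (\<kappa>(i := a, j := a)) else 0)"
      unfolding E_def by (intro sum.cong HOL.refl) (auto intro!: sum.cong)
    also have "\<dots> = (\<Sum>i\<in>J. \<Sum>a\<in>{1..<n} - {b}. \<Sum>j\<in>J. if i \<noteq> j \<and> \<kappa> i = b \<and> \<kappa> j = b then y (\<kappa>(i := a, j := a)) else 0)"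
      by (rule sum.swap)
    also have "\<dots> = (\<Sum>i\<in>J. \<Sum>j\<in>J. \<Sum>a\<in>{1..<n} - {b}. if i \<noteq> j \<and> \<kappa> i = b \<and> \<kappa> j = b then y (\<kappa>(i := a, j := a)) else 0)"
      by (intro sum.cong HOL.refl sum.swap)
    also have "\<dots> = (\<Sum>i\<in>J. \<Sum>j\<in>J. if i \<noteq> j \<and> \<kappa> i = b \<and> \<kappa> j = b then - y \<kappa> else 0)"
    proof (intro sum.cong HOL.refl)
      fix i j assume ij: "i \<in> J" "j \<in> J"
      show "(\<Sum>a\<in>{1..<n} - {b}. if i \<noteq> j \<and> \<kappa> i = b \<and> \<kappa> j = b then y (\<kappa>(i := a, j := a)) else 0) =
         (if i \<noteq> j \<and> \<kappa> i = b \<and> \<kappa> j = b then - y \<kappa> else 0)"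
      proof (cases "i \<noteq> j \<and> \<kappa> i = b \<and> \<kappa> j = b")
        case False
        then show ?thesis by (simp only: if_False sum.neutral_const)
      qed (use tr[of i j] ij in simp)
    qed
    also have "\<dots> = (\<Sum>x\<in>J \<times> J. if fst x \<noteq> snd x \<and> \<kappa> (fst x) = b \<and> \<kappa> (snd x) = b then - y \<kappa> else 0)"
      unfolding sum.cartesian_product by (simp add: case_prod_beta)
    also have "\<dots> = (\<Sum>x\<in>{x \<in> J \<times> J. fst x \<noteq> snd x \<and> \<kappa> (fst x) = b \<and> \<kappa> (snd x) = b}. - y \<kappa>)"
      using J by (intro sum.inter_filter[symmetric]) simp
    also have "{x \<in> J \<times> J. fst x \<noteq> snd x \<and> \<kappa> (fst x) = b \<and> \<kappa> (snd x) = b} =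
        {(i, j). i \<in> J \<and> j \<in> J \<and> i \<noteq> j \<and> \<kappa> i = b \<and> \<kappa> j = b}" by auto
    finally show ?thesis by (simp add: P_def)
  qed
  have "(\<Sum>a\<in>{1..<n} - {b}. \<Sum>\<kappa>\<in>?K. E a b \<kappa> * cnj (E a b \<kappa>)) =
    (\<Sum>a\<in>{1..<n} - {b}. \<Sum>\<kappa>\<in>?K. y \<kappa> * cnj (\<Sum>i\<in>J. if \<kappa> i = b then E b a (\<kappa>(i := a)) else 0))"
  proof (rule sum.cong[OF HOL.refl])
    fix a assume a: "a \<in> {1..<n} - {b}"
    have "(\<Sum>\<kappa>\<in>?K. E a b \<kappa> * cnj (E a b \<kappa>)) = (\<Sum>\<kappa>\<in>?K. E a b \<kappa> * cnj (E b a \<kappa>))"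
      using inv[of a] a by (intro sum.cong HOL.refl) (simp add: E_def)
    also have "\<dots> = (\<Sum>\<kappa>\<in>?K. y \<kappa> * (\<Sum>i\<in>J. if \<kappa> i = b then cnj (E b a (\<kappa>(i := a))) else 0))"
      by (rule adj[of a "\<lambda>\<kappa>. cnj (E b a \<kappa>)"]) (use a in auto)
    finally show "(\<Sum>\<kappa>\<in>?K. E a b \<kappa> * cnj (E a b \<kappa>)) =
      (\<Sum>\<kappa>\<in>?K. y \<kappa> * cnj (\<Sum>i\<in>J. if \<kappa> i = b then E b a (\<kappa>(i := a)) else 0))"
      by (simp add: if_distrib cong: if_cong)
  qed
  also have "\<dots> = (\<Sum>\<kappa>\<in>?K. y \<kappa> * cnj (\<Sum>a\<in>{1..<n} - {b}. \<Sum>i\<in>J. if \<kappa> i = b then E b a (\<kappa>(i := a)) else 0))"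
    unfolding cnj_sum sum_distrib_left by (rule sum.swap)
  also have "\<dots> = (\<Sum>\<kappa>\<in>?K. - of_nat (P \<kappa>) * (y \<kappa> * cnj (y \<kappa>)))"
    by (intro sum.cong HOL.refl) (simp only: EE complex_cnj_minus complex_cnj_mult complex_cnj_of_nat mult_minus_left mult_minus_right mult.left_commute)
  finally have "complex_of_real ((\<Sum>a\<in>{1..<n} - {b}. \<Sum>\<kappa>\<in>?K. (cmod (E a b \<kappa>))\<^sup>2) + (\<Sum>\<kappa>\<in>?K. real (P \<kappa>) * (cmod (y \<kappa>))\<^sup>2)) = 0"
    by (simp add: complex_norm_square[symmetric] sum_negf)
  then have "(\<Sum>a\<in>{1..<n} - {b}. \<Sum>\<kappa>\<in>?K. (cmod (E a b \<kappa>))\<^sup>2) + (\<Sum>\<kappa>\<in>?K. real (P \<kappa>) * (cmod (y \<kappa>))\<^sup>2) = 0"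
    by (simp only: of_real_eq_0_iff)
  moreover have "(\<Sum>a\<in>{1..<n} - {b}. \<Sum>\<kappa>\<in>?K. (cmod (E a b \<kappa>))\<^sup>2) \<ge> 0" by (intro sum_nonneg) simp
  moreover have "(\<Sum>\<kappa>\<in>?K. real (P \<kappa>) * (cmod (y \<kappa>))\<^sup>2) \<ge> 0" by (intro sum_nonneg) simp
  ultimately have "(\<Sum>\<kappa>\<in>?K. real (P \<kappa>) * (cmod (y \<kappa>))\<^sup>2) = 0" by linarith
  then have "real (P \<kappa>) * (cmod (y \<kappa>))\<^sup>2 = 0"
    using \<kappa>(1) J by (subst (asm) sum_nonneg_eq_0_iff) (auto intro!: finite_PiE)
  moreover have "P \<kappa> \<noteq> 0"
  proof -
    have "{(i, j). i \<in> J \<and> j \<in> J \<and> i \<noteq> j \<and> \<kappa> i = b \<and> \<kappa> j = b} \<subseteq> J \<times> J" by auto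
    then have "finite {(i, j). i \<in> J \<and> j \<in> J \<and> i \<noteq> j \<and> \<kappa> i = b \<and> \<kappa> j = b}"
      using J by (meson finite_SigmaI finite_subset)
    then show ?thesis using \<kappa> by (auto simp: P_def card_eq_0_iff)
  qed
  ultimately show ?thesis by simp
qed

text \<open>The first fundamental theorem for the orthogonal group of the nonzero colours, in dual form. Fixing the
  colour \<open>0\<close> at one position, or contracting two positions, produces an invariant of fewer
  positions that is orthogonal to all matchings of the remaining ones, since a matching extends by a single
  vertex or by an edge. By induction \<open>y\<close> vanishes where the colour \<open>0\<close> occurs and is
  traceless. In a colouring of nonzero colours parity makes every colour occur twice, and positivity applies.\<close>

lemma invariant_orthogonal_to_matchings_zero:
  fixes y :: "('p \<Rightarrow> nat) \<Rightarrow> complex"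
  assumes J: "finite J" and n: "n \<ge> 1"
    and inv: "\<And>a b \<kappa>. a \<in> {1..<n} \<Longrightarrow> b \<in> {1..<n} \<Longrightarrow> \<kappa> \<in> J \<rightarrow>\<^sub>E {0..<n} \<Longrightarrow>
       (\<Sum>i\<in>J. if \<kappa> i = a then y (\<kappa>(i := b)) else 0) = (\<Sum>i\<in>J. if \<kappa> i = b then y (\<kappa>(i := a)) else 0)"
    and par: "\<And>a \<kappa>. a \<in> {1..<n} \<Longrightarrow> \<kappa> \<in> J \<rightarrow>\<^sub>E {0..<n} \<Longrightarrow> y \<kappa> \<noteq> 0 \<Longrightarrow> even (card {i \<in> J. \<kappa> i = a})"
    and orth: "\<And>d. d \<in> matchings J \<Longrightarrow> (\<Sum>\<kappa>\<in>J \<rightarrow>\<^sub>E {0..<n}. if compat d \<kappa> then y \<kappa> else 0) = 0"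
    and \<kappa>: "\<kappa> \<in> J \<rightarrow>\<^sub>E {0..<n}"
  shows "y \<kappa> = 0"
  using assms
proof (induction "card J" arbitrary: J y \<kappa> rule: less_induct)
  case less
  note J = less.prems(1) and inv = less.prems(3) and par = less.prems(4) and orth = less.prems(5)
  let ?C = "{0..<n}" and ?K = "J \<rightarrow>\<^sub>E {0..<n}"
  show ?case
  proof (cases "J = {}")
    case True
    have "{} \<in> matchings J" using True by (simp add: matchings_def partition_on_empty)
    from orth[OF this] show ?thesis using True less.prems(6) by (simp add: compat_def)
  next
    case ne: False
    \<comment> \<open>The induction hypothesis for \<open>y\<close> restricted to colour \<open>0\<close> at position \<open>i\<close>.\<close>
    have zero: "y \<kappa> = 0" if \<kappa>: "\<kappa> \<in> ?K" "i \<in> J" "\<kappa> i = 0" for \<kappa> i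
    proof -
      define y' where "y' \<mu> = y (\<mu>(i := 0))" for \<mu>
      let ?J = "J - {i}"
      have ext: "\<mu>(i := 0) \<in> ?K" if "\<mu> \<in> ?J \<rightarrow>\<^sub>E ?C" for \<mu>
        using that \<kappa>(2) n by (auto simp: PiE_iff extensional_def)
      have "y' (restrict \<kappa> ?J) = 0"
      proof (rule less.hyps[where J = ?J])
        show "card ?J < card J" using J \<kappa>(2) by (meson card_Diff1_less)
        show "(\<Sum>x\<in>?J. if \<mu> x = a then y' (\<mu>(x := b)) else 0) = (\<Sum>x\<in>?J. if \<mu> x = b then y' (\<mu>(x := a)) else 0)"
          if ab: "a \<in> {1..<n}" "b \<in> {1..<n}" and \<mu>: "\<mu> \<in> ?J \<rightarrow>\<^sub>E ?C" for a b \<mu>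
        proof -
          have "(\<Sum>x\<in>J. if (\<mu>(i := 0)) x = a then y ((\<mu>(i := 0))(x := b)) else 0) =
            (\<Sum>x\<in>?J. if \<mu> x = a then y' (\<mu>(x := b)) else 0)" if "a \<noteq> 0" for a b
          proof -
            have "(\<Sum>x\<in>J. if (\<mu>(i := 0)) x = a then y ((\<mu>(i := 0))(x := b)) else 0) =
               (\<Sum>x\<in>?J. if (\<mu>(i := 0)) x = a then y ((\<mu>(i := 0))(x := b)) else 0)"
              using that J \<kappa>(2) by (subst sum.remove[of J i]) auto
            also have "\<dots> = (\<Sum>x\<in>?J. if \<mu> x = a then y' (\<mu>(x := b)) else 0)"
              by (intro sum.cong HOL.refl) (auto simp: y'_def fun_upd_twist)
            finally show ?thesis .
          qed
          from this[of a b] this[of b a] inv[OF ab ext[OF \<mu>]] ab show ?thesis by simp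
        qed
        show "even (card {x \<in> ?J. \<mu> x = a})" if "a \<in> {1..<n}" "\<mu> \<in> ?J \<rightarrow>\<^sub>E ?C" "y' \<mu> \<noteq> 0" for a \<mu>
        proof -
          have "{x \<in> J. (\<mu>(i := 0)) x = a} = {x \<in> ?J. \<mu> x = a}" using that by auto
          then show ?thesis using par[OF that(1) ext[OF that(2)]] that(3) by (simp add: y'_def)
        qed
        show "(\<Sum>\<mu>\<in>?J \<rightarrow>\<^sub>E ?C. if compat d \<mu> then y' \<mu> else 0) = 0" if d: "d \<in> matchings ?J" for d
        proof -
          have U: "\<Union>d = ?J" using d by (simp add: matchings_def partition_on_def)
          have "compat (insert {i} d) (\<mu>(i := c)) \<longleftrightarrow> c = 0 \<and> compat d \<mu>" for \<mu> c
            using compat_cong[of d "\<mu>(i := c)" \<mu>] U by (auto simp: compat_insert)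
          moreover have "insert {i} d \<in> matchings J" using d \<kappa>(2) by (intro matchings_insert) auto
          note orth[OF this]
          ultimately have "(\<Sum>\<mu>\<in>?J \<rightarrow>\<^sub>E ?C. \<Sum>c\<in>?C. if c = 0 then if compat d \<mu> then y (\<mu>(i := c)) else 0 else 0) = 0"
            unfolding sum_PiE_split'[OF \<kappa>(2)] by (simp add: if_if_eq_conj)
          then show ?thesis using n unfolding y'_def by simp
        qed
        show "restrict \<kappa> ?J \<in> ?J \<rightarrow>\<^sub>E ?C" using \<kappa>(1) by auto
      qed (use J n in auto)
      moreover have "(restrict \<kappa> ?J)(i := 0) = \<kappa>"
        using \<kappa> by (auto simp: fun_eq_iff PiE_iff extensional_def)
      ultimately show ?thesis by (simp add: y'_def)
    qed
    \<comment> \<open>The induction hypothesis for the contraction of positions \<open>i\<close> and \<open>j\<close>.\<close>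
    have trace: "(\<Sum>c\<in>?C. y (\<kappa>(i := c, j := c))) = 0"
      if \<kappa>: "\<kappa> \<in> ?K" "i \<in> J" "j \<in> J" "i \<noteq> j" for \<kappa> i j
    proof -
      define y' where "y' \<mu> = (\<Sum>c\<in>?C. y (\<mu>(i := c, j := c)))" for \<mu>
      let ?J = "J - {i, j}"
      have ext: "\<mu>(i := c, j := c) \<in> ?K" if "\<mu> \<in> ?J \<rightarrow>\<^sub>E ?C" "c \<in> ?C" for \<mu> c
        using that \<kappa>(2,3) by (auto simp: PiE_iff extensional_def)
      have "y' (restrict \<kappa> ?J) = 0"
      proof (rule less.hyps[where J = ?J])
        show "card ?J < card J" using J \<kappa>(2) by (intro psubset_card_mono) auto
        show "(\<Sum>x\<in>?J. if \<mu> x = a then y' (\<mu>(x := b)) else 0) = (\<Sum>x\<in>?J. if \<mu> x = b then y' (\<mu>(x := a)) else 0)"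
          if ab: "a \<in> {1..<n}" "b \<in> {1..<n}" and \<mu>: "\<mu> \<in> ?J \<rightarrow>\<^sub>E ?C" for a b \<mu>
        proof -
          let ?\<mu> = "\<lambda>c. \<mu>(i := c, j := c)"
          \<comment> \<open>The terms that change position \<open>i\<close> or \<open>j\<close> are symmetric in \<open>a\<close> and \<open>b\<close>, so they cancel in the invariance equation.\<close>
          have *: "(\<Sum>c\<in>?C. \<Sum>x\<in>J. if ?\<mu> c x = a then y ((?\<mu> c)(x := b)) else 0) =
            (\<Sum>x\<in>?J. if \<mu> x = a then y' (\<mu>(x := b)) else 0) + (y (\<mu>(i := b, j := a)) + y (\<mu>(i := a, j := b)))"
            if a: "a \<in> {1..<n}" for a b
          proof -
            have 1: "(\<Sum>x\<in>J. if ?\<mu> c x = a then y ((?\<mu> c)(x := b)) else 0) =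
               (\<Sum>x\<in>?J. if \<mu> x = a then y (\<mu>(x := b, i := c, j := c)) else 0) +
               (if c = a then y (\<mu>(i := b, j := a)) + y (\<mu>(i := a, j := b)) else 0)" for c
            proof -
              have J': "J = insert i (insert j ?J)" using \<kappa> by auto
              have "(\<Sum>x\<in>J. if ?\<mu> c x = a then y ((?\<mu> c)(x := b)) else 0) =
                (if c = a then y ((?\<mu> c)(i := b)) else 0) + ((if c = a then y ((?\<mu> c)(j := b)) else 0) +
                (\<Sum>x\<in>?J. if ?\<mu> c x = a then y ((?\<mu> c)(x := b)) else 0))"
                using J \<kappa>(4) by (subst J', subst sum.insert, simp, simp, subst sum.insert) simp_all
              moreover have "(\<Sum>x\<in>?J. if ?\<mu> c x = a then y ((?\<mu> c)(x := b)) else 0) =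
                 (\<Sum>x\<in>?J. if \<mu> x = a then y (\<mu>(x := b, i := c, j := c)) else 0)"
              proof (intro sum.cong HOL.refl)
                fix x assume "x \<in> ?J"
                then have "(?\<mu> c)(x := b) = \<mu>(x := b, i := c, j := c)" "?\<mu> c x = \<mu> x" by (auto simp: fun_eq_iff)
                then show "(if ?\<mu> c x = a then y ((?\<mu> c)(x := b)) else 0) =
                   (if \<mu> x = a then y (\<mu>(x := b, i := c, j := c)) else 0)" by simp
              qed
              moreover have "(?\<mu> c)(i := b) = \<mu>(i := b, j := c)" "(?\<mu> c)(j := b) = \<mu>(i := c, j := b)"
                using \<kappa>(4) by (auto simp: fun_eq_iff)
              ultimately show ?thesis
                by (cases "c = a") (simp_all only: if_True if_False add_ac add_0_left add_0_right simp_thms)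
            qed
            have "(\<Sum>c\<in>?C. \<Sum>x\<in>?J. if \<mu> x = a then y (\<mu>(x := b, i := c, j := c)) else 0) =
               (\<Sum>x\<in>?J. if \<mu> x = a then y' (\<mu>(x := b)) else 0)"
              unfolding y'_def by (subst sum.swap) (intro sum.cong HOL.refl, simp split: if_split)
            then show ?thesis using a unfolding 1 sum.distrib by simp
          qed
          have "(\<Sum>c\<in>?C. \<Sum>x\<in>J. if ?\<mu> c x = a then y ((?\<mu> c)(x := b)) else 0) =
             (\<Sum>c\<in>?C. \<Sum>x\<in>J. if ?\<mu> c x = b then y ((?\<mu> c)(x := a)) else 0)"
            by (intro sum.cong HOL.refl inv ab ext \<mu>)
          then show ?thesis unfolding *[OF ab(1)] *[OF ab(2)] by (simp add: add_ac)
        qed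
        show "even (card {x \<in> ?J. \<mu> x = a})" if a: "a \<in> {1..<n}" "\<mu> \<in> ?J \<rightarrow>\<^sub>E ?C" "y' \<mu> \<noteq> 0" for a \<mu>
        proof -
          obtain c where c: "c \<in> ?C" "y (\<mu>(i := c, j := c)) \<noteq> 0"
            using a(3) unfolding y'_def by (meson sum.neutral)
          have ev: "even (card {x \<in> J. (\<mu>(i := c, j := c)) x = a})"
            using par[OF a(1) ext[OF a(2) c(1)] c(2)] .
          have "{x \<in> J. (\<mu>(i := c, j := c)) x = a} = (if c = a then {i, j} else {}) \<union> {x \<in> ?J. \<mu> x = a}"
            using \<kappa> by auto
          then have "card {x \<in> J. (\<mu>(i := c, j := c)) x = a} = (if c = a then 2 else 0) + card {x \<in> ?J. \<mu> x = a}"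
            using J \<kappa>(4) by (auto simp: card_insert_if)
          then show ?thesis using ev by (simp split: if_splits)
        qed
        show "(\<Sum>\<mu>\<in>?J \<rightarrow>\<^sub>E ?C. if compat d \<mu> then y' \<mu> else 0) = 0" if d: "d \<in> matchings ?J" for d
        proof -
          have U: "\<Union>d = ?J" using d by (simp add: matchings_def partition_on_def)
          have cp: "compat (insert {i, j} d) (\<mu>(j := c', i := c)) \<longleftrightarrow> c' = c \<and> compat d \<mu>" for \<mu> c c'
            using compat_cong[of d "\<mu>(j := c', i := c)" \<mu>] U \<kappa>(4) by (auto simp: compat_insert)
          have "insert {i, j} d \<in> matchings J" using d \<kappa> by (intro matchings_insert) auto
          then have "(\<Sum>\<kappa>\<in>?K. if compat (insert {i, j} d) \<kappa> then y \<kappa> else 0) = 0" by (rule orth)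
          also have "(\<Sum>\<kappa>\<in>?K. if compat (insert {i, j} d) \<kappa> then y \<kappa> else 0) =
            (\<Sum>c\<in>?C. \<Sum>c'\<in>?C. \<Sum>\<mu>\<in>?J \<rightarrow>\<^sub>E ?C. if c' = c \<and> compat d \<mu> then y (\<mu>(j := c', i := c)) else 0)"
          proof -
            have j: "j \<in> J - {i}" using \<kappa> by auto
            have J2: "J - {i} - {j} = ?J" by auto
            show ?thesis unfolding sum_PiE_split[OF \<kappa>(2)] sum_PiE_split[OF j] cp J2 ..
          qed
          also have "\<dots> = (\<Sum>c\<in>?C. \<Sum>\<mu>\<in>?J \<rightarrow>\<^sub>E ?C. \<Sum>c'\<in>?C. if c' = c then if compat d \<mu> then y (\<mu>(j := c', i := c)) else 0 else 0)"
            by (intro sum.cong HOL.refl, subst sum.swap) (simp add: if_if_eq_conj)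
          also have "\<dots> = (\<Sum>c\<in>?C. \<Sum>\<mu>\<in>?J \<rightarrow>\<^sub>E ?C. if compat d \<mu> then y (\<mu>(i := c, j := c)) else 0)"
            using \<kappa>(4) by (intro sum.cong HOL.refl) (simp add: fun_upd_twist)
          also have "\<dots> = (\<Sum>\<mu>\<in>?J \<rightarrow>\<^sub>E ?C. if compat d \<mu> then y' \<mu> else 0)"
            unfolding y'_def by (subst sum.swap) (intro sum.cong HOL.refl, simp split: if_split)
          finally show ?thesis .
        qed
        show "restrict \<kappa> ?J \<in> ?J \<rightarrow>\<^sub>E ?C" using \<kappa>(1) by auto
      qed (use J n in auto)
      moreover have "(restrict \<kappa> ?J)(i := c, j := c) = \<kappa>(i := c, j := c)" for c
        using \<kappa> by (auto simp: fun_eq_iff PiE_iff extensional_def)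
      ultimately show ?thesis by (simp add: y'_def)
    qed
    show "y \<kappa> = 0"
    proof (rule ccontr)
      assume nz: "y \<kappa> \<noteq> 0"
      obtain i where i: "i \<in> J" using ne by blast
      have b: "\<kappa> i \<in> {1..<n}" using zero[OF less.prems(6) i] nz i less.prems(6) by (auto simp: PiE_iff Suc_le_eq)
      have fin: "finite {x \<in> J. \<kappa> x = \<kappa> i}" using J by simp
      have "even (card {x \<in> J. \<kappa> x = \<kappa> i})" by (rule par[OF b less.prems(6) nz])
      moreover have "card {x \<in> J. \<kappa> x = \<kappa> i} \<noteq> 0" using i fin by auto
      ultimately have "{x \<in> J. \<kappa> x = \<kappa> i} \<noteq> {i}" by auto
      then obtain j where j: "j \<in> J" "\<kappa> j = \<kappa> i" "j \<noteq> i" using i by auto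
      have "y \<kappa> = 0"
        by (rule traceless_positivity[OF J b inv[OF _ b] zero trace less.prems(6) i j(1) j(3)[symmetric]]) (use j in auto)
      then show False using nz by simp
    qed
  qed
qed

section \<open>A double commutant theorem\<close>

definition herm :: "'a set \<Rightarrow> ('a \<Rightarrow> complex) \<Rightarrow> ('a \<Rightarrow> complex) \<Rightarrow> complex" where
  "herm I f g = (\<Sum>x\<in>I. f x * cnj (g x))"

lemma herm_linear: "herm I (f + f') g = herm I f g + herm I f' g" "herm I (c *\<^sub>v f) g = c * herm I f g"
  "herm I (f - f') g = herm I f g - herm I f' g"
  "herm I g (f + f') = herm I g f + herm I g f'" "herm I g (c *\<^sub>v f) = cnj c * herm I g f" "herm I 0 g = 0" "herm I g 0 = 0"
  by (simp_all add: herm_def vscale_def algebra_simps sum.distrib sum_distrib_left sum_subtractf)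

lemma herm_sum: "herm I (\<Sum>i\<in>S. f i) g = (\<Sum>i\<in>S. herm I (f i) g)"
  by (induction S rule: infinite_finite_induct) (simp_all only: herm_linear sum.infinite sum.empty sum.insert simp_thms)

lemma herm_self_eq_0:
  assumes "finite I" "f \<in> supported I" "herm I f f = 0" shows "f = 0"
proof
  have "herm I f f = complex_of_real (\<Sum>x\<in>I. (cmod (f x))\<^sup>2)"
    unfolding herm_def of_real_sum complex_norm_square ..
  then have "(\<Sum>x\<in>I. (cmod (f x))\<^sup>2) = 0" using assms(3) by (metis of_real_eq_0_iff)
  then have "\<forall>x\<in>I. f x = 0" using assms(1) by (simp add: sum_nonneg_eq_0_iff)
  then show "f x = 0 x" for x using assms(2) by (cases "x \<in> I") (auto simp: supported_def)
qed

lemma span_delta: "finite I \<Longrightarrow> supported I \<subseteq> cfun.span (delta ` I)"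
proof
  fix x :: "'a \<Rightarrow> complex" assume I: "finite I" and x: "x \<in> supported I"
  have "x = (\<Sum>i\<in>I. x i *\<^sub>v delta i)"
  proof
    fix j
    show "x j = (\<Sum>i\<in>I. x i *\<^sub>v delta i) j"
      using I x by (cases "j \<in> I") (auto simp: sum_apply vscale_def delta_def supported_def if_distrib cong: if_cong)
  qed
  moreover have "(\<Sum>i\<in>I. x i *\<^sub>v delta i) \<in> cfun.span (delta ` I)"
    by (intro cfun.span_sum cfun.span_scale cfun.span_base) auto
  ultimately show "x \<in> cfun.span (delta ` I)" by (simp only:)
qed

lemma finite_basis_of_subspace:
  assumes "finite I" "cfun.subspace S" "S \<subseteq> supported I"
  obtains B where "finite B" "cfun.span B = S"
proof -
  obtain B where B: "B \<subseteq> S" "cfun.independent B" "S \<subseteq> cfun.span B"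
    by (rule cfun.maximal_independent_subset)
  have "finite B"
    using cfun.independent_span_bound[of "delta ` I" B] B span_delta[OF assms(1)] assms by blast
  moreover have "cfun.span B = S"
    using B assms(2) by (metis cfun.span_minimal subset_antisym)
  ultimately show ?thesis using that by blast
qed

text \<open>Orthogonalisation: the projection is built up along a finite spanning set, correcting by one new orthogonal
  direction in each step.\<close>

lemma orthogonal_decomposition:
  assumes I: "finite I" and S: "cfun.subspace S" "S \<subseteq> supported I" and x: "x \<in> supported I"
  obtains p where "p \<in> S" "\<And>s. s \<in> S \<Longrightarrow> herm I (x - p) s = 0"
proof -
  have fin: "\<exists>p\<in>cfun.span B. \<forall>s\<in>B. herm I (x - p) s = 0" if "finite B" "B \<subseteq> supported I" for B :: "('a \<Rightarrow> complex) set" and x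
    using that
  proof (induction B arbitrary: x rule: finite_induct)
    case (insert v B)
    have mono: "cfun.span B \<subseteq> cfun.span (insert v B)" by (intro cfun.span_mono) auto
    obtain p where p: "p \<in> cfun.span B" "\<forall>s\<in>B. herm I (x - p) s = 0" using insert by blast
    obtain w where w: "w \<in> cfun.span B" "\<forall>s\<in>B. herm I (v - w) s = 0" using insert by blast
    have 0: "herm I y s = 0" if "\<forall>s\<in>B. herm I y s = 0" "s \<in> cfun.span B" for y s
      using that(2) by (induction rule: cfun.span_induct_alt) (simp_all only: herm_linear(4,5,7) that(1)[rule_format] mult_zero_right add_0)
    let ?y = "v - w"
    have B_sub: "cfun.span B \<subseteq> supported I" using insert.prems by (intro cfun.span_minimal supported_subspace) auto
    have yI: "?y \<in> supported I" using w(1) B_sub insert.prems by (auto simp: supported_def)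
    define c where "c = herm I (x - p) ?y / herm I ?y ?y"
    define p' where "p' = p + c *\<^sub>v ?y"
    have "p' \<in> cfun.span (insert v B)"
      unfolding p'_def using p(1) w(1) mono
      by (intro cfun.span_add cfun.span_scale cfun.span_diff) (auto intro: cfun.span_base)
    moreover have oB: "herm I (x - p') s = 0" if "s \<in> B" for s
    proof -
      have e: "x - p' = (x - p) - c *\<^sub>v ?y" by (simp add: p'_def)
      show ?thesis unfolding e using p(2) w(2) that by (simp only: herm_linear) simp
    qed
    moreover have "herm I (x - p') v = 0"
    proof -
      have e: "x - p' = (x - p) - c *\<^sub>v ?y" by (simp add: p'_def)
      have "herm I (x - p') ?y = 0"
      proof (cases "?y = 0")
        case True
        then show ?thesis by (simp only: herm_linear)
      next
        case False
        then have "herm I ?y ?y \<noteq> 0" using herm_self_eq_0[OF I yI] by blast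
        then show ?thesis unfolding e by (simp add: herm_linear c_def)
      qed
      moreover have "herm I (x - p') w = 0" using 0 oB w(1) by blast
      moreover have "v = ?y + w" by simp
      ultimately show ?thesis by (metis herm_linear(4) add_0)
    qed
    ultimately show ?case by blast
  qed (auto intro: cfun.span_zero)
  obtain B where B: "finite B" "cfun.span B = S" by (rule finite_basis_of_subspace[OF I S])
  have "B \<subseteq> supported I" using B S cfun.span_superset by blast
  then obtain p where p: "p \<in> cfun.span B" "\<forall>s\<in>B. herm I (x - p) s = 0" using fin B by blast
  have "herm I (x - p) s = 0" if "s \<in> cfun.span B" for s
    using that by (induction rule: cfun.span_induct_alt) (simp_all only: herm_linear(4,5,7) p(2)[rule_format] mult_zero_right add_0)
  then show ?thesis using that p B by blast
qed

text \<open>The conjugate transpose.\<close>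

definition star :: "('k \<times> 'k \<Rightarrow> complex) \<Rightarrow> 'k \<times> 'k \<Rightarrow> complex" where
  "star M = (\<lambda>(k, l). cnj (M (l, k)))"

lemma herm_mm:
  "herm (K \<times> K) (mm K x M) a = herm (K \<times> K) M (mm K (star x) a)"
proof -
  have cart: "herm (K \<times> K) f g = (\<Sum>k\<in>K. \<Sum>l\<in>K. f (k, l) * cnj (g (k, l)))" for f g
    by (simp add: herm_def sum.cartesian_product case_prod_beta)
  have "herm (K \<times> K) (mm K x M) a = (\<Sum>k\<in>K. \<Sum>l\<in>K. \<Sum>j\<in>K. x (k, j) * M (j, l) * cnj (a (k, l)))"
    unfolding cart by (simp add: mm_apply sum_distrib_right)
  also have "\<dots> = (\<Sum>l\<in>K. \<Sum>k\<in>K. \<Sum>j\<in>K. x (k, j) * M (j, l) * cnj (a (k, l)))"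
    by (rule sum.swap)
  also have "\<dots> = (\<Sum>l\<in>K. \<Sum>j\<in>K. \<Sum>k\<in>K. x (k, j) * M (j, l) * cnj (a (k, l)))"
    by (intro sum.cong HOL.refl sum.swap)
  also have "\<dots> = (\<Sum>j\<in>K. \<Sum>l\<in>K. \<Sum>k\<in>K. x (k, j) * M (j, l) * cnj (a (k, l)))"
    by (rule sum.swap)
  also have "\<dots> = (\<Sum>j\<in>K. \<Sum>l\<in>K. M (j, l) * cnj (mm K (star x) a (j, l)))"
    by (intro sum.cong HOL.refl) (simp add: mm_apply star_def sum_distrib_left mult_ac)
  also have "\<dots> = herm (K \<times> K) M (mm K (star x) a)"
    unfolding cart ..
  finally show ?thesis .
qed

lemma mm_delta:
  assumes K: "finite K" and x: "x \<in> mats K" and l: "l \<in> K" "v \<in> K"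
  shows "mm K x (delta (l, v)) = (\<Sum>j\<in>K. x (j, l) *\<^sub>v delta (j, v))"
proof (rule mats_eqI[of _ K])
  fix a b assume ab: "a \<in> K" "b \<in> K"
  have "mm K x (delta (l, v)) (a, b) = (\<Sum>j\<in>K. if j = l then if b = v then x (a, j) else 0 else 0)"
    unfolding mm_apply[OF ab] by (intro sum.cong HOL.refl) (auto simp: delta_def)
  also have "\<dots> = (\<Sum>j\<in>K. if a = j then if b = v then x (j, l) else 0 else 0)"
    using K l ab by simp
  also have "\<dots> = (\<Sum>j\<in>K. x (j, l) *\<^sub>v delta (j, v)) (a, b)"
    unfolding sum_apply by (intro sum.cong HOL.refl) (auto simp: delta_def vscale_def)
  finally show "mm K x (delta (l, v)) (a, b) = (\<Sum>j\<in>K. x (j, l) *\<^sub>v delta (j, v)) (a, b)" .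
next
  show "(\<Sum>j\<in>K. x (j, l) *\<^sub>v delta (j, v)) \<in> mats K"
    using l by (intro mats_sum mats_closed) (auto simp: mats_def supported_def delta_def)
qed simp

text \<open>The orthogonal projection \<open>P\<close> onto \<open>A\<close>, for the Hermitian form on matrices,
  commutes with left multiplication by \<open>X\<close> because \<open>A\<close> and hence its orthogonal
  complement are stable under it. For fixed \<open>v\<close> and \<open>w\<close> the numbers \<open>P (delta
  (l, v)) (k, w)\<close> therefore form a matrix in the commutant of \<open>X\<close>, so \<open>T\<close>
  commutes with it; that is, \<open>P\<close> commutes with left multiplication by \<open>T\<close>, and
  \<open>T = T P(1) = P(T)\<close> is in \<open>A\<close>. Only stability under a star-closed set
  \<open>X\<close> is asked of \<open>A\<close>, as \<open>A\<close> is the image of a group acting by complex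
  orthogonal matrices, which need not be star-closed.\<close>

lemma double_commutant:
  assumes K: "finite K" and A: "cfun.subspace A" "A \<subseteq> mats K" "mone K \<in> A"
    and X: "X \<subseteq> mats K"
    and XA: "\<And>x a. x \<in> X \<Longrightarrow> a \<in> A \<Longrightarrow> mm K x a \<in> A" "\<And>x a. x \<in> X \<Longrightarrow> a \<in> A \<Longrightarrow> mm K (star x) a \<in> A"
    and T: "T \<in> mats K"
    and comm: "\<And>N. N \<in> mats K \<Longrightarrow> (\<And>x. x \<in> X \<Longrightarrow> mm K x N = mm K N x) \<Longrightarrow> mm K T N = mm K N T"
  shows "T \<in> A"
proof -
  let ?h = "herm (K \<times> K)"
  have KK: "finite (K \<times> K)" using K by simp
  define P where "P M = (SOME p. p \<in> A \<and> (\<forall>s\<in>A. ?h (M - p) s = 0))" for M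
  have P: "P M \<in> A" "\<And>s. s \<in> A \<Longrightarrow> ?h (M - P M) s = 0" if M: "M \<in> mats K" for M
  proof -
    obtain p where "p \<in> A" "\<And>s. s \<in> A \<Longrightarrow> ?h (M - p) s = 0"
      using orthogonal_decomposition[OF KK A(1)] A(2) M unfolding mats_def by metis
    then have "\<exists>p. p \<in> A \<and> (\<forall>s\<in>A. ?h (M - p) s = 0)" by blast
    from someI_ex[OF this] show "P M \<in> A" "\<And>s. s \<in> A \<Longrightarrow> ?h (M - P M) s = 0" by (auto simp: P_def)
  qed
  have uniq: "P M = p" if M: "M \<in> mats K" and p: "p \<in> A" "\<And>s. s \<in> A \<Longrightarrow> ?h (M - p) s = 0" for M p
  proof -
    have d: "P M - p \<in> A" using P[OF M] p A(1) by (intro cfun.subspace_diff)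
    have e: "P M - p = (M - p) - (M - P M)" by simp
    have "?h (P M - p) (P M - p) = ?h ((M - p) - (M - P M)) (P M - p)" by simp
    also have "\<dots> = 0" using p(2)[OF d] P(2)[OF M d] by (simp only: herm_linear) simp
    finally have "P M - p = 0" using d A(2) by (intro herm_self_eq_0[OF KK]) (auto simp: mats_def)
    then show ?thesis by simp
  qed
  have dm: "delta (j, v) \<in> mats K" if "j \<in> K" "v \<in> K" for j v
    using that by (auto simp: mats_def supported_def delta_def)
  have Plin: "P (\<Sum>j\<in>K. c j *\<^sub>v delta (j, v)) = (\<Sum>j\<in>K. c j *\<^sub>v P (delta (j, v)))" if v: "v \<in> K" for c v
  proof (rule uniq)
    show "(\<Sum>j\<in>K. c j *\<^sub>v delta (j, v)) \<in> mats K" using v by (intro mats_sum mats_closed dm)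
    show "(\<Sum>j\<in>K. c j *\<^sub>v P (delta (j, v))) \<in> A"
      by (intro cfun.subspace_sum[OF A(1)] cfun.subspace_scale[OF A(1)] P(1) dm v)
    fix s assume s: "s \<in> A"
    have "(\<Sum>j\<in>K. c j *\<^sub>v delta (j, v)) - (\<Sum>j\<in>K. c j *\<^sub>v P (delta (j, v))) =
       (\<Sum>j\<in>K. c j *\<^sub>v (delta (j, v) - P (delta (j, v))))"
      by (simp add: cfun.scale_right_diff_distrib sum_subtractf)
    then show "?h ((\<Sum>j\<in>K. c j *\<^sub>v delta (j, v)) - (\<Sum>j\<in>K. c j *\<^sub>v P (delta (j, v)))) s = 0"
      using P(2)[OF dm s] v by (simp only: herm_sum herm_linear) simp
  qed
  have Pmm: "P (mm K x M) = mm K x (P M)" if x: "x \<in> X" and M: "M \<in> mats K" for x M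
  proof (rule uniq)
    show "mm K x (P M) \<in> A" using XA(1)[OF x] P(1)[OF M] .
    fix s assume "s \<in> A"
    then show "?h (mm K x M - mm K x (P M)) s = 0"
      unfolding mm_linear(4)[symmetric] herm_mm by (intro P(2)[OF M] XA(2)[OF x])
  qed simp
  have key: "mm K T (P (delta (l, v))) (k, w) = (\<Sum>j\<in>K. T (j, l) *\<^sub>v P (delta (j, v))) (k, w)"
    if lv: "l \<in> K" "v \<in> K" "w \<in> K" "k \<in> K" for l v w k
  proof -
    \<comment> \<open>This matrix is a block of \<open>P\<close>, seen as an operator on matrices.\<close>
    define b where "b = (\<lambda>(k, l). if k \<in> K \<and> l \<in> K then P (delta (l, v)) (k, w) else 0)"
    have b: "b \<in> mats K" by (auto simp: b_def mats_def supported_def)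
    have one: "mm K x b (k, l) = mm K x (P (delta (l, v))) (k, w)"
       "mm K b x (k, l) = (\<Sum>j\<in>K. x (j, l) *\<^sub>v P (delta (j, v))) (k, w)" if "k \<in> K" "l \<in> K" for x k l
      using that lv by (auto simp: mm_apply b_def sum_apply vscale_def mult.commute intro!: sum.cong)
    have "mm K T b = mm K b T"
    proof (rule comm[OF b])
      fix x assume x: "x \<in> X"
      then have xm: "x \<in> mats K" using X by blast
      show "mm K x b = mm K b x"
      proof (rule mats_eqI[of _ K])
        fix k l assume kl: "k \<in> K" "l \<in> K"
        have "mm K x b (k, l) = P (mm K x (delta (l, v))) (k, w)"
          unfolding one[OF kl] Pmm[OF x dm[OF kl(2) lv(2)]] ..
        also have "\<dots> = mm K b x (k, l)"
          unfolding one[OF kl] mm_delta[OF K xm kl(2) lv(2)] Plin[OF lv(2)] ..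
        finally show "mm K x b (k, l) = mm K b x (k, l)" .
      qed simp_all
    qed
    then have "mm K T b (k, l) = mm K b T (k, l)" by simp
    then show ?thesis using one lv by simp
  qed
  have mone: "mone K = (\<Sum>v\<in>K. delta (v, v))"
  proof (rule mats_eqI[of _ K])
    fix k l assume kl: "k \<in> K" "l \<in> K"
    have "(\<Sum>v\<in>K. delta (v, v)) (k, l) = (\<Sum>v\<in>K. if v = k then if k = l then 1 else 0 else 0)"
      unfolding sum_apply by (intro sum.cong HOL.refl) (auto simp: delta_def)
    then show "mone K (k, l) = (\<Sum>v\<in>K. delta (v, v)) (k, l)"
      using kl K by (simp add: mone_apply)
  next
    show "(\<Sum>v\<in>K. delta (v, v)) \<in> mats K" by (intro mats_sum dm)
  qed simp
  have P1: "P (mone K) = mone K" by (rule uniq) (auto simp: A herm_linear)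
  have Pone: "(\<Sum>v\<in>K. P (delta (v, v))) = mone K"
  proof -
    have "P (mone K) = (\<Sum>v\<in>K. P (delta (v, v)))"
    proof (rule uniq)
      show "(\<Sum>v\<in>K. P (delta (v, v))) \<in> A" by (intro cfun.subspace_sum[OF A(1)] P(1) dm)
      fix s assume s: "s \<in> A"
      have "mone K - (\<Sum>v\<in>K. P (delta (v, v))) = (\<Sum>v\<in>K. delta (v, v) - P (delta (v, v)))"
        by (simp add: mone sum_subtractf)
      then show "?h (mone K - (\<Sum>v\<in>K. P (delta (v, v)))) s = 0"
        using P(2)[OF dm s] by (simp only: herm_sum) simp
    qed simp
    then show ?thesis using P1 by simp
  qed
  have "T = mm K T (\<Sum>v\<in>K. P (delta (v, v)))" unfolding Pone mm_one[OF K T] ..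
  also have "\<dots> = (\<Sum>v\<in>K. \<Sum>j\<in>K. T (j, v) *\<^sub>v P (delta (j, v)))"
    unfolding mm_sum
  proof (intro sum.cong HOL.refl mats_eqI[of _ K])
    fix v k w assume "v \<in> K" "k \<in> K" "w \<in> K"
    then show "mm K T (P (delta (v, v))) (k, w) = (\<Sum>j\<in>K. T (j, v) *\<^sub>v P (delta (j, v))) (k, w)"
      using key by blast
  qed (use P dm A in \<open>auto intro!: mats_sum mats_closed\<close>)
  finally have T_eq: "T = (\<Sum>v\<in>K. \<Sum>j\<in>K. T (j, v) *\<^sub>v P (delta (j, v)))" .
  have "(\<Sum>v\<in>K. \<Sum>j\<in>K. T (j, v) *\<^sub>v P (delta (j, v))) \<in> A"
    by (intro cfun.subspace_sum[OF A(1)] cfun.subspace_scale[OF A(1)] P(1) dm)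
  then show ?thesis by (subst T_eq)
qed

section \<open>Stacking diagrams\<close>

text \<open>The edge relation of a partial matching: symmetric, irreflexive, at most one edge at each vertex.\<close>

definition pmatch :: "'v set \<Rightarrow> ('v \<times> 'v) set \<Rightarrow> bool" where
  "pmatch V U \<longleftrightarrow> U \<subseteq> V \<times> V \<and> sym_on UNIV U \<and> single_valued U \<and> (\<forall>x. (x, x) \<notin> U)"

text \<open>A component of the union of two partial matchings is a path or a cycle. It is connected, so it has at least
  \<open>card C - 1\<close> edges, while \<open>card C\<close> minus the number of vertices missed by a
  matching is twice its number of edges; adding the two equations leaves \<open>0\<close> or \<open>2\<close>
  for the number of loose ends.\<close>

lemma pmatch_ends:
  assumes V: "finite V" and U: "pmatch V U" and L: "pmatch V L" and x: "x \<in> V"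
  defines "C \<equiv> (U \<union> L)\<^sup>* `` {x}"
  shows "card (C - Domain U) + card (C - Domain L) \<in> {0, 2}"
proof -
  let ?R = "U \<union> L"
  have xC: "x \<in> C" by (simp add: C_def)
  have step: "b \<in> C" if "a \<in> C" "(a, b) \<in> ?R" for a b
    using that unfolding C_def by (auto intro: rtrancl_into_rtrancl)
  have "C \<subseteq> V"
  proof
    fix y assume "y \<in> C"
    then have "(x, y) \<in> ?R\<^sup>*" by (simp add: C_def)
    then show "y \<in> V" using x U L by (induction rule: rtrancl_induct) (auto simp: pmatch_def)
  qed
  then have fin: "finite C" using V finite_subset by blast
  define E where "E M = {{a, b} | a b. (a, b) \<in> M \<and> a \<in> C}" for M
  have half: "card (C \<inter> Domain M) = 2 * card (E M)" "finite (E M)" if M: "M = U \<or> M = L" for M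
  proof -
    have pm: "pmatch V M" and MR: "M \<subseteq> ?R" using M U L by auto
    have sy: "(b, a) \<in> M" if "(a, b) \<in> M" for a b
      using pm that by (auto simp: pmatch_def sym_on_def)
    have un: "\<Union>(E M) = C \<inter> Domain M"
    proof (intro Set.set_eqI iffI)
      fix z assume "z \<in> \<Union>(E M)"
      then obtain a b where ab: "(a, b) \<in> M" "a \<in> C" "z = a \<or> z = b" by (auto simp: E_def)
      then show "z \<in> C \<inter> Domain M" using step[of a b] sy[of a b] MR by auto
    qed (auto simp: E_def)
    have "E M \<subseteq> Pow C" using step MR by (auto simp: E_def)
    then show finE: "finite (E M)" using fin by (meson finite_Pow_iff finite_subset)
    have "2 * card (E M) = card (\<Union>(E M))"
    proof (rule card_partition)
      show "finite (\<Union>(E M))" using un fin by simp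
      show "card c = 2" if "c \<in> E M" for c
        using that pm by (auto simp: E_def pmatch_def card_insert_if)
      show "c1 \<inter> c2 = {}" if c: "c1 \<in> E M" "c2 \<in> E M" "c1 \<noteq> c2" for c1 c2
      proof -
        obtain a b a' b' where ab: "c1 = {a, b}" "(a, b) \<in> M" "c2 = {a', b'}" "(a', b') \<in> M"
          using c by (auto simp: E_def)
        have sv: "y = z" if "(w, y) \<in> M" "(w, z) \<in> M" for w y z
          using pm that by (auto simp: pmatch_def single_valued_def)
        show ?thesis
        proof (rule ccontr)
          assume "c1 \<inter> c2 \<noteq> {}"
          then obtain z where z: "z \<in> c1" "z \<in> c2" by blast
          obtain w where w: "c1 = {z, w}" "(z, w) \<in> M"
            using ab(1) sy[OF ab(2)] ab(2) z(1) by (auto simp: insert_commute)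
          obtain w' where w': "c2 = {z, w'}" "(z, w') \<in> M"
            using ab(3) sy[OF ab(4)] ab(4) z(2) by (auto simp: insert_commute)
          show False using sv[OF w(2) w'(2)] w(1) w'(1) c(3) by simp
        qed
      qed
    qed (rule finE)
    then show "card (C \<inter> Domain M) = 2 * card (E M)" by (simp add: un)
  qed
  \<comment> \<open>Sending each vertex to the edge towards \<open>x\<close> shows that there are at least \<open>card C - 1\<close> edges.\<close>
  define dist where "dist y = (LEAST k. (x, y) \<in> ?R ^^ k)" for y
  have "\<exists>z. z \<in> C \<and> (z, y) \<in> ?R \<and> dist z < dist y" if y: "y \<in> C - {x}" for y
  proof -
    have "\<exists>k. (x, y) \<in> ?R ^^ k" using y by (auto simp: C_def rtrancl_is_UN_relpow)
    then have k: "(x, y) \<in> ?R ^^ dist y" unfolding dist_def by (rule LeastI_ex)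
    then have "dist y \<noteq> 0" using y by (intro notI) simp
    then obtain m where m: "dist y = Suc m" by (cases "dist y") auto
    then obtain z where z: "(x, z) \<in> ?R ^^ m" "(z, y) \<in> ?R" using k by auto
    then have "dist z \<le> m" unfolding dist_def by (intro Least_le)
    moreover have "z \<in> C" using z(1) by (auto simp: C_def rtrancl_is_UN_relpow)
    ultimately show ?thesis using z m by auto
  qed
  then obtain par where par: "\<And>y. y \<in> C - {x} \<Longrightarrow> par y \<in> C \<and> (par y, y) \<in> ?R \<and> dist (par y) < dist y"
    by metis
  have "inj_on (\<lambda>y. {par y, y}) (C - {x})"
  proof (rule inj_onI, rule ccontr)
    fix y z assume yz: "y \<in> C - {x}" "z \<in> C - {x}" "{par y, y} = {par z, z}" "y \<noteq> z"
    then have "par y = z" "par z = y" by (auto simp: doubleton_eq_iff)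
    then show False using par[OF yz(1)] par[OF yz(2)] by auto
  qed
  moreover have "(\<lambda>y. {par y, y}) ` (C - {x}) \<subseteq> E U \<union> E L"
    using par by (fastforce simp: E_def)
  ultimately have "card (C - {x}) \<le> card (E U \<union> E L)"
    using half(2) by (intro card_inj_on_le) auto
  also have "\<dots> \<le> card (E U) + card (E L)" by (rule card_Un_le)
  finally have "card C \<le> Suc (card (E U) + card (E L))" using xC fin by (simp add: card_Diff_singleton)
  moreover have "card (C - Domain M) + 2 * card (E M) = card C" if "M = U \<or> M = L" for M
    using half(1)[OF that] card_Diff_subset_Int[of C "Domain M"] fin card_mono[OF fin, of "C \<inter> Domain M"] by auto
  from this[of U] this[of L] have "card (C - Domain U) + 2 * card (E U) = card C"
    "card (C - Domain L) + 2 * card (E L) = card C" by auto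
  moreover have "a + b \<in> {0, 2 :: nat}" if "c \<le> Suc (e + f)" "a + 2 * e = c" "b + 2 * f = c" for a b c e f
    using that by (simp, presburger)
  ultimately show ?thesis by blast
qed

text \<open>The number of isolated vertices.\<close>

definition n_single :: "'p set set \<Rightarrow> nat" where
  "n_single d = card {x. {x} \<in> d}"

lemma matchings_blocks:
  assumes "d \<in> matchings J" "finite J"
  shows "b \<in> d \<Longrightarrow> b \<subseteq> J" "b \<in> d \<Longrightarrow> b \<noteq> {}" "x \<in> J \<Longrightarrow> \<exists>b\<in>d. x \<in> b"
    "b \<in> d \<Longrightarrow> b' \<in> d \<Longrightarrow> x \<in> b \<Longrightarrow> x \<in> b' \<Longrightarrow> b = b'" "finite d" "b \<in> d \<Longrightarrow> card b = 1 \<or> card b = 2"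
proof -
  have p: "partition_on J d" using assms by (simp add: matchings_def)
  show sub: "b \<in> d \<Longrightarrow> b \<subseteq> J" and ne: "b \<in> d \<Longrightarrow> b \<noteq> {}" and "x \<in> J \<Longrightarrow> \<exists>b\<in>d. x \<in> b" for b
    using p by (auto simp: partition_on_def)
  show "b \<in> d \<Longrightarrow> b' \<in> d \<Longrightarrow> x \<in> b \<Longrightarrow> x \<in> b' \<Longrightarrow> b = b'"
    using p by (auto simp: partition_on_def disjoint_def)
  show "finite d" using p assms(2) by (metis finite_elements)
  assume b: "b \<in> d"
  have "card b \<le> 2" using b assms by (simp add: matchings_def)
  moreover have "card b \<noteq> 0" using sub[OF b] ne[OF b] assms(2) finite_subset by (metis card_0_eq)
  ultimately show "card b = 1 \<or> card b = 2" by linarith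
qed

lemma matchings_count:
  assumes d: "d \<in> matchings J" and J: "finite J"
  shows "2 * card d = card J + n_single d"
proof -
  note mb = matchings_blocks[OF d J]
  let ?S = "{b \<in> d. card b = 1}" and ?P = "{b \<in> d. card b = 2}"
  have dsp: "d = ?S \<union> ?P" "?S \<inter> ?P = {}" using mb(6) by auto
  have fin: "finite ?S" "finite ?P" using mb(5) by auto
  have "card J = (\<Sum>b\<in>d. card b)"
  proof (rule product_partition)
    show "partition_on J d" using d by (simp add: matchings_def)
    show "finite b" if "b \<in> d" for b using mb(1)[OF that] J finite_subset by blast
  qed
  also have "\<dots> = (\<Sum>b\<in>?S. card b) + (\<Sum>b\<in>?P. card b)"
    by (subst dsp(1), rule sum.union_disjoint) (use fin dsp(2) in auto)
  also have "\<dots> = card ?S + 2 * card ?P" by simp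
  finally have 1: "card J = card ?S + 2 * card ?P" .
  have 2: "card d = card ?S + card ?P"
    by (subst dsp(1), rule card_Un_disjoint) (use fin dsp(2) in auto)
  have "bij_betw (\<lambda>x. {x}) {x. {x} \<in> d} ?S"
    by (rule bij_betwI[where g = the_elem]) (auto simp: card_1_singleton_iff)
  then have "n_single d = card ?S" unfolding n_single_def by (rule bij_betw_same_card)
  then show ?thesis using 1 2 by simp
qed

lemma pb_diagrams_matchings: "pb_diagrams r = matchings (pb_verts r)"
  by (simp add: pb_diagrams_def matchings_def)

lemma finite_pb_verts [simp]: "finite (pb_verts r)"
  by (simp add: pb_verts_def)

lemma card_pb_verts: "card (pb_verts r) = 2 * r"
  by (simp add: pb_verts_def card_Plus)

lemma finite_pb_diagrams: "finite (pb_diagrams r)"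
proof (rule finite_subset)
  show "pb_diagrams r \<subseteq> Pow (Pow (pb_verts r))"
    by (auto simp: pb_diagrams_def partition_on_def)
qed simp

lemma matching_single_or_pair:
  assumes "d \<in> matchings J" "finite J" "x \<in> J"
  shows "{x} \<in> d \<or> (\<exists>y. y \<noteq> x \<and> y \<in> J \<and> {x, y} \<in> d)"
proof -
  note mb = matchings_blocks[OF assms(1,2)]
  obtain b where b: "b \<in> d" "x \<in> b" using mb(3)[OF assms(3)] by blast
  then consider "card b = 1" | "card b = 2" using mb(6) by blast
  then show ?thesis
  proof cases
    case 1
    then show ?thesis using b by (auto simp: card_1_singleton_iff)
  next
    case 2
    then obtain y z where "b = {y, z}" "y \<noteq> z" by (auto simp: card_2_iff)
    then show ?thesis using b mb(1)[OF b(1)] by (auto simp: insert_commute)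
  qed
qed

lemma pb_edges_pmatch:
  assumes d: "d \<in> pb_diagrams r" shows "pmatch (pb_verts r) (pb_edges d)"
    and "Domain (pb_edges d) = pb_verts r - {x. {x} \<in> d}"
proof -
  have d': "d \<in> matchings (pb_verts r)" using d by (simp add: pb_diagrams_matchings)
  note mb = matchings_blocks[OF d' finite_pb_verts]
  show "pmatch (pb_verts r) (pb_edges d)"
    unfolding pmatch_def
  proof (intro conjI)
    show "pb_edges d \<subseteq> pb_verts r \<times> pb_verts r" using mb(1) by (auto simp: pb_edges_def)
    show "sym_on UNIV (pb_edges d)" by (auto simp: pb_edges_def sym_on_def insert_commute)
    show "single_valued (pb_edges d)"
    proof (rule single_valuedI)
      fix x y z assume "(x, y) \<in> pb_edges d" "(x, z) \<in> pb_edges d"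
      then have "{x, y} = {x, z}" using mb(4)[of "{x, y}" "{x, z}" x] by (auto simp: pb_edges_def)
      then show "y = z" by (auto simp: doubleton_eq_iff)
    qed
  qed (auto simp: pb_edges_def)
  show "Domain (pb_edges d) = pb_verts r - {x. {x} \<in> d}"
  proof (intro Set.set_eqI iffI)
    fix x assume "x \<in> Domain (pb_edges d)"
    then obtain y where y: "x \<noteq> y" "{x, y} \<in> d" by (auto simp: pb_edges_def)
    then have "{x} \<notin> d" using mb(4)[of "{x, y}" "{x}" x] by auto
    then show "x \<in> pb_verts r - {x. {x} \<in> d}" using mb(1)[OF y(2)] by auto
  next
    fix x assume "x \<in> pb_verts r - {x. {x} \<in> d}"
    then show "x \<in> Domain (pb_edges d)"
      using matching_single_or_pair[OF d' finite_pb_verts, of x] by (auto simp: pb_edges_def)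
  qed
qed

lemma compat_edges:
  assumes "d \<in> pb_diagrams r"
  shows "compat d \<kappa> \<longleftrightarrow> (\<forall>(x, y)\<in>pb_edges d. \<kappa> x = \<kappa> y) \<and> (\<forall>x. {x} \<in> d \<longrightarrow> \<kappa> x = 0)"
proof
  assume c: "compat d \<kappa>"
  have "\<kappa> x = \<kappa> y" if "(x, y) \<in> pb_edges d" for x y
  proof -
    have "{x, y} \<in> d" using that by (simp add: pb_edges_def)
    moreover have "\<forall>b\<in>d. \<forall>x\<in>b. \<forall>y\<in>b. \<kappa> x = \<kappa> y" using c unfolding compat_def by blast
    ultimately show ?thesis by (meson insertI1 insertI2)
  qed
  moreover have "\<kappa> x = 0" if "{x} \<in> d" for x
    using c that unfolding compat_def by blast
  ultimately show "(\<forall>(x, y)\<in>pb_edges d. \<kappa> x = \<kappa> y) \<and> (\<forall>x. {x} \<in> d \<longrightarrow> \<kappa> x = 0)" by blast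
next
  assume R: "(\<forall>(x, y)\<in>pb_edges d. \<kappa> x = \<kappa> y) \<and> (\<forall>x. {x} \<in> d \<longrightarrow> \<kappa> x = 0)"
  have d': "d \<in> matchings (pb_verts r)" using assms by (simp add: pb_diagrams_matchings)
  note mb = matchings_blocks[OF d' finite_pb_verts]
  show "compat d \<kappa>"
    unfolding compat_def
  proof (intro ballI conjI allI impI)
    fix b x y assume b: "b \<in> d" "x \<in> b" "y \<in> b"
    show "\<kappa> x = \<kappa> y"
    proof (cases "x = y")
      case False
      have "{x, y} = b"
      proof (rule card_seteq)
        show "finite b" by (rule finite_subset[OF mb(1)[OF b(1)] finite_pb_verts])
        show "card b \<le> card {x, y}" using mb(6)[OF b(1)] False by auto
      qed (use b in auto)
      then show ?thesis using R b False by (auto simp: pb_edges_def)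
    qed simp
  qed (use R in auto)
qed

lemma edge_image_pmatch:
  assumes "pmatch A U" "inj_on f A"
  shows "pmatch (f ` A) (map_prod f f ` U)" "Domain (map_prod f f ` U) = f ` Domain U"
proof -
  have U: "U \<subseteq> A \<times> A" "sym_on UNIV U" "single_valued U" "\<And>x. (x, x) \<notin> U" using assms(1) by (auto simp: pmatch_def)
  show "pmatch (f ` A) (map_prod f f ` U)"
    unfolding pmatch_def
  proof (intro conjI)
    show "map_prod f f ` U \<subseteq> f ` A \<times> f ` A" using U(1) by auto
    show "sym_on UNIV (map_prod f f ` U)" using U(2) by (force simp: sym_on_def)
    show "single_valued (map_prod f f ` U)"
    proof (rule single_valuedI)
      fix x y z assume "(x, y) \<in> map_prod f f ` U" "(x, z) \<in> map_prod f f ` U"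
      then obtain a b c d where ab: "(a, b) \<in> U" "(c, d) \<in> U" "x = f a" "y = f b" "x = f c" "z = f d" by auto
      then have "a = c" using U(1) assms(2) by (metis inj_onD mem_Sigma_iff subset_eq)
      then show "y = z" using ab U(3) by (metis single_valuedD)
    qed
    show "\<forall>x. (x, x) \<notin> map_prod f f ` U"
    proof (intro allI notI)
      fix x assume "(x, x) \<in> map_prod f f ` U"
      then obtain a b where ab: "(a, b) \<in> U" "x = f a" "x = f b" by auto
      then have "a = b" using U(1) assms(2) by (metis inj_onD mem_Sigma_iff subset_eq)
      then show False using ab U(4) by simp
    qed
  qed
  show "Domain (map_prod f f ` U) = f ` Domain U" by force
qed

text \<open>Colourings of the three rows as one colouring of the stacked graph.\<close>

definition glue :: "(nat \<Rightarrow> nat) \<Rightarrow> (nat \<Rightarrow> nat) \<Rightarrow> (nat \<Rightarrow> nat) \<Rightarrow> row \<times> nat \<Rightarrow> nat" where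
  "glue l j k = (\<lambda>(\<rho>, i). case \<rho> of Top \<Rightarrow> l i | Mid \<Rightarrow> j i | Bot \<Rightarrow> k i)"

text \<open>The graph with three rows of vertices obtained by stacking \<open>d1\<close> above \<open>d2\<close>. Below,
  \<open>U\<close> and \<open>L\<close> are its upper and lower edges, \<open>St\<close> the vertices isolated
  in their own diagram, and \<open>cls v\<close> is the component of \<open>v\<close>; a component has two
  loose ends or none, and a loose end is either an isolated vertex of one diagram or a vertex of an outer row.\<close>

locale stack =
  fixes r :: nat and d1 d2 :: diagram
  assumes d1: "d1 \<in> pb_diagrams r" and d2: "d2 \<in> pb_diagrams r"
begin

definition "V = (UNIV :: row set) \<times> {1..r}"
definition "U = upper_edges d1"
definition "L = lower_edges d2"
definition "Out = {Top, Bot} \<times> {1..r}"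
definition "St = upper ` {x. {x} \<in> d1} \<union> lower ` {x. {x} \<in> d2}"
definition "cls v = (U \<union> L)\<^sup>* `` {v}"

lemma UNIV_row: "(UNIV :: row set) = {Top, Mid, Bot}"
  using row.exhaust by auto

lemma finite_V: "finite V"
  by (simp add: V_def UNIV_row)

lemma inj_row: "inj upper" "inj lower" "inj outer"
  by (auto simp: inj_def upper_def lower_def outer_def split: sum.splits)

lemma row_images: "upper ` pb_verts r = {Top, Mid} \<times> {1..r}" "lower ` pb_verts r = {Mid, Bot} \<times> {1..r}"
  "outer ` pb_verts r = Out"
  unfolding pb_verts_def Plus_def image_Un image_image Out_def
  by (auto simp: upper_def lower_def outer_def)

lemma pmatch_mono: "pmatch A M \<Longrightarrow> A \<subseteq> B \<Longrightarrow> pmatch B M"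
  by (auto simp: pmatch_def)

lemma pmatch_UL: "pmatch V U" "pmatch V L"
proof -
  have "pmatch (upper ` pb_verts r) U" "pmatch (lower ` pb_verts r) L"
    unfolding U_def L_def upper_edges_def lower_edges_def
    using pb_edges_pmatch(1)[OF d1] pb_edges_pmatch(1)[OF d2] inj_row
    by (auto intro!: edge_image_pmatch intro: inj_on_subset)
  from pmatch_mono[OF this(1), of V] pmatch_mono[OF this(2), of V] show "pmatch V U" "pmatch V L"
    unfolding row_images V_def UNIV_row by auto
qed

lemma singles_verts: "{x. {x} \<in> d1} \<subseteq> pb_verts r" "{x. {x} \<in> d2} \<subseteq> pb_verts r"
  using d1 d2 by (auto simp: pb_diagrams_def partition_on_def)

lemma not_Domain:
  "V - Domain U = upper ` {x. {x} \<in> d1} \<union> {Bot} \<times> {1..r}"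
  "V - Domain L = lower ` {x. {x} \<in> d2} \<union> {Top} \<times> {1..r}"
proof -
  have DU: "Domain U = upper ` pb_verts r - upper ` {x. {x} \<in> d1}"
    unfolding U_def upper_edges_def edge_image_pmatch(2)[OF pb_edges_pmatch(1)[OF d1] inj_on_subset[OF inj_row(1) subset_UNIV]]
      pb_edges_pmatch(2)[OF d1] by (rule image_set_diff[OF inj_row(1)])
  have DL: "Domain L = lower ` pb_verts r - lower ` {x. {x} \<in> d2}"
    unfolding L_def lower_edges_def edge_image_pmatch(2)[OF pb_edges_pmatch(1)[OF d2] inj_on_subset[OF inj_row(2) subset_UNIV]]
      pb_edges_pmatch(2)[OF d2] by (rule image_set_diff[OF inj_row(2)])
  have su: "upper ` {x. {x} \<in> d1} \<subseteq> {Top, Mid} \<times> {1..r}" using singles_verts(1) row_images(1) by blast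
  have sl: "lower ` {x. {x} \<in> d2} \<subseteq> {Mid, Bot} \<times> {1..r}" using singles_verts(2) row_images(2) by blast
  show "V - Domain U = upper ` {x. {x} \<in> d1} \<union> {Bot} \<times> {1..r}"
    unfolding DU row_images V_def UNIV_row using su by auto
  show "V - Domain L = lower ` {x. {x} \<in> d2} \<union> {Top} \<times> {1..r}"
    unfolding DL row_images V_def UNIV_row using sl by auto
qed

lemma joined_eq: "joined d1 d2 = (U \<union> L)\<^sup>*"
  by (simp add: joined_def U_def L_def)

lemma sym_UL: "(v, w) \<in> (U \<union> L)\<^sup>* \<Longrightarrow> (w, v) \<in> (U \<union> L)\<^sup>*"
proof -
  have "(U \<union> L)\<inverse> = U \<union> L" using pmatch_UL by (auto simp: pmatch_def sym_on_def)
  then show "(v, w) \<in> (U \<union> L)\<^sup>* \<Longrightarrow> (w, v) \<in> (U \<union> L)\<^sup>*" by (metis rtrancl_converseD rtrancl_converseI converse_converse)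
qed

lemma cls_self: "v \<in> cls v"
  by (simp add: cls_def)

lemma cls_eq:
  assumes "w \<in> cls v" shows "cls w = cls v"
proof -
  have vw: "(v, w) \<in> (U \<union> L)\<^sup>*" using assms by (simp add: cls_def)
  show ?thesis
    unfolding cls_def using rtrancl_trans[OF vw] rtrancl_trans[OF sym_UL[OF vw]] by blast
qed

lemma cls_V: "v \<in> V \<Longrightarrow> cls v \<subseteq> V"
proof
  fix w assume v: "v \<in> V" and "w \<in> cls v"
  then have "(v, w) \<in> (U \<union> L)\<^sup>*" by (simp add: cls_def)
  then show "w \<in> V" using v pmatch_UL by (induction rule: rtrancl_induct) (auto simp: pmatch_def)
qed

text \<open>A vertex of the middle row that is isolated in both diagrams counts twice, so that it is a path of length
  zero with two ends.\<close>

definition "stubs v = card (cls v \<inter> upper ` {x. {x} \<in> d1}) + card (cls v \<inter> lower ` {x. {x} \<in> d2})"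
definition "ends v = card (cls v - Domain U) + card (cls v - Domain L)"

lemma fin_cls: "v \<in> V \<Longrightarrow> finite (cls v)"
  using cls_V finite_V finite_subset by blast

lemma ends: "v \<in> V \<Longrightarrow> ends v \<in> {0, 2}"
  unfolding ends_def cls_def by (rule pmatch_ends[OF finite_V pmatch_UL])

lemma ends_stubs:
  assumes "v \<in> V" shows "ends v = stubs v + card (cls v \<inter> Out)"
proof -
  have 1: "cls v - Domain U = (cls v \<inter> upper ` {x. {x} \<in> d1}) \<union> (cls v \<inter> {Bot} \<times> {1..r})"
    using not_Domain(1) cls_V[OF assms] by blast
  have 2: "cls v - Domain L = (cls v \<inter> lower ` {x. {x} \<in> d2}) \<union> (cls v \<inter> {Top} \<times> {1..r})"
    using not_Domain(2) cls_V[OF assms] by blast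
  have 3: "cls v \<inter> Out = (cls v \<inter> {Top} \<times> {1..r}) \<union> (cls v \<inter> {Bot} \<times> {1..r})" by (auto simp: Out_def)
  have su: "upper ` {x. {x} \<in> d1} \<subseteq> {Top, Mid} \<times> {1..r}" using singles_verts(1) row_images(1) by blast
  have sl: "lower ` {x. {x} \<in> d2} \<subseteq> {Mid, Bot} \<times> {1..r}" using singles_verts(2) row_images(2) by blast
  have "card (cls v - Domain U) = card (cls v \<inter> upper ` {x. {x} \<in> d1}) + card (cls v \<inter> {Bot} \<times> {1..r})"
    unfolding 1 using fin_cls[OF assms] su by (intro card_Un_disjoint) auto
  moreover have "card (cls v - Domain L) = card (cls v \<inter> lower ` {x. {x} \<in> d2}) + card (cls v \<inter> {Top} \<times> {1..r})"
    unfolding 2 using fin_cls[OF assms] sl by (intro card_Un_disjoint) auto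
  moreover have "card (cls v \<inter> Out) = card (cls v \<inter> {Top} \<times> {1..r}) + card (cls v \<inter> {Bot} \<times> {1..r})"
    unfolding 3 using fin_cls[OF assms] by (intro card_Un_disjoint) auto
  ultimately show ?thesis by (simp add: ends_def stubs_def)
qed

lemma stubs_0: "v \<in> V \<Longrightarrow> stubs v = 0 \<longleftrightarrow> cls v \<inter> St = {}"
  using fin_cls by (auto simp: stubs_def St_def)

lemma ends_0: "v \<in> V \<Longrightarrow> ends v = 0 \<longleftrightarrow> cls v \<subseteq> Domain U \<inter> Domain L"
  using fin_cls[of v] by (auto simp: ends_def)

definition "Loops = {C \<in> mid_components r d1 d2. is_loop d1 d2 C}"

lemma mid_iff: "v \<in> V \<Longrightarrow> cls v \<subseteq> {Mid} \<times> {1..r} \<longleftrightarrow> cls v \<inter> Out = {}"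
  using cls_V[of v] unfolding Out_def V_def UNIV_row by fastforce

lemma mid_components_eq: "mid_components r d1 d2 = {C \<in> cls ` V. C \<inter> Out = {}}"
proof (intro equalityI subsetI)
  fix C assume "C \<in> mid_components r d1 d2"
  then obtain i where i: "i \<in> {1..r}" "C = cls (Mid, i)" "C \<subseteq> {Mid} \<times> {1..r}"
    by (auto simp: mid_components_def joined_eq cls_def)
  have "(Mid, i) \<in> V" using i by (simp add: V_def)
  then show "C \<in> {C \<in> cls ` V. C \<inter> Out = {}}" using i mid_iff[of "(Mid, i)"] by auto
next
  fix C assume "C \<in> {C \<in> cls ` V. C \<inter> Out = {}}"
  then obtain v where v: "v \<in> V" "C = cls v" "C \<inter> Out = {}" by auto
  then have sub: "C \<subseteq> {Mid} \<times> {1..r}" using mid_iff by auto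
  then obtain i where "v = (Mid, i)" "i \<in> {1..r}" using cls_self[of v] v by auto
  then show "C \<in> mid_components r d1 d2"
    using v sub by (auto simp: mid_components_def joined_eq cls_def)
qed

lemma Loops_iff: "v \<in> V \<Longrightarrow> cls v \<in> Loops \<longleftrightarrow> ends v = 0"
proof -
  assume v: "v \<in> V"
  have "cls v \<inter> Out = {}" if "ends v = 0" using that ends_stubs[OF v] fin_cls[OF v] by auto
  then show ?thesis
    using v by (auto simp: Loops_def mid_components_eq is_loop_def ends_0 U_def L_def)
qed

text \<open>The colourings of the whole stacked graph that are compatible with both diagrams.\<close>

definition "good \<gamma> \<longleftrightarrow> (\<forall>(v, w)\<in>U \<union> L. \<gamma> v = \<gamma> w) \<and> (\<forall>v\<in>St. \<gamma> v = (0::nat))"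

lemma good_iff: "good (glue l j k) \<longleftrightarrow> compat d1 (case_sum l j) \<and> compat d2 (case_sum j k)"
proof -
  have u: "glue l j k (upper x) = case_sum l j x" and lo: "glue l j k (lower x) = case_sum j k x" for x
    by (auto simp: glue_def upper_def lower_def split: sum.splits)
  have "(\<forall>(v, w)\<in>map_prod f f ` E. g v = g w) \<longleftrightarrow> (\<forall>(x, y)\<in>E. g (f x) = g (f y))" for f E and g :: "row \<times> nat \<Rightarrow> nat"
    by (simp add: case_prod_beta)
  then show ?thesis
    unfolding compat_edges[OF d1] compat_edges[OF d2] good_def U_def L_def upper_edges_def lower_edges_def St_def
      ball_Un u[symmetric] lo[symmetric] by auto
qed

lemma good_cls: "good \<gamma> \<Longrightarrow> w \<in> cls v \<Longrightarrow> \<gamma> w = \<gamma> v"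
proof -
  assume g: "good \<gamma>" and "w \<in> cls v"
  then have "(v, w) \<in> (U \<union> L)\<^sup>*" by (simp add: cls_def)
  then show "\<gamma> w = \<gamma> v"
  proof (induction rule: rtrancl_induct)
    case (step y z)
    then have "\<gamma> y = \<gamma> z" using g unfolding good_def by blast
    then show ?case using step by simp
  qed simp
qed

definition "Q = {(x, y). x \<in> pb_verts r \<and> y \<in> pb_verts r \<and> (outer x, outer y) \<in> joined d1 d2}"

lemma Q_block: "x \<in> pb_verts r \<Longrightarrow> Q `` {x} = {y \<in> pb_verts r. outer y \<in> cls (outer x)}"
  by (auto simp: Q_def joined_eq cls_def)

lemma pb_comp_eq: "pb_comp r d1 d2 = (\<lambda>x. {y \<in> pb_verts r. outer y \<in> cls (outer x)}) ` pb_verts r"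
proof -
  have "pb_comp r d1 d2 = (\<lambda>x. Q `` {x}) ` pb_verts r"
    by (auto simp: pb_comp_def Q_def quotient_def)
  then show ?thesis using Q_block by simp
qed

lemma outer_V: "x \<in> pb_verts r \<Longrightarrow> outer x \<in> V \<and> outer x \<in> Out"
proof -
  assume "x \<in> pb_verts r"
  then have "outer x \<in> Out" using row_images(3) by blast
  then show ?thesis by (auto simp: Out_def V_def)
qed

lemma card_block:
  "card {y \<in> pb_verts r. outer y \<in> cls v} = card (cls v \<inter> Out)"
proof -
  have "outer ` {y \<in> pb_verts r. outer y \<in> cls v} = cls v \<inter> Out" unfolding row_images(3)[symmetric] by auto
  then show ?thesis using card_image[OF inj_on_subset[OF inj_row(3) subset_UNIV]] by metis
qed

text \<open>An outer vertex is a loose end of its component, and a component has at most two loose ends.\<close>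

lemma pb_comp_diagram: "pb_comp r d1 d2 \<in> pb_diagrams r"
proof -
  have "equiv (pb_verts r) Q"
  proof (rule equivI)
    show "refl_on (pb_verts r) Q" by (auto simp: refl_on_def Q_def joined_eq)
    show "Q \<subseteq> pb_verts r \<times> pb_verts r" by (auto simp: Q_def)
    show "sym Q" using sym_UL by (auto simp: sym_def Q_def joined_eq)
    show "trans Q" by (auto simp: trans_def Q_def joined_eq intro: rtrancl_trans)
  qed
  then have "partition_on (pb_verts r) (pb_comp r d1 d2)"
    unfolding pb_comp_def Q_def[symmetric] by (rule partition_on_quotient)
  moreover have "card b \<le> 2" if b: "b \<in> pb_comp r d1 d2" for b
  proof -
    obtain x where x: "x \<in> pb_verts r" "b = {y \<in> pb_verts r. outer y \<in> cls (outer x)}" using b unfolding pb_comp_eq by blast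
    have "card b = card (cls (outer x) \<inter> Out)" unfolding x(2) by (rule card_block)
    then show ?thesis using ends[of "outer x"] ends_stubs[of "outer x"] outer_V[OF x(1)] by auto
  qed
  ultimately show ?thesis by (simp add: pb_diagrams_def)
qed

lemma compat_comp:
  "compat (pb_comp r d1 d2) \<kappa> \<longleftrightarrow>
    (\<forall>x\<in>pb_verts r. \<forall>y\<in>pb_verts r. outer y \<in> cls (outer x) \<longrightarrow> \<kappa> x = \<kappa> y) \<and>
    (\<forall>x\<in>pb_verts r. card (cls (outer x) \<inter> Out) = 1 \<longrightarrow> \<kappa> x = 0)" (is "?l \<longleftrightarrow> ?a \<and> ?b")
proof
  assume c: ?l
  have "\<kappa> x = \<kappa> y" if "x \<in> pb_verts r" "y \<in> pb_verts r" "outer y \<in> cls (outer x)" for x y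
  proof -
    let ?b = "{y \<in> pb_verts r. outer y \<in> cls (outer x)}"
    have "?b \<in> pb_comp r d1 d2" using that by (auto simp: pb_comp_eq)
    moreover have "x \<in> ?b" "y \<in> ?b" using that cls_self by auto
    moreover have "\<forall>b\<in>pb_comp r d1 d2. \<forall>x\<in>b. \<forall>y\<in>b. \<kappa> x = \<kappa> y" using c unfolding compat_def by blast
    ultimately show ?thesis by meson
  qed
  moreover have "\<kappa> x = 0" if x: "x \<in> pb_verts r" "card (cls (outer x) \<inter> Out) = 1" for x
  proof -
    let ?b = "{y \<in> pb_verts r. outer y \<in> cls (outer x)}"
    have "card ?b = 1" using x(2) by (simp add: card_block)
    moreover have "x \<in> ?b" using x cls_self by auto
    ultimately have "?b = {x}" by (metis card_1_singletonE singletonD)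
    moreover have "?b \<in> pb_comp r d1 d2" using x by (auto simp: pb_comp_eq)
    moreover have "\<forall>b\<in>pb_comp r d1 d2. \<forall>x. b = {x} \<longrightarrow> \<kappa> x = 0" using c unfolding compat_def by blast
    ultimately show ?thesis by blast
  qed
  ultimately show "?a \<and> ?b" by blast
next
  assume ab: "?a \<and> ?b"
  show ?l
    unfolding compat_def
  proof (intro ballI conjI allI impI)
    fix b y z assume "b \<in> pb_comp r d1 d2" and yz: "y \<in> b" "z \<in> b"
    then obtain x where x: "x \<in> pb_verts r" "b = {y \<in> pb_verts r. outer y \<in> cls (outer x)}"
      unfolding pb_comp_eq by blast
    then have "\<kappa> x = \<kappa> y" "\<kappa> x = \<kappa> z" using ab yz by auto
    then show "\<kappa> y = \<kappa> z" by simp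
  next
    fix b y assume "b \<in> pb_comp r d1 d2" and b: "b = {y}"
    then obtain x where x: "x \<in> pb_verts r" "b = {y \<in> pb_verts r. outer y \<in> cls (outer x)}"
      unfolding pb_comp_eq by blast
    have "x \<in> b" using x cls_self by auto
    then have xy: "x = y" using b by simp
    have "card b = card (cls (outer x) \<inter> Out)" unfolding x(2) by (rule card_block)
    then show "\<kappa> y = 0" using ab x(1) b xy by auto
  qed
qed

text \<open>A compatible colouring of the outer vertices determines the colour of each component that reaches an outer
  row, a component ending in the middle row at both ends has colour \<open>0\<close>, and the closed loops are
  coloured freely by \<open>f\<close>.\<close>

lemma good_extension:
  assumes c: "compat (pb_comp r d1 d2) (case_sum l k)" and \<gamma>: "\<And>v. v \<in> V \<Longrightarrow> \<gamma> v =
     (if cls v \<in> Loops then f (cls v) else if cls v \<inter> Out \<noteq> {} then glue l j k (SOME w. w \<in> cls v \<inter> Out) else 0)"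
  shows "good \<gamma>" "v \<in> Out \<Longrightarrow> \<gamma> v = glue l j k v"
proof -
  have ex: "\<exists>x\<in>pb_verts r. v = outer x \<and> glue l j k v = case_sum l k x" if v: "v \<in> Out" for v
  proof -
    obtain x where "x \<in> pb_verts r" "v = outer x" using v row_images(3) by blast
    then show ?thesis by (auto simp: glue_def outer_def split: sum.splits)
  qed
  have const: "glue l j k w = glue l j k v" if v: "v \<in> Out" "w \<in> cls v" "w \<in> Out" for v w
  proof -
    obtain x y where "x \<in> pb_verts r" "v = outer x" "glue l j k v = case_sum l k x"
      "y \<in> pb_verts r" "w = outer y" "glue l j k w = case_sum l k y" using ex v(1,3) by metis
    then show ?thesis using c v(2) unfolding compat_comp by metis
  qed
  have OV: "Out \<subseteq> V" by (auto simp: Out_def V_def)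
  show out: "\<gamma> v = glue l j k v" if v: "v \<in> Out" for v
  proof -
    have vV: "v \<in> V" using v OV by blast
    have ne: "v \<in> cls v \<inter> Out" using v cls_self by blast
    then have "card (cls v \<inter> Out) \<noteq> 0" using fin_cls[OF vV] by auto
    then have "cls v \<notin> Loops" using Loops_iff[OF vV] ends_stubs[OF vV] by simp
    moreover have s: "(SOME w. w \<in> cls v \<inter> Out) \<in> cls v \<inter> Out" using ne by (rule someI)
    moreover have "glue l j k (SOME w. w \<in> cls v \<inter> Out) = glue l j k v"
      using s by (intro const[OF v]) simp_all
    moreover have "cls v \<inter> Out \<noteq> {}" using ne by blast
    ultimately show ?thesis using \<gamma>[OF vV] by (simp only: if_True if_False simp_thms)
  qed
  show "good \<gamma>"
    unfolding good_def
  proof (intro conjI ballI)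
    fix e assume e: "e \<in> U \<union> L"
    obtain v w where vw: "e = (v, w)" by (cases e)
    have "v \<in> V" "w \<in> V" using e pmatch_UL unfolding vw by (auto simp: pmatch_def)
    moreover have "cls w = cls v" using e unfolding vw by (intro cls_eq) (auto simp: cls_def)
    ultimately show "case e of (v, w) \<Rightarrow> \<gamma> v = \<gamma> w" using \<gamma> unfolding vw by simp
  next
    fix v assume v: "v \<in> St"
    have vV: "v \<in> V" using v not_Domain by (auto simp: St_def)
    have st: "stubs v \<noteq> 0" using stubs_0[OF vV] v cls_self by blast
    then have nl: "cls v \<notin> Loops" using Loops_iff[OF vV] ends_stubs[OF vV] by simp
    show "\<gamma> v = 0"
    proof (cases "cls v \<inter> Out = {}")
      case False
      then obtain w where w: "w \<in> cls v" "w \<in> Out" by blast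
      have "card (cls v \<inter> Out) \<noteq> 0" using False fin_cls[OF vV] by auto
      then have one: "card (cls v \<inter> Out) = 1" using st ends[OF vV] ends_stubs[OF vV] by auto
      have s: "(SOME w. w \<in> cls v \<inter> Out) \<in> cls v \<inter> Out" (is "?s \<in> _") using w by (intro someI) blast
      then obtain x where x: "x \<in> pb_verts r" "?s = outer x" "glue l j k ?s = case_sum l k x" using ex by blast
      have "cls (outer x) = cls v" using s x(2) cls_eq by auto
      then have "case_sum l k x = 0" using c one x(1) unfolding compat_comp by metis
      then show ?thesis using \<gamma>[OF vV] nl False x(3) by simp
    qed (use \<gamma>[OF vV] nl in simp)
  qed
qed

text \<open>The middle colours are forced except on the closed loops, each of which can take any of the \<open>n\<close>
  colours. This is the combinatorial content of the product rule for diagrams.\<close>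

lemma mid_coloring_count:
  assumes n: "n \<ge> 1" and l: "l \<in> {1..r} \<rightarrow>\<^sub>E {0..<n}" and k: "k \<in> {1..r} \<rightarrow>\<^sub>E {0..<n}"
  shows "card {j \<in> {1..r} \<rightarrow>\<^sub>E {0..<n}. compat d1 (case_sum l j) \<and> compat d2 (case_sum j k)} =
    (if compat (pb_comp r d1 d2) (case_sum l k) then n ^ n_loops r d1 d2 else 0)"
proof -
  let ?J = "{j \<in> {1..r} \<rightarrow>\<^sub>E {0..<n}. good (glue l j k)}"
  have goodO: "compat (pb_comp r d1 d2) (case_sum l k)" if g: "good (glue l j k)" for j
    unfolding compat_comp
  proof (intro conjI ballI impI)
    have go: "glue l j k (outer x) = case_sum l k x" for x
      by (auto simp: glue_def outer_def split: sum.splits)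
    show "case_sum l k x = case_sum l k y" if "x \<in> pb_verts r" "y \<in> pb_verts r" "outer y \<in> cls (outer x)" for x y
      using good_cls[OF g that(3)] by (simp add: go)
    show "case_sum l k x = 0" if x: "x \<in> pb_verts r" "card (cls (outer x) \<inter> Out) = 1" for x
    proof -
      have xV: "outer x \<in> V" using outer_V[OF x(1)] by blast
      have "stubs (outer x) \<noteq> 0" using x(2) ends[OF xV] ends_stubs[OF xV] by auto
      then have "cls (outer x) \<inter> St \<noteq> {}" using stubs_0[OF xV] by simp
      then obtain w where w: "w \<in> cls (outer x)" "w \<in> St" by blast
      have "glue l j k w = 0" using g w(2) unfolding good_def by blast
      then show ?thesis using good_cls[OF g w(1)] by (simp add: go)
    qed
  qed
  show ?thesis
  proof (cases "compat (pb_comp r d1 d2) (case_sum l k)")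
    case False
    then have "?J = {}" using goodO by blast
    then have "card ?J = 0" by (simp only: card.empty)
    then show ?thesis using False by (simp only: good_iff if_False)
  next
    case c: True
    define \<gamma> where "\<gamma> f v = (if cls v \<in> Loops then f (cls v) else if cls v \<inter> Out \<noteq> {} then glue l l k (SOME w. w \<in> cls v \<inter> Out) else 0)" for f v
    \<comment> \<open>The two maps are mutually inverse: middle colourings correspond to free choices \<open>f\<close> of colours for the loops. In \<open>\<gamma>\<close> the middle colouring given to \<open>glue\<close> is arbitrary, as only outer values are read.\<close>
    define jf where "jf f = (\<lambda>i\<in>{1..r}. \<gamma> f (Mid, i))" for f
    define fj where "fj j = (\<lambda>C\<in>Loops. glue l j k (SOME w. w \<in> C))" for j
    have LoopsE: "\<exists>v\<in>V. C = cls v" if "C \<in> Loops" for C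
      using that by (auto simp: Loops_def mid_components_eq)
    have g_out: "glue l j k v = glue l j' k v" if "v \<in> Out" for j j' v
      using that by (auto simp: glue_def Out_def split: row.splits)
    have some_out: "(SOME w. w \<in> cls v \<inter> Out) \<in> cls v \<inter> Out" if ne: "cls v \<inter> Out \<noteq> {}" for v
    proof -
      obtain w where w: "w \<in> cls v \<inter> Out" using ne by blast
      show ?thesis by (rule someI[of "\<lambda>w. w \<in> cls v \<inter> Out", OF w])
    qed
    have glue_jf: "glue l (jf f) k v = \<gamma> f v" if v: "v \<in> V" for f v
    proof (cases "v \<in> Out")
      case True
      then show ?thesis
        using good_extension(2)[OF c, of "\<gamma> f" f l v] g_out[of v "jf f" l] by (simp add: \<gamma>_def)
    next
      case False
      then obtain i where "v = (Mid, i)" "i \<in> {1..r}" using v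
        by (cases v; cases "fst v") (auto simp: V_def Out_def)
      then show ?thesis by (simp add: glue_def jf_def)
    qed
    have good_\<gamma>: "good (\<gamma> f)" for f
      by (rule good_extension(1)[OF c, where f = f and j = l]) (simp add: \<gamma>_def)
    have UV: "U \<union> L \<subseteq> V \<times> V" and StV: "St \<subseteq> V"
      using pmatch_UL not_Domain by (auto simp: pmatch_def St_def)
    have good_jf: "good (glue l (jf f) k)" for f
      unfolding good_def
    proof (intro conjI ballI)
      fix e assume e: "e \<in> U \<union> L"
      obtain v w where vw: "e = (v, w)" by (cases e)
      have "v \<in> V" "w \<in> V" using e UV unfolding vw by auto
      moreover have "\<gamma> f v = \<gamma> f w" using good_\<gamma>[of f] e unfolding vw good_def by blast
      ultimately show "case e of (v, w) \<Rightarrow> glue l (jf f) k v = glue l (jf f) k w" unfolding vw by (simp add: glue_jf)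
    next
      fix v assume v: "v \<in> St"
      have "\<gamma> f v = 0" using good_\<gamma>[of f] v unfolding good_def by blast
      then show "glue l (jf f) k v = 0" by (simp add: glue_jf[OF subsetD[OF StV v]])
    qed
    have out_n: "glue l j k v < n" if "v \<in> Out" for j v
      using that l k by (auto simp: glue_def Out_def PiE_iff)
    have "bij_betw jf (Loops \<rightarrow>\<^sub>E {0..<n}) ?J"
    proof (rule bij_betw_byWitness[where f' = fj])
      show "\<forall>f\<in>Loops \<rightarrow>\<^sub>E {0..<n}. fj (jf f) = f"
      proof (intro ballI)
        fix f assume f: "f \<in> Loops \<rightarrow>\<^sub>E {0..<n}"
        show "fj (jf f) = f"
        proof
          fix C
          show "fj (jf f) C = f C"
          proof (cases "C \<in> Loops")
            case True
            then obtain v where v: "v \<in> V" "C = cls v" using LoopsE by blast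
            have s: "(SOME w. w \<in> C) \<in> C" unfolding v(2) by (rule someI[of "\<lambda>w. w \<in> cls v"]) (rule cls_self)
            then have sc: "cls (SOME w. w \<in> C) = C" using v cls_eq by auto
            have sV: "(SOME w. w \<in> C) \<in> V" using s v cls_V by blast
            have "fj (jf f) C = \<gamma> f (SOME w. w \<in> C)" using True by (simp add: fj_def glue_jf[OF sV])
            also have "\<dots> = f C" using True by (simp add: \<gamma>_def sc)
            finally show ?thesis .
          next
            case False
            then show ?thesis using f by (simp add: fj_def PiE_iff extensional_def)
          qed
        qed
      qed
      show "\<forall>j\<in>?J. jf (fj j) = j"
      proof (intro ballI)
        fix j assume j: "j \<in> ?J"
        then have g: "good (glue l j k)" by simp
        show "jf (fj j) = j"
        proof
          fix i
          show "jf (fj j) i = j i"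
          proof (cases "i \<in> {1..r}")
            case False
            then show ?thesis using j by (auto simp: jf_def PiE_iff extensional_def)
          next
            case i: True
            let ?v = "(Mid, i)"
            have v: "?v \<in> V" using i by (simp add: V_def)
            have "\<gamma> (fj j) ?v = glue l j k ?v"
            proof (cases "cls ?v \<in> Loops")
              case True
              have "(SOME w. w \<in> cls ?v) \<in> cls ?v" by (rule someI[of "\<lambda>w. w \<in> cls ?v"]) (rule cls_self)
              then show ?thesis using True good_cls[OF g] by (simp add: \<gamma>_def fj_def)
            next
              case nl: False
              show ?thesis
              proof (cases "cls ?v \<inter> Out = {}")
                case True
                have "ends ?v \<noteq> 0" using nl Loops_iff[OF v] by simp
                then have "stubs ?v \<noteq> 0" using ends_stubs[OF v] True by simp
                then have "cls ?v \<inter> St \<noteq> {}" using stubs_0[OF v] by simp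
                then obtain w where w: "w \<in> cls ?v" "w \<in> St" by blast
                have "glue l j k w = 0" using g w(2) unfolding good_def by blast
                then show ?thesis using good_cls[OF g w(1)] nl True by (simp add: \<gamma>_def)
              next
                case False
                note s = some_out[OF False]
                have "glue l j k ?v = glue l j k (SOME w. w \<in> cls ?v \<inter> Out)"
                  by (rule good_cls[OF g IntD1[OF s], symmetric])
                also have "\<dots> = glue l l k (SOME w. w \<in> cls ?v \<inter> Out)" using s by (intro g_out) blast
                finally show ?thesis using nl False by (simp add: \<gamma>_def)
              qed
            qed
            then show ?thesis using i by (simp add: jf_def glue_def)
          qed
        qed
      qed
      show "jf ` (Loops \<rightarrow>\<^sub>E {0..<n}) \<subseteq> ?J"
      proof (intro subsetI)
        fix j assume "j \<in> jf ` (Loops \<rightarrow>\<^sub>E {0..<n})"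
        then obtain f where f: "f \<in> Loops \<rightarrow>\<^sub>E {0..<n}" "j = jf f" by blast
        have "\<gamma> f v < n" for v
          using f(1) n out_n some_out[of v] by (auto simp: \<gamma>_def PiE_iff)
        then have "j \<in> {1..r} \<rightarrow>\<^sub>E {0..<n}" by (auto simp: f(2) jf_def)
        then show "j \<in> ?J" using good_jf f(2) by blast
      qed
      show "fj ` ?J \<subseteq> Loops \<rightarrow>\<^sub>E {0..<n}"
      proof (intro subsetI)
        fix f assume "f \<in> fj ` ?J"
        then obtain j where j: "j \<in> ?J" "f = fj j" by blast
        have "glue l j k (SOME w. w \<in> C) < n" if C: "C \<in> Loops" for C
        proof -
          obtain v where v: "v \<in> V" "C = cls v" using C LoopsE by blast
          have "(SOME w. w \<in> C) \<in> C" unfolding v(2) by (rule someI[of "\<lambda>w. w \<in> cls v"]) (rule cls_self)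
          then have "(SOME w. w \<in> C) \<in> V" using v cls_V by blast
          then show ?thesis using l k j(1) by (auto simp: glue_def V_def PiE_iff split: row.splits)
        qed
        then show "f \<in> Loops \<rightarrow>\<^sub>E {0..<n}" by (auto simp: j(2) fj_def)
      qed
    qed
    then have "card ?J = card (Loops \<rightarrow>\<^sub>E {0..<n})" by (simp add: bij_betw_same_card)
    also have "\<dots> = n ^ card Loops"
    proof -
      have "finite Loops" using finite_V by (auto simp: Loops_def mid_components_eq)
      then show ?thesis by (simp add: card_PiE)
    qed
    finally show ?thesis using c by (simp only: n_loops_def Loops_def good_iff if_True)
  qed
qed

text \<open>Count the loose ends of all components in two ways. By diagrams they are the isolated vertices of both
  diagrams and the \<open>2 * r\<close> outer vertices. By components they are two for every component that is
  not a loop, and those are the blocks of the product and the components left in the middle row.\<close>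

lemma n_single_comp:
  "n_single d1 + n_single d2 = n_single (pb_comp r d1 d2) + 2 * n_nonloops r d1 d2"
proof -
  let ?Cl = "cls ` V" and ?e = "\<lambda>C. card (C - Domain U) + card (C - Domain L)"
  have disj: "C \<inter> C' = {}" if C: "C \<in> ?Cl" "C' \<in> ?Cl" "C \<noteq> C'" for C C'
  proof (rule ccontr)
    assume "C \<inter> C' \<noteq> {}"
    then obtain w where "w \<in> C" "w \<in> C'" by blast
    then have "C = C'" using C(1,2) cls_eq by (metis imageE)
    then show False using C(3) by simp
  qed
  have finCl: "finite ?Cl" using finite_V by simp
  have fin: "finite C" if "C \<in> ?Cl" for C using that fin_cls by auto
  have un: "\<Union>?Cl = V" using cls_self cls_V by blast
  have cnt: "(\<Sum>C\<in>?Cl. card (C - D)) = card (V - D)" for D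
  proof -
    have "card (\<Union>C\<in>?Cl. C - D) = (\<Sum>C\<in>?Cl. card (C - D))"
      using finCl fin disj by (intro card_UN_disjoint) blast+
    moreover have "(\<Union>C\<in>?Cl. C - D) = V - D" using un by blast
    ultimately show ?thesis by simp
  qed
  have VD: "card (V - Domain U) = n_single d1 + r" "card (V - Domain L) = n_single d2 + r"
  proof -
    have su: "upper ` {x. {x} \<in> d1} \<subseteq> {Top, Mid} \<times> {1..r}" using singles_verts(1) row_images(1) by blast
    have sl: "lower ` {x. {x} \<in> d2} \<subseteq> {Mid, Bot} \<times> {1..r}" using singles_verts(2) row_images(2) by blast
    have f: "finite {x. {x} \<in> d1}" "finite {x. {x} \<in> d2}" using singles_verts finite_pb_verts finite_subset by blast+
    have "card (V - Domain U) = card (upper ` {x. {x} \<in> d1}) + card ({Bot} \<times> {1..r})"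
      unfolding not_Domain(1) using su f by (intro card_Un_disjoint) auto
    moreover have "card (V - Domain L) = card (lower ` {x. {x} \<in> d2}) + card ({Top} \<times> {1..r})"
      unfolding not_Domain(2) using sl f by (intro card_Un_disjoint) auto
    ultimately show "card (V - Domain U) = n_single d1 + r" "card (V - Domain L) = n_single d2 + r"
      by (simp_all add: n_single_def card_image[OF inj_on_subset[OF inj_row(1) subset_UNIV]] card_image[OF inj_on_subset[OF inj_row(2) subset_UNIV]])
  qed
  have e02: "?e C = (if ?e C = 0 then 0 else 2)" if C: "C \<in> ?Cl" for C
  proof -
    obtain v where v: "v \<in> V" "C = cls v" using C by blast
    then show ?thesis using ends[OF v(1)] by (simp only: ends_def v(2)) auto
  qed
  have "n_single d1 + n_single d2 + 2 * r = (\<Sum>C\<in>?Cl. ?e C)"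
    by (simp add: sum.distrib cnt VD)
  also have "\<dots> = (\<Sum>C\<in>?Cl. if ?e C = 0 then 0 else 2)" by (rule sum.cong[OF HOL.refl e02])
  also have "\<dots> = 2 * card {C \<in> ?Cl. ?e C \<noteq> 0}"
    using finCl by (simp add: sum.If_cases Int_def)
  also have "{C \<in> ?Cl. ?e C \<noteq> 0} = {C \<in> ?Cl. C \<inter> Out = {} \<and> ?e C \<noteq> 0} \<union> {C \<in> ?Cl. C \<inter> Out \<noteq> {}}"
  proof -
    have "?e C \<noteq> 0" if C: "C \<in> ?Cl" "C \<inter> Out \<noteq> {}" for C
    proof -
      obtain v where v: "v \<in> V" "C = cls v" using C by blast
      have "card (C \<inter> Out) \<noteq> 0" using fin[OF C(1)] C(2) by simp
      then have "ends v \<noteq> 0" using ends_stubs[OF v(1)] v(2) by simp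
      then show ?thesis by (simp add: ends_def v(2))
    qed
    then have "C \<in> ?Cl \<and> ?e C \<noteq> 0 \<longleftrightarrow> C \<in> ?Cl \<and> C \<inter> Out = {} \<and> ?e C \<noteq> 0 \<or> C \<in> ?Cl \<and> C \<inter> Out \<noteq> {}" for C
      by meson
    then show ?thesis by (simp only: Un_def mem_Collect_eq)
  qed
  also have "card \<dots> = card {C \<in> ?Cl. C \<inter> Out = {} \<and> ?e C \<noteq> 0} + card {C \<in> ?Cl. C \<inter> Out \<noteq> {}}"
    using finCl by (intro card_Un_disjoint) auto
  also have "card {C \<in> ?Cl. C \<inter> Out = {} \<and> ?e C \<noteq> 0} = n_nonloops r d1 d2"
  proof -
    have "?e C \<noteq> 0 \<longleftrightarrow> \<not> is_loop d1 d2 C" if C: "C \<in> ?Cl" for C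
    proof -
      obtain v where v: "v \<in> V" "C = cls v" using C by blast
      show ?thesis using ends_0[OF v(1)] by (simp add: ends_def v(2) is_loop_def U_def L_def)
    qed
    then have "C \<in> ?Cl \<and> C \<inter> Out = {} \<and> ?e C \<noteq> 0 \<longleftrightarrow> C \<in> mid_components r d1 d2 \<and> \<not> is_loop d1 d2 C" for C
      unfolding mid_components_eq mem_Collect_eq by meson
    then have "{C \<in> ?Cl. C \<inter> Out = {} \<and> ?e C \<noteq> 0} = {C \<in> mid_components r d1 d2. \<not> is_loop d1 d2 C}"
      by (simp only:)
    then show ?thesis by (simp add: n_nonloops_def)
  qed
  also have "card {C \<in> ?Cl. C \<inter> Out \<noteq> {}} = card (pb_comp r d1 d2)"
  proof -
    let ?g = "\<lambda>C. {y \<in> pb_verts r. outer y \<in> C}"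
    have "pb_comp r d1 d2 = ?g ` {C \<in> ?Cl. C \<inter> Out \<noteq> {}}"
    proof (intro equalityI subsetI)
      fix b assume "b \<in> pb_comp r d1 d2"
      then obtain x where x: "x \<in> pb_verts r" "b = ?g (cls (outer x))" unfolding pb_comp_eq by blast
      then show "b \<in> ?g ` {C \<in> ?Cl. C \<inter> Out \<noteq> {}}" using outer_V[OF x(1)] cls_self[of "outer x"] by blast
    next
      fix b assume "b \<in> ?g ` {C \<in> ?Cl. C \<inter> Out \<noteq> {}}"
      then obtain v w where vw: "v \<in> V" "w \<in> cls v" "w \<in> Out" "b = ?g (cls v)" by blast
      obtain x where x: "x \<in> pb_verts r" "w = outer x" using vw(3) row_images(3) by blast
      have "b = ?g (cls (outer x))" using vw(4) cls_eq[OF vw(2)] x(2) by simp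
      then show "b \<in> pb_comp r d1 d2" unfolding pb_comp_eq using x(1) by blast
    qed
    moreover have "inj_on ?g {C \<in> ?Cl. C \<inter> Out \<noteq> {}}"
    proof (rule inj_onI)
      fix C C' assume C: "C \<in> {C \<in> ?Cl. C \<inter> Out \<noteq> {}}" "C' \<in> {C \<in> ?Cl. C \<inter> Out \<noteq> {}}" "?g C = ?g C'"
      then obtain w where w: "w \<in> C" "w \<in> Out" by blast
      obtain x where x: "x \<in> pb_verts r" "w = outer x" using w(2) row_images(3) by blast
      then have "w \<in> C'" using C(3) w(1) by blast
      then show "C = C'" using disj[of C C'] C(1,2) w(1) by blast
    qed
    ultimately show ?thesis by (simp add: card_image)
  qed
  finally have "n_single d1 + n_single d2 + 2 * r = 2 * (n_nonloops r d1 d2 + card (pb_comp r d1 d2))" .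
  moreover have "2 * card (pb_comp r d1 d2) = 2 * r + n_single (pb_comp r d1 d2)"
    using matchings_count[of "pb_comp r d1 d2" "pb_verts r"] pb_comp_diagram
    by (simp add: pb_diagrams_matchings card_pb_verts)
  ultimately show ?thesis by simp
qed

end

section \<open>Generators of the partial Brauer monoid\<close>

lemma matchings_union:
  assumes "d \<in> matchings J" "d' \<in> matchings J'" "J \<inter> J' = {}"
  shows "d \<union> d' \<in> matchings (J \<union> J')"
proof -
  have p: "partition_on J d" "partition_on J' d'" using assms by (auto simp: matchings_def)
  then have "disjoint (d \<union> d')"
    using assms(3) by (intro disjoint_union) (auto simp: partition_on_def)
  then have "partition_on (J \<union> J') (d \<union> d')"
    using p by (auto simp: partition_on_def)
  then show ?thesis using assms by (auto simp: matchings_def)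
qed

lemma matchings_pair: "a \<noteq> b \<Longrightarrow> {{a, b}} \<in> matchings {a, b}"
  by (auto simp: matchings_def partition_on_def)

lemma matchings_single: "{{a}} \<in> matchings {a}"
  by (auto simp: matchings_def partition_on_def)

lemma strands_matchings: "strands T \<in> matchings (T <+> T)"
  by (auto simp: matchings_def partition_on_def strands_def disjoint_def card_insert_if)

lemma diagram_eq_edges:
  assumes d: "d \<in> pb_diagrams r" and d': "d' \<in> pb_diagrams r" and e: "pb_edges d = pb_edges d'"
  shows "d = d'"
proof -
  have sub: "a \<subseteq> b" if a: "a \<in> pb_diagrams r" and b: "b \<in> pb_diagrams r" and e: "pb_edges a = pb_edges b" for a b
  proof
    have a': "a \<in> matchings (pb_verts r)" using a by (simp add: pb_diagrams_matchings)
    note mb = matchings_blocks[OF a' finite_pb_verts]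
    fix x assume x: "x \<in> a"
    then consider "card x = 1" | "card x = 2" using mb(6) by blast
    then show "x \<in> b"
    proof cases
      case 1
      then obtain v where v: "x = {v}" by (auto simp: card_1_singleton_iff)
      have "v \<in> pb_verts r - Domain (pb_edges a)"
        unfolding pb_edges_pmatch(2)[OF a] using x v mb(1)[OF x] by auto
      then show ?thesis unfolding e pb_edges_pmatch(2)[OF b] v by auto
    next
      case 2
      then obtain v w where "x = {v, w}" "v \<noteq> w" by (auto simp: card_2_iff)
      then have "(v, w) \<in> pb_edges a" using x by (simp add: pb_edges_def)
      then show ?thesis unfolding e using \<open>x = {v, w}\<close> by (simp add: pb_edges_def)
    qed
  qed
  show ?thesis using sub[OF d d' e] sub[OF d' d e[symmetric]] by blast
qed

text \<open>Give different nonzero colours to the edges of \<open>d\<close> (there are at most \<open>r\<close> of them)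
  and \<open>0\<close> to its isolated vertices. In a diagram compatible with this colouring a nonzero colour
  cannot sit on an isolated vertex, so the two vertices that carry it are joined.\<close>

lemma canonical_coloring:
  assumes d: "d \<in> pb_diagrams r" and n: "n > r"
  obtains l k where "l \<in> {1..r} \<rightarrow>\<^sub>E {0..<n}" "k \<in> {1..r} \<rightarrow>\<^sub>E {0..<n}" "compat d (case_sum l k)"
    "\<And>d'. d' \<in> pb_diagrams r \<Longrightarrow> compat d' (case_sum l k) \<Longrightarrow> pb_edges d \<subseteq> pb_edges d'"
proof -
  have dm: "d \<in> matchings (pb_verts r)" using d by (simp add: pb_diagrams_matchings)
  note mb = matchings_blocks[OF dm finite_pb_verts]
  let ?P = "{b \<in> d. card b = 2}"
  have finP: "finite ?P" using mb(5) by simp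
  have "2 * card ?P = card (\<Union>?P)"
  proof (rule card_partition)
    show "finite (\<Union>?P)" by (rule finite_subset[OF _ finite_pb_verts]) (use mb(1) in blast)
    show "c1 \<inter> c2 = {}" if "c1 \<in> ?P" "c2 \<in> ?P" "c1 \<noteq> c2" for c1 c2 using mb(4)[of c1 c2] that by blast
  qed (use finP in auto)
  also have "\<dots> \<le> card (pb_verts r)" using mb(1) by (intro card_mono) auto
  finally have "card ?P \<le> r" by (simp add: card_pb_verts)
  then have "card ?P \<le> card {1..<n}" using n by simp
  then obtain g where g: "g ` ?P \<subseteq> {1..<n}" "inj_on g ?P" using card_le_inj[OF finP, of "{1..<n}"] by auto
  define blk where "blk x = (THE b. b \<in> d \<and> x \<in> b)" for x
  have blk: "blk x = b" if "b \<in> d" "x \<in> b" for b x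
    unfolding blk_def by (rule the_equality) (use that mb(4) in blast)+
  \<comment> \<open>The function \<open>g\<close> is an injection of the edges into the nonzero colours.\<close>
  define c where "c x = (if {x} \<in> d then 0 else g (blk x))" for x
  have cpair: "c x = g {x, y}" "g {x, y} \<in> {1..<n}" if "{x, y} \<in> d" "x \<noteq> y" for x y
  proof -
    have "{x} \<notin> d" using mb(4)[of "{x, y}" "{x}" x] that by auto
    then show "c x = g {x, y}" using blk[OF that(1), of x] by (simp add: c_def)
    have "{x, y} \<in> ?P" using that by simp
    then show "g {x, y} \<in> {1..<n}" using g(1) by blast
  qed
  have cn: "c x < n" if x: "x \<in> pb_verts r" for x
  proof (cases "{x} \<in> d")
    case False
    then obtain y where "y \<noteq> x" "{x, y} \<in> d" using matching_single_or_pair[OF dm finite_pb_verts x] by blast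
    then show ?thesis using cpair[of x y] by auto
  qed (use n in \<open>simp add: c_def\<close>)
  define l k where "l = (\<lambda>i\<in>{1..r}. c (Inl i))" and "k = (\<lambda>i\<in>{1..r}. c (Inr i))"
  have lk: "case_sum l k x = c x" if "x \<in> pb_verts r" for x
    using that by (auto simp: l_def k_def pb_verts_def)
  have "compat d (case_sum l k)"
    unfolding compat_edges[OF d]
  proof (intro conjI ballI allI impI)
    fix e assume "e \<in> pb_edges d"
    then obtain x y where xy: "e = (x, y)" "x \<noteq> y" "{x, y} \<in> d" by (auto simp: pb_edges_def)
    then have "x \<in> pb_verts r" "y \<in> pb_verts r" using mb(1)[OF xy(3)] by auto
    then show "case e of (x, y) \<Rightarrow> case_sum l k x = case_sum l k y"
      using cpair[of x y] cpair[of y x] xy by (simp add: lk insert_commute)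
  next
    fix x assume "{x} \<in> d"
    then show "case_sum l k x = 0" using lk mb(1)[of "{x}"] by (simp add: c_def)
  qed
  moreover have "pb_edges d \<subseteq> pb_edges d'" if d': "d' \<in> pb_diagrams r" "compat d' (case_sum l k)" for d'
  proof
    fix e assume "e \<in> pb_edges d"
    then obtain x y where xy: "e = (x, y)" "x \<noteq> y" "{x, y} \<in> d" by (auto simp: pb_edges_def)
    have x: "x \<in> pb_verts r" using mb(1)[OF xy(3)] by auto
    have cx: "c x = g {x, y}" "c x \<noteq> 0" using cpair[OF xy(3,2)] by auto
    have dm': "d' \<in> matchings (pb_verts r)" using d' by (simp add: pb_diagrams_matchings)
    have "{x} \<notin> d'"
    proof
      assume "{x} \<in> d'"
      then have "case_sum l k x = 0" using d'(2) unfolding compat_edges[OF d'(1)] by blast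
      then show False using cx lk[OF x] by simp
    qed
    then obtain z where z: "z \<noteq> x" "z \<in> pb_verts r" "{x, z} \<in> d'"
      using matching_single_or_pair[OF dm' finite_pb_verts x] by blast
    then have "case_sum l k x = case_sum l k z" using d'(2) by (auto simp: compat_def)
    then have cz: "c z = c x" using lk x z by simp
    then have "{z} \<notin> d" using cx by (auto simp: c_def)
    then obtain w where w: "w \<noteq> z" "{z, w} \<in> d" using matching_single_or_pair[OF dm finite_pb_verts z(2)] by blast
    have "g {z, w} = g {x, y}" using cpair(1)[OF w(2)] w(1) cz cx by auto
    then have "{z, w} = {x, y}" using g(2) w xy by (auto simp: inj_on_def)
    then have "z = y" using z(1) by (auto simp: doubleton_eq_iff)
    then show "e \<in> pb_edges d'" using xy z by (simp add: pb_edges_def)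
  qed
  moreover have "l \<in> {1..r} \<rightarrow>\<^sub>E {0..<n}" "k \<in> {1..r} \<rightarrow>\<^sub>E {0..<n}"
    using cn[of "Inl i" for i] cn[of "Inr i" for i] by (auto simp: l_def k_def pb_verts_def intro!: cn)
  ultimately show ?thesis using that by blast
qed

text \<open>A diagram is determined by its compatible colourings, as soon as there are more than \<open>r\<close>
  colours.\<close>

lemma diagram_eqI:
  assumes d: "d \<in> pb_diagrams r" and d': "d' \<in> pb_diagrams r"
    and eq: "\<And>l k. l \<in> {1..r} \<rightarrow>\<^sub>E {0..<Suc r} \<Longrightarrow> k \<in> {1..r} \<rightarrow>\<^sub>E {0..<Suc r} \<Longrightarrow>
      compat d (case_sum l k) \<longleftrightarrow> compat d' (case_sum l k)"
  shows "d = d'"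
proof (rule diagram_eq_edges[OF d d'])
  have "pb_edges d \<subseteq> pb_edges d'"
    by (rule canonical_coloring[OF d lessI]) (use d' eq in blast)
  moreover have "pb_edges d' \<subseteq> pb_edges d"
    by (rule canonical_coloring[OF d' lessI]) (use d eq in blast)
  ultimately show "pb_edges d = pb_edges d'" by blast
qed

text \<open>Composition of diagrams becomes composition of relations between colourings; this is how products of
  explicit diagrams are computed from here on, without following paths.\<close>

lemma compat_pb_comp:
  assumes "d1 \<in> pb_diagrams r" "d2 \<in> pb_diagrams r" "n \<ge> 1"
    "l \<in> {1..r} \<rightarrow>\<^sub>E {0..<n}" "k \<in> {1..r} \<rightarrow>\<^sub>E {0..<n}"
  shows "compat (pb_comp r d1 d2) (case_sum l k) \<longleftrightarrow>
    (\<exists>j\<in>{1..r} \<rightarrow>\<^sub>E {0..<n}. compat d1 (case_sum l j) \<and> compat d2 (case_sum j k))"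
proof -
  interpret stack r d1 d2 by standard (use assms in auto)
  have "finite {j \<in> {1..r} \<rightarrow>\<^sub>E {0..<n}. compat d1 (case_sum l j) \<and> compat d2 (case_sum j k)}"
    by (simp add: finite_PiE)
  then have "(\<exists>j\<in>{1..r} \<rightarrow>\<^sub>E {0..<n}. compat d1 (case_sum l j) \<and> compat d2 (case_sum j k)) \<longleftrightarrow>
    card {j \<in> {1..r} \<rightarrow>\<^sub>E {0..<n}. compat d1 (case_sum l j) \<and> compat d2 (case_sum j k)} \<noteq> 0"
    by (auto simp: card_eq_0_iff)
  then show ?thesis unfolding mid_coloring_count[OF assms(3-5)] using assms(3) by simp
qed

text \<open>The middle colouring \<open>j\<close> is the witness for the composition of the two relations.\<close>

lemma pb_comp_eqI:
  assumes d: "d1 \<in> pb_diagrams r" "d2 \<in> pb_diagrams r" "d \<in> pb_diagrams r"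
    and fwd: "\<And>l k. l \<in> {1..r} \<rightarrow>\<^sub>E {0..<Suc r} \<Longrightarrow> k \<in> {1..r} \<rightarrow>\<^sub>E {0..<Suc r} \<Longrightarrow> compat d (case_sum l k) \<Longrightarrow>
       compat d1 (case_sum l (j l k)) \<and> compat d2 (case_sum (j l k) k) \<and> j l k \<in> {1..r} \<rightarrow>\<^sub>E {0..<Suc r}"
    and bwd: "\<And>l m k. l \<in> {1..r} \<rightarrow>\<^sub>E {0..<Suc r} \<Longrightarrow> m \<in> {1..r} \<rightarrow>\<^sub>E {0..<Suc r} \<Longrightarrow> k \<in> {1..r} \<rightarrow>\<^sub>E {0..<Suc r} \<Longrightarrow>
       compat d1 (case_sum l m) \<Longrightarrow> compat d2 (case_sum m k) \<Longrightarrow> compat d (case_sum l k)"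
  shows "pb_comp r d1 d2 = d"
proof (rule diagram_eqI)
  show "pb_comp r d1 d2 \<in> pb_diagrams r"
    using stack.pb_comp_diagram[of r d1 d2] d by (simp add: stack_def)
  fix l k assume lk: "l \<in> {1..r} \<rightarrow>\<^sub>E {0..<Suc r}" "k \<in> {1..r} \<rightarrow>\<^sub>E {0..<Suc r}"
  show "compat (pb_comp r d1 d2) (case_sum l k) = compat d (case_sum l k)"
  proof
    assume "compat d (case_sum l k)"
    then show "compat (pb_comp r d1 d2) (case_sum l k)"
      using fwd[OF lk] by (subst compat_pb_comp[OF d(1,2) _ lk]) auto
  next
    assume "compat (pb_comp r d1 d2) (case_sum l k)"
    then obtain m where "m \<in> {1..r} \<rightarrow>\<^sub>E {0..<Suc r}" "compat d1 (case_sum l m)" "compat d2 (case_sum m k)"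
      by (subst (asm) compat_pb_comp[OF d(1,2) _ lk]) auto
    then show "compat d (case_sum l k)" using bwd[OF lk(1) _ lk(2)] by blast
  qed
qed (rule d)

text \<open>The diagram of a permutation.\<close>

definition perm_diag :: "nat \<Rightarrow> (nat \<Rightarrow> nat) \<Rightarrow> diagram" where
  "perm_diag r \<sigma> = (\<lambda>i. {Inl i, Inr (\<sigma> i)}) ` {1..r}"

text \<open>The generator with an edge in each row, for an arbitrary pair of positions.\<close>

definition arc_diag :: "nat \<Rightarrow> nat \<Rightarrow> nat \<Rightarrow> diagram" where
  "arc_diag r k l = {{Inl k, Inl l}, {Inr k, Inr l}} \<union> strands ({1..r} - {k, l})"

lemma compat_strands: "compat (strands T) (case_sum l k) \<longleftrightarrow> (\<forall>i\<in>T. l i = k i)"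
  by (auto simp: compat_def strands_def)

lemma compat_perm_diag: "compat (perm_diag r \<sigma>) (case_sum l k) \<longleftrightarrow> (\<forall>i\<in>{1..r}. l i = k (\<sigma> i))"
  by (auto simp: compat_def perm_diag_def)

lemma compat_pair: "x \<noteq> y \<Longrightarrow> compat (insert {x, y} d) \<kappa> \<longleftrightarrow> \<kappa> x = \<kappa> y \<and> compat d \<kappa>"
  by (auto simp: compat_insert)

lemma compat_single: "compat (insert {x} d) \<kappa> \<longleftrightarrow> \<kappa> x = 0 \<and> compat d \<kappa>"
  by (auto simp: compat_insert)

lemma compat_arc_diag: "k \<noteq> l \<Longrightarrow> compat (arc_diag r k l) (case_sum L M) \<longleftrightarrow>
    L k = L l \<and> M k = M l \<and> (\<forall>i\<in>{1..r} - {k, l}. L i = M i)"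
  by (simp add: arc_diag_def compat_pair compat_strands)

lemma compat_p_diag: "compat (p_diag r j) (case_sum L M) \<longleftrightarrow>
    L j = 0 \<and> M j = 0 \<and> (\<forall>i\<in>{1..r} - {j}. L i = M i)"
  by (simp add: p_diag_def compat_single compat_strands)

lemma arc_diag_diagram: "k \<in> {1..r} \<Longrightarrow> l \<in> {1..r} \<Longrightarrow> k \<noteq> l \<Longrightarrow> arc_diag r k l \<in> pb_diagrams r"
proof -
  assume kl: "k \<in> {1..r}" "l \<in> {1..r}" "k \<noteq> l"
  let ?T = "{1..r} - {k, l}"
  have "({{Inl k, Inl l}} \<union> {{Inr k, Inr l}}) \<union> strands ?T \<in> matchings (({Inl k, Inl l} \<union> {Inr k, Inr l}) \<union> (?T <+> ?T))"
    using kl by (intro matchings_union matchings_pair strands_matchings) auto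
  moreover have "({Inl k, Inl l} \<union> {Inr k, Inr l}) \<union> (?T <+> ?T) = pb_verts r"
    using kl by (auto simp: pb_verts_def)
  moreover have "({{Inl k, Inl l}} \<union> {{Inr k, Inr l}}) \<union> strands ?T = arc_diag r k l" by (auto simp: arc_diag_def)
  ultimately show "arc_diag r k l \<in> pb_diagrams r" by (simp only: pb_diagrams_matchings)
qed

lemma p_diag_diagram: "j \<in> {1..r} \<Longrightarrow> p_diag r j \<in> pb_diagrams r"
proof -
  assume j: "j \<in> {1..r}"
  let ?T = "{1..r} - {j}"
  have "({{Inl j}} \<union> {{Inr j}}) \<union> strands ?T \<in> matchings (({Inl j} \<union> {Inr j}) \<union> (?T <+> ?T))"
    using j by (intro matchings_union matchings_single strands_matchings) auto
  moreover have "({Inl j} \<union> {Inr j}) \<union> (?T <+> ?T) = pb_verts r"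
    using j by (auto simp: pb_verts_def)
  moreover have "({{Inl j}} \<union> {{Inr j}}) \<union> strands ?T = p_diag r j" by (auto simp: p_diag_def)
  ultimately show "p_diag r j \<in> pb_diagrams r" by (simp only: pb_diagrams_matchings)
qed

lemma perm_diag_diagram:
  assumes "\<sigma> permutes {1..r}" shows "perm_diag r \<sigma> \<in> pb_diagrams r"
proof -
  have inj: "\<sigma> i = \<sigma> j \<longleftrightarrow> i = j" for i j using permutes_inj[OF assms] by (auto simp: inj_def)
  have im: "\<sigma> ` {1..r} = {1..r}" using assms by (rule permutes_image)
  have "\<Union>(perm_diag r \<sigma>) = pb_verts r"
  proof (intro equalityI subsetI)
    fix x assume "x \<in> pb_verts r"
    then show "x \<in> \<Union>(perm_diag r \<sigma>)"
    proof (cases x)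
      case (Inr a)
      then have "a \<in> \<sigma> ` {1..r}" using \<open>x \<in> pb_verts r\<close> unfolding im by (auto simp: pb_verts_def)
      then show ?thesis using Inr by (auto simp: perm_diag_def)
    qed (auto simp: perm_diag_def pb_verts_def)
  next
    fix x assume "x \<in> \<Union>(perm_diag r \<sigma>)"
    then obtain i where "i \<in> {1..r}" "x = Inl i \<or> x = Inr (\<sigma> i)" by (auto simp: perm_diag_def)
    then show "x \<in> pb_verts r" using im unfolding pb_verts_def by blast
  qed
  moreover have "disjoint (perm_diag r \<sigma>)" by (auto simp: disjoint_def perm_diag_def inj)
  moreover have "card b \<le> 2" if "b \<in> perm_diag r \<sigma>" for b using that by (auto simp: perm_diag_def card_insert_if)
  ultimately show ?thesis by (auto simp: pb_diagrams_def partition_on_def perm_diag_def)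
qed

lemma strands_perm_diag: "strands {1..r} = perm_diag r id"
  by (simp add: strands_def perm_diag_def)

lemma s_diag_perm_diag: "i \<in> {1..<r} \<Longrightarrow> s_diag r i = perm_diag r (transpose i (i + 1))"
proof -
  assume i: "i \<in> {1..<r}"
  have "{1..r} = insert i (insert (i + 1) ({1..r} - {i, i + 1}))" using i by auto
  then have "perm_diag r (transpose i (i + 1)) =
    (\<lambda>j. {Inl j, Inr (transpose i (i + 1) j)}) ` insert i (insert (i + 1) ({1..r} - {i, i + 1}))"
    unfolding perm_diag_def by (rule arg_cong)
  also have "\<dots> = s_diag r i"
    unfolding s_diag_def strands_def image_insert by (auto simp: transpose_def intro!: image_cong)
  finally show ?thesis ..
qed

lemma e_diag_arc_diag: "e_diag r i = arc_diag r i (i + 1)"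
  by (simp add: e_diag_def arc_diag_def)

text \<open>Products of diagrams are taken up to the scalars counting loops and other middle components.\<close>

inductive_set gen_diagrams :: "nat \<Rightarrow> diagram set" for r where
  one: "strands {1..r} \<in> gen_diagrams r"
| s: "i \<in> {1..<r} \<Longrightarrow> s_diag r i \<in> gen_diagrams r"
| e: "i \<in> {1..<r} \<Longrightarrow> e_diag r i \<in> gen_diagrams r"
| p: "j \<in> {1..r} \<Longrightarrow> p_diag r j \<in> gen_diagrams r"
| comp: "d \<in> gen_diagrams r \<Longrightarrow> d' \<in> gen_diagrams r \<Longrightarrow> pb_comp r d d' \<in> gen_diagrams r"

lemma perm_diag_comp:
  assumes "\<sigma> permutes {1..r}" "\<tau> permutes {1..r}"
  shows "pb_comp r (perm_diag r \<sigma>) (perm_diag r \<tau>) = perm_diag r (\<tau> \<circ> \<sigma>)"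
proof (rule pb_comp_eqI[where j = "\<lambda>l k. \<lambda>i\<in>{1..r}. k (\<tau> i)"])
  have "\<tau> \<circ> \<sigma> permutes {1..r}" using assms by (intro permutes_compose)
  then show "perm_diag r (\<tau> \<circ> \<sigma>) \<in> pb_diagrams r" by (rule perm_diag_diagram)
  have im: "\<sigma> i \<in> {1..r}" "\<tau> i \<in> {1..r}" if "i \<in> {1..r}" for i
    using that permutes_in_image[OF assms(1), of i] permutes_in_image[OF assms(2), of i] by blast+
  show "compat (perm_diag r \<sigma>) (case_sum l (\<lambda>i\<in>{1..r}. k (\<tau> i))) \<and> compat (perm_diag r \<tau>) (case_sum (\<lambda>i\<in>{1..r}. k (\<tau> i)) k) \<and>
     (\<lambda>i\<in>{1..r}. k (\<tau> i)) \<in> {1..r} \<rightarrow>\<^sub>E {0..<Suc r}"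
    if "k \<in> {1..r} \<rightarrow>\<^sub>E {0..<Suc r}" "compat (perm_diag r (\<tau> \<circ> \<sigma>)) (case_sum l k)" for l k
    using that im unfolding compat_perm_diag by auto
  show "compat (perm_diag r (\<tau> \<circ> \<sigma>)) (case_sum l k)"
    if "compat (perm_diag r \<sigma>) (case_sum l m)" "compat (perm_diag r \<tau>) (case_sum m k)" for l m k
    using that im unfolding compat_perm_diag by auto
qed (use assms perm_diag_diagram in auto)

lemma transpose_permutes: "a \<in> S \<Longrightarrow> b \<in> S \<Longrightarrow> transpose a b permutes S"
  by (rule permutes_swap_id)

lemma transposition_generated:
  assumes "1 \<le> a" "a < b" "b \<le> r" shows "perm_diag r (transpose a b) \<in> gen_diagrams r"
  using assms(2,3)
proof (induction b)
  case (Suc b)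
  show ?case
  proof (cases "a = b")
    case True
    then show ?thesis using Suc.prems assms(1) gen_diagrams.s[of a r] s_diag_perm_diag[of a r] by simp
  next
    case False
    let ?s = "transpose b (Suc b)" and ?t = "transpose a b"
    have g: "perm_diag r ?t \<in> gen_diagrams r" "perm_diag r ?s \<in> gen_diagrams r"
      using Suc False assms(1) gen_diagrams.s[of b r] s_diag_perm_diag[of b r] by auto
    have perm: "?t permutes {1..r}" "?s permutes {1..r}"
      using Suc.prems False assms(1) by (auto intro!: transpose_permutes)
    have "transpose a (Suc b) = ?s \<circ> (?t \<circ> ?s)"
      using Suc.prems False by (auto simp: fun_eq_iff transpose_def)
    then have "perm_diag r (transpose a (Suc b)) = pb_comp r (pb_comp r (perm_diag r ?s) (perm_diag r ?t)) (perm_diag r ?s)"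
      using perm permutes_compose[OF perm(2,1)] by (simp add: perm_diag_comp)
    then show ?thesis using g by (simp add: gen_diagrams.comp)
  qed
qed simp

lemma permutation_generated:
  assumes "\<sigma> permutes {1..r}" shows "perm_diag r \<sigma> \<in> gen_diagrams r"
  using finite_atLeastAtMost assms
proof (induction \<sigma> rule: permutes_rev_induct)
  case id
  then show ?case using gen_diagrams.one[of r] by (simp only: strands_perm_diag)
next
  case (swap a b p)
  have p: "p permutes {1..r}" using swap by simp
  have "perm_diag r (transpose a b) \<in> gen_diagrams r"
    using transposition_generated[of a b r] transposition_generated[of b a r] swap gen_diagrams.one[of r]
    by (cases a b rule: linorder_cases) (auto simp: transpose_commute strands_perm_diag)
  moreover have "perm_diag r (p \<circ> transpose a b) = pb_comp r (perm_diag r (transpose a b)) (perm_diag r p)"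
    using swap p by (subst perm_diag_comp) (auto intro: transpose_permutes)
  ultimately show ?case using gen_diagrams.comp[OF _ swap.IH] by metis
qed

text \<open>Conjugate the generator for adjacent positions by a transposition.\<close>

lemma arc_diag_generated:
  assumes kl: "k \<in> {1..r}" "l \<in> {1..r}" "k < l" shows "arc_diag r k l \<in> gen_diagrams r"
proof -
  have k: "k \<in> {1..<r}" using kl by auto
  have base: "arc_diag r k (k + 1) \<in> gen_diagrams r" using gen_diagrams.e[OF k] by (simp add: e_diag_arc_diag)
  let ?t = "transpose (k + 1) l"
  have tp: "?t permutes {1..r}" using kl k by (intro transpose_permutes) auto
  have tin: "?t i \<in> {1..r} \<longleftrightarrow> i \<in> {1..r}" for i using tp by (rule permutes_in_image)
  have tk: "?t k = k" "?t (k + 1) = l" "?t l = k + 1" using kl by (auto simp: transpose_def)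
  have tt: "?t (?t i) = i" for i by simp
  have kk: "k + 1 \<in> {1..r}" using k by auto
  define c1 where "c1 = pb_comp r (perm_diag r ?t) (arc_diag r k (k + 1))"
  have c1d: "c1 \<in> pb_diagrams r"
    unfolding c1_def by (rule stack.pb_comp_diagram) (use perm_diag_diagram[OF tp] arc_diag_diagram[OF kl(1) kk] in \<open>simp add: stack_def\<close>)
  have c1: "compat c1 (case_sum L M) \<longleftrightarrow> L k = L l \<and> M k = M (k + 1) \<and> (\<forall>i\<in>{1..r} - {k, k + 1}. L (?t i) = M i)"
    if LM: "L \<in> {1..r} \<rightarrow>\<^sub>E {0..<Suc r}" "M \<in> {1..r} \<rightarrow>\<^sub>E {0..<Suc r}" for L M
  proof -
    have "compat c1 (case_sum L M) \<longleftrightarrow> (\<exists>j\<in>{1..r} \<rightarrow>\<^sub>E {0..<Suc r}. (\<forall>i\<in>{1..r}. L i = j (?t i)) \<and>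
        (j k = j (k + 1) \<and> M k = M (k + 1) \<and> (\<forall>i\<in>{1..r} - {k, k + 1}. j i = M i)))"
      unfolding c1_def
      by (subst compat_pb_comp[OF perm_diag_diagram[OF tp] arc_diag_diagram[OF kl(1) kk] _ LM]) (auto simp: compat_perm_diag compat_arc_diag)
    also have "\<dots> \<longleftrightarrow> L k = L l \<and> M k = M (k + 1) \<and> (\<forall>i\<in>{1..r} - {k, k + 1}. L (?t i) = M i)" (is "?a \<longleftrightarrow> ?b")
    proof
      assume ?a
      then obtain j where j: "\<forall>i\<in>{1..r}. L i = j (?t i)" "j k = j (k + 1)" "M k = M (k + 1)"
        "\<forall>i\<in>{1..r} - {k, k + 1}. j i = M i" by blast
      have "L (?t i) = M i" if i: "i \<in> {1..r} - {k, k + 1}" for i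
      proof -
        have "L (?t i) = j (?t (?t i))" using j(1) i tin by blast
        then show ?thesis using j(4) i tt by simp
      qed
      moreover have "L k = j k" "L l = j (k + 1)" using j(1) kl tk by metis+
      ultimately show ?b using j by simp
    next
      assume b: ?b
      let ?j = "\<lambda>i\<in>{1..r}. L (?t i)"
      have jE: "?j \<in> {1..r} \<rightarrow>\<^sub>E {0..<Suc r}" using LM(1) tin by (auto simp: PiE_iff)
      moreover have "\<forall>i\<in>{1..r}. L i = ?j (?t i)" using tin tt by simp
      moreover have "?j k = ?j (k + 1)" using b kl kk tk by simp
      moreover have "\<forall>i\<in>{1..r} - {k, k + 1}. ?j i = M i" using b by simp
      ultimately show ?a using b by blast
    qed
    finally show ?thesis .
  qed
  have "pb_comp r c1 (perm_diag r ?t) = arc_diag r k l"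
  proof (rule pb_comp_eqI[where j = "\<lambda>L M. \<lambda>i\<in>{1..r}. M (?t i)"])
    have kl': "k \<noteq> l" using kl by simp
    show "compat c1 (case_sum L (\<lambda>i\<in>{1..r}. M (?t i))) \<and> compat (perm_diag r ?t) (case_sum (\<lambda>i\<in>{1..r}. M (?t i)) M) \<and>
       (\<lambda>i\<in>{1..r}. M (?t i)) \<in> {1..r} \<rightarrow>\<^sub>E {0..<Suc r}"
      if LM: "L \<in> {1..r} \<rightarrow>\<^sub>E {0..<Suc r}" "M \<in> {1..r} \<rightarrow>\<^sub>E {0..<Suc r}" and c: "compat (arc_diag r k l) (case_sum L M)" for L M
    proof -
      let ?j = "\<lambda>i\<in>{1..r}. M (?t i)"
      have jE: "?j \<in> {1..r} \<rightarrow>\<^sub>E {0..<Suc r}" using LM(2) tin by (auto simp: PiE_iff)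
      have cc: "L k = L l" "M k = M l" "\<And>i. i \<in> {1..r} - {k, l} \<Longrightarrow> L i = M i" using c unfolding compat_arc_diag[OF kl'] by auto
      have "L (?t i) = ?j i" if i: "i \<in> {1..r} - {k, k + 1}" for i
      proof -
        have "?t i \<in> {1..r} - {k, l}" using i tin[of i] tk tt by (metis Diff_iff insert_iff singletonD)
        then show ?thesis using cc(3) i by simp
      qed
      then have "compat c1 (case_sum L ?j)" unfolding c1[OF LM(1) jE] using cc kl kk tk by simp
      then show ?thesis using jE by (simp add: compat_perm_diag)
    qed
    show "compat (arc_diag r k l) (case_sum L M)"
      if LM: "L \<in> {1..r} \<rightarrow>\<^sub>E {0..<Suc r}" "X \<in> {1..r} \<rightarrow>\<^sub>E {0..<Suc r}" "M \<in> {1..r} \<rightarrow>\<^sub>E {0..<Suc r}"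
        and c: "compat c1 (case_sum L X)" "compat (perm_diag r ?t) (case_sum X M)" for L X M
    proof -
      have x: "X i = M (?t i)" if "i \<in> {1..r}" for i using c(2) that unfolding compat_perm_diag by blast
      have cc: "L k = L l" "X k = X (k + 1)" "\<And>i. i \<in> {1..r} - {k, k + 1} \<Longrightarrow> L (?t i) = X i" using c(1) unfolding c1[OF LM(1,2)] by auto
      have "L i = M i" if i: "i \<in> {1..r} - {k, l}" for i
      proof -
        have "?t i \<in> {1..r} - {k, k + 1}" using i tin[of i] tk tt by (metis Diff_iff insert_iff singletonD)
        then show ?thesis using cc(3)[of "?t i"] x[of "?t i"] tt by simp
      qed
      moreover have "M k = M l" using cc(2) x[OF kl(1)] x[OF kk] tk by simp
      ultimately show ?thesis unfolding compat_arc_diag[OF kl'] using cc(1) by blast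
    qed
  qed (use c1d perm_diag_diagram[OF tp] arc_diag_diagram[OF kl(1,2)] kl in auto)
  then show ?thesis
    unfolding c1_def using base permutation_generated[OF tp] gen_diagrams.comp by metis
qed

text \<open>The blocks that stay in one row; the induction measure for the generation of all diagrams.\<close>

definition n_nonthrough :: "diagram \<Rightarrow> nat" where
  "n_nonthrough d = card {b \<in> d. b \<subseteq> range Inl \<or> b \<subseteq> range Inr}"

lemma n_nonthrough_union:
  assumes "finite d" "finite d'" "d \<inter> d' = {}"
  shows "n_nonthrough (d \<union> d') = n_nonthrough d + n_nonthrough d'"
proof -
  have "{b \<in> d \<union> d'. b \<subseteq> range Inl \<or> b \<subseteq> range Inr} =
    {b \<in> d. b \<subseteq> range Inl \<or> b \<subseteq> range Inr} \<union> {b \<in> d'. b \<subseteq> range Inl \<or> b \<subseteq> range Inr}" by auto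
  then show ?thesis
    unfolding n_nonthrough_def using assms by (simp, intro card_Un_disjoint) auto
qed

lemma n_nonthrough_blocks:
  "n_nonthrough {{Inl i}, {Inr k}} = 2" "n_nonthrough {{Inl i, Inr k}} = 0"
  "i \<noteq> j \<Longrightarrow> k \<noteq> l \<Longrightarrow> n_nonthrough {{Inl i, Inl j}, {Inr k, Inr l}} = 2"
  "n_nonthrough {{Inl i, Inr k}, {Inl j, Inr l}} = 0"
  "i \<noteq> j \<Longrightarrow> k \<noteq> l \<Longrightarrow> n_nonthrough {{Inl i, Inl j}, {Inr k}, {Inr l}} = 3"
  "i \<noteq> j \<Longrightarrow> k \<noteq> l \<Longrightarrow> n_nonthrough {{Inl i}, {Inl j}, {Inr k, Inr l}} = 3"
proof -
  have P: "{Inl i} \<subseteq> range Inl \<or> {Inl i} \<subseteq> range Inr" "{Inr k} \<subseteq> range Inl \<or> {Inr k} \<subseteq> range Inr"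
    "{Inl i, Inl j} \<subseteq> range Inl \<or> {Inl i, Inl j} \<subseteq> range Inr" "{Inr k, Inr l} \<subseteq> range Inl \<or> {Inr k, Inr l} \<subseteq> range Inr"
    "\<not> ({Inl i, Inr k} \<subseteq> range Inl \<or> {Inl i, Inr k} \<subseteq> range Inr)" for i j k l :: nat
    by auto
  have F: "{b \<in> insert a B. Q b} = (if Q a then insert a {b \<in> B. Q b} else {b \<in> B. Q b})" "{b \<in> {}. Q b} = {}"
    for a :: "(nat + nat) set" and B Q by auto
  show "n_nonthrough {{Inl i}, {Inr k}} = 2" "n_nonthrough {{Inl i, Inr k}} = 0"
    "i \<noteq> j \<Longrightarrow> k \<noteq> l \<Longrightarrow> n_nonthrough {{Inl i, Inl j}, {Inr k, Inr l}} = 2"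
    "n_nonthrough {{Inl i, Inr k}, {Inl j, Inr l}} = 0"
    "i \<noteq> j \<Longrightarrow> k \<noteq> l \<Longrightarrow> n_nonthrough {{Inl i, Inl j}, {Inr k}, {Inr l}} = 3"
    "i \<noteq> j \<Longrightarrow> k \<noteq> l \<Longrightarrow> n_nonthrough {{Inl i}, {Inl j}, {Inr k, Inr l}} = 3"
    unfolding n_nonthrough_def F P if_True if_False by (auto simp: card_insert_if doubleton_eq_iff)
qed

lemma compat_rest:
  assumes D: "D \<in> matchings (pb_verts r - W)"
    and "\<And>i. i \<in> {1..r} \<Longrightarrow> Inl i \<notin> W \<Longrightarrow> L i = L' i" "\<And>i. i \<in> {1..r} \<Longrightarrow> Inr i \<notin> W \<Longrightarrow> M i = M' i"
  shows "compat D (case_sum L M) = compat D (case_sum L' M')"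
proof (rule compat_cong)
  fix x assume "x \<in> \<Union>D"
  then have "x \<in> pb_verts r - W" using D by (auto simp: matchings_def partition_on_def)
  then show "case_sum L M x = case_sum L' M' x" using assms(2,3) by (cases x) (auto simp: pb_verts_def)
qed

lemma upd_in_PiE: "f \<in> S \<rightarrow>\<^sub>E T \<Longrightarrow> i \<in> S \<Longrightarrow> c \<in> T \<Longrightarrow> f(i := c) \<in> S \<rightarrow>\<^sub>E T"
  by (auto simp: PiE_iff extensional_def)

lemma reattach:
  assumes D: "D \<in> matchings (pb_verts r - W)" and B: "B \<in> matchings W" and W: "W \<subseteq> pb_verts r"
  shows "B \<union> D \<in> pb_diagrams r" "n_nonthrough (B \<union> D) = n_nonthrough B + n_nonthrough D"
proof -
  have "B \<union> D \<in> matchings (W \<union> (pb_verts r - W))" using assms by (intro matchings_union) auto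
  moreover have "W \<union> (pb_verts r - W) = pb_verts r" using W by auto
  ultimately show "B \<union> D \<in> pb_diagrams r" by (simp add: pb_diagrams_matchings)
  have "finite (pb_verts r - W)" "finite W" using finite_subset[OF W finite_pb_verts] by simp_all
  note mD = matchings_blocks[OF D this(1)] and mB = matchings_blocks[OF B this(2)]
  show "n_nonthrough (B \<union> D) = n_nonthrough B + n_nonthrough D"
  proof (rule n_nonthrough_union[OF mB(5) mD(5)])
    show "B \<inter> D = {}"
    proof (rule ccontr)
      assume "B \<inter> D \<noteq> {}"
      then obtain b where b: "b \<in> B" "b \<in> D" by blast
      show False using mB(1)[OF b(1)] mD(1)[OF b(2)] mB(2)[OF b(1)] by blast
    qed
  qed
qed

lemma matchings_two: "B \<in> matchings W \<Longrightarrow> b \<inter> W = {} \<Longrightarrow> {b} \<in> matchings b \<Longrightarrow> insert b B \<in> matchings (b \<union> W)"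
  using matchings_union[of "{b}" b B W] by simp

text \<open>Stacking the generator with edges \<open>k l\<close> in both rows below the diagram cuts the strands ending
  in \<open>k\<close> and \<open>l\<close> and joins their upper ends.\<close>

lemma attach_pairs:
  assumes D: "D \<in> matchings (pb_verts r - {Inl i, Inl j, Inr k, Inr l})"
    and ij: "i \<in> {1..r}" "j \<in> {1..r}" "i \<noteq> j" and kl: "k \<in> {1..r}" "l \<in> {1..r}" "k \<noteq> l"
    and gen: "{{Inl i, Inr k}, {Inl j, Inr l}} \<union> D \<in> gen_diagrams r"
  shows "{{Inl i, Inl j}, {Inr k, Inr l}} \<union> D \<in> gen_diagrams r"
proof -
  let ?W = "{Inl i, Inl j, Inr k, Inr l} :: (nat + nat) set"
  let ?src = "{{Inl i, Inr k}, {Inl j, Inr l}} \<union> D" and ?dst = "{{Inl i, Inl j}, {Inr k, Inr l}} \<union> D"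
  have W: "?W \<subseteq> pb_verts r" using ij kl by (auto simp: pb_verts_def)
  have b: "{{Inl i, Inr k}, {Inl j, Inr l}} \<in> matchings ({Inl i, Inr k} \<union> {Inl j, Inr l})"
    using ij kl by (intro matchings_two matchings_pair) auto
  have e: "{Inl i, Inr k} \<union> {Inl j, Inr l} = ?W" by auto
  have d0: "?src \<in> pb_diagrams r" by (rule reattach(1)[OF D b[unfolded e] W])
  have b: "{{Inl i, Inl j}, {Inr k, Inr l}} \<in> matchings ({Inl i, Inl j} \<union> {Inr k, Inr l})"
    using ij kl by (intro matchings_two matchings_pair) auto
  have e: "{Inl i, Inl j} \<union> {Inr k, Inr l} = ?W" by auto
  have d: "?dst \<in> pb_diagrams r" by (rule reattach(1)[OF D b[unfolded e] W])
  have c0: "compat ?src (case_sum L X) \<longleftrightarrow> L i = X k \<and> L j = X l \<and> compat D (case_sum L X)" for L X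
    by (simp add: compat_pair)
  have cd: "compat ?dst (case_sum L M) \<longleftrightarrow> L i = L j \<and> M k = M l \<and> compat D (case_sum L M)" for L M
    using ij kl by (simp add: compat_pair)
  have "pb_comp r ?src (arc_diag r k l) = ?dst"
  proof (rule pb_comp_eqI[where j = "\<lambda>L M. M(k := L i, l := L j)"])
    show "compat ?src (case_sum L (M(k := L i, l := L j))) \<and> compat (arc_diag r k l) (case_sum (M(k := L i, l := L j)) M) \<and>
       M(k := L i, l := L j) \<in> {1..r} \<rightarrow>\<^sub>E {0..<Suc r}"
      if LM: "L \<in> {1..r} \<rightarrow>\<^sub>E {0..<Suc r}" "M \<in> {1..r} \<rightarrow>\<^sub>E {0..<Suc r}" and c: "compat ?dst (case_sum L M)" for L M
    proof -
      have "compat D (case_sum L (M(k := L i, l := L j))) = compat D (case_sum L M)"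
        by (rule compat_rest[OF D]) auto
      moreover have "M(k := L i, l := L j) \<in> {1..r} \<rightarrow>\<^sub>E {0..<Suc r}"
        using LM kl ij by (intro upd_in_PiE) auto
      ultimately show ?thesis using c kl unfolding c0 cd compat_arc_diag[OF kl(3)] by auto
    qed
    show "compat ?dst (case_sum L M)"
      if c: "compat ?src (case_sum L X)" "compat (arc_diag r k l) (case_sum X M)" for L X M
    proof -
      have "compat D (case_sum L X) = compat D (case_sum L M)"
        using c(2) unfolding compat_arc_diag[OF kl(3)] by (intro compat_rest[OF D]) auto
      then show ?thesis using c unfolding c0 cd compat_arc_diag[OF kl(3)] by auto
    qed
  qed (use d d0 arc_diag_diagram kl in auto)
  moreover have "arc_diag r k l \<in> gen_diagrams r"
  proof (cases "k < l")
    case False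
    have "arc_diag r k l = arc_diag r l k" by (simp add: arc_diag_def insert_commute)
    then show ?thesis using arc_diag_generated[of l r k] False kl by simp
  qed (use arc_diag_generated kl in auto)
  ultimately show ?thesis using gen gen_diagrams.comp by metis
qed

text \<open>Multiplication by \<open>p_diag r k\<close> from below cuts the strand at its lower end.\<close>

lemma attach_singles:
  assumes D: "D \<in> matchings (pb_verts r - {Inl i, Inr k})" and ik: "i \<in> {1..r}" "k \<in> {1..r}"
    and gen: "{{Inl i, Inr k}} \<union> D \<in> gen_diagrams r"
  shows "{{Inl i}, {Inr k}} \<union> D \<in> gen_diagrams r"
proof -
  let ?W = "{Inl i, Inr k} :: (nat + nat) set"
  let ?src = "{{Inl i, Inr k}} \<union> D" and ?dst = "{{Inl i}, {Inr k}} \<union> D"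
  have W: "?W \<subseteq> pb_verts r" using ik by (auto simp: pb_verts_def)
  have d0: "?src \<in> pb_diagrams r" by (rule reattach(1)[OF D matchings_pair W]) simp
  have b: "{{Inl i}, {Inr k}} \<in> matchings ({Inl i} \<union> {Inr k})"
    by (intro matchings_two matchings_single) auto
  have e: "{Inl i} \<union> {Inr k} = ?W" by auto
  have d: "?dst \<in> pb_diagrams r" by (rule reattach(1)[OF D b[unfolded e] W])
  have c0: "compat ?src (case_sum L X) \<longleftrightarrow> L i = X k \<and> compat D (case_sum L X)" for L X
    by (simp add: compat_pair)
  have cd: "compat ?dst (case_sum L M) \<longleftrightarrow> L i = 0 \<and> M k = 0 \<and> compat D (case_sum L M)" for L M
    by (simp add: compat_single)
  have "pb_comp r ?src (p_diag r k) = ?dst"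
  proof (rule pb_comp_eqI[where j = "\<lambda>L M. M(k := L i)"])
    show "compat ?src (case_sum L (M(k := L i))) \<and> compat (p_diag r k) (case_sum (M(k := L i)) M) \<and>
       M(k := L i) \<in> {1..r} \<rightarrow>\<^sub>E {0..<Suc r}"
      if LM: "L \<in> {1..r} \<rightarrow>\<^sub>E {0..<Suc r}" "M \<in> {1..r} \<rightarrow>\<^sub>E {0..<Suc r}" and c: "compat ?dst (case_sum L M)" for L M
    proof -
      have "compat D (case_sum L (M(k := L i))) = compat D (case_sum L M)"
        by (rule compat_rest[OF D]) auto
      moreover have "M(k := L i) \<in> {1..r} \<rightarrow>\<^sub>E {0..<Suc r}"
        using LM ik by (intro upd_in_PiE) auto
      ultimately show ?thesis using c unfolding c0 cd compat_p_diag by auto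
    qed
    show "compat ?dst (case_sum L M)"
      if c: "compat ?src (case_sum L X)" "compat (p_diag r k) (case_sum X M)" for L X M
    proof -
      have "compat D (case_sum L X) = compat D (case_sum L M)"
        using c(2) unfolding compat_p_diag by (intro compat_rest[OF D]) auto
      then show ?thesis using c unfolding c0 cd compat_p_diag by auto
    qed
  qed (use d d0 p_diag_diagram ik in auto)
  then show ?thesis using gen gen_diagrams.p[OF ik(2)] gen_diagrams.comp by metis
qed

text \<open>Multiplication by \<open>p_diag r k\<close> from below isolates both ends of the edge, since
  \<open>l\<close> loses its partner.\<close>

lemma cut_bottom_pair:
  assumes D: "D \<in> matchings (pb_verts r - {Inl i, Inl j, Inr k, Inr l})"
    and ij: "i \<in> {1..r}" "j \<in> {1..r}" "i \<noteq> j" and kl: "k \<in> {1..r}" "l \<in> {1..r}" "k \<noteq> l"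
    and gen: "{{Inl i, Inl j}, {Inr k, Inr l}} \<union> D \<in> gen_diagrams r"
  shows "{{Inl i, Inl j}, {Inr k}, {Inr l}} \<union> D \<in> gen_diagrams r"
proof -
  let ?W = "{Inl i, Inl j, Inr k, Inr l} :: (nat + nat) set"
  let ?src = "{{Inl i, Inl j}, {Inr k, Inr l}} \<union> D" and ?dst = "{{Inl i, Inl j}, {Inr k}, {Inr l}} \<union> D"
  have W: "?W \<subseteq> pb_verts r" using ij kl by (auto simp: pb_verts_def)
  have b: "{{Inl i, Inl j}, {Inr k, Inr l}} \<in> matchings ({Inl i, Inl j} \<union> {Inr k, Inr l})"
    using ij kl by (intro matchings_two matchings_pair) auto
  have e: "{Inl i, Inl j} \<union> {Inr k, Inr l} = ?W" by auto
  have d0: "?src \<in> pb_diagrams r" by (rule reattach(1)[OF D b[unfolded e] W])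
  have b: "{{Inl i, Inl j}, {Inr k}, {Inr l}} \<in> matchings ({Inl i, Inl j} \<union> ({Inr k} \<union> {Inr l}))"
    using ij kl by (intro matchings_two matchings_pair matchings_single) auto
  have e: "{Inl i, Inl j} \<union> ({Inr k} \<union> {Inr l}) = ?W" by auto
  have d: "?dst \<in> pb_diagrams r" by (rule reattach(1)[OF D b[unfolded e] W])
  have c0: "compat ?src (case_sum L X) \<longleftrightarrow> L i = L j \<and> X k = X l \<and> compat D (case_sum L X)" for L X
    using ij kl by (simp add: compat_pair)
  have cd: "compat ?dst (case_sum L M) \<longleftrightarrow> L i = L j \<and> M k = 0 \<and> M l = 0 \<and> compat D (case_sum L M)" for L M
    using ij by (simp add: compat_pair compat_single)
  have "pb_comp r ?src (p_diag r k) = ?dst"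
  proof (rule pb_comp_eqI[where j = "\<lambda>L M. M"])
    show "compat ?src (case_sum L M) \<and> compat (p_diag r k) (case_sum M M) \<and> M \<in> {1..r} \<rightarrow>\<^sub>E {0..<Suc r}"
      if "M \<in> {1..r} \<rightarrow>\<^sub>E {0..<Suc r}" and c: "compat ?dst (case_sum L M)" for L M
      using that unfolding c0 cd compat_p_diag by auto
    show "compat ?dst (case_sum L M)"
      if c: "compat ?src (case_sum L X)" "compat (p_diag r k) (case_sum X M)" for L X M
    proof -
      have "compat D (case_sum L X) = compat D (case_sum L M)"
        using c(2) unfolding compat_p_diag by (intro compat_rest[OF D]) auto
      moreover have "X l = M l" using c(2) kl unfolding compat_p_diag by auto
      ultimately show ?thesis using c unfolding c0 cd compat_p_diag by auto
    qed
  qed (use d d0 p_diag_diagram kl in auto)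
  then show ?thesis using gen gen_diagrams.p[OF kl(1)] gen_diagrams.comp by metis
qed

lemma cut_top_pair:
  assumes D: "D \<in> matchings (pb_verts r - {Inl i, Inl j, Inr k, Inr l})"
    and ij: "i \<in> {1..r}" "j \<in> {1..r}" "i \<noteq> j" and kl: "k \<in> {1..r}" "l \<in> {1..r}" "k \<noteq> l"
    and gen: "{{Inl i, Inl j}, {Inr k, Inr l}} \<union> D \<in> gen_diagrams r"
  shows "{{Inl i}, {Inl j}, {Inr k, Inr l}} \<union> D \<in> gen_diagrams r"
proof -
  let ?W = "{Inl i, Inl j, Inr k, Inr l} :: (nat + nat) set"
  let ?src = "{{Inl i, Inl j}, {Inr k, Inr l}} \<union> D" and ?dst = "{{Inl i}, {Inl j}, {Inr k, Inr l}} \<union> D"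
  have W: "?W \<subseteq> pb_verts r" using ij kl by (auto simp: pb_verts_def)
  have b: "{{Inl i, Inl j}, {Inr k, Inr l}} \<in> matchings ({Inl i, Inl j} \<union> {Inr k, Inr l})"
    using ij kl by (intro matchings_two matchings_pair) auto
  have e: "{Inl i, Inl j} \<union> {Inr k, Inr l} = ?W" by auto
  have d0: "?src \<in> pb_diagrams r" by (rule reattach(1)[OF D b[unfolded e] W])
  have b: "{{Inl i}, {Inl j}, {Inr k, Inr l}} \<in> matchings ({Inl i} \<union> ({Inl j} \<union> {Inr k, Inr l}))"
    using ij kl by (intro matchings_two matchings_pair matchings_single) auto
  have e: "{Inl i} \<union> ({Inl j} \<union> {Inr k, Inr l}) = ?W" by auto
  have d: "?dst \<in> pb_diagrams r" by (rule reattach(1)[OF D b[unfolded e] W])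
  have c0: "compat ?src (case_sum L X) \<longleftrightarrow> L i = L j \<and> X k = X l \<and> compat D (case_sum L X)" for L X
    using ij kl by (simp add: compat_pair)
  have cd: "compat ?dst (case_sum L M) \<longleftrightarrow> L i = 0 \<and> L j = 0 \<and> M k = M l \<and> compat D (case_sum L M)" for L M
    using kl by (simp add: compat_pair compat_single)
  have "pb_comp r (p_diag r i) ?src = ?dst"
  proof (rule pb_comp_eqI[where j = "\<lambda>L M. L"])
    show "compat (p_diag r i) (case_sum L L) \<and> compat ?src (case_sum L M) \<and> L \<in> {1..r} \<rightarrow>\<^sub>E {0..<Suc r}"
      if "L \<in> {1..r} \<rightarrow>\<^sub>E {0..<Suc r}" and c: "compat ?dst (case_sum L M)" for L M
      using that unfolding c0 cd compat_p_diag by auto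
    show "compat ?dst (case_sum L M)"
      if c: "compat (p_diag r i) (case_sum L X)" "compat ?src (case_sum X M)" for L X M
    proof -
      have "compat D (case_sum X M) = compat D (case_sum L M)"
        using c(1) unfolding compat_p_diag by (intro compat_rest[OF D]) auto
      moreover have "L j = X j" using c(1) ij unfolding compat_p_diag by auto
      ultimately show ?thesis using c unfolding c0 cd compat_p_diag by auto
    qed
  qed (use d d0 p_diag_diagram ij in auto)
  then show ?thesis using gen gen_diagrams.p[OF ij(1)] gen_diagrams.comp by metis
qed

lemma split_blocks:
  assumes d: "d \<in> matchings J" and B: "B \<subseteq> d"
  shows "d - B \<in> matchings (J - \<Union>B)" "B \<in> matchings (\<Union>B)" "B \<union> (d - B) = d"
proof -
  have p: "partition_on J d" using d by (simp add: matchings_def)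
  then have dj: "disjoint d" and ne: "{} \<notin> d" and J: "J = \<Union>d" by (auto simp: partition_on_def)
  have "\<Union>(d - B) = J - \<Union>B"
  proof (intro equalityI subsetI)
    fix x assume "x \<in> \<Union>(d - B)"
    then obtain b where b: "b \<in> d" "b \<notin> B" "x \<in> b" by blast
    have "x \<notin> b'" if "b' \<in> B" for b'
    proof
      assume "x \<in> b'"
      then have "b = b'" using dj b that B unfolding disjoint_def by blast
      then show False using b that by simp
    qed
    then show "x \<in> J - \<Union>B" using b J by blast
  qed (use J in blast)
  moreover have "disjoint (d - B)" "disjoint B" using dj B by (auto intro: pairwise_subset)
  ultimately show "d - B \<in> matchings (J - \<Union>B)" "B \<in> matchings (\<Union>B)"
    using d B ne by (auto simp: matchings_def partition_on_def)
  show "B \<union> (d - B) = d" using B by blast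
qed

text \<open>The two rows have equally many vertices that are not on a strand between the rows. So two such vertices, or
  two such pairs, can be replaced by strands, or a pair facing two isolated vertices by a pair of edges; each
  replacement lowers the number of blocks inside a row and is undone by multiplication with a generated
  diagram. A diagram of strands is a permutation.\<close>

lemma all_generated: "d \<in> pb_diagrams r \<Longrightarrow> d \<in> gen_diagrams r"
proof (induction "n_nonthrough d" arbitrary: d rule: less_induct)
  case less
  have d: "d \<in> matchings (pb_verts r)" using less.prems by (simp add: pb_diagrams_matchings)
  note mb = matchings_blocks[OF d finite_pb_verts]
  have vert: "Inl i \<in> pb_verts r \<longleftrightarrow> i \<in> {1..r}" "Inr i \<in> pb_verts r \<longleftrightarrow> i \<in> {1..r}" for i
    by (auto simp: pb_verts_def)
  define T where "T = {i \<in> {1..r}. \<exists>k. {Inl i, Inr k} \<in> d}"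
  define B where "B = {k \<in> {1..r}. \<exists>i. {Inl i, Inr k} \<in> d}"
  have uniq: "k = k'" if "{Inl i, Inr k} \<in> d" "{Inl i, Inr k'} \<in> d" for i k k'
    using mb(4)[OF that, of "Inl i"] by (auto simp: doubleton_eq_iff)
  have uniq': "i = i'" if "{Inl i, Inr k} \<in> d" "{Inl i', Inr k} \<in> d" for i i' k
    using mb(4)[OF that, of "Inr k"] by (auto simp: doubleton_eq_iff)
  have in_r: "i \<in> {1..r}" "k \<in> {1..r}" if "{Inl i, Inr k} \<in> d" for i k
    using mb(1)[OF that] vert by auto
  have "\<forall>i\<in>T. \<exists>k. {Inl i, Inr k} \<in> d" by (auto simp: T_def)
  then obtain f where f: "\<And>i. i \<in> T \<Longrightarrow> {Inl i, Inr (f i)} \<in> d" by metis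
  have fB: "bij_betw f T B"
    unfolding bij_betw_def
  proof (intro conjI)
    show "inj_on f T" using f uniq' by (metis inj_onI)
    have "k \<in> f ` T" if k: "k \<in> B" for k
    proof -
      obtain i where i: "{Inl i, Inr k} \<in> d" using k by (auto simp: B_def)
      then have "i \<in> T" using in_r by (auto simp: T_def)
      then show ?thesis using uniq[OF i f] by blast
    qed
    moreover have "f i \<in> B" if i: "i \<in> T" for i
      using in_r[OF f[OF i]] f[OF i] unfolding B_def by blast
    ultimately show "f ` T = B" by blast
  qed
  have TB: "T \<subseteq> {1..r}" "B \<subseteq> {1..r}" by (auto simp: T_def B_def)
  \<comment> \<open>The vertices of the two rows that are not on a strand.\<close>
  define NT where "NT = {1..r} - T"
  define NB where "NB = {1..r} - B"
  have cNT: "card NT = card NB"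
    using bij_betw_same_card[OF fB] TB by (simp add: NT_def NB_def card_Diff_subset finite_subset)
  have finN: "finite NT" "finite NB" by (auto simp: NT_def NB_def)
  have top: "{Inl i} \<in> d \<or> (\<exists>j. j \<noteq> i \<and> j \<in> NT \<and> {Inl i, Inl j} \<in> d)" if i: "i \<in> NT" for i
  proof (rule ccontr)
    assume n: "\<not> ?thesis"
    have "Inl i \<in> pb_verts r" using i by (simp add: NT_def vert)
    then obtain y where y: "y \<noteq> Inl i" "y \<in> pb_verts r" "{Inl i, y} \<in> d"
      using matching_single_or_pair[OF d finite_pb_verts] n by blast
    show False
    proof (cases y)
      case (Inl j)
      have "j \<in> {1..r}" using y(2) by (simp add: Inl vert)
      moreover have "j \<notin> T"
      proof
        assume "j \<in> T"
        then have "{Inl i, Inl j} = {Inl j, Inr (f j)}" using mb(4)[OF y(3) f, of j "Inl j"] Inl by simp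
        then show False by (auto simp: doubleton_eq_iff)
      qed
      ultimately show False using n y Inl by (auto simp: NT_def)
    next
      case (Inr k)
      then show False using i y by (auto simp: NT_def T_def)
    qed
  qed
  have bot: "{Inr k} \<in> d \<or> (\<exists>l. l \<noteq> k \<and> l \<in> NB \<and> {Inr k, Inr l} \<in> d)" if k: "k \<in> NB" for k
  proof (rule ccontr)
    assume n: "\<not> ?thesis"
    have "Inr k \<in> pb_verts r" using k by (simp add: NB_def vert)
    then obtain y where y: "y \<noteq> Inr k" "y \<in> pb_verts r" "{Inr k, y} \<in> d"
      using matching_single_or_pair[OF d finite_pb_verts] n by blast
    show False
    proof (cases y)
      case (Inr l)
      have "l \<in> {1..r}" using y(2) by (simp add: Inr vert)
      moreover have "l \<notin> B"
      proof
        assume "l \<in> B"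
        then obtain i where "{Inl i, Inr l} \<in> d" by (auto simp: B_def)
        then have "{Inr k, Inr l} = {Inl i, Inr l}" using mb(4)[OF y(3), of "{Inl i, Inr l}" "Inr l"] Inr by simp
        then show False by (auto simp: doubleton_eq_iff)
      qed
      ultimately show False using n y Inr by (auto simp: NB_def)
    next
      case (Inl i)
      then have "{Inl i, Inr k} \<in> d" using y(3) by (simp add: insert_commute)
      then show False using k by (auto simp: NB_def B_def)
    qed
  qed
  have NTr: "i \<in> {1..r}" if "i \<in> NT" for i using that by (simp add: NT_def)
  have NBr: "i \<in> {1..r}" if "i \<in> NB" for i using that by (simp add: NB_def)
  \<comment> \<open>Replace the two edges by two strands.\<close>
  have pairs: ?case if ij: "i \<in> NT" "j \<in> NT" "i \<noteq> j" "{Inl i, Inl j} \<in> d" and kl: "k \<in> NB" "l \<in> NB" "k \<noteq> l" "{Inr k, Inr l} \<in> d" for i j k l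
  proof -
    let ?B = "{{Inl i, Inl j}, {Inr k, Inr l}} :: (nat + nat) set set" and ?W = "{Inl i, Inl j, Inr k, Inr l} :: (nat + nat) set"
    have W: "\<Union>?B = ?W" by auto
    have sub: "?B \<subseteq> d" using ij kl by simp
    note sp = split_blocks[OF d sub, unfolded W]
    have Wv: "?W \<subseteq> pb_verts r" using ij kl NTr NBr by (simp add: vert)
    have b: "{{Inl i, Inr k}, {Inl j, Inr l}} \<in> matchings ({Inl i, Inr k} \<union> {Inl j, Inr l})"
      using ij kl by (intro matchings_two matchings_pair) auto
    have e: "{Inl i, Inr k} \<union> {Inl j, Inr l} = ?W" by auto
    note ra = reattach[OF sp(1) b[unfolded e] Wv] and rb = reattach(2)[OF sp(1,2) Wv]
    have "{{Inl i, Inr k}, {Inl j, Inr l}} \<union> (d - ?B) \<in> gen_diagrams r"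
      using ra rb sp(3) ij(3) kl(3) by (intro less.hyps) (simp_all add: n_nonthrough_blocks)
    then have "?B \<union> (d - ?B) \<in> gen_diagrams r"
      using ij kl by (intro attach_pairs[OF sp(1)] NTr NBr)
    then show ?thesis by (simp only: sp(3))
  qed
  show ?case
  proof (cases "NT = {}")
    case True
    then have "NB = {}" using cNT finN by simp
    then have T: "T = {1..r}" and B: "B = {1..r}" using True TB by (auto simp: NT_def NB_def)
    define \<sigma> where "\<sigma> i = (if i \<in> {1..r} then f i else i)" for i
    have "bij_betw \<sigma> {1..r} {1..r}"
      using fB unfolding T B by (rule bij_betw_cong[THEN iffD1, rotated]) (simp add: \<sigma>_def)
    then have perm: "\<sigma> permutes {1..r}" by (intro bij_imp_permutes) (auto simp: \<sigma>_def)
    have \<sigma>d: "{Inl i, Inr (\<sigma> i)} \<in> d" if "i \<in> {1..r}" for i using f[of i] that T by (simp add: \<sigma>_def)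
    have "d = perm_diag r \<sigma>"
    proof (intro equalityI subsetI)
      fix b assume b: "b \<in> d"
      then obtain x where x: "x \<in> b" "x \<in> pb_verts r" using mb(1,2) by blast
      show "b \<in> perm_diag r \<sigma>"
      proof (cases x)
        case (Inl i)
        then have i: "i \<in> {1..r}" using x vert by simp
        have "b = {Inl i, Inr (\<sigma> i)}" using mb(4)[OF b \<sigma>d[OF i] x(1)] Inl by simp
        then show ?thesis using i by (auto simp: perm_diag_def)
      next
        case (Inr k)
        then have "k \<in> \<sigma> ` {1..r}" using x vert permutes_image[OF perm] by simp
        then obtain i where i: "i \<in> {1..r}" "k = \<sigma> i" by blast
        have "b = {Inl i, Inr (\<sigma> i)}" using mb(4)[OF b \<sigma>d[OF i(1)] x(1)] Inr i(2) by simp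
        then show ?thesis using i by (auto simp: perm_diag_def)
      qed
    qed (use \<sigma>d in \<open>auto simp: perm_diag_def\<close>)
    then show ?thesis using permutation_generated[OF perm] by simp
  next
    case False
    then obtain i where i: "i \<in> NT" by blast
    have "NB \<noteq> {}" using False cNT finN by (metis card_0_eq)
    then obtain k where k: "k \<in> NB" by blast
    have two: "\<exists>l. l \<in> N \<and> l \<noteq> k" if "card N \<ge> 2" for N :: "nat set" and k
      using that by (metis One_nat_def Suc_1 Suc_n_not_le_n card_1_singleton_iff card_mono finite.emptyI finite.insertI insertCI singletonD subsetI le_trans card.infinite card_gt_0_iff)
    have ge2: "card N \<ge> 2" if "a \<in> N" "b \<in> N" "a \<noteq> b" "finite N" for a b and N :: "nat set"
      using card_mono[OF that(4), of "{a, b}"] that by simp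
    consider (ss) "{Inl i} \<in> d" "{Inr k} \<in> d"
      | (pp) j l where "j \<noteq> i" "j \<in> NT" "{Inl i, Inl j} \<in> d" "l \<noteq> k" "l \<in> NB" "{Inr k, Inr l} \<in> d"
      | (ps) j where "j \<noteq> i" "j \<in> NT" "{Inl i, Inl j} \<in> d" "{Inr k} \<in> d"
      | (sp) l where "{Inl i} \<in> d" "l \<noteq> k" "l \<in> NB" "{Inr k, Inr l} \<in> d"
      using top[OF i] bot[OF k] by blast
    then show ?thesis
    proof cases
      case ss
      let ?B = "{{Inl i}, {Inr k}} :: (nat + nat) set set" and ?W = "{Inl i, Inr k} :: (nat + nat) set"
      have W: "\<Union>?B = ?W" by auto
      have sub: "?B \<subseteq> d" using ss by simp
      note sp = split_blocks[OF d sub, unfolded W]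
      have Wv: "?W \<subseteq> pb_verts r" using i k NTr NBr by (simp add: vert)
      have b: "{{Inl i, Inr k}} \<in> matchings ?W" by (intro matchings_pair) simp
      note ra = reattach[OF sp(1) b Wv] and rb = reattach(2)[OF sp(1,2) Wv]
      have "{{Inl i, Inr k}} \<union> (d - ?B) \<in> gen_diagrams r"
        using ra rb sp(3) by (intro less.hyps) (simp_all add: n_nonthrough_blocks)
      then have "?B \<union> (d - ?B) \<in> gen_diagrams r"
        using i k by (intro attach_singles[OF sp(1)] NTr NBr)
      then show ?thesis by (simp only: sp(3))
    next
      case pp
      then show ?thesis using pairs[of i j k l] i k by simp
    next
      case ps
      have "card NB \<ge> 2" using ge2[OF i ps(2) ps(1)[symmetric] finN(1)] cNT by simp
      then obtain l where l: "l \<in> NB" "l \<noteq> k" using two by blast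
      show ?thesis
      proof (cases "{Inr l} \<in> d")
        case False
        then obtain l' where "l' \<noteq> l" "l' \<in> NB" "{Inr l, Inr l'} \<in> d" using bot[OF l(1)] by blast
        then show ?thesis using pairs[of i j l l'] i l ps by simp
      next
        case True
        let ?B = "{{Inl i, Inl j}, {Inr k}, {Inr l}} :: (nat + nat) set set" and ?W = "{Inl i, Inl j, Inr k, Inr l} :: (nat + nat) set"
        have W: "\<Union>?B = ?W" by auto
        have sub: "?B \<subseteq> d" using ps True by simp
        note sp = split_blocks[OF d sub, unfolded W]
        have Wv: "?W \<subseteq> pb_verts r" using i k l ps NTr NBr by (simp add: vert)
        have b: "{{Inl i, Inl j}, {Inr k, Inr l}} \<in> matchings ({Inl i, Inl j} \<union> {Inr k, Inr l})"
          using ps l by (intro matchings_two matchings_pair) auto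
        have e: "{Inl i, Inl j} \<union> {Inr k, Inr l} = ?W" by auto
        note ra = reattach[OF sp(1) b[unfolded e] Wv] and rb = reattach(2)[OF sp(1,2) Wv]
        have "{{Inl i, Inl j}, {Inr k, Inr l}} \<union> (d - ?B) \<in> gen_diagrams r"
          using ra rb sp(3) ps(1) l(2) by (intro less.hyps) (simp_all add: n_nonthrough_blocks)
        then have "?B \<union> (d - ?B) \<in> gen_diagrams r"
          using i k l ps by (intro cut_bottom_pair[OF sp(1)] NTr NBr) auto
        then show ?thesis by (simp only: sp(3))
      qed
    next
      case sp': sp
      have "card NT \<ge> 2" using ge2[OF k sp'(3) sp'(2)[symmetric] finN(2)] cNT by simp
      then obtain j where j: "j \<in> NT" "j \<noteq> i" using two by blast
      show ?thesis
      proof (cases "{Inl j} \<in> d")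
        case False
        then obtain j' where "j' \<noteq> j" "j' \<in> NT" "{Inl j, Inl j'} \<in> d" using top[OF j(1)] by blast
        then show ?thesis using pairs[of j j' k l] k j sp' by simp
      next
        case True
        let ?B = "{{Inl i}, {Inl j}, {Inr k, Inr l}} :: (nat + nat) set set" and ?W = "{Inl i, Inl j, Inr k, Inr l} :: (nat + nat) set"
        have W: "\<Union>?B = ?W" by auto
        have sub: "?B \<subseteq> d" using sp' True by simp
        note sp = split_blocks[OF d sub, unfolded W]
        have Wv: "?W \<subseteq> pb_verts r" using i k j sp' NTr NBr by (simp add: vert)
        have b: "{{Inl i, Inl j}, {Inr k, Inr l}} \<in> matchings ({Inl i, Inl j} \<union> {Inr k, Inr l})"
          using sp' j by (intro matchings_two matchings_pair) auto
        have e: "{Inl i, Inl j} \<union> {Inr k, Inr l} = ?W" by auto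
        note ra = reattach[OF sp(1) b[unfolded e] Wv] and rb = reattach(2)[OF sp(1,2) Wv]
        have "{{Inl i, Inl j}, {Inr k, Inr l}} \<union> (d - ?B) \<in> gen_diagrams r"
          using ra rb sp(3) sp'(2) j(2) by (intro less.hyps) (simp_all add: n_nonthrough_blocks)
        then have "?B \<union> (d - ?B) \<in> gen_diagrams r"
          using i k j sp' by (intro cut_top_pair[OF sp(1)] NTr NBr) auto
        then show ?thesis by (simp only: sp(3))
      qed
    qed
  qed
qed

section \<open>The matrices of diagrams\<close>

text \<open>The matrix of a diagram, rows being indexed by the bottom colouring. The weight \<open>t\<close> of an
  isolated vertex splits the parameter of the middle components evenly between their two ends:
  \<open>t\<^sup>2 = \<delta>'\<close>.\<close>

definition diag_mat :: "nat \<Rightarrow> nat \<Rightarrow> complex \<Rightarrow> diagram \<Rightarrow> (nat \<Rightarrow> nat) \<times> (nat \<Rightarrow> nat) \<Rightarrow> complex" where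
  "diag_mat r n t d = (\<lambda>(k, l). if k \<in> {1..r} \<rightarrow>\<^sub>E {0..<n} \<and> l \<in> {1..r} \<rightarrow>\<^sub>E {0..<n} \<and> compat d (case_sum l k)
     then t ^ n_single d else 0)"

lemma diag_mat_mats [simp]: "diag_mat r n t d \<in> mats ({1..r} \<rightarrow>\<^sub>E {0..<n})"
  by (auto simp: mats_def supported_def diag_mat_def)

text \<open>Every middle colouring contributes the same power of \<open>t\<close>; the excess of this power over the one
  in the matrix of the product is twice the number of middle components that are not loops. The order of
  factors is reversed because the algebra acts on the right.\<close>

lemma diag_mat_mult:
  assumes d: "d1 \<in> pb_diagrams r" "d2 \<in> pb_diagrams r" and n: "n \<ge> 1"
  shows "mm ({1..r} \<rightarrow>\<^sub>E {0..<n}) (diag_mat r n t d2) (diag_mat r n t d1) =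
    (of_nat n ^ n_loops r d1 d2 * (t\<^sup>2) ^ n_nonloops r d1 d2) *\<^sub>v diag_mat r n t (pb_comp r d1 d2)"
proof (rule mats_eqI[of _ "{1..r} \<rightarrow>\<^sub>E {0..<n}"])
  interpret stack r d1 d2 by standard (use d in auto)
  let ?K = "{1..r} \<rightarrow>\<^sub>E {0..<n}"
  fix k l assume kl: "k \<in> ?K" "l \<in> ?K"
  have fin: "finite ?K" by (simp add: finite_PiE)
  have "mm ?K (diag_mat r n t d2) (diag_mat r n t d1) (k, l) =
    (\<Sum>j\<in>?K. if compat d1 (case_sum l j) \<and> compat d2 (case_sum j k) then t ^ (n_single d1 + n_single d2) else 0)"
    using kl by (auto simp: mm_apply diag_mat_def power_add mult.commute intro!: sum.cong)
  also have "\<dots> = (\<Sum>j\<in>{j \<in> ?K. compat d1 (case_sum l j) \<and> compat d2 (case_sum j k)}. t ^ (n_single d1 + n_single d2))"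
    using fin by (rule sum.inter_filter[symmetric])
  also have "\<dots> = of_nat (if compat (pb_comp r d1 d2) (case_sum l k) then n ^ n_loops r d1 d2 else 0) * t ^ (n_single d1 + n_single d2)"
    unfolding sum_constant mid_coloring_count[OF n kl(2,1)] ..
  also have "\<dots> = ((of_nat n ^ n_loops r d1 d2 * (t\<^sup>2) ^ n_nonloops r d1 d2) *\<^sub>v diag_mat r n t (pb_comp r d1 d2)) (k, l)"
    unfolding n_single_comp using kl by (simp add: diag_mat_def vscale_apply power_add power_mult mult_ac)
  finally show "mm ?K (diag_mat r n t d2) (diag_mat r n t d1) (k, l) =
    ((of_nat n ^ n_loops r d1 d2 * (t\<^sup>2) ^ n_nonloops r d1 d2) *\<^sub>v diag_mat r n t (pb_comp r d1 d2)) (k, l)" .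
qed (simp, intro mats_closed diag_mat_mats)

section \<open>The commutant of the orthogonal group\<close>

lemma tens_mat_single:
  assumes J: "finite J" "i \<in> J" and kj: "k \<in> J \<rightarrow>\<^sub>E C" "j \<in> J \<rightarrow>\<^sub>E C"
  shows "tens_mat J C ((\<lambda>_. mone C)(i := x)) (k, j) = (if j = k(i := j i) then x (k i, j i) else 0)"
proof -
  have "tens_mat J C ((\<lambda>_. mone C)(i := x)) (k, j) = (\<Prod>m\<in>J. ((\<lambda>_. mone C)(i := x)) m (k m, j m))"
    using kj by (simp add: tens_mat_apply)
  also have "\<dots> = x (k i, j i) * (\<Prod>m\<in>J - {i}. if k m = j m then 1 else 0)"
    using J kj by (subst prod.remove[OF J]) (auto simp: mone_apply PiE_mem[of k J "\<lambda>_. C"] intro!: prod.cong)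
  also have "(\<Prod>m\<in>J - {i}. if k m = j m then 1 else 0) = (if \<forall>m\<in>J - {i}. k m = j m then 1 else (0::complex))"
    using J by (auto simp: prod_zero_iff)
  also have "(\<forall>m\<in>J - {i}. k m = j m) \<longleftrightarrow> j = k(i := j i)"
  proof
    assume h: "\<forall>m\<in>J - {i}. k m = j m"
    show "j = k(i := j i)"
    proof
      fix m show "j m = (k(i := j i)) m"
        using h kj by (cases "m \<in> J") (auto simp: PiE_iff extensional_def)
    qed
  next
    assume h: "j = k(i := j i)"
    show "\<forall>m\<in>J - {i}. k m = j m"
    proof
      fix m assume "m \<in> J - {i}"
      then show "k m = j m" using fun_cong[OF h, of m] by simp
    qed
  qed
  finally show ?thesis by (simp only: if_mult mult_1_right)
qed

text \<open>A derivation changes one coordinate at a time, so its matrix products reduce to sums over one coordinate.\<close>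

lemma sum_one_coordinate:
  fixes F :: "('p \<Rightarrow> 'c) \<Rightarrow> complex"
  assumes J: "finite J" "i \<in> J" and C: "finite C" and k: "k \<in> J \<rightarrow>\<^sub>E C"
    and F: "\<And>j. j \<in> J \<rightarrow>\<^sub>E C \<Longrightarrow> j \<noteq> k(i := j i) \<Longrightarrow> F j = 0"
  shows "(\<Sum>j\<in>J \<rightarrow>\<^sub>E C. F j) = (\<Sum>c\<in>C. F (k(i := c)))"
proof -
  have sub: "(\<lambda>c. k(i := c)) ` C \<subseteq> J \<rightarrow>\<^sub>E C" using k J by (auto intro!: upd_in_PiE)
  have "(\<Sum>j\<in>J \<rightarrow>\<^sub>E C. F j) = (\<Sum>j\<in>(\<lambda>c. k(i := c)) ` C. F j)"
  proof (rule sum.mono_neutral_right[OF finite_PiE sub])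
    show "\<forall>j\<in>(J \<rightarrow>\<^sub>E C) - (\<lambda>c. k(i := c)) ` C. F j = 0"
    proof
      fix j assume j: "j \<in> (J \<rightarrow>\<^sub>E C) - (\<lambda>c. k(i := c)) ` C"
      have "j i \<in> C" using j J(2) by auto
      then have "j \<noteq> k(i := j i)" using j by blast
      then show "F j = 0" using F j by blast
    qed
  qed (use J C in auto)
  also have "\<dots> = (\<Sum>c\<in>C. F (k(i := c)))"
  proof (subst sum.reindex)
    show "inj_on (\<lambda>c. k(i := c)) C" by (rule inj_onI) (metis fun_upd_same)
  qed simp
  finally show ?thesis .
qed

lemma deriv_mat_mm_left:
  assumes J: "finite J" and C: "finite C" and kl: "k \<in> J \<rightarrow>\<^sub>E C" "l \<in> J \<rightarrow>\<^sub>E C"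
  shows "mm (J \<rightarrow>\<^sub>E C) (deriv_mat J C x) Y (k, l) = (\<Sum>i\<in>J. \<Sum>c\<in>C. x (k i, c) * Y (k(i := c), l))"
  unfolding deriv_mat_def mm_sum sum_apply
proof (rule sum.cong[OF HOL.refl])
  fix i assume i: "i \<in> J"
  have "mm (J \<rightarrow>\<^sub>E C) (tens_mat J C ((\<lambda>_. mone C)(i := x))) Y (k, l) =
    (\<Sum>j\<in>J \<rightarrow>\<^sub>E C. (if j = k(i := j i) then x (k i, j i) else 0) * Y (j, l))"
    unfolding mm_apply[OF kl] by (intro sum.cong HOL.refl) (simp only: tens_mat_single[OF J i kl(1)])
  also have "\<dots> = (\<Sum>c\<in>C. (if k(i := c) = k(i := (k(i := c)) i) then x (k i, (k(i := c)) i) else 0) * Y (k(i := c), l))"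
    by (rule sum_one_coordinate[OF J i C kl(1)]) simp
  finally show "mm (J \<rightarrow>\<^sub>E C) (tens_mat J C ((\<lambda>_. mone C)(i := x))) Y (k, l) = (\<Sum>c\<in>C. x (k i, c) * Y (k(i := c), l))"
    by simp
qed

lemma deriv_mat_mm_right:
  assumes J: "finite J" and C: "finite C" and kl: "k \<in> J \<rightarrow>\<^sub>E C" "l \<in> J \<rightarrow>\<^sub>E C"
  shows "mm (J \<rightarrow>\<^sub>E C) Y (deriv_mat J C x) (k, l) = (\<Sum>i\<in>J. \<Sum>c\<in>C. Y (k, l(i := c)) * x (c, l i))"
  unfolding deriv_mat_def mm_sum sum_apply
proof (rule sum.cong[OF HOL.refl])
  fix i assume i: "i \<in> J"
  have eq: "l = j(i := l i) \<longleftrightarrow> j = l(i := j i)" for j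
    by (metis fun_upd_triv fun_upd_upd)
  have "mm (J \<rightarrow>\<^sub>E C) Y (tens_mat J C ((\<lambda>_. mone C)(i := x))) (k, l) =
    (\<Sum>j\<in>J \<rightarrow>\<^sub>E C. Y (k, j) * (if l = j(i := l i) then x (j i, l i) else 0))"
    unfolding mm_apply[OF kl] by (intro sum.cong HOL.refl) (simp only: tens_mat_single[OF J i _ kl(2)])
  also have "\<dots> = (\<Sum>c\<in>C. Y (k, l(i := c)) * (if l = (l(i := c))(i := l i) then x ((l(i := c)) i, l i) else 0))"
    by (rule sum_one_coordinate[OF J i C kl(2)]) (simp add: eq)
  finally show "mm (J \<rightarrow>\<^sub>E C) Y (tens_mat J C ((\<lambda>_. mone C)(i := x))) (k, l) = (\<Sum>c\<in>C. Y (k, l(i := c)) * x (c, l i))"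
    by simp
qed

lemma wedge_delta:
  assumes "c \<in> C" "c' \<in> C"
  shows "wedge C (delta a) (delta b) (c, c') = (if c = a \<and> c' = b then 1 else 0) - (if c = b \<and> c' = a then 1 else 0)"
proof -
  have "wedge C (delta a) (delta b) (c, c') = delta a c * delta b c' - delta b c * delta a c'"
    using assms by (simp add: wedge_def outer1_apply)
  also have "\<dots> = (if c = a \<and> c' = b then 1 else 0) - (if c = b \<and> c' = a then 1 else 0)"
    unfolding delta_def by (cases "c = a"; cases "c' = b"; cases "c = b"; cases "c' = a") simp_all
  finally show ?thesis .
qed

text \<open>A pair of colourings of the two rows as one colouring of all vertices. With its inverse \<open>top_col\<close>,
  \<open>bot_col\<close> it turns a matrix into a tensor in all \<open>2 * r\<close> positions.\<close>

definition join_col :: "nat \<Rightarrow> (nat \<Rightarrow> nat) \<Rightarrow> (nat \<Rightarrow> nat) \<Rightarrow> nat + nat \<Rightarrow> nat" where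
  "join_col r l k = restrict (case_sum l k) (pb_verts r)"

definition top_col :: "nat \<Rightarrow> (nat + nat \<Rightarrow> nat) \<Rightarrow> nat \<Rightarrow> nat" where
  "top_col r \<kappa> = (\<lambda>i\<in>{1..r}. \<kappa> (Inl i))"

definition bot_col :: "nat \<Rightarrow> (nat + nat \<Rightarrow> nat) \<Rightarrow> nat \<Rightarrow> nat" where
  "bot_col r \<kappa> = (\<lambda>i\<in>{1..r}. \<kappa> (Inr i))"

lemma vert_iff: "Inl i \<in> pb_verts r \<longleftrightarrow> i \<in> {1..r}" "Inr i \<in> pb_verts r \<longleftrightarrow> i \<in> {1..r}"
  by (auto simp: pb_verts_def)

lemma join_col_PiE: "l \<in> {1..r} \<rightarrow>\<^sub>E C \<Longrightarrow> k \<in> {1..r} \<rightarrow>\<^sub>E C \<Longrightarrow> join_col r l k \<in> pb_verts r \<rightarrow>\<^sub>E C"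
  by (auto simp: join_col_def pb_verts_def)

lemma top_col_PiE: "\<kappa> \<in> pb_verts r \<rightarrow>\<^sub>E C \<Longrightarrow> top_col r \<kappa> \<in> {1..r} \<rightarrow>\<^sub>E C" "\<kappa> \<in> pb_verts r \<rightarrow>\<^sub>E C \<Longrightarrow> bot_col r \<kappa> \<in> {1..r} \<rightarrow>\<^sub>E C"
  by (auto simp: top_col_def bot_col_def vert_iff PiE_iff)

lemma top_col_join_col:
  assumes "l \<in> {1..r} \<rightarrow>\<^sub>E C" "k \<in> {1..r} \<rightarrow>\<^sub>E C"
  shows "top_col r (join_col r l k) = l" "bot_col r (join_col r l k) = k"
  using assms by (auto simp: top_col_def bot_col_def join_col_def vert_iff fun_eq_iff PiE_iff extensional_def)

lemma join_col_top_col: "\<kappa> \<in> pb_verts r \<rightarrow>\<^sub>E C \<Longrightarrow> join_col r (top_col r \<kappa>) (bot_col r \<kappa>) = \<kappa>"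
  by (auto simp: top_col_def bot_col_def join_col_def vert_iff fun_eq_iff PiE_iff extensional_def pb_verts_def split: sum.splits)

lemma sum_pb_verts:
  "(\<Sum>\<kappa>\<in>pb_verts r \<rightarrow>\<^sub>E C. F \<kappa>) = (\<Sum>l\<in>{1..r} \<rightarrow>\<^sub>E C. \<Sum>k\<in>{1..r} \<rightarrow>\<^sub>E C. F (join_col r l k))"
proof -
  have bij: "bij_betw (\<lambda>(l, k). join_col r l k) (({1..r} \<rightarrow>\<^sub>E C) \<times> ({1..r} \<rightarrow>\<^sub>E C)) (pb_verts r \<rightarrow>\<^sub>E C)"
    by (rule bij_betw_byWitness[where f' = "\<lambda>\<kappa>. (top_col r \<kappa>, bot_col r \<kappa>)"])
      (simp_all add: image_subset_iff top_col_join_col[of _ r C] join_col_top_col[of _ r C] join_col_PiE top_col_PiE case_prod_beta del: One_nat_def)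
  show ?thesis
    unfolding sum.cartesian_product sum.reindex_bij_betw[OF bij, symmetric] by (simp add: case_prod_beta)
qed

lemma sum_verts: "(\<Sum>x\<in>pb_verts r. h x) = (\<Sum>i\<in>{1..r}. h (Inl i)) + (\<Sum>i\<in>{1..r}. h (Inr i))" for h :: "nat + nat \<Rightarrow> 'b::comm_monoid_add"
  unfolding pb_verts_def by (subst sum.Plus) (auto simp: comp_def)

lemma prod_verts: "(\<Prod>x\<in>pb_verts r. h x) = (\<Prod>i\<in>{1..r}. h (Inl i)) * (\<Prod>i\<in>{1..r}. h (Inr i))" for h :: "nat + nat \<Rightarrow> 'b::comm_monoid_mult"
  unfolding pb_verts_def by (subst prod.Plus) (auto simp: comp_def)

lemma compat_join_col: "d \<in> pb_diagrams r \<Longrightarrow> compat d (join_col r l k) \<longleftrightarrow> compat d (case_sum l k)"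
  by (rule compat_cong) (auto simp: join_col_def pb_diagrams_def partition_on_def)

text \<open>Split \<open>M\<close> into its orthogonal projection onto the span of the diagram matrices and a rest
  \<open>Y\<close>. The diagram matrices commute with \<open>X\<close>, hence so does \<open>Y\<close>. Read
  as a tensor in all \<open>2 * r\<close> positions, \<open>Y\<close> is invariant under the orthogonal Lie
  algebra, since \<open>v \<and> w\<close> is antisymmetric, even in each nonzero colour, since the
  reflections are diagonal with entries \<open>\<plusminus>1\<close>, and orthogonal to all matchings; so it
  is zero.\<close>

lemma commutant_in_diagram_span:
  fixes r n :: nat and t :: complex
  defines "C \<equiv> {0..<n}" and "K \<equiv> {1..r} \<rightarrow>\<^sub>E {0..<n}"
  assumes n: "n \<ge> 1" and t: "t \<noteq> 0" and M: "M \<in> mats K"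
    and X: "X = {deriv_mat {1..r} C (wedge C (delta a) (delta b)) | a b. a \<in> {1..<n} \<and> b \<in> {1..<n}} \<union>
                {tens_mat {1..r} C (\<lambda>_. refl_mat C (delta a)) | a. a \<in> {1..<n}}"
    and comm: "\<And>x. x \<in> X \<Longrightarrow> mm K x M = mm K M x"
    and diag: "\<And>x d. x \<in> X \<Longrightarrow> d \<in> pb_diagrams r \<Longrightarrow> mm K x (diag_mat r n t d) = mm K (diag_mat r n t d) x"
  shows "M \<in> cfun.span (diag_mat r n t ` pb_diagrams r)"
proof -
  let ?S = "cfun.span (diag_mat r n t ` pb_diagrams r)"
  have fin: "finite (K \<times> K)" "finite K" "finite C" by (simp_all add: K_def C_def finite_PiE)
  have "?S \<subseteq> mats K"
    unfolding K_def by (rule cfun.span_minimal[OF _ mats_subspace]) (use diag_mat_mats in blast)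
  then obtain p where p: "p \<in> ?S" and orth: "\<And>s. s \<in> ?S \<Longrightarrow> herm (K \<times> K) (M - p) s = 0"
    using orthogonal_decomposition[OF fin(1) cfun.subspace_span, of "diag_mat r n t ` pb_diagrams r" M] M
    unfolding mats_def by metis
  have pm: "p \<in> mats K" using p \<open>?S \<subseteq> mats K\<close> by blast
  have comm_p: "mm K x p = mm K p x" if x: "x \<in> X" for x
    using p
  proof (induction rule: cfun.span_induct_alt)
    case (step c y z)
    then show ?case using diag[OF x] by (auto simp only: mm_linear)
  qed (simp only: mm_linear)
  define Y where "Y = M - p"
  have Ym: "Y \<in> mats K" unfolding Y_def using M pm by (rule mats_closed)
  have comm_Y: "mm K x Y = mm K Y x" if "x \<in> X" for x
    unfolding Y_def mm_linear using comm[OF that] comm_p[OF that] by (simp only:)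
  \<comment> \<open>The rest as a tensor in all vertices.\<close>
  define y where "y \<kappa> = Y (bot_col r \<kappa>, top_col r \<kappa>)" for \<kappa>
  have yjn: "y (join_col r l k) = Y (k, l)" if "l \<in> K" "k \<in> K" for l k
    using that by (simp add: y_def top_col_join_col[of l r C k] K_def C_def)
  have updl: "(join_col r l k)(Inl i := c) = join_col r (l(i := c)) k" "(join_col r l k)(Inr i := c) = join_col r l (k(i := c))" if "i \<in> {1..r}" for l k i c
    using that by (auto simp: join_col_def fun_eq_iff vert_iff split: sum.splits)
  have jnv: "join_col r l k (Inl i) = l i" "join_col r l k (Inr i) = k i" if "i \<in> {1..r}" for l k i
    using that by (simp_all add: join_col_def vert_iff)
  have "y \<kappa> = 0" if \<kappa>: "\<kappa> \<in> pb_verts r \<rightarrow>\<^sub>E {0..<n}" for \<kappa>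
  proof (rule invariant_orthogonal_to_matchings_zero[OF finite_pb_verts n _ _ _ \<kappa>])
    fix a b \<kappa> assume ab: "a \<in> {1..<n}" "b \<in> {1..<n}" and \<kappa>: "\<kappa> \<in> pb_verts r \<rightarrow>\<^sub>E {0..<n}"
    obtain l k where lk: "l \<in> K" "k \<in> K" "\<kappa> = join_col r l k"
      by (rule that[of "top_col r \<kappa>" "bot_col r \<kappa>"]) (simp_all only: K_def top_col_PiE[OF \<kappa>] join_col_top_col[OF \<kappa>])
    let ?x = "deriv_mat {1..r} C (wedge C (delta a) (delta b))"
    have aC: "a \<in> C" "b \<in> C" using ab by (auto simp: C_def)
    have lkC: "l i \<in> C" "k i \<in> C" if "i \<in> {1..r}" for i using lk that by (auto simp: K_def C_def PiE_iff)
    note W = wedge_delta[of _ C]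
    have KC: "K = {1..r} \<rightarrow>\<^sub>E C" by (simp add: K_def C_def)
    have left: "mm K ?x Y (k, l) = (\<Sum>i\<in>{1..r}. (if k i = a then Y (k(i := b), l) else 0) - (if k i = b then Y (k(i := a), l) else 0))"
    proof -
      have "mm K ?x Y (k, l) = (\<Sum>i\<in>{1..r}. \<Sum>c\<in>C. wedge C (delta a) (delta b) (k i, c) * Y (k(i := c), l))"
        unfolding KC by (rule deriv_mat_mm_left) (use lk fin KC in auto)
      also have "\<dots> = (\<Sum>i\<in>{1..r}. (if k i = a then Y (k(i := b), l) else 0) - (if k i = b then Y (k(i := a), l) else 0))"
      proof (rule sum.cong[OF HOL.refl])
        fix i assume i: "i \<in> {1..r}"
        have "(\<Sum>c\<in>C. wedge C (delta a) (delta b) (k i, c) * Y (k(i := c), l)) =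
          (\<Sum>c\<in>C. (if c = b then if k i = a then Y (k(i := b), l) else 0 else 0) - (if c = a then if k i = b then Y (k(i := a), l) else 0 else 0))"
          by (rule sum.cong[OF HOL.refl]) (use W lkC[OF i] in auto)
        then show "(\<Sum>c\<in>C. wedge C (delta a) (delta b) (k i, c) * Y (k(i := c), l)) =
          (if k i = a then Y (k(i := b), l) else 0) - (if k i = b then Y (k(i := a), l) else 0)"
          using fin(3) aC by (simp add: sum_subtractf)
      qed
      finally show ?thesis .
    qed
    have right: "mm K Y ?x (k, l) = (\<Sum>i\<in>{1..r}. (if l i = b then Y (k, l(i := a)) else 0) - (if l i = a then Y (k, l(i := b)) else 0))"
    proof -
      have "mm K Y ?x (k, l) = (\<Sum>i\<in>{1..r}. \<Sum>c\<in>C. Y (k, l(i := c)) * wedge C (delta a) (delta b) (c, l i))"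
        unfolding KC by (rule deriv_mat_mm_right) (use lk fin KC in auto)
      also have "\<dots> = (\<Sum>i\<in>{1..r}. (if l i = b then Y (k, l(i := a)) else 0) - (if l i = a then Y (k, l(i := b)) else 0))"
      proof (rule sum.cong[OF HOL.refl])
        fix i assume i: "i \<in> {1..r}"
        have "(\<Sum>c\<in>C. Y (k, l(i := c)) * wedge C (delta a) (delta b) (c, l i)) =
          (\<Sum>c\<in>C. (if c = a then if l i = b then Y (k, l(i := a)) else 0 else 0) - (if c = b then if l i = a then Y (k, l(i := b)) else 0 else 0))"
          by (rule sum.cong[OF HOL.refl]) (use W lkC[OF i] in auto)
        then show "(\<Sum>c\<in>C. Y (k, l(i := c)) * wedge C (delta a) (delta b) (c, l i)) =
          (if l i = b then Y (k, l(i := a)) else 0) - (if l i = a then Y (k, l(i := b)) else 0)"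
          using fin(3) aC by (simp add: sum_subtractf)
      qed
      finally show ?thesis .
    qed
    have "?x \<in> X" using ab unfolding X by blast
    then have eq: "mm K ?x Y (k, l) = mm K Y ?x (k, l)" by (simp only: comm_Y)
    have upd: "k(i := c) \<in> K" "l(i := c) \<in> K" if "i \<in> {1..r}" "c \<in> C" for i c
      using lk that unfolding KC by (auto intro!: upd_in_PiE)
    have S: "(\<Sum>x\<in>pb_verts r. if \<kappa> x = a then y (\<kappa>(x := b)) else 0) =
       (\<Sum>i\<in>{1..r}. if l i = a then Y (k, l(i := b)) else 0) + (\<Sum>i\<in>{1..r}. if k i = a then Y (k(i := b), l) else 0)"
      if "b \<in> C" for a b
      unfolding sum_verts lk(3)
      by (intro arg_cong2[of _ _ _ _ "(+)"] sum.cong HOL.refl) (use that upd lk in \<open>auto simp: jnv updl yjn\<close>)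
    show "(\<Sum>x\<in>pb_verts r. if \<kappa> x = a then y (\<kappa>(x := b)) else 0) = (\<Sum>x\<in>pb_verts r. if \<kappa> x = b then y (\<kappa>(x := a)) else 0)"
      unfolding S[OF aC(1)] S[OF aC(2)] using eq unfolding left right sum_subtractf by (simp add: algebra_simps)
  next
    fix a \<kappa> assume a: "a \<in> {1..<n}" and \<kappa>: "\<kappa> \<in> pb_verts r \<rightarrow>\<^sub>E {0..<n}" and nz: "y \<kappa> \<noteq> 0"
    obtain l k where lk: "l \<in> K" "k \<in> K" "\<kappa> = join_col r l k"
      by (rule that[of "top_col r \<kappa>" "bot_col r \<kappa>"]) (simp_all only: K_def top_col_PiE[OF \<kappa>] join_col_top_col[OF \<kappa>])
    have KC: "K = {1..r} \<rightarrow>\<^sub>E C" by (simp add: K_def C_def)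
    let ?x = "tens_mat {1..r} C (\<lambda>_. refl_mat C (delta a))"
    define N where "N k = card {i \<in> {1..r}. k i = a}" for k :: "nat \<Rightarrow> nat"
    have R: "refl_mat C (delta a) (c, c') = (if c = c' then if c = a then - 1 else 1 else 0)" if "c \<in> C" "c' \<in> C" for c c'
      using that by (simp add: refl_mat_def mone_apply outer1_apply delta_def vscale_apply)
    have x: "?x (k, j) = (if k = j then (- 1) ^ N k else 0)" if kj: "k \<in> K" "j \<in> K" for k j
    proof -
      have kjC: "k i \<in> C" "j i \<in> C" if "i \<in> {1..r}" for i using kj that by (auto simp: KC PiE_iff)
      have e: "?x (k, j) = (\<Prod>i\<in>{1..r}. if k i = j i then if k i = a then - 1 else 1 else 0)"
        using kj unfolding KC by (simp only: tens_mat_apply) (intro prod.cong HOL.refl R kjC)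
      show ?thesis
      proof (cases "k = j")
        case True
        have "(\<Prod>i\<in>{1..r}. if k i = a then - 1 else (1::complex)) = (\<Prod>i\<in>{i \<in> {1..r}. k i = a}. - 1)"
          by (rule prod.inter_filter[symmetric]) simp
        then show ?thesis unfolding e using True by (simp add: N_def)
      next
        case False
        then obtain i where "i \<in> {1..r}" "k i \<noteq> j i" using kj unfolding KC by (meson PiE_ext)
        then show ?thesis unfolding e using False by (auto simp: prod_zero_iff)
      qed
    qed
    have "mm K ?x Y (k, l) = (\<Sum>j\<in>K. if j = k then (- 1) ^ N k * Y (k, l) else 0)"
      unfolding mm_apply[OF lk(2,1)] by (rule sum.cong[OF HOL.refl]) (use lk x in auto)
    moreover have "mm K Y ?x (k, l) = (\<Sum>j\<in>K. if j = l then Y (k, l) * (- 1) ^ N l else 0)"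
      unfolding mm_apply[OF lk(2,1)] by (rule sum.cong[OF HOL.refl]) (use lk x in auto)
    moreover have "mm K ?x Y (k, l) = mm K Y ?x (k, l)"
    proof -
      have "?x \<in> X" using a unfolding X by blast
      then show ?thesis by (simp only: comm_Y)
    qed
    ultimately have "(- 1) ^ N k * Y (k, l) = Y (k, l) * (- 1) ^ N l" using fin(2) lk by simp
    moreover have "Y (k, l) \<noteq> 0" using nz lk yjn by simp
    ultimately have "(- 1) ^ N k = ((- 1) ^ N l :: complex)" by simp
    then have "even (N k) = even (N l)" by (cases "even (N k)"; cases "even (N l)") auto
    moreover have "card {x \<in> pb_verts r. \<kappa> x = a} = N l + N k"
    proof -
      have "{x \<in> pb_verts r. \<kappa> x = a} = {i \<in> {1..r}. l i = a} <+> {i \<in> {1..r}. k i = a}"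
        unfolding lk(3) by (auto simp: join_col_def pb_verts_def)
      then show ?thesis by (simp add: card_Plus N_def)
    qed
    ultimately show "even (card {x \<in> pb_verts r. \<kappa> x = a})" by simp
  next
    fix d assume "d \<in> matchings (pb_verts r)"
    then have d: "d \<in> pb_diagrams r" by (simp add: pb_diagrams_matchings)
    have "0 = herm (K \<times> K) Y (diag_mat r n t d)" unfolding Y_def using orth d by (simp add: cfun.span_base)
    also have "\<dots> = (\<Sum>k\<in>K. \<Sum>l\<in>K. Y (k, l) * cnj (diag_mat r n t d (k, l)))"
      by (simp add: herm_def sum.cartesian_product case_prod_beta)
    also have "\<dots> = (\<Sum>l\<in>K. \<Sum>k\<in>K. Y (k, l) * cnj (diag_mat r n t d (k, l)))" by (rule sum.swap)
    also have "\<dots> = (\<Sum>l\<in>K. \<Sum>k\<in>K. cnj (t ^ n_single d) * (if compat d (join_col r l k) then y (join_col r l k) else 0))"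
      by (intro sum.cong HOL.refl) (auto simp: compat_join_col[OF d] yjn diag_mat_def K_def)
    also have "\<dots> = cnj (t ^ n_single d) * (\<Sum>\<kappa>\<in>pb_verts r \<rightarrow>\<^sub>E {0..<n}. if compat d \<kappa> then y \<kappa> else 0)"
      unfolding sum_pb_verts K_def sum_distrib_left ..
    finally show "(\<Sum>\<kappa>\<in>pb_verts r \<rightarrow>\<^sub>E {0..<n}. if compat d \<kappa> then y \<kappa> else 0) = 0"
      using t by auto
  qed
  then have "Y (k, l) = 0" if "k \<in> K" "l \<in> K" for k l
    using yjn[OF that(2,1)] join_col_PiE[of l r C k] that by (simp add: K_def C_def)
  then have "Y = 0" by (intro mats_eqI[OF Ym mats_closed(4)]) auto
  then show ?thesis using p by (simp add: Y_def)
qed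

section \<open>Orthogonal matrices commute with diagrams\<close>

text \<open>An edge contributes \<open>g g\<^sup>T = 1\<close> and an isolated vertex the column of \<open>g\<close>
  fixed by it, so the blocks can be summed out one after the other.\<close>

lemma orthogonal_invariance:
  assumes J: "finite J" and n: "n \<ge> 1" and d: "d \<in> matchings J"
    and g: "\<And>a b. a < n \<Longrightarrow> b < n \<Longrightarrow> (\<Sum>c\<in>{0..<n}. g (a, c) * g (b, c)) = (if a = b then 1 else 0)"
    and g0: "\<And>a. a < n \<Longrightarrow> g (a, 0) = (if a = 0 then 1 else (0::complex))"
    and \<kappa>: "\<And>x. x \<in> J \<Longrightarrow> \<kappa> x < n"
  shows "(\<Sum>\<mu>\<in>J \<rightarrow>\<^sub>E {0..<n}. if compat d \<mu> then \<Prod>x\<in>J. g (\<kappa> x, \<mu> x) else 0) = (if compat d \<kappa> then 1 else 0)"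
  using J d \<kappa>
proof (induction "card J" arbitrary: J d rule: less_induct)
  case less
  note J = less.prems(1) and d = less.prems(2)
  let ?C = "{0..<n}"
  show ?case
  proof (cases "J = {}")
    case True
    then have "d = {}" using d by (auto simp: matchings_def partition_on_def)
    then show ?thesis using True by (simp add: compat_def)
  next
    case False
    then obtain x where x: "x \<in> J" by blast
    from matching_single_or_pair[OF d J x] show ?thesis
    proof
      assume b: "{x} \<in> d"
      let ?d = "d - {{x}}" and ?J = "J - {x}"
      have sp: "?d \<in> matchings ?J" "insert {x} ?d = d" using split_blocks[OF d, of "{{x}}"] b by auto
      have U: "\<Union>?d = ?J" using sp(1) by (simp add: matchings_def partition_on_def)
      have IH: "(\<Sum>\<mu>\<in>?J \<rightarrow>\<^sub>E ?C. if compat ?d \<mu> then \<Prod>z\<in>?J. g (\<kappa> z, \<mu> z) else 0) = (if compat ?d \<kappa> then 1 else 0)"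
        using less.prems x by (intro less.hyps sp psubset_card_mono) auto
      have c: "compat d (\<mu>(x := c)) \<longleftrightarrow> c = 0 \<and> compat ?d \<mu>" for \<mu> c
      proof -
        have "compat ?d (\<mu>(x := c)) = compat ?d \<mu>" by (rule compat_cong) (use U in auto)
        then show ?thesis using compat_single[of x ?d "\<mu>(x := c)"] unfolding sp(2) by simp
      qed
      have p: "(\<Prod>z\<in>J. g (\<kappa> z, (\<mu>(x := c)) z)) = g (\<kappa> x, c) * (\<Prod>z\<in>?J. g (\<kappa> z, \<mu> z))" for \<mu> c
        by (subst prod.remove[OF J x]) (auto intro!: prod.cong)
      have "(\<Sum>\<mu>\<in>J \<rightarrow>\<^sub>E ?C. if compat d \<mu> then \<Prod>z\<in>J. g (\<kappa> z, \<mu> z) else 0) =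
        (\<Sum>\<mu>\<in>?J \<rightarrow>\<^sub>E ?C. \<Sum>c\<in>?C. if c = 0 then if compat ?d \<mu> then g (\<kappa> x, 0) * (\<Prod>z\<in>?J. g (\<kappa> z, \<mu> z)) else 0 else 0)"
        unfolding sum_PiE_split'[OF x] c p by (intro sum.cong HOL.refl) auto
      also have "\<dots> = (\<Sum>\<mu>\<in>?J \<rightarrow>\<^sub>E ?C. g (\<kappa> x, 0) * (if compat ?d \<mu> then \<Prod>z\<in>?J. g (\<kappa> z, \<mu> z) else 0))"
        using n by (intro sum.cong HOL.refl) simp
      also have "\<dots> = g (\<kappa> x, 0) * (if compat ?d \<kappa> then 1 else 0)"
        unfolding sum_distrib_left[symmetric] IH ..
      also have "\<dots> = (if compat d \<kappa> then 1 else 0)"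
        using g0 less.prems(3)[OF x] compat_single[of x ?d \<kappa>] unfolding sp(2) by auto
      finally show ?thesis .
    next
      assume "\<exists>y. y \<noteq> x \<and> y \<in> J \<and> {x, y} \<in> d"
      then obtain y where y: "y \<noteq> x" "y \<in> J" "{x, y} \<in> d" by blast
      let ?d = "d - {{x, y}}" and ?J = "J - {x, y}"
      have sp: "?d \<in> matchings ?J" "insert {x, y} ?d = d" using split_blocks[OF d, of "{{x, y}}"] y by auto
      have U: "\<Union>?d = ?J" using sp(1) by (simp add: matchings_def partition_on_def)
      have IH: "(\<Sum>\<mu>\<in>?J \<rightarrow>\<^sub>E ?C. if compat ?d \<mu> then \<Prod>z\<in>?J. g (\<kappa> z, \<mu> z) else 0) = (if compat ?d \<kappa> then 1 else 0)"
        using less.prems x by (intro less.hyps sp psubset_card_mono) auto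
      have c: "compat d (\<mu>(y := c', x := c)) \<longleftrightarrow> c = c' \<and> compat ?d \<mu>" for \<mu> c c'
      proof -
        have "compat ?d (\<mu>(y := c', x := c)) = compat ?d \<mu>" by (rule compat_cong) (use U in auto)
        then show ?thesis using compat_pair[OF y(1)[symmetric], of ?d "\<mu>(y := c', x := c)"] y(1) unfolding sp(2) by auto
      qed
      have yJ: "y \<in> J - {x}" using y by simp
      have JJ: "J - {x} - {y} = ?J" by auto
      have p: "(\<Prod>z\<in>J. g (\<kappa> z, (\<mu>(y := c', x := c)) z)) = g (\<kappa> x, c) * g (\<kappa> y, c') * (\<Prod>z\<in>?J. g (\<kappa> z, \<mu> z))" for \<mu> c c'
      proof -
        have "(\<Prod>z\<in>J. g (\<kappa> z, (\<mu>(y := c', x := c)) z)) = g (\<kappa> x, c) * (\<Prod>z\<in>J - {x}. g (\<kappa> z, (\<mu>(y := c', x := c)) z))"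
          by (subst prod.remove[OF J x]) simp
        also have "(\<Prod>z\<in>J - {x}. g (\<kappa> z, (\<mu>(y := c', x := c)) z)) = g (\<kappa> y, c') * (\<Prod>z\<in>?J. g (\<kappa> z, (\<mu>(y := c', x := c)) z))"
          using J y by (subst prod.remove[OF _ yJ]) (simp_all add: JJ)
        also have "(\<Prod>z\<in>?J. g (\<kappa> z, (\<mu>(y := c', x := c)) z)) = (\<Prod>z\<in>?J. g (\<kappa> z, \<mu> z))"
          by (rule prod.cong) auto
        finally show ?thesis by (simp only: mult_ac)
      qed
      have "(\<Sum>\<mu>\<in>J \<rightarrow>\<^sub>E ?C. if compat d \<mu> then \<Prod>z\<in>J. g (\<kappa> z, \<mu> z) else 0) =
        (\<Sum>c\<in>?C. \<Sum>c'\<in>?C. \<Sum>\<mu>\<in>?J \<rightarrow>\<^sub>E ?C. if c = c' \<and> compat ?d \<mu> then g (\<kappa> x, c) * g (\<kappa> y, c') * (\<Prod>z\<in>?J. g (\<kappa> z, \<mu> z)) else 0)"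
        unfolding sum_PiE_split[OF x] sum_PiE_split[OF yJ] JJ c p ..
      also have "\<dots> = (\<Sum>c\<in>?C. \<Sum>c'\<in>?C. if c = c' then g (\<kappa> x, c) * g (\<kappa> y, c) * (if compat ?d \<kappa> then 1 else 0) else 0)"
      proof (intro sum.cong HOL.refl)
        fix c c'
        have "(\<Sum>\<mu>\<in>?J \<rightarrow>\<^sub>E ?C. if c = c' \<and> compat ?d \<mu> then g (\<kappa> x, c) * g (\<kappa> y, c') * (\<Prod>z\<in>?J. g (\<kappa> z, \<mu> z)) else 0) =
          (\<Sum>\<mu>\<in>?J \<rightarrow>\<^sub>E ?C. (if c = c' then g (\<kappa> x, c) * g (\<kappa> y, c) else 0) * (if compat ?d \<mu> then \<Prod>z\<in>?J. g (\<kappa> z, \<mu> z) else 0))"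
          by (intro sum.cong HOL.refl) auto
        also have "\<dots> = (if c = c' then g (\<kappa> x, c) * g (\<kappa> y, c) else 0) * (if compat ?d \<kappa> then 1 else 0)"
          unfolding sum_distrib_left[symmetric] IH ..
        finally show "(\<Sum>\<mu>\<in>?J \<rightarrow>\<^sub>E ?C. if c = c' \<and> compat ?d \<mu> then g (\<kappa> x, c) * g (\<kappa> y, c') * (\<Prod>z\<in>?J. g (\<kappa> z, \<mu> z)) else 0) =
          (if c = c' then g (\<kappa> x, c) * g (\<kappa> y, c) * (if compat ?d \<kappa> then 1 else 0) else 0)" by simp
      qed
      also have "\<dots> = (\<Sum>c\<in>?C. g (\<kappa> x, c) * g (\<kappa> y, c)) * (if compat ?d \<kappa> then 1 else 0)"
        unfolding sum_distrib_right by (intro sum.cong HOL.refl) simp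
      also have "\<dots> = (if compat d \<kappa> then 1 else 0)"
        using g[of "\<kappa> x" "\<kappa> y"] less.prems(3) x y compat_pair[OF y(1)[symmetric], of ?d \<kappa>] unfolding sp(2) by simp
      finally show ?thesis .
    qed
  qed
qed

text \<open>A reflection is symmetric and its own inverse, so commuting with its tensor power \<open>G\<close> means
  \<open>G d G = d\<close>. That is the invariance of the tensor of \<open>d\<close> under an orthogonal
  matrix fixing the first basis vector.\<close>

lemma reflection_commutes_diagram:
  fixes r n :: nat
  defines "C \<equiv> {0..<n}" and "K \<equiv> {1..r} \<rightarrow>\<^sub>E {0..<n}"
  assumes n: "n \<ge> 1" and w: "ip C w w = 1" "w 0 = 0" and d: "d \<in> pb_diagrams r"
  shows "mm K (tens_mat {1..r} C (\<lambda>_. refl_mat C w)) (diag_mat r n t d) = mm K (diag_mat r n t d) (tens_mat {1..r} C (\<lambda>_. refl_mat C w))"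
proof -
  let ?G = "tens_mat {1..r} C (\<lambda>_. refl_mat C w)" and ?g = "refl_mat C w"
  have fC: "finite C" by (simp add: C_def)
  have KC: "K = {1..r} \<rightarrow>\<^sub>E C" by (simp add: K_def C_def)
  have fK: "finite K" by (simp add: K_def finite_PiE)
  have sym: "?g (a, b) = ?g (b, a)" for a b
    by (auto simp: refl_mat_def mone_def outer1_def vscale_def)
  have g: "(\<Sum>c\<in>{0..<n}. ?g (a, c) * ?g (b, c)) = (if a = b then 1 else 0)" if "a < n" "b < n" for a b
  proof -
    have ab: "a \<in> C" "b \<in> C" using that by (auto simp: C_def)
    have "(\<Sum>c\<in>C. ?g (a, c) * ?g (b, c)) = mm C ?g ?g (a, b)"
      unfolding mm_apply[OF ab] by (intro sum.cong HOL.refl) (simp add: sym[of b])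
    then show ?thesis using refl_mat_refl_mat[OF fC w(1)] ab by (simp add: mone_apply C_def)
  qed
  have g0: "?g (a, 0) = (if a = 0 then 1 else 0)" if "a < n" for a
    using that w(2) n by (auto simp: refl_mat_def mone_apply outer1_apply vscale_apply C_def)
  have GG: "mm K ?G ?G = mone K"
    unfolding KC by (simp add: tens_mat_mm fC refl_mat_refl_mat[OF fC w(1)] tens_mat_one)
  have "mm K (mm K ?G (diag_mat r n t d)) ?G = diag_mat r n t d"
  proof (rule mats_eqI[of _ K])
    fix k l assume kl: "k \<in> K" "l \<in> K"
    have "mm K (mm K ?G (diag_mat r n t d)) ?G (k, l) = (\<Sum>m\<in>K. \<Sum>j\<in>K. ?G (k, j) * diag_mat r n t d (j, m) * ?G (m, l))"
      using kl by (simp add: mm_apply sum_distrib_right)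
    also have "\<dots> = (\<Sum>m\<in>K. \<Sum>j\<in>K. t ^ n_single d *
       (if compat d (join_col r m j) then \<Prod>x\<in>pb_verts r. ?g (join_col r l k x, join_col r m j x) else 0))"
    proof (intro sum.cong HOL.refl)
      fix m j assume mj: "m \<in> K" "j \<in> K"
      have "(\<Prod>x\<in>pb_verts r. ?g (join_col r l k x, join_col r m j x)) = (\<Prod>i\<in>{1..r}. ?g (l i, m i)) * (\<Prod>i\<in>{1..r}. ?g (k i, j i))"
        unfolding prod_verts by (intro arg_cong2[of _ _ _ _ "(*)"] prod.cong HOL.refl) (simp_all add: join_col_def vert_iff)
      also have "\<dots> = ?G (m, l) * ?G (k, j)"
        using kl mj unfolding KC by (simp add: tens_mat_apply sym[of "l _"])
      finally show "?G (k, j) * diag_mat r n t d (j, m) * ?G (m, l) = t ^ n_single d *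
         (if compat d (join_col r m j) then \<Prod>x\<in>pb_verts r. ?g (join_col r l k x, join_col r m j x) else 0)"
        using mj by (simp add: compat_join_col[OF d] diag_mat_def K_def mult_ac)
    qed
    also have "\<dots> = t ^ n_single d * (\<Sum>\<mu>\<in>pb_verts r \<rightarrow>\<^sub>E {0..<n}. if compat d \<mu> then \<Prod>x\<in>pb_verts r. ?g (join_col r l k x, \<mu> x) else 0)"
      unfolding sum_pb_verts K_def sum_distrib_left ..
    also have "\<dots> = t ^ n_single d * (if compat d (join_col r l k) then 1 else 0)"
    proof (subst orthogonal_invariance[OF finite_pb_verts n _ g g0])
      show "d \<in> matchings (pb_verts r)" using d by (simp add: pb_diagrams_matchings)
      show "join_col r l k x < n" if "x \<in> pb_verts r" for x
        using PiE_mem[OF join_col_PiE[of l r "{0..<n}" k] that] kl by (simp add: K_def)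
    qed simp_all
    also have "\<dots> = diag_mat r n t d (k, l)" using kl by (simp add: compat_join_col[OF d] diag_mat_def K_def)
    finally show "mm K (mm K ?G (diag_mat r n t d)) ?G (k, l) = diag_mat r n t d (k, l)" .
  qed (rule mm_mats, simp only: K_def diag_mat_mats)
  then have "mm K (mm K (mm K ?G (diag_mat r n t d)) ?G) ?G = mm K (diag_mat r n t d) ?G" by simp
  moreover have "diag_mat r n t d \<in> mats K" unfolding K_def by (rule diag_mat_mats)
  ultimately show ?thesis
    by (simp only: mm_assoc GG mm_one(2)[OF fK])
qed

section \<open>Linear dependencies between diagram matrices\<close>

text \<open>Evaluate a relation at the canonical colouring of a diagram \<open>e\<close> with the largest number of
  edges among those that occur: any other diagram with a nonzero entry there has more edges.\<close>

lemma diag_mat_independent: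
  assumes n: "n > r" and t: "t \<noteq> 0" and a: "(\<Sum>d\<in>pb_diagrams r. a d *\<^sub>v diag_mat r n t d) = 0" and d: "d \<in> pb_diagrams r"
  shows "a d = 0"
proof (rule ccontr)
  assume "a d \<noteq> 0"
  then have ne: "{d \<in> pb_diagrams r. a d \<noteq> 0} \<noteq> {}" using d by blast
  have fin: "finite {d \<in> pb_diagrams r. a d \<noteq> 0}" using finite_pb_diagrams by simp
  obtain e where e: "e \<in> {d \<in> pb_diagrams r. a d \<noteq> 0}"
    and max: "\<And>d. d \<in> {d \<in> pb_diagrams r. a d \<noteq> 0} \<Longrightarrow> card (pb_edges d) \<le> card (pb_edges e)"
  proof -
    let ?A = "{d \<in> pb_diagrams r. a d \<noteq> 0}"
    have "Max ((\<lambda>d. card (pb_edges d)) ` ?A) \<in> (\<lambda>d. card (pb_edges d)) ` ?A"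
      using fin ne by (intro Max_in) auto
    then obtain e where e: "e \<in> ?A" "Max ((\<lambda>d. card (pb_edges d)) ` ?A) = card (pb_edges e)" by blast
    have "card (pb_edges d) \<le> card (pb_edges e)" if "d \<in> ?A" for d
      unfolding e(2)[symmetric] using fin that by (intro Max_ge) auto
    then show ?thesis using that e(1) by blast
  qed
  have e': "e \<in> pb_diagrams r" "a e \<noteq> 0" using e by auto
  obtain l k where lk: "l \<in> {1..r} \<rightarrow>\<^sub>E {0..<n}" "k \<in> {1..r} \<rightarrow>\<^sub>E {0..<n}" "compat e (case_sum l k)"
    and sub: "\<And>d'. d' \<in> pb_diagrams r \<Longrightarrow> compat d' (case_sum l k) \<Longrightarrow> pb_edges e \<subseteq> pb_edges d'"
    by (rule canonical_coloring[OF e'(1) n]) blast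
  have "a d * diag_mat r n t d (k, l) = 0" if d: "d \<in> pb_diagrams r" "d \<noteq> e" for d
  proof (rule ccontr)
    assume nz: "a d * diag_mat r n t d (k, l) \<noteq> 0"
    then have c: "compat d (case_sum l k)" and ad: "a d \<noteq> 0" by (auto simp: diag_mat_def split: if_splits)
    have "pb_edges d \<subseteq> pb_verts r \<times> pb_verts r" using pb_edges_pmatch(1)[OF d(1)] by (simp add: pmatch_def)
    then have "finite (pb_edges d)" by (rule finite_subset) simp
    moreover have "card (pb_edges d) \<le> card (pb_edges e)" using max[of d] d(1) ad by blast
    ultimately have "pb_edges e = pb_edges d" using sub[OF d(1) c] by (simp add: card_seteq)
    then show False using diagram_eq_edges[OF d(1) e'(1)] d(2) by simp
  qed
  then have "(\<Sum>d\<in>pb_diagrams r. a d * diag_mat r n t d (k, l)) = (\<Sum>d\<in>pb_diagrams r. if d = e then a e * diag_mat r n t e (k, l) else 0)"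
    by (intro sum.cong HOL.refl) auto
  also have "\<dots> = a e * diag_mat r n t e (k, l)" using finite_pb_diagrams e' by simp
  also have "\<dots> = a e * t ^ n_single e" using lk by (simp add: diag_mat_def)
  also have "(\<Sum>d\<in>pb_diagrams r. a d * diag_mat r n t d (k, l)) = (\<Sum>d\<in>pb_diagrams r. a d *\<^sub>v diag_mat r n t d) (k, l)"
    by (simp add: sum_apply vscale_apply)
  finally show False using a e' t by simp
qed

text \<open>The diagram of a permutation with the strands that start in \<open>S\<close> cut in two.\<close>

definition cut_perm_diag :: "nat \<Rightarrow> (nat \<Rightarrow> nat) \<Rightarrow> nat set \<Rightarrow> diagram" where
  "cut_perm_diag r \<sigma> S = (\<lambda>i. {Inl i, Inr (\<sigma> i)}) ` ({1..r} - S) \<union> ((\<lambda>i. {Inl i}) ` S \<union> (\<lambda>i. {Inr (\<sigma> i)}) ` S)"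

lemma compat_cut_perm_diag: "compat (cut_perm_diag r \<sigma> S) (case_sum l k) \<longleftrightarrow>
    (\<forall>i\<in>{1..r} - S. l i = k (\<sigma> i)) \<and> (\<forall>i\<in>S. l i = 0 \<and> k (\<sigma> i) = 0)"
  unfolding cut_perm_diag_def compat_union by (auto simp: compat_def)

lemma cut_perm_diag_diagram:
  assumes \<sigma>: "\<sigma> permutes {1..r}" and S: "S \<subseteq> {1..r}"
  shows "cut_perm_diag r \<sigma> S \<in> pb_diagrams r" "n_single (cut_perm_diag r \<sigma> S) = 2 * card S"
proof -
  have inj: "\<sigma> i = \<sigma> j \<longleftrightarrow> i = j" for i j using permutes_inj[OF \<sigma>] by (auto simp: inj_def)
  have im: "\<sigma> ` {1..r} = {1..r}" using \<sigma> by (rule permutes_image)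
  have in_r: "\<sigma> i \<in> {1..r}" if "i \<in> {1..r}" for i using im that by blast
  have "\<Union>(cut_perm_diag r \<sigma> S) = pb_verts r"
  proof (intro equalityI subsetI)
    fix x assume x: "x \<in> pb_verts r"
    show "x \<in> \<Union>(cut_perm_diag r \<sigma> S)"
    proof (cases x)
      case (Inl i)
      then show ?thesis using x by (cases "i \<in> S") (auto simp: cut_perm_diag_def vert_iff)
    next
      case (Inr a)
      then have "a \<in> \<sigma> ` {1..r}" using x unfolding im by (simp add: vert_iff)
      then obtain i where "i \<in> {1..r}" "a = \<sigma> i" by blast
      then show ?thesis using Inr by (cases "i \<in> S") (auto simp: cut_perm_diag_def)
    qed
  next
    fix x assume "x \<in> \<Union>(cut_perm_diag r \<sigma> S)"
    then obtain i where "i \<in> {1..r}" "x = Inl i \<or> x = Inr (\<sigma> i)" using S by (auto simp: cut_perm_diag_def)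
    then show "x \<in> pb_verts r" using in_r vert_iff by blast
  qed
  moreover have "disjoint (cut_perm_diag r \<sigma> S)" by (auto simp: disjoint_def cut_perm_diag_def inj)
  moreover have "card b \<le> 2" if "b \<in> cut_perm_diag r \<sigma> S" for b using that by (auto simp: cut_perm_diag_def card_insert_if)
  ultimately show "cut_perm_diag r \<sigma> S \<in> pb_diagrams r" by (auto simp: pb_diagrams_def partition_on_def cut_perm_diag_def)
  have "{x. {x} \<in> cut_perm_diag r \<sigma> S} = Inl ` S \<union> Inr ` \<sigma> ` S"
    by (auto simp: cut_perm_diag_def doubleton_eq_iff)
  moreover have "card (Inl ` S \<union> Inr ` \<sigma> ` S :: (nat + nat) set) = card (Inl ` S :: (nat + nat) set) + card (Inr ` \<sigma> ` S :: (nat + nat) set)"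
    using S finite_subset by (intro card_Un_disjoint) auto
  moreover have "card (Inr ` \<sigma> ` S :: (nat + nat) set) = card S" "card (Inl ` S :: (nat + nat) set) = card S"
    using permutes_inj[OF \<sigma>] by (simp_all add: card_image inj_on_subset)
  ultimately show "n_single (cut_perm_diag r \<sigma> S) = 2 * card S" by (simp add: n_single_def)
qed

lemma cut_perm_diag_one:
  assumes \<sigma>: "\<sigma> permutes A" "A \<subseteq> {1..r}" and S: "S \<subseteq> A" and eq: "cut_perm_diag r \<sigma> S = strands {1..r}"
  shows "\<sigma> = id" "S = {}"
proof -
  show S0: "S = {}"
  proof (rule ccontr)
    assume "S \<noteq> {}"
    then obtain i where "i \<in> S" by blast
    then have "{Inl i} \<in> strands {1..r}" unfolding eq[symmetric] by (auto simp: cut_perm_diag_def)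
    then show False by (auto simp: strands_def)
  qed
  show "\<sigma> = id"
  proof
    fix i show "\<sigma> i = id i"
    proof (cases "i \<in> A")
      case True
      then have "{Inl i, Inr (\<sigma> i)} \<in> strands {1..r}" unfolding eq[symmetric] using S0 \<sigma>(2) by (auto simp: cut_perm_diag_def)
      then show ?thesis by (auto simp: strands_def doubleton_eq_iff)
    qed (use \<sigma>(1) in \<open>simp add: permutes_def\<close>)
  qed
qed

text \<open>Row \<open>0\<close> of \<open>h\<close> vanishes, so effectively \<open>n\<close> positions share \<open>n
  - 1\<close> colours; two positions agree and their transposition changes the sign.\<close>

lemma antisymmetrizer_vanishes:
  fixes h :: "nat \<Rightarrow> nat \<Rightarrow> complex"
  assumes n: "n \<ge> 1" and l: "\<And>i. i \<in> {1..n} \<Longrightarrow> l i < n"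
    and h: "\<And>b. h 0 b = 0"
  shows "(\<Sum>\<sigma>\<in>{\<sigma>. \<sigma> permutes {1..n}}. of_int (sign \<sigma>) * (\<Prod>i\<in>{1..n}. h (l i) (k (\<sigma> i)))) = 0"
proof (cases "\<exists>i\<in>{1..n}. l i = 0")
  case True
  then have "(\<Prod>i\<in>{1..n}. h (l i) (k (\<sigma> i))) = 0" for \<sigma> using h by (force simp: prod_zero_iff)
  then show ?thesis by (simp only: mult_zero_right sum.neutral_const)
next
  case False
  have "\<not> inj_on l {1..n}"
  proof
    assume "inj_on l {1..n}"
    moreover have "l ` {1..n} \<subseteq> {1..<n}" using l False by (force simp: Suc_le_eq)
    ultimately have "card {1..n} \<le> card {1..<n}" by (intro card_inj_on_le) auto
    then show False using n by simp
  qed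
  then obtain i j where ij: "i \<in> {1..n}" "j \<in> {1..n}" "i \<noteq> j" "l i = l j" by (auto simp: inj_on_def)
  let ?f = "\<lambda>\<sigma>. of_int (sign \<sigma>) * (\<Prod>i\<in>{1..n}. h (l i) (k (\<sigma> i)))" and ?t = "transpose i j"
  have tp: "?t permutes {1..n}" using ij by (intro permutes_swap_id)
  have lt: "l (?t x) = l x" for x using ij by (auto simp: transpose_def)
  have "sum ?f {\<sigma>. \<sigma> permutes {1..n}} = sum (\<lambda>\<sigma>. ?f (\<sigma> \<circ> ?t)) {\<sigma>. \<sigma> permutes {1..n}}"
    by (rule sum_permutations_compose_right[OF tp])
  also have "\<dots> = sum (\<lambda>\<sigma>. - ?f \<sigma>) {\<sigma>. \<sigma> permutes {1..n}}"
  proof (rule sum.cong[OF HOL.refl])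
    fix \<sigma> assume "\<sigma> \<in> {\<sigma>. \<sigma> permutes {1..n}}"
    then have "permutation \<sigma>" unfolding permutation_permutes by blast
    then have sg: "sign (\<sigma> \<circ> ?t) = - sign \<sigma>" using ij by (simp add: sign_compose permutation_swap_id sign_swap_id)
    have "(\<Prod>x\<in>{1..n}. h (l x) (k ((\<sigma> \<circ> ?t) x))) = (\<Prod>x\<in>{1..n}. h (l (?t x)) (k (\<sigma> (?t x))))"
      by (simp add: lt)
    also have "\<dots> = (\<Prod>x\<in>{1..n}. h (l x) (k (\<sigma> x)))"
      using prod.permute[OF tp, of "\<lambda>x. h (l x) (k (\<sigma> x))"] by (simp add: comp_def)
    finally show "?f (\<sigma> \<circ> ?t) = - ?f \<sigma>" by (simp only: sg) simp
  qed
  also have "\<dots> = - sum ?f {\<sigma>. \<sigma> permutes {1..n}}" by (rule sum_negf)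
  finally show ?thesis by simp
qed

text \<open>Project each of \<open>n\<close> strands to the hyperplane of dimension \<open>n - 1\<close>, by subtracting
  the cut strand, and antisymmetrise. The result is zero as an operator, yet multiplied out it is a
  combination of diagrams in which the identity diagram has coefficient \<open>1\<close>.\<close>

lemma diag_mat_dependent:
  assumes n: "1 \<le> n" "n \<le> r" and t: "t \<noteq> 0"
  obtains a where "(\<Sum>d\<in>pb_diagrams r. a d *\<^sub>v diag_mat r n t d) = 0" "a (strands {1..r}) = 1"
proof -
  let ?P = "{\<sigma>. \<sigma> permutes {1..n}}" and ?S = "Pow {1..n}"
  have finP: "finite ?P" by (simp add: finite_permutations)
  have perm: "\<sigma> permutes {1..r}" if "\<sigma> \<in> ?P" for \<sigma> using that n by (auto intro: permutes_subset)
  define co where "co \<sigma> S = of_int (sign \<sigma>) * (- 1) ^ card S / t ^ (2 * card S)" for \<sigma> :: "nat \<Rightarrow> nat" and S :: "nat set"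
  \<comment> \<open>The factor \<open>t ^ (2 * card S)\<close> in the denominator of \<open>co\<close> compensates the weight of the isolated vertices.\<close>
  define a where "a d = (\<Sum>\<sigma>\<in>?P. \<Sum>S\<in>?S. if d = cut_perm_diag r \<sigma> S then co \<sigma> S else 0)" for d
  have dia: "cut_perm_diag r \<sigma> S \<in> pb_diagrams r" "n_single (cut_perm_diag r \<sigma> S) = 2 * card S" if "\<sigma> \<in> ?P" "S \<in> ?S" for \<sigma> S
  proof -
    have "S \<subseteq> {1..r}" using that(2) atLeastatMost_subset_iff[of 1 n 1 r] n by blast
    then show "cut_perm_diag r \<sigma> S \<in> pb_diagrams r" "n_single (cut_perm_diag r \<sigma> S) = 2 * card S"
      using cut_perm_diag_diagram[OF perm[OF that(1)], of S] by blast+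
  qed
  have "a (strands {1..r}) = (\<Sum>\<sigma>\<in>?P. \<Sum>S\<in>?S. if \<sigma> = id then if S = {} then 1 else 0 else 0)"
    unfolding a_def
  proof (intro sum.cong HOL.refl)
    fix \<sigma> S assume s: "\<sigma> \<in> ?P" "S \<in> ?S"
    have A: "{1..n} \<subseteq> {1..r}" using n by auto
    have "strands {1..r} = cut_perm_diag r id {}" by (simp add: cut_perm_diag_def strands_def)
    then have "strands {1..r} = cut_perm_diag r \<sigma> S \<longleftrightarrow> \<sigma> = id \<and> S = {}"
      using cut_perm_diag_one[of \<sigma> "{1..n}" r S] s A by auto
    then show "(if strands {1..r} = cut_perm_diag r \<sigma> S then co \<sigma> S else 0) = (if \<sigma> = id then if S = {} then 1 else 0 else 0)"
      by (auto simp: co_def sign_id)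
  qed
  also have "\<dots> = (\<Sum>\<sigma>\<in>?P. if \<sigma> = id then 1 else 0)"
    by (intro sum.cong HOL.refl) simp
  also have "\<dots> = 1" using finP by (simp add: permutes_id)
  finally have one: "a (strands {1..r}) = 1" .
  have "(\<Sum>d\<in>pb_diagrams r. a d *\<^sub>v diag_mat r n t d) = 0"
  proof (rule mats_eqI[of _ "{1..r} \<rightarrow>\<^sub>E {0..<n}"])
    fix k l assume kl: "k \<in> {1..r} \<rightarrow>\<^sub>E {0..<n}" "l \<in> {1..r} \<rightarrow>\<^sub>E {0..<n}"
    let ?M = "\<lambda>d. diag_mat r n t d (k, l)"
    \<comment> \<open>The identity minus the projection onto colour \<open>0\<close>.\<close>
    define h where "h a b = (if a = b then 1 else 0) + (if a = 0 \<and> b = 0 then - 1 else (0::complex))" for a b :: nat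
    have "(\<Sum>d\<in>pb_diagrams r. a d *\<^sub>v diag_mat r n t d) (k, l) =
      (\<Sum>d\<in>pb_diagrams r. \<Sum>\<sigma>\<in>?P. \<Sum>S\<in>?S. if d = cut_perm_diag r \<sigma> S then co \<sigma> S * ?M (cut_perm_diag r \<sigma> S) else 0)"
      by (auto simp: sum_apply vscale_apply a_def sum_distrib_right intro!: sum.cong)
    also have "\<dots> = (\<Sum>\<sigma>\<in>?P. \<Sum>d\<in>pb_diagrams r. \<Sum>S\<in>?S. if d = cut_perm_diag r \<sigma> S then co \<sigma> S * ?M (cut_perm_diag r \<sigma> S) else 0)"
      by (rule sum.swap)
    also have "\<dots> = (\<Sum>\<sigma>\<in>?P. \<Sum>S\<in>?S. \<Sum>d\<in>pb_diagrams r. if d = cut_perm_diag r \<sigma> S then co \<sigma> S * ?M (cut_perm_diag r \<sigma> S) else 0)"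
      by (intro sum.cong HOL.refl sum.swap)
    also have "\<dots> = (\<Sum>\<sigma>\<in>?P. \<Sum>S\<in>?S. co \<sigma> S * ?M (cut_perm_diag r \<sigma> S))"
      using dia by (intro sum.cong HOL.refl) (simp add: finite_pb_diagrams)
    also have "\<dots> = (\<Sum>\<sigma>\<in>?P. of_int (sign \<sigma>) * (\<Prod>i\<in>{1..n}. h (l i) (k (\<sigma> i))) * (if \<forall>i\<in>{1..r} - {1..n}. l i = k i then 1 else 0))"
    proof (rule sum.cong[OF HOL.refl])
      fix \<sigma> assume \<sigma>: "\<sigma> \<in> ?P"
      have \<sigma>i: "\<sigma> i = i" if "i \<notin> {1..n}" for i using \<sigma> that by (simp add: permutes_def)
      have "(\<Sum>S\<in>?S. co \<sigma> S * ?M (cut_perm_diag r \<sigma> S)) =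
        (\<Sum>S\<in>?S. of_int (sign \<sigma>) * ((\<Prod>i\<in>S. if l i = 0 \<and> k (\<sigma> i) = 0 then - 1 else 0) * (\<Prod>i\<in>{1..n} - S. if l i = k (\<sigma> i) then 1 else 0)) *
           (if \<forall>i\<in>{1..r} - {1..n}. l i = k i then 1 else 0))"
      proof (rule sum.cong[OF HOL.refl])
        fix S assume S: "S \<in> ?S"
        then have fS: "finite S" using finite_subset by auto
        have 1: "(\<Prod>i\<in>S. if l i = 0 \<and> k (\<sigma> i) = 0 then - 1 else 0) = (if \<forall>i\<in>S. l i = 0 \<and> k (\<sigma> i) = 0 then (- 1) ^ card S else (0::complex))"
          using fS by (auto simp: prod_zero_iff)
        have 2: "(\<Prod>i\<in>{1..n} - S. if l i = k (\<sigma> i) then 1 else 0) = (if \<forall>i\<in>{1..n} - S. l i = k (\<sigma> i) then 1 else (0::complex))"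
          by (auto simp: prod_zero_iff)
        have un: "{1..r} - S = ({1..n} - S) \<union> ({1..r} - {1..n})" using S n by auto
        have "compat (cut_perm_diag r \<sigma> S) (case_sum l k) \<longleftrightarrow>
          (\<forall>i\<in>S. l i = 0 \<and> k (\<sigma> i) = 0) \<and> (\<forall>i\<in>{1..n} - S. l i = k (\<sigma> i)) \<and> (\<forall>i\<in>{1..r} - {1..n}. l i = k i)"
          unfolding compat_cut_perm_diag un ball_Un using \<sigma>i by auto
        then have "?M (cut_perm_diag r \<sigma> S) = (if (\<forall>i\<in>S. l i = 0 \<and> k (\<sigma> i) = 0) \<and> (\<forall>i\<in>{1..n} - S. l i = k (\<sigma> i)) \<and> (\<forall>i\<in>{1..r} - {1..n}. l i = k i)
            then t ^ (2 * card S) else 0)"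
          using kl dia(2)[OF \<sigma> S] by (simp add: diag_mat_def)
        then show "co \<sigma> S * ?M (cut_perm_diag r \<sigma> S) = of_int (sign \<sigma>) * ((\<Prod>i\<in>S. if l i = 0 \<and> k (\<sigma> i) = 0 then - 1 else 0) * (\<Prod>i\<in>{1..n} - S. if l i = k (\<sigma> i) then 1 else 0)) *
           (if \<forall>i\<in>{1..r} - {1..n}. l i = k i then 1 else 0)"
          unfolding 1 2 using t by (simp add: co_def)
      qed
      also have "\<dots> = of_int (sign \<sigma>) * (\<Prod>i\<in>{1..n}. h (l i) (k (\<sigma> i))) * (if \<forall>i\<in>{1..r} - {1..n}. l i = k i then 1 else 0)"
      proof -
        have "(\<Prod>i\<in>{1..n}. h (l i) (k (\<sigma> i))) = (\<Prod>i\<in>{1..n}. (if l i = 0 \<and> k (\<sigma> i) = 0 then - 1 else 0) + (if l i = k (\<sigma> i) then 1 else 0))"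
          by (simp add: h_def add.commute)
        also have "\<dots> = (\<Sum>S\<in>?S. (\<Prod>i\<in>S. if l i = 0 \<and> k (\<sigma> i) = 0 then - 1 else 0) * (\<Prod>i\<in>{1..n} - S. if l i = k (\<sigma> i) then 1 else 0))"
          by (rule prod_add) simp
        finally show ?thesis by (simp only: sum_distrib_left sum_distrib_right)
      qed
      finally show "(\<Sum>S\<in>?S. co \<sigma> S * ?M (cut_perm_diag r \<sigma> S)) =
         of_int (sign \<sigma>) * (\<Prod>i\<in>{1..n}. h (l i) (k (\<sigma> i))) * (if \<forall>i\<in>{1..r} - {1..n}. l i = k i then 1 else 0)" .
    qed
    also have "\<dots> = 0"
    proof -
      have "l i < n" if "i \<in> {1..n}" for i using PiE_mem[OF kl(2), of i] that n by auto
      then have "(\<Sum>\<sigma>\<in>?P. of_int (sign \<sigma>) * (\<Prod>i\<in>{1..n}. h (l i) (k (\<sigma> i)))) = 0"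
        by (intro antisymmetrizer_vanishes[OF n(1)]) (auto simp: h_def)
      then show ?thesis by (simp only: sum_distrib_right[symmetric] mult_zero_left)
    qed
    finally show "(\<Sum>d\<in>pb_diagrams r. a d *\<^sub>v diag_mat r n t d) (k, l) = 0 (k, l)" by simp
  next
    show "(\<Sum>d\<in>pb_diagrams r. a d *\<^sub>v diag_mat r n t d) \<in> mats ({1..r} \<rightarrow>\<^sub>E {0..<n})"
      by (intro mats_sum mats_closed diag_mat_mats)
  qed (rule mats_closed)
  then show ?thesis using one that by blast
qed

section \<open>Operators and their matrices in an orthonormal basis\<close>

lemma endo_linear:
  assumes "T \<in> endo V" shows "x \<in> V \<Longrightarrow> T x \<in> V" "x \<in> V \<Longrightarrow> y \<in> V \<Longrightarrow> T (x + y) = T x + T y" "x \<in> V \<Longrightarrow> T (c *\<^sub>v x) = c *\<^sub>v T x"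
    "x \<notin> V \<Longrightarrow> T x = undefined"
  using assms by (auto simp: endo_def PiE_iff extensional_def)

lemma endo_sum:
  assumes T: "T \<in> endo V" and V: "cfun.subspace V" and x: "\<And>j. j \<in> J \<Longrightarrow> x j \<in> V"
  shows "T (\<Sum>j\<in>J. x j) = (\<Sum>j\<in>J. T (x j))"
proof -
  have 0: "T 0 = 0"
    using endo_linear(3)[OF T cfun.subspace_0[OF V], of 0] by (metis cfun.scale_zero_left)
  show ?thesis using x
  proof (induction J rule: infinite_finite_induct)
    case (insert j J)
    have "(\<Sum>j\<in>J. x j) \<in> V" using insert.prems by (intro cfun.subspace_sum[OF V]) auto
    then show ?case using insert by (simp only: sum.insert simp_thms) (simp only: endo_linear(2)[OF T] insertI1 insert.prems insertI2)
  qed (simp_all only: sum.infinite sum.empty 0 simp_thms)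
qed

text \<open>The dictionary between operators and matrices for an orthonormal basis \<open>b\<close> of the functions on
  \<open>I\<close>, with respect to the bilinear form that is diagonal with entries \<open>g\<close>. It
  serves the original space, its tensor power and the standard bases alike.\<close>

locale orthonormal =
  fixes I :: "'a set" and g :: "'a \<Rightarrow> complex" and J :: "'j set" and b :: "'j \<Rightarrow> 'a \<Rightarrow> complex"
  assumes finI: "finite I" and finJ: "finite J" and card: "card J = card I"
    and b_in: "j \<in> J \<Longrightarrow> b j \<in> supported I"
    and b_orth: "i \<in> J \<Longrightarrow> j \<in> J \<Longrightarrow> (\<Sum>x\<in>I. b i x * b j x * g x) = (if i = j then 1 else 0)"
begin

abbreviation "V \<equiv> supported I"

definition co :: "('a \<Rightarrow> complex) \<Rightarrow> 'j \<Rightarrow> complex" where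
  "co x j = (\<Sum>i\<in>I. x i * b j i * g i)"

lemma co_linear: "co (x + y) j = co x j + co y j" "co (c *\<^sub>v x) j = c * co x j"
  by (simp_all add: co_def vscale_def algebra_simps sum.distrib sum_distrib_left)

lemma co_sum: "co (\<Sum>i\<in>S. F i) j = (\<Sum>i\<in>S. co (F i) j)"
proof -
  have "co 0 j = 0" by (simp add: co_def)
  then show ?thesis
    by (induction S rule: infinite_finite_induct) (simp_all only: co_linear sum.infinite sum.empty sum.insert simp_thms)
qed

lemma co_b: "i \<in> J \<Longrightarrow> j \<in> J \<Longrightarrow> co (b i) j = (if i = j then 1 else 0)"
  using b_orth by (simp add: co_def)

lemma co_comb: "j \<in> J \<Longrightarrow> co (\<Sum>i\<in>J. c i *\<^sub>v b i) j = c j"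
  using finJ by (simp add: co_sum co_linear co_b if_mult)

lemma subV: "cfun.subspace V"
  by (rule supported_subspace)

text \<open>Orthonormal families are independent, and as many vectors as the dimension span.\<close>

lemma basis: "is_basis V J b"
proof -
  have inj: "inj_on b J"
  proof (rule inj_onI, rule ccontr)
    fix i j assume ij: "i \<in> J" "j \<in> J" "b i = b j" "i \<noteq> j"
    then have "co (b i) j = co (b j) j" by simp
    then show False using co_b[of i j] co_b[of j j] ij by simp
  qed
  have ind: "cfun.independent (b ` J)"
  proof (rule cfun.independent_if_scalars_zero)
    fix f x assume s: "(\<Sum>x\<in>b ` J. f x *\<^sub>v x) = 0" and x: "x \<in> b ` J"
    then obtain j where j: "j \<in> J" "x = b j" by blast
    have "(\<Sum>i\<in>J. f (b i) *\<^sub>v b i) = 0" using s by (simp add: sum.reindex[OF inj])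
    then have "co (\<Sum>i\<in>J. f (b i) *\<^sub>v b i) j = co 0 j" by simp
    moreover have "co 0 j = 0" by (simp add: co_def)
    ultimately show "f x = 0" using co_comb[OF j(1), of "\<lambda>i. f (b i)"] j(2) by simp
  qed (use finJ in simp)
  have sub: "b ` J \<subseteq> V" using b_in by blast
  have "V \<subseteq> cfun.span (b ` J)"
  proof
    fix x assume x: "x \<in> V"
    show "x \<in> cfun.span (b ` J)"
    proof (rule ccontr)
      assume n: "x \<notin> cfun.span (b ` J)"
      then have "cfun.independent (insert x (b ` J))" using ind by (rule cfun.independent_insertI)
      moreover have "insert x (b ` J) \<subseteq> cfun.span (delta ` I)" using x sub span_delta[OF finI] by blast
      ultimately have "card (insert x (b ` J)) \<le> card (delta ` I)"
        using cfun.independent_span_bound[of "delta ` I" "insert x (b ` J)"] finI by blast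
      also have "\<dots> \<le> card I" using finI by (rule card_image_le)
      finally have "card (insert x (b ` J)) \<le> card J" by (simp add: card)
      moreover have "x \<notin> b ` J" using n cfun.span_base by blast
      ultimately show False using finJ inj by (simp add: card_image)
    qed
  qed
  moreover have "cfun.span (b ` J) \<subseteq> V" using sub subV by (rule cfun.span_minimal)
  ultimately show ?thesis using inj ind by (simp add: is_basis_def subset_antisym)
qed

lemma expand: "x \<in> V \<Longrightarrow> x = (\<Sum>j\<in>J. co x j *\<^sub>v b j)"
proof -
  assume "x \<in> V"
  then have "x \<in> cfun.span (b ` J)" using basis by (simp add: is_basis_def)
  then obtain f where f: "x = (\<Sum>v\<in>b ` J. f v *\<^sub>v v)" using finJ by (auto simp: cfun.span_finite)
  have x: "x = (\<Sum>j\<in>J. f (b j) *\<^sub>v b j)"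
    unfolding f using basis by (subst sum.reindex) (auto simp: is_basis_def)
  have "(\<Sum>j\<in>J. co x j *\<^sub>v b j) = (\<Sum>j\<in>J. f (b j) *\<^sub>v b j)"
    by (intro sum.cong HOL.refl) (subst x, simp only: co_comb)
  then show ?thesis using x by simp
qed

lemma endo_eqI:
  assumes T: "T \<in> endo V" and S: "S \<in> endo V" and eq: "\<And>j. j \<in> J \<Longrightarrow> T (b j) = S (b j)"
  shows "T = S"
proof
  fix x show "T x = S x"
  proof (cases "x \<in> V")
    case True
    have in_V: "co x j *\<^sub>v b j \<in> V" if "j \<in> J" for j using b_in[OF that] by (rule cfun.subspace_scale[OF subV])
    have "T (\<Sum>j\<in>J. co x j *\<^sub>v b j) = S (\<Sum>j\<in>J. co x j *\<^sub>v b j)"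
    proof -
      have "T (\<Sum>j\<in>J. co x j *\<^sub>v b j) = (\<Sum>j\<in>J. T (co x j *\<^sub>v b j))"
        by (rule endo_sum[OF T subV in_V])
      also have "\<dots> = (\<Sum>j\<in>J. S (co x j *\<^sub>v b j))"
        by (intro sum.cong HOL.refl) (simp only: endo_linear(3)[OF T b_in] endo_linear(3)[OF S b_in] eq)
      also have "\<dots> = S (\<Sum>j\<in>J. co x j *\<^sub>v b j)"
        by (rule endo_sum[OF S subV in_V, symmetric])
      finally show ?thesis .
    qed
    then show ?thesis using expand[OF True] by simp
  qed (use endo_linear(4)[OF T] endo_linear(4)[OF S] in simp)
qed

definition mat_op :: "('j \<times> 'j \<Rightarrow> complex) \<Rightarrow> ('a \<Rightarrow> complex) \<Rightarrow> 'a \<Rightarrow> complex" where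
  "mat_op M = (\<lambda>x\<in>V. \<Sum>k\<in>J. (\<Sum>l\<in>J. M (k, l) * co x l) *\<^sub>v b k)"

definition mtx :: "(('a \<Rightarrow> complex) \<Rightarrow> 'a \<Rightarrow> complex) \<Rightarrow> 'j \<times> 'j \<Rightarrow> complex" where
  "mtx T = (\<lambda>(k, l). if k \<in> J \<and> l \<in> J then co (T (b l)) k else 0)"

lemma comb_in_V: "(\<Sum>k\<in>J. c k *\<^sub>v b k) \<in> V"
  by (intro cfun.subspace_sum[OF subV] cfun.subspace_scale[OF subV] b_in)

lemma mat_op_endo [simp]: "mat_op M \<in> endo V"
proof -
  have add: "mat_op M (x + y) = mat_op M x + mat_op M y" if "x \<in> V" "y \<in> V" for x y
  proof -
    have "x + y \<in> V" using that by (rule cfun.subspace_add[OF subV])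
    then show ?thesis using that
      by (simp add: mat_op_def co_linear algebra_simps sum.distrib cfun.scale_left_distrib)
  qed
  have scale: "mat_op M (c *\<^sub>v x) = c *\<^sub>v mat_op M x" if "x \<in> V" for c x
  proof -
    have "c *\<^sub>v x \<in> V" using that by (rule cfun.subspace_scale[OF subV])
    then show ?thesis using that
      by (simp add: mat_op_def co_linear mult.left_commute[of _ c] sum_distrib_left[symmetric] cfun.scale_sum_right)
  qed
  have "mat_op M \<in> V \<rightarrow>\<^sub>E V" using comb_in_V by (auto simp: mat_op_def)
  then show ?thesis using add scale unfolding endo_def by blast
qed

lemma mat_op_b: "l \<in> J \<Longrightarrow> mat_op M (b l) = (\<Sum>k\<in>J. M (k, l) *\<^sub>v b k)"
  using b_in finJ by (simp add: mat_op_def co_b if_distrib cong: if_cong sum.cong)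

lemma mtx_mats [simp]: "mtx T \<in> mats J"
  by (auto simp: mtx_def mats_def supported_def)

lemma mtx_mat_op: "M \<in> mats J \<Longrightarrow> mtx (mat_op M) = M"
  by (rule mats_eqI[of _ J], rule mtx_mats, assumption) (simp add: mtx_def mat_op_b co_comb)

lemma mat_op_mtx: "T \<in> endo V \<Longrightarrow> mat_op (mtx T) = T"
proof (rule endo_eqI)
  fix l assume T: "T \<in> endo V" and l: "l \<in> J"
  have "mat_op (mtx T) (b l) = (\<Sum>k\<in>J. co (T (b l)) k *\<^sub>v b k)"
    unfolding mat_op_b[OF l] using l by (simp add: mtx_def)
  also have "\<dots> = T (b l)" by (rule expand[symmetric, OF endo_linear(1)[OF T b_in[OF l]]])
  finally show "mat_op (mtx T) (b l) = T (b l)" .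
qed simp_all

lemma compose_endo: "S \<in> endo V \<Longrightarrow> T \<in> endo V \<Longrightarrow> compose V S T \<in> endo V"
proof -
  assume S: "S \<in> endo V" and T: "T \<in> endo V"
  have "compose V S T \<in> V \<rightarrow>\<^sub>E V" using endo_linear(1)[OF S] endo_linear(1)[OF T] by (auto simp: compose_def)
  moreover have "compose V S T (x + y) = compose V S T x + compose V S T y" if "x \<in> V" "y \<in> V" for x y
    using that cfun.subspace_add[OF subV that] endo_linear(1)[OF T]
    by (simp only: compose_eq endo_linear(2)[OF T] endo_linear(2)[OF S])
  moreover have "compose V S T (c *\<^sub>v x) = c *\<^sub>v compose V S T x" if "x \<in> V" for c x
    using that cfun.subspace_scale[OF subV that] endo_linear(1)[OF T]
    by (simp only: compose_eq endo_linear(3)[OF T] endo_linear(3)[OF S])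
  ultimately show ?thesis unfolding endo_def by blast
qed

lemma mat_op_mm: "mat_op (mm J M N) = compose V (mat_op M) (mat_op N)"
proof (rule endo_eqI)
  fix l assume l: "l \<in> J"
  have "compose V (mat_op M) (mat_op N) (b l) = mat_op M (\<Sum>j\<in>J. N (j, l) *\<^sub>v b j)"
    using b_in[OF l] by (simp only: compose_eq mat_op_b[OF l])
  also have "\<dots> = (\<Sum>j\<in>J. mat_op M (N (j, l) *\<^sub>v b j))"
    by (intro endo_sum[OF mat_op_endo subV] cfun.subspace_scale[OF subV] b_in)
  also have "\<dots> = (\<Sum>j\<in>J. N (j, l) *\<^sub>v (\<Sum>k\<in>J. M (k, j) *\<^sub>v b k))"
    by (intro sum.cong HOL.refl) (simp only: endo_linear(3)[OF mat_op_endo b_in] mat_op_b)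
  also have "\<dots> = (\<Sum>j\<in>J. \<Sum>k\<in>J. (M (k, j) * N (j, l)) *\<^sub>v b k)"
    by (simp add: cfun.scale_sum_right mult.commute)
  also have "\<dots> = (\<Sum>k\<in>J. \<Sum>j\<in>J. (M (k, j) * N (j, l)) *\<^sub>v b k)" by (rule sum.swap)
  also have "\<dots> = mat_op (mm J M N) (b l)"
    unfolding mat_op_b[OF l] using l by (intro sum.cong HOL.refl) (simp add: mm_apply cfun.scale_sum_left)
  finally show "mat_op (mm J M N) (b l) = compose V (mat_op M) (mat_op N) (b l)" ..
qed (simp_all add: compose_endo)

lemma mtx_compose: "S \<in> endo V \<Longrightarrow> T \<in> endo V \<Longrightarrow> mtx (compose V S T) = mm J (mtx S) (mtx T)"
  using mat_op_mm[of "mtx S" "mtx T"] mtx_mat_op[of "mm J (mtx S) (mtx T)"] by (simp add: mat_op_mtx)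

lemma mat_op_linear: "x \<in> V \<Longrightarrow> mat_op (M + N) x = mat_op M x + mat_op N x" "x \<in> V \<Longrightarrow> mat_op (c *\<^sub>v M) x = c *\<^sub>v mat_op M x"
  by (simp_all add: mat_op_def algebra_simps sum.distrib cfun.scale_left_distrib vscale_apply mult.assoc sum_distrib_left[symmetric] cfun.scale_sum_right)

lemma mat_op_mone: "x \<in> V \<Longrightarrow> mat_op (mone J) x = x"
proof -
  assume x: "x \<in> V"
  have "mat_op (mone J) x = (\<Sum>k\<in>J. co x k *\<^sub>v b k)"
    using x finJ by (simp add: mat_op_def mone_def if_distribR if_distrib cong: if_cong)
  then show ?thesis using expand[OF x] by simp
qed

lemma mat_op_cong: "M = N \<longleftrightarrow> mat_op M = mat_op N" if "M \<in> mats J" "N \<in> mats J"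
  using mtx_mat_op that by metis

lemma lin_ext_mat_op:
  assumes "\<And>l. l \<in> J \<Longrightarrow> f l = (\<Sum>k\<in>J. M (k, l) *\<^sub>v b k)"
  shows "lin_ext V J b f = mat_op M"
proof (rule endo_eqI)
  have fV: "f l \<in> V" if "l \<in> J" for l unfolding assms[OF that] by (rule comb_in_V)
  show "lin_ext V J b f \<in> endo V" by (rule lin_ext(1)[OF basis fV])
  show "lin_ext V J b f (b l) = mat_op M (b l)" if "l \<in> J" for l
    using lin_ext(2)[OF basis fV that] assms[OF that] mat_op_b[OF that] by simp
qed simp

end

section \<open>Representations of algebras with a multiplicative basis\<close>

text \<open>The linear extension of \<open>F\<close> from basis elements to finitely supported functions.\<close>

definition lin :: "('b \<Rightarrow> 'k \<Rightarrow> complex) \<Rightarrow> ('b \<Rightarrow> complex) \<Rightarrow> 'k \<Rightarrow> complex" where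
  "lin F a = (\<Sum>x | a x \<noteq> 0. a x *\<^sub>v F x)"

definition fin_supp :: "'b set \<Rightarrow> ('b \<Rightarrow> complex) set" where
  "fin_supp B = {a. finite {x. a x \<noteq> 0} \<and> a \<in> supported B}"

lemma basis_algebra_simps:
  "carrier (basis_algebra B c m e) = fin_supp B" "\<one>\<^bsub>basis_algebra B c m e\<^esub> = delta e"
  "a \<oplus>\<^bsub>basis_algebra B c m e\<^esub> b = a + b" "s \<odot>\<^bsub>basis_algebra B c m e\<^esub> a = s *\<^sub>v a"
  "a \<otimes>\<^bsub>basis_algebra B c m e\<^esub> b = (\<Sum>x | a x \<noteq> 0. \<Sum>y | b y \<noteq> 0. (a x * b y * c x y) *\<^sub>v delta (m x y))"
  by (simp_all add: basis_algebra_def fin_supp_def)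

lemma lin_superset:
  assumes "finite S" "{x. a x \<noteq> 0} \<subseteq> S" shows "lin F a = (\<Sum>x\<in>S. a x *\<^sub>v F x)"
  unfolding lin_def using assms by (intro sum.mono_neutral_left) auto

lemma fin_supp_subspace: "cfun.subspace (fin_supp B)"
proof -
  have "finite {x. a x + b x \<noteq> (0::complex)}" if "finite {x. a x \<noteq> 0}" "finite {x. b x \<noteq> 0}" for a b :: "'a \<Rightarrow> complex"
    by (rule finite_subset[of _ "{x. a x \<noteq> 0} \<union> {x. b x \<noteq> 0}"]) (use that in auto)
  then show ?thesis
    by (auto simp: cfun.subspace_def fin_supp_def supported_def vscale_def)
qed

lemma delta_fin_supp: "x \<in> B \<Longrightarrow> delta x \<in> fin_supp B"
  by (auto simp: fin_supp_def supported_def delta_def)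

lemma lin_linear:
  assumes "a \<in> fin_supp B" shows "b \<in> fin_supp B \<Longrightarrow> lin F (a + b) = lin F a + lin F b" "lin F (c *\<^sub>v a) = c *\<^sub>v lin F a"
proof -
  have fa: "finite {x. a x \<noteq> 0}" using assms by (simp add: fin_supp_def)
  show "lin F (c *\<^sub>v a) = c *\<^sub>v lin F a"
    by (subst (1 2) lin_superset[OF fa]) (auto simp: vscale_apply cfun.scale_sum_right)
  assume "b \<in> fin_supp B"
  then have fb: "finite ({x. a x \<noteq> 0} \<union> {x. b x \<noteq> 0})" using fa by (simp add: fin_supp_def)
  have "lin F (a + b) = (\<Sum>x\<in>{x. a x \<noteq> 0} \<union> {x. b x \<noteq> 0}. (a + b) x *\<^sub>v F x)"
    by (rule lin_superset[OF fb]) auto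
  also have "\<dots> = (\<Sum>x\<in>{x. a x \<noteq> 0} \<union> {x. b x \<noteq> 0}. a x *\<^sub>v F x) + (\<Sum>x\<in>{x. a x \<noteq> 0} \<union> {x. b x \<noteq> 0}. b x *\<^sub>v F x)"
    by (simp only: plus_fun_apply cfun.scale_left_distrib sum.distrib)
  also have "\<dots> = lin F a + lin F b"
    by (subst (1 2) lin_superset[OF fb, symmetric]) auto
  finally show "lin F (a + b) = lin F a + lin F b" .
qed

lemma lin_delta: "lin F (delta x) = F x"
proof -
  have "lin F (delta x) = (\<Sum>y\<in>{x}. delta x y *\<^sub>v F y)" by (rule lin_superset) (auto simp: delta_def)
  then show ?thesis by (simp add: delta_def)
qed

lemma lin_sum:
  assumes "\<And>i. i \<in> S \<Longrightarrow> a i \<in> fin_supp B" shows "lin F (\<Sum>i\<in>S. a i) = (\<Sum>i\<in>S. lin F (a i))"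
proof -
  have 0: "lin F 0 = 0" by (simp add: lin_def)
  show ?thesis using assms
  proof (induction S rule: infinite_finite_induct)
    case (insert i S)
    have "(\<Sum>i\<in>S. a i) \<in> fin_supp B" using insert.prems by (intro cfun.subspace_sum[OF fin_supp_subspace]) auto
    then show ?case using insert.prems insert.IH by (simp only: sum.insert[OF insert.hyps] lin_linear(1)[OF insert.prems[OF insertI1]] insertI2)
  qed (simp_all only: sum.infinite sum.empty 0 simp_thms)
qed

lemma fin_supp_expand: "a \<in> fin_supp B \<Longrightarrow> a = (\<Sum>x | a x \<noteq> 0. a x *\<^sub>v delta x)"
proof
  fix y assume a: "a \<in> fin_supp B"
  have "(\<Sum>x | a x \<noteq> 0. a x *\<^sub>v delta x) y = (\<Sum>x | a x \<noteq> 0. if x = y then a y else 0)"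
    unfolding sum_apply by (intro sum.cong HOL.refl) (auto simp: vscale_def delta_def)
  then show "a y = (\<Sum>x | a x \<noteq> 0. a x *\<^sub>v delta x) y"
    using a by (simp add: fin_supp_def)
qed

lemma lin_image: "lin F ` fin_supp B = cfun.span (F ` B)"
proof (intro equalityI subsetI)
  fix y assume "y \<in> lin F ` fin_supp B"
  then obtain a where a: "a \<in> fin_supp B" "y = lin F a" by blast
  then have "x \<in> B" if "a x \<noteq> 0" for x using that by (auto simp: fin_supp_def supported_def)
  then show "y \<in> cfun.span (F ` B)"
    unfolding a(2) lin_def by (intro cfun.span_sum cfun.span_scale cfun.span_base) auto
next
  fix y assume "y \<in> cfun.span (F ` B)"
  then show "y \<in> lin F ` fin_supp B"
  proof (induction rule: cfun.span_induct_alt)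
    case base
    have "lin F 0 = 0" by (simp add: lin_def)
    then show ?case using cfun.subspace_0[OF fin_supp_subspace[of B]] by (metis image_eqI)
  next
    case (step c x y)
    then obtain b a where ba: "b \<in> B" "x = F b" "a \<in> fin_supp B" "y = lin F a" by blast
    have d: "c *\<^sub>v delta b \<in> fin_supp B" using delta_fin_supp[OF ba(1)] by (rule cfun.subspace_scale[OF fin_supp_subspace])
    have "c *\<^sub>v x + y = lin F (c *\<^sub>v delta b + a)"
      by (simp only: lin_linear(1)[OF d ba(3)] lin_linear(2)[OF delta_fin_supp[OF ba(1)]] lin_delta ba)
    then show ?case using cfun.subspace_add[OF fin_supp_subspace d ba(3)] by blast
  qed
qed

lemma mult_closed:
  assumes m: "\<And>x y. x \<in> B \<Longrightarrow> y \<in> B \<Longrightarrow> m x y \<in> B" and ab: "a \<in> fin_supp B" "b \<in> fin_supp B"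
  shows "(\<Sum>x | a x \<noteq> 0. \<Sum>y | b y \<noteq> 0. (a x * b y * c x y) *\<^sub>v delta (m x y)) \<in> fin_supp B"
proof -
  have "x \<in> B" if "a x \<noteq> 0" for x using that ab by (auto simp: fin_supp_def supported_def)
  moreover have "x \<in> B" if "b x \<noteq> 0" for x using that ab by (auto simp: fin_supp_def supported_def)
  ultimately show ?thesis
    by (intro cfun.subspace_sum[OF fin_supp_subspace] cfun.subspace_scale[OF fin_supp_subspace] delta_fin_supp m) auto
qed

text \<open>The product \<open>P\<close> is kept abstract to cover both matrix multiplication and its opposite.\<close>

lemma lin_mult:
  fixes F :: "'b \<Rightarrow> 'k \<Rightarrow> complex" and P :: "('k \<Rightarrow> complex) \<Rightarrow> ('k \<Rightarrow> complex) \<Rightarrow> 'k \<Rightarrow> complex"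
  assumes m: "\<And>x y. x \<in> B \<Longrightarrow> y \<in> B \<Longrightarrow> m x y \<in> B" and ab: "a \<in> fin_supp B" "b \<in> fin_supp B"
    and P: "\<And>(I :: 'b set) f z. P (\<Sum>i\<in>I. f i) z = (\<Sum>i\<in>I. P (f i) z)" "\<And>(I :: 'b set) f z. P z (\<Sum>i\<in>I. f i) = (\<Sum>i\<in>I. P z (f i))"
      "\<And>s y z. P (s *\<^sub>v y) z = s *\<^sub>v P y z" "\<And>s y z. P y (s *\<^sub>v z) = s *\<^sub>v P y z"
    and F: "\<And>x y. x \<in> B \<Longrightarrow> y \<in> B \<Longrightarrow> P (F x) (F y) = c x y *\<^sub>v F (m x y)"
  shows "lin F (\<Sum>x | a x \<noteq> 0. \<Sum>y | b y \<noteq> 0. (a x * b y * c x y) *\<^sub>v delta (m x y)) = P (lin F a) (lin F b)"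
proof -
  have aB: "x \<in> B" if "a x \<noteq> 0" for x using that ab by (auto simp: fin_supp_def supported_def)
  have bB: "x \<in> B" if "b x \<noteq> 0" for x using that ab by (auto simp: fin_supp_def supported_def)
  have d: "(a x * b y * c x y) *\<^sub>v delta (m x y) \<in> fin_supp B" if "a x \<noteq> 0" "b y \<noteq> 0" for x y
    using that by (intro cfun.subspace_scale[OF fin_supp_subspace] delta_fin_supp m aB bB)
  have "lin F (\<Sum>x | a x \<noteq> 0. \<Sum>y | b y \<noteq> 0. (a x * b y * c x y) *\<^sub>v delta (m x y)) =
    (\<Sum>x | a x \<noteq> 0. lin F (\<Sum>y | b y \<noteq> 0. (a x * b y * c x y) *\<^sub>v delta (m x y)))"
    by (rule lin_sum) (use d in \<open>auto intro!: cfun.subspace_sum[OF fin_supp_subspace]\<close>)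
  also have "\<dots> = (\<Sum>x | a x \<noteq> 0. \<Sum>y | b y \<noteq> 0. (a x * b y * c x y) *\<^sub>v F (m x y))"
  proof (rule sum.cong[OF HOL.refl])
    fix x assume "x \<in> {x. a x \<noteq> 0}"
    then have x: "a x \<noteq> 0" by simp
    have "lin F (\<Sum>y | b y \<noteq> 0. (a x * b y * c x y) *\<^sub>v delta (m x y)) = (\<Sum>y | b y \<noteq> 0. lin F ((a x * b y * c x y) *\<^sub>v delta (m x y)))"
      by (rule lin_sum) (use d x in auto)
    also have "\<dots> = (\<Sum>y | b y \<noteq> 0. (a x * b y * c x y) *\<^sub>v F (m x y))"
    proof (rule sum.cong[OF HOL.refl])
      fix y assume "y \<in> {y. b y \<noteq> 0}"
      then have "delta (m x y) \<in> fin_supp B" using x by (intro delta_fin_supp m aB bB) auto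
      then show "lin F ((a x * b y * c x y) *\<^sub>v delta (m x y)) = (a x * b y * c x y) *\<^sub>v F (m x y)"
        by (simp only: lin_linear(2) lin_delta)
    qed
    finally show "lin F (\<Sum>y | b y \<noteq> 0. (a x * b y * c x y) *\<^sub>v delta (m x y)) = (\<Sum>y | b y \<noteq> 0. (a x * b y * c x y) *\<^sub>v F (m x y))" .
  qed
  also have "\<dots> = (\<Sum>x | a x \<noteq> 0. \<Sum>y | b y \<noteq> 0. a x *\<^sub>v b y *\<^sub>v P (F x) (F y))"
    using F aB bB by (intro sum.cong HOL.refl) simp
  also have "\<dots> = P (lin F a) (lin F b)"
  proof -
    have "P z (lin F b) = (\<Sum>y | b y \<noteq> 0. b y *\<^sub>v P z (F y))" for z
      unfolding lin_def P(2) P(4) ..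
    moreover have "P (lin F a) (lin F b) = (\<Sum>x | a x \<noteq> 0. a x *\<^sub>v P (F x) (lin F b))"
      unfolding lin_def[of F a] P(1) P(3) ..
    ultimately show ?thesis by (simp only: cfun.scale_sum_right)
  qed
  finally show ?thesis .
qed

context orthonormal
begin

lemma linear_action_mat_op:
  assumes m: "\<And>x y. x \<in> B \<Longrightarrow> y \<in> B \<Longrightarrow> m x y \<in> B" and e: "e \<in> B" "F e = mone J"
    and \<phi>: "\<And>a. a \<in> fin_supp B \<Longrightarrow> \<phi> a = mat_op (lin F a)"
  shows "linear_action (basis_algebra B c m e) V \<phi>"
  unfolding linear_action_def basis_algebra_simps
proof (intro conjI ballI allI)
  show "\<phi> \<in> fin_supp B \<rightarrow> endo V" using \<phi> by auto
  fix a b v assume a: "a \<in> fin_supp B" and b: "b \<in> fin_supp B" and v: "v \<in> V"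
  show "\<phi> (a + b) v = \<phi> a v + \<phi> b v"
    using cfun.subspace_add[OF fin_supp_subspace a b] by (simp only: \<phi> a b lin_linear(1)[OF a b] mat_op_linear[OF v])
next
  fix s a v assume a: "a \<in> fin_supp B" and v: "v \<in> V"
  show "\<phi> (s *\<^sub>v a) v = s *\<^sub>v \<phi> a v"
    using cfun.subspace_scale[OF fin_supp_subspace a] by (simp only: \<phi> a lin_linear(2)[OF a] mat_op_linear[OF v])
next
  fix v assume v: "v \<in> V"
  show "\<phi> (delta e) v = v"
    using \<phi>[OF delta_fin_supp[OF e(1)]] e(2) mat_op_mone[OF v] by (simp only: lin_delta)
qed

end

section \<open>Homomorphisms from a presented group\<close>

lemma GL_hom_properties:
  assumes "\<tau> \<in> hom G (GL V)"
  shows "g \<in> carrier G \<Longrightarrow> \<tau> g \<in> endo V" "g \<in> carrier G \<Longrightarrow> \<tau> g \<in> Bij V"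
    "g \<in> carrier G \<Longrightarrow> h \<in> carrier G \<Longrightarrow> \<tau> (g \<otimes>\<^bsub>G\<^esub> h) = compose V (\<tau> g) (\<tau> h)"
proof -
  have c: "g \<in> carrier G \<Longrightarrow> \<tau> g \<in> endo V \<inter> Bij V" for g
    using hom_in_carrier[OF assms] by (simp add: GL_def)
  then show "g \<in> carrier G \<Longrightarrow> \<tau> g \<in> endo V" "g \<in> carrier G \<Longrightarrow> \<tau> g \<in> Bij V" by auto
  assume g: "g \<in> carrier G" "h \<in> carrier G"
  then have "\<tau> (g \<otimes>\<^bsub>G\<^esub> h) = \<tau> g \<otimes>\<^bsub>GL V\<^esub> \<tau> h" using assms by (auto simp: hom_def)
  also have "\<dots> = compose V (\<tau> g) (\<tau> h)" using c[OF g(1)] c[OF g(2)] by (simp add: GL_def BijGroup_def)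
  finally show "\<tau> (g \<otimes>\<^bsub>G\<^esub> h) = compose V (\<tau> g) (\<tau> h)" .
qed

lemma GL_hom_one:
  assumes "\<tau> \<in> hom G (GL V)" "group G"
  shows "\<tau> \<one>\<^bsub>G\<^esub> = (\<lambda>x\<in>V. x)"
proof
  interpret group G by fact
  note h = GL_hom_properties[OF assms(1)]
  have c: "compose V (\<tau> \<one>\<^bsub>G\<^esub>) (\<tau> \<one>\<^bsub>G\<^esub>) = \<tau> \<one>\<^bsub>G\<^esub>" using h(3)[OF one_closed one_closed] by simp
  have bij: "bij_betw (\<tau> \<one>\<^bsub>G\<^esub>) V V" and ext: "\<tau> \<one>\<^bsub>G\<^esub> \<in> extensional V" using h(2)[OF one_closed] by (auto simp: Bij_def)
  fix x show "\<tau> \<one>\<^bsub>G\<^esub> x = (\<lambda>x\<in>V. x) x"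
  proof (cases "x \<in> V")
    case True
    then have "\<tau> \<one>\<^bsub>G\<^esub> (\<tau> \<one>\<^bsub>G\<^esub> x) = \<tau> \<one>\<^bsub>G\<^esub> x" using fun_cong[OF c, of x] by (simp add: compose_def)
    moreover have "\<tau> \<one>\<^bsub>G\<^esub> x \<in> V" using bij True by (auto simp: bij_betw_def)
    ultimately show ?thesis using bij True by (auto simp: bij_betw_def inj_on_def)
  qed (use ext in \<open>auto simp: extensional_def\<close>)
qed

text \<open>The letters act by involutions, so a letter and its formal inverse may act by the same operator; the
  congruence generated by free reduction and the relations then lies in the kernel of the evaluation of words.\<close>

lemma presented_group_hom:
  fixes S :: "'g \<Rightarrow> ('a \<Rightarrow> complex) \<Rightarrow> 'a \<Rightarrow> complex"
  assumes sub: "cfun.subspace V"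
    and S: "\<And>x. x \<in> X \<Longrightarrow> S x \<in> endo V" "\<And>x. x \<in> X \<Longrightarrow> compose V (S x) (S x) = (\<lambda>v\<in>V. v)"
    and ev: "ev = (\<lambda>w. foldr (\<lambda>(x, s). compose V (S x)) w (\<lambda>v\<in>V. v))"
    and rels: "\<And>v w. (v, w) \<in> R \<Longrightarrow> ev v = ev w"
  obtains \<tau> where "\<tau> \<in> hom (presented_group X R) (GL V)"
    "\<And>w. w \<in> words X \<Longrightarrow> \<tau> (pres_rel X R `` {w}) = ev w"
proof -
  have SV: "S x \<in> V \<rightarrow> V" if "x \<in> X" for x using S(1)[OF that] by (auto simp: endo_def)
  have S_Bij: "S x \<in> Bij V" if x: "x \<in> X" for x
  proof -
    have inv: "S x (S x v) = v" if "v \<in> V" for v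
      using fun_cong[OF S(2)[OF x], of v] that by (simp add: compose_def)
    have "bij_betw (S x) V V" by (rule bij_betw_byWitness[where f' = "S x"]) (use inv SV[OF x] in auto)
    then show ?thesis using S(1)[OF x] by (auto simp: Bij_def endo_def PiE_def)
  qed
  have id_V: "(\<lambda>v\<in>V. v) \<in> endo V" "(\<lambda>v\<in>V. v) \<in> Bij V"
    using cfun.subspace_add[OF sub] cfun.subspace_scale[OF sub] by (auto simp: endo_def Bij_def bij_betw_def inj_on_def)
  have comp_endo: "compose V f g \<in> endo V" if "f \<in> endo V" "g \<in> endo V" for f g
  proof -
    have "compose V f g \<in> V \<rightarrow>\<^sub>E V" using endo_linear(1)[OF that(1)] endo_linear(1)[OF that(2)] by (auto simp: compose_def)
    moreover have "compose V f g (x + y) = compose V f g x + compose V f g y" if "x \<in> V" "y \<in> V" for x y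
      using that cfun.subspace_add[OF sub that] endo_linear(1)[OF \<open>g \<in> endo V\<close>]
      by (simp only: compose_eq endo_linear(2)[OF \<open>g \<in> endo V\<close>] endo_linear(2)[OF \<open>f \<in> endo V\<close>])
    moreover have "compose V f g (c *\<^sub>v x) = c *\<^sub>v compose V f g x" if "x \<in> V" for c x
      using that cfun.subspace_scale[OF sub that] endo_linear(1)[OF \<open>g \<in> endo V\<close>]
      by (simp only: compose_eq endo_linear(3)[OF \<open>g \<in> endo V\<close>] endo_linear(3)[OF \<open>f \<in> endo V\<close>])
    ultimately show ?thesis unfolding endo_def by blast
  qed
  have ev_Cons: "ev ((x, s) # w) = compose V (S x) (ev w)" and ev_Nil: "ev [] = (\<lambda>v\<in>V. v)" for x s w
    by (simp_all add: ev)
  have ev_in: "ev w \<in> endo V \<and> ev w \<in> Bij V" if "w \<in> words X" for w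
    using that
  proof (induction w)
    case Nil
    show ?case by (simp only: ev_Nil id_V simp_thms)
  next
    case (Cons a w)
    obtain x s where a: "a = (x, s)" by (cases a)
    have "x \<in> X" "w \<in> words X" using Cons.prems by (auto simp: words_def a)
    then show ?case unfolding a ev_Cons using Cons.IH S(1) S_Bij by (auto intro: comp_endo compose_Bij)
  qed
  have ev_V: "ev w \<in> V \<rightarrow> V" "ev w \<in> extensional V" if "w \<in> words X" for w
    using ev_in[OF that] by (auto simp: endo_def PiE_def)
  have ev_app: "ev (v @ w) = compose V (ev v) (ev w)" if v: "v \<in> words X" and w: "w \<in> words X" for v w
    using v
  proof (induction v)
    case Nil
    show ?case using Id_compose[OF ev_V(1)[OF w] ev_V(2)[OF w]] by (simp only: ev_Nil append_Nil)
  next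
    case (Cons a v)
    obtain x s where a: "a = (x, s)" by (cases a)
    have "x \<in> X" "v \<in> words X" using Cons.prems by (auto simp: words_def a)
    then show ?case
      unfolding a append_Cons ev_Cons using Cons.IH compose_assoc[OF ev_V(1)[OF w], where h = "S x" and g = "ev v"] by simp
  qed
  have respects: "ev v = ev w" if "pres_eq X R v w" for v w
    using that
  proof (induction rule: pres_eq.induct)
    case (mult v w v' w')
    then show ?case using pres_eq_words ev_app by metis
  next
    case (cancel x s)
    have "compose V (S x) (\<lambda>v\<in>V. v) = S x"
      using compose_Id[OF SV[OF cancel]] S(1)[OF cancel] by (auto simp: endo_def PiE_def)
    then show ?case using S(2)[OF cancel] by (simp add: ev_Cons ev_Nil)
  qed (auto intro: rels)
  define \<tau> where "\<tau> A = ev (SOME w. w \<in> A)" for A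
  have \<tau>: "\<tau> (pres_rel X R `` {w}) = ev w" if w: "w \<in> words X" for w
  proof -
    have "w \<in> pres_rel X R `` {w}" using w by (auto simp: pres_rel_def intro: pres_eq.refl)
    then have "(SOME v. v \<in> pres_rel X R `` {w}) \<in> pres_rel X R `` {w}" by (rule someI)
    then show ?thesis unfolding \<tau>_def using respects by (auto simp: pres_rel_def)
  qed
  have "\<tau> \<in> hom (presented_group X R) (GL V)"
  proof (rule homI)
    fix A assume "A \<in> carrier (presented_group X R)"
    then obtain v where "v \<in> words X" "A = pres_rel X R `` {v}" by (auto simp: presented_group_def quotient_def)
    then show "\<tau> A \<in> carrier (GL V)" using \<tau> ev_in by (simp add: GL_def)
    fix B assume "B \<in> carrier (presented_group X R)"
    then obtain w where w: "w \<in> words X" "B = pres_rel X R `` {w}" by (auto simp: presented_group_def quotient_def)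
    have vw: "v @ w \<in> words X" using \<open>v \<in> words X\<close> w by (auto simp: words_def)
    have "\<tau> (A \<otimes>\<^bsub>presented_group X R\<^esub> B) = ev (v @ w)"
      unfolding \<open>A = _\<close> w(2) presented_group_mult_class[OF \<open>v \<in> words X\<close> w(1)] by (rule \<tau>[OF vw])
    also have "\<dots> = compose V (\<tau> A) (\<tau> B)" using ev_app \<open>v \<in> words X\<close> w \<open>A = _\<close> \<tau> by simp
    also have "\<dots> = \<tau> A \<otimes>\<^bsub>GL V\<^esub> \<tau> B"
      using ev_in[OF \<open>v \<in> words X\<close>] ev_in[OF w(1)] \<tau>[OF \<open>v \<in> words X\<close>] \<tau>[OF w(1)] \<open>A = _\<close> w(2) by (simp add: GL_def BijGroup_def)
    finally show "\<tau> (A \<otimes>\<^bsub>presented_group X R\<^esub> B) = \<tau> A \<otimes>\<^bsub>GL V\<^esub> \<tau> B" .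
  qed
  then show ?thesis using that \<tau> by blast
qed

section \<open>The reflection representation of the twin group\<close>

(* Keeps the index sets {1..n} and {1..r} from being rewritten to start at Suc 0. *)
declare One_nat_def [simp del]

text \<open>An orthonormal basis adapted to the decomposition into the line of \<open>ell0 n\<close> and its orthogonal
  complement, for generic \<open>q\<close>.\<close>

locale twin_setting =
  fixes n r :: nat and q root_n :: complex and u :: "nat \<Rightarrow> nat \<Rightarrow> complex"
  assumes n2: "n \<ge> 2" and q0: "q \<noteq> 0" and q1: "q \<noteq> -1" and qn: "qint q n \<noteq> 0"
    and generic: "\<And>(k::int) (m::nat) l. m \<ge> 1 \<Longrightarrow> l = complex_of_real (cos (2 * of_int k * pi / of_nat m)) \<Longrightarrow>
           l \<noteq> -1 \<Longrightarrow>
           q \<noteq> (- l + csqrt (- 1 - 2 * l)) / (1 + l) \<and>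
           q \<noteq> (- l - csqrt (- 1 - 2 * l)) / (1 + l)"
    and root: "root_n ^ 2 = qint q n" and u0: "u 0 = inverse root_n *\<^sub>v ell0 n"
    and uF: "orthonormal_basis n q (sp_F n q) {1..<n} u"
begin

text \<open>The vectors spanning \<open>sp_F n q\<close>, which turn out to be the roots of the reflections.\<close>

definition v :: "nat \<Rightarrow> nat \<Rightarrow> complex" where
  "v i = q *\<^sub>v delta i - delta (i + 1)"

abbreviation "C \<equiv> {0..<n}"

lemma form_linear: "form n q (x + y) z = form n q x z + form n q y z" "form n q (c *\<^sub>v x) z = c * form n q x z"
  "form n q z (x + y) = form n q z x + form n q z y" "form n q z (c *\<^sub>v x) = c * form n q z x"
  "form n q (x - y) z = form n q x z - form n q y z" "form n q z (x - y) = form n q z x - form n q z y"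
  by (simp_all add: form_def vscale_def algebra_simps sum.distrib sum_distrib_left sum_subtractf)

lemma form_commute: "form n q x y = form n q y x"
  by (simp add: form_def mult.commute)

lemma form_delta: "j \<in> {1..n} \<Longrightarrow> form n q x (delta j) = x j * q ^ (j - 1)"
proof -
  assume j: "j \<in> {1..n}"
  have "form n q x (delta j) = (\<Sum>i=1..n. if i = j then x j * q ^ (j - 1) else 0)"
    unfolding form_def delta_def by (intro sum.cong HOL.refl) auto
  then show ?thesis using j by simp
qed

lemma form_v: "i \<in> {1..<n} \<Longrightarrow> form n q x (v i) = q ^ i * (x i - x (i + 1))"
proof -
  assume i: "i \<in> {1..<n}"
  have "form n q x (v i) = q * (x i * q ^ (i - 1)) - x (i + 1) * q ^ i"
    unfolding v_def form_linear using i by (simp add: form_delta)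
  moreover have "q * q ^ (i - 1) = q ^ i" using i by (metis atLeastLessThan_iff One_nat_def Suc_le_eq power_minus_mult mult.commute)
  ultimately show ?thesis by (simp add: right_diff_distrib mult.commute mult.left_commute)
qed

lemma v_apply: "v i j = (if j = i then q else 0) - (if j = i + 1 then 1 else 0)"
  by (simp add: v_def delta_def vscale_def)

lemma form_vv: "i \<in> {1..<n} \<Longrightarrow> form n q (v i) (v i) = q ^ i * (1 + q)"
  by (simp add: form_v v_apply algebra_simps)

lemma form_vv_next: "i \<in> {1..<n} \<Longrightarrow> i + 1 \<in> {1..<n} \<Longrightarrow> form n q (v i) (v (i + 1)) = - (q ^ (i + 1))"
  by (subst form_v) (auto simp: v_apply)

lemma form_vv_far: "i \<in> {1..<n} \<Longrightarrow> j \<in> {1..<n} \<Longrightarrow> \<bar>int i - int j\<bar> > 1 \<Longrightarrow> form n q (v i) (v j) = 0"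
  by (subst form_v) (auto simp: v_apply)

lemma ell0_apply: "ell0 n j = (if j \<in> {1..n} then 1 else 0)"
proof -
  have "ell0 n j = (\<Sum>i=1..n. if i = j then 1 else 0)"
    unfolding ell0_def sum_apply by (intro sum.cong HOL.refl) (simp add: delta_def)
  then show ?thesis by simp
qed

lemma form_ell0: "i \<in> {1..<n} \<Longrightarrow> form n q (ell0 n) (v i) = 0" "form n q (ell0 n) (ell0 n) = qint q n"
proof -
  show "i \<in> {1..<n} \<Longrightarrow> form n q (ell0 n) (v i) = 0" by (simp add: form_v ell0_apply)
  have "form n q (ell0 n) (ell0 n) = (\<Sum>j\<in>{1..n}. q ^ (j - 1))"
    unfolding form_def by (intro sum.cong HOL.refl) (simp add: ell0_apply)
  also have "\<dots> = (\<Sum>i<n. q ^ i)"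
    by (rule sum.reindex_bij_witness[of _ Suc "\<lambda>j. j - 1"]) auto
  finally show "form n q (ell0 n) (ell0 n) = qint q n" by (simp add: qint_def)
qed

lemma v_in: "i \<in> {1..<n} \<Longrightarrow> v i \<in> sp_E n"
  by (auto simp: sp_E_def supported_def v_apply)

lemma sp_F_v: "sp_F n q = cfun.span (v ` {1..<n})"
  by (simp add: sp_F_def v_def)

lemma sp_F_E: "sp_F n q \<subseteq> sp_E n"
  unfolding sp_F_v sp_E_def using v_in by (intro cfun.span_minimal supported_subspace) (auto simp: sp_E_def)

lemma u_F: "a \<in> {1..<n} \<Longrightarrow> u a \<in> sp_F n q"
  using uF cfun.span_base[of "u a" "u ` {1..<n}"] by (auto simp: orthonormal_basis_def is_basis_def)

lemma root0: "root_n \<noteq> 0"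
  using root qn by auto

sublocale E: orthonormal "{1..n}" "\<lambda>j. q ^ (j - 1)" "{0..<n}" u
proof
  show "u a \<in> supported {1..n}" if "a \<in> {0..<n}" for a
  proof (cases "a = 0")
    case True
    then show ?thesis by (auto simp: u0 supported_def vscale_def ell0_apply)
  next
    case False
    then show ?thesis using u_F[of a] sp_F_E that by (auto simp: sp_E_def)
  qed
  have 00: "form n q (u 0) (u 0) = 1"
    unfolding u0 form_linear form_ell0 root[symmetric] using root0 by (simp add: power2_eq_square field_simps)
  have F0: "form n q (u 0) x = 0" if "x \<in> cfun.span (v ` {1..<n})" for x
    using that
  proof (induction rule: cfun.span_induct_alt)
    case base
    show ?case by (simp add: form_def)
  next
    case (step c x y)
    then obtain i where "i \<in> {1..<n}" "x = v i" by blast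
    then show ?case unfolding u0 form_linear using step form_ell0(1) by (simp add: u0 form_linear)
  qed
  have "form n q (u a) (u b) = (if a = b then 1 else 0)" if "a \<in> {0..<n}" "b \<in> {0..<n}" for a b
  proof (cases "a = 0 \<or> b = 0")
    case True
    have z: "form n q (u 0) (u c) = 0" "form n q (u c) (u 0) = 0" if "c \<in> {0..<n}" "c \<noteq> 0" for c
    proof -
      have "c \<in> {1..<n}" using that by auto
      then show "form n q (u 0) (u c) = 0" using F0 u_F[of c] by (simp add: sp_F_v)
      then show "form n q (u c) (u 0) = 0" by (simp only: form_commute[of "u c"])
    qed
    show ?thesis using True 00 z[OF that(1)] z[OF that(2)] by (cases "a = 0"; cases "b = 0") auto
  next
    case False
    then show ?thesis using uF that by (auto simp: orthonormal_basis_def)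
  qed
  then show "(\<Sum>x=1..n. u a x * u b x * q ^ (x - 1)) = (if a = b then 1 else 0)" if "a \<in> {0..<n}" "b \<in> {0..<n}" for a b
    using that by (simp only: form_def)
qed simp_all

lemma E_co: "E.co x a = form n q x (u a)"
  by (simp only: E.co_def form_def)

lemma sp_E_V: "sp_E n = supported {1..n}"
  by (simp add: sp_E_def)

lemma parseval: "x \<in> sp_E n \<Longrightarrow> form n q x y = (\<Sum>a\<in>C. form n q x (u a) * form n q y (u a))"
proof -
  assume x: "x \<in> sp_E n"
  have "form n q x y = form n q (\<Sum>a\<in>C. E.co x a *\<^sub>v u a) y" using E.expand[of x] x by (simp add: sp_E_def)
  also have "\<dots> = (\<Sum>a\<in>C. E.co x a * form n q (u a) y)"
    by (simp add: form_def sum_apply vscale_apply sum_distrib_left sum_distrib_right mult.assoc) (rule sum.swap)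
  finally show ?thesis by (simp only: E_co form_commute[of y])
qed

sublocale D: orthonormal "{1..n}" "\<lambda>_. 1" "{1..n}" "delta :: nat \<Rightarrow> nat \<Rightarrow> complex"
proof
  fix i j :: nat assume "i \<in> {1..n}" "j \<in> {1..n}"
  then have "(\<Sum>x=1..n. delta i x * delta j x * 1) = (\<Sum>x=1..n. if x = i then if i = j then 1 else 0 else (0::complex))"
    by (intro sum.cong HOL.refl) (auto simp: delta_def)
  then show "(\<Sum>x=1..n. delta i x * delta j x * 1) = (if i = j then 1 else (0::complex))" using \<open>i \<in> {1..n}\<close> by simp
qed (auto simp: supported_def delta_def)

definition refl_op :: "nat \<Rightarrow> (nat \<Rightarrow> complex) \<Rightarrow> nat \<Rightarrow> complex" where
  "refl_op i = (\<lambda>x\<in>sp_E n. x - (2 / (q ^ i * (1 + q)) * form n q x (v i)) *\<^sub>v v i)"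

lemma refl_op_endo: "i \<in> {1..<n} \<Longrightarrow> refl_op i \<in> endo (sp_E n)"
proof -
  assume i: "i \<in> {1..<n}"
  have sub: "cfun.subspace (sp_E n)" by (simp add: sp_E_def supported_subspace)
  have "refl_op i x \<in> sp_E n" if "x \<in> sp_E n" for x
    unfolding refl_op_def restrict_apply using that
    by (simp only: if_True) (intro cfun.subspace_diff[OF sub] cfun.subspace_scale[OF sub] v_in[OF i])
  then have "refl_op i \<in> sp_E n \<rightarrow>\<^sub>E sp_E n" by (auto simp: refl_op_def)
  moreover have "refl_op i (x + y) = refl_op i x + refl_op i y" if "x \<in> sp_E n" "y \<in> sp_E n" for x y
  proof -
    have "x + y \<in> sp_E n" using that by (rule cfun.subspace_add[OF sub])
    then show ?thesis using that
      unfolding refl_op_def restrict_apply by (simp only: if_True form_linear) (auto simp: fun_eq_iff vscale_def algebra_simps)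
  qed
  moreover have "refl_op i (c *\<^sub>v x) = c *\<^sub>v refl_op i x" if "x \<in> sp_E n" for c x
  proof -
    have "c *\<^sub>v x \<in> sp_E n" using that by (rule cfun.subspace_scale[OF sub])
    then show ?thesis using that
      unfolding refl_op_def restrict_apply by (simp only: if_True form_linear) (auto simp: fun_eq_iff vscale_def algebra_simps)
  qed
  ultimately show ?thesis unfolding endo_def by blast
qed

lemma q1': "1 + q \<noteq> 0"
  using q1 by (metis add.inverse_unique)

text \<open>The generator is the reflection in \<open>v i\<close>, a vector of square length \<open>q\<^sup>i (1 +
  q)\<close>; this is compared on the standard basis.\<close>

lemma Sbar_refl: "i \<in> {1..<n} \<Longrightarrow> Sbar n q i = refl_op i"
proof -
  assume i: "i \<in> {1..<n}"
  define f where "f = (\<lambda>j.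
     if j = i then (1 / (1 + q)) *\<^sub>v ((1 - q) *\<^sub>v delta i + 2 *\<^sub>v delta (i + 1))
     else if j = i + 1 then (1 / (1 + q)) *\<^sub>v ((2 * q) *\<^sub>v delta i - (1 - q) *\<^sub>v delta (i + 1))
     else delta j)"
  have f_in: "f j \<in> supported {1..n}" if "j \<in> {1..n}" for j
    using that i by (auto simp: f_def supported_def vscale_def delta_def)
  have S: "Sbar n q i = lin_ext (supported {1..n}) {1..n} delta f"
    by (simp add: Sbar_def f_def sp_E_def)
  have b: "is_basis (supported {1..n}) {1..n} (delta :: nat \<Rightarrow> nat \<Rightarrow> complex)" by (rule D.basis)
  show ?thesis
    unfolding S
  proof (rule D.endo_eqI)
    show "lin_ext (supported {1..n}) {1..n} delta f \<in> endo (supported {1..n})" by (rule lin_ext(1)[OF b f_in])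
    show "refl_op i \<in> endo (supported {1..n})" using refl_op_endo[OF i] by (simp add: sp_E_def)
    fix j assume j: "j \<in> {1..n}"
    have dj: "delta j \<in> sp_E n" using j by (auto simp: sp_E_def supported_def delta_def)
    have "refl_op i (delta j) = f j"
    proof
      fix m
      have "refl_op i (delta j) m = delta j m - 2 / (1 + q) * (delta j i - delta j (i + 1)) * v i m"
        using dj q0 by (simp add: refl_op_def form_v[OF i] vscale_def)
      also have "\<dots> = f j m"
      proof -
        have v: "v i m = q * delta i m - delta (i + 1) m" by (simp add: v_def vscale_def)
        consider "j = i" | "j = i + 1" | "j \<noteq> i" "j \<noteq> i + 1" by blast
        then show ?thesis
        proof cases
          case 1
          have "delta j i = 1" "delta j (i + 1) = 0" using 1 by (auto simp: delta_def)
          then show ?thesis using q1' 1 unfolding v by (simp add: f_def vscale_def field_simps)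
        next
          case 2
          have "delta j i = 0" "delta j (i + 1) = 1" using 2 by (auto simp: delta_def)
          then show ?thesis using q1' 2 unfolding v by (simp add: f_def vscale_def field_simps)
        next
          case 3
          have "delta j i = 0" "delta j (i + 1) = 0" using 3 by (auto simp: delta_def)
          then show ?thesis using 3 by (simp add: f_def)
        qed
      qed
      finally show "refl_op i (delta j) m = f j m" .
    qed
    then show "lin_ext (supported {1..n}) {1..n} delta f (delta j) = refl_op i (delta j)"
      using lin_ext(2)[OF b f_in j] by simp
  qed
qed

lemma refl_op_apply: "x \<in> sp_E n \<Longrightarrow> refl_op i x = x - (2 / (q ^ i * (1 + q)) * form n q x (v i)) *\<^sub>v v i"
  by (simp add: refl_op_def)

lemma Sbar_endo: "i \<in> {1..<n} \<Longrightarrow> Sbar n q i \<in> endo (sp_E n)"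
  using Sbar_refl refl_op_endo by simp

lemma Sbar_involution: "i \<in> {1..<n} \<Longrightarrow> compose (sp_E n) (Sbar n q i) (Sbar n q i) = (\<lambda>x\<in>sp_E n. x)"
proof
  fix x assume i: "i \<in> {1..<n}"
  show "compose (sp_E n) (Sbar n q i) (Sbar n q i) x = (\<lambda>x\<in>sp_E n. x) x"
  proof (cases "x \<in> sp_E n")
    case True
    let ?c = "2 / (q ^ i * (1 + q))" and ?f = "form n q x (v i)"
    have in_E: "refl_op i x \<in> sp_E n" using endo_linear(1)[OF refl_op_endo[OF i] True] .
    have "form n q (refl_op i x) (v i) = ?f - (?c * ?f) * (q ^ i * (1 + q))"
      unfolding refl_op_apply[OF True] form_linear form_vv[OF i] ..
    also have "\<dots> = - ?f" using q0 q1' by simp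
    finally have "refl_op i (refl_op i x) = x"
      unfolding refl_op_apply[OF in_E] by (simp only:) (auto simp: refl_op_apply[OF True] fun_eq_iff vscale_def)
    then show ?thesis using True by (simp add: compose_def Sbar_refl[OF i])
  qed (simp add: compose_def)
qed

text \<open>The vectors \<open>v i\<close> and \<open>v j\<close> have disjoint supports and are orthogonal.\<close>

lemma Sbar_far_commute:
  assumes i: "i \<in> {1..<n}" and j: "j \<in> {1..<n}" and ij: "\<bar>int i - int j\<bar> > 1"
  shows "compose (sp_E n) (Sbar n q i) (Sbar n q j) = compose (sp_E n) (Sbar n q j) (Sbar n q i)"
proof
  fix x
  show "compose (sp_E n) (Sbar n q i) (Sbar n q j) x = compose (sp_E n) (Sbar n q j) (Sbar n q i) x"
  proof (cases "x \<in> sp_E n")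
    case True
    have in_E: "refl_op k x \<in> sp_E n" if "k \<in> {1..<n}" for k using endo_linear(1)[OF refl_op_endo[OF that] True] .
    have far: "form n q (v i) (v j) = 0" "form n q (v j) (v i) = 0" using form_vv_far[OF i j ij] form_commute by simp_all
    have "form n q (refl_op j x) (v i) = form n q x (v i)" "form n q (refl_op i x) (v j) = form n q x (v j)"
      unfolding refl_op_apply[OF True] form_linear far by simp_all
    then have "refl_op i (refl_op j x) = refl_op j (refl_op i x)"
      unfolding refl_op_apply[OF in_E[OF i]] refl_op_apply[OF in_E[OF j]] by (simp only:) (auto simp: refl_op_apply[OF True] fun_eq_iff)
    then show ?thesis using True by (simp add: compose_def Sbar_refl[OF i] Sbar_refl[OF j])
  qed (simp add: compose_def)
qed

definition s :: "nat \<Rightarrow> complex" where "s i = csqrt (q ^ i * (1 + q))"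

lemma s2: "s i * s i = q ^ i * (1 + q)" "s i \<noteq> 0"
proof -
  show 1: "s i * s i = q ^ i * (1 + q)" using power2_csqrt[of "q ^ i * (1 + q)"] by (simp add: s_def power2_eq_square)
  show "s i \<noteq> 0" using 1 q0 q1' by auto
qed

text \<open>The coordinates of the normalised root \<open>v i\<close> in the orthonormal basis. The coordinate along
  \<open>u 0\<close> is zero, and the choice of the square root \<open>s i\<close> does not affect the
  reflection.\<close>

definition w :: "nat \<Rightarrow> nat \<Rightarrow> complex" where
  "w i a = (if a \<in> {1..<n} then form n q (v i) (u a) / s i else 0)"

lemma form_v_u0: "i \<in> {1..<n} \<Longrightarrow> form n q (v i) (u 0) = 0"
  unfolding u0 form_linear using form_ell0(1)[of i] form_commute by simp

lemma w_form: "i \<in> {1..<n} \<Longrightarrow> a \<in> C \<Longrightarrow> w i a = form n q (v i) (u a) / s i"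
  using form_v_u0[of i] by (cases "a = 0") (auto simp: w_def)

lemma ip_w: "i \<in> {1..<n} \<Longrightarrow> j \<in> {1..<n} \<Longrightarrow> ip C (w i) (w j) = form n q (v i) (v j) / (s i * s j)"
proof -
  assume ij: "i \<in> {1..<n}" "j \<in> {1..<n}"
  have "ip C (w i) (w j) = (\<Sum>a\<in>C. form n q (v i) (u a) * form n q (v j) (u a)) / (s i * s j)"
    unfolding ip_def sum_divide_distrib using ij by (intro sum.cong HOL.refl) (simp add: w_form)
  then show ?thesis using parseval[OF v_in[OF ij(1)], of "v j"] by simp
qed

lemma w_unit: "i \<in> {1..<n} \<Longrightarrow> ip C (w i) (w i) = 1"
  using s2[of i] q0 q1' by (simp add: ip_w form_vv)

lemma w_supported: "w i \<in> supported {1..<n}" "w i 0 = 0"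
  by (auto simp: supported_def w_def)

lemma mtx_Sbar: "i \<in> {1..<n} \<Longrightarrow> E.mtx (Sbar n q i) = refl_mat C (w i)"
proof (rule mats_eqI[of _ C])
  fix a b assume i: "i \<in> {1..<n}" and ab: "a \<in> C" "b \<in> C"
  have ub: "u b \<in> sp_E n" using E.b_in[OF ab(2)] by (simp add: sp_E_def)
  have "E.mtx (Sbar n q i) (a, b) = form n q (u b) (u a) - (2 / (s i * s i) * form n q (v i) (u b)) * form n q (v i) (u a)"
    using ab by (simp add: E.mtx_def E_co Sbar_refl[OF i] refl_op_apply[OF ub] form_linear s2 form_commute[of "u b" "v i"])
  also have "\<dots> = refl_mat C (w i) (a, b)"
    using ab i E.co_b[OF ab(2,1)] by (simp add: refl_mat_def mone_apply outer1_apply vscale_apply w_form E_co)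
  finally show "E.mtx (Sbar n q i) (a, b) = refl_mat C (w i) (a, b)" .
qed simp_all

text \<open>Taking coordinates maps the roots \<open>v i\<close>, which span the complement of the line, to multiples of
  the \<open>w i\<close>.\<close>

lemma w_span: "a \<in> {1..<n} \<Longrightarrow> delta a \<in> cfun.span (w ` {1..<n})"
proof -
  assume a: "a \<in> {1..<n}"
  \<comment> \<open>The coordinates of \<open>x\<close> along the complement of \<open>u 0\<close>.\<close>
  define L where "L x = (\<lambda>b. if b \<in> {1..<n} then form n q x (u b) else 0)" for x
  have "L x \<in> cfun.span (w ` {1..<n})" if "x \<in> cfun.span (v ` {1..<n})" for x
    using that
  proof (induction rule: cfun.span_induct_alt)
    case base
    have "L 0 = 0" by (auto simp: L_def form_def fun_eq_iff)
    then show ?case by (simp only: cfun.span_zero)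
  next
    case (step c x y)
    then obtain i where i: "i \<in> {1..<n}" "x = v i" by blast
    have "L (c *\<^sub>v x + y) = (c * s i) *\<^sub>v w i + L y"
    proof
      fix b show "L (c *\<^sub>v x + y) b = ((c * s i) *\<^sub>v w i + L y) b"
        using s2(2)[of i] by (simp add: L_def form_linear vscale_apply w_def i(2))
    qed
    then show ?case using step i by (simp only: cfun.span_add cfun.span_scale cfun.span_base imageI)
  qed
  moreover have "L (u a) = delta a"
    using a E.co_b[of a] by (auto simp: L_def delta_def fun_eq_iff E_co)
  ultimately show ?thesis using u_F[OF a] by (metis sp_F_v)
qed

text \<open>A root of unity \<open>z\<close> would give \<open>z + inverse z = 2 * l\<close> with \<open>l\<close> the
  cosine of a rational angle. Then \<open>q\<close> solves \<open>(1 + l) (1 + q)\<^sup>2 = 2 q\<close>, a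
  quadratic equation whose roots are the excluded values. The case \<open>l = -1\<close> would force \<open>q
  = 0\<close>.\<close>

lemma root_of_unity_excluded:
  assumes c: "c\<^sup>2 = q / (1 + q)\<^sup>2" and k: "k \<ge> 1" and z: "z ^ k = 1" "z + inverse z = 4 * c\<^sup>2 - 2"
  shows False
proof -
  have "bij_betw (\<lambda>j. cis (2 * pi * real j / real k)) {..<k} {z. z ^ k = 1}"
    using k by (intro bij_betw_roots_unity) simp
  then obtain j where j: "z = cis (2 * pi * real j / real k)" using z(1) by (auto simp: bij_betw_def)
  define l where "l = complex_of_real (cos (2 * of_int (int j) * pi / of_nat k))"
  have "z + inverse z = 2 * l"
  proof -
    have "inverse z = cis (- (2 * pi * real j / real k))" unfolding j by (rule cis_inverse)
    then have "z + inverse z = complex_of_real (2 * cos (2 * pi * real j / real k))"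
      unfolding j by (simp add: complex_eq_iff)
    then show ?thesis by (simp add: l_def mult_ac)
  qed
  then have "2 * (1 + l) = 2 * (2 * c\<^sup>2)" using z(2) by (simp add: algebra_simps)
  then have l: "1 + l = 2 * c\<^sup>2" by (simp only: mult_cancel_left) simp
  then have l1: "(1 + l) * (1 + q)\<^sup>2 = 2 * q" using c q1' by simp
  then have lm: "1 + l \<noteq> 0" using q0 by auto
  then have lm': "l \<noteq> -1" by auto
  \<comment> \<open>Completing the square.\<close>
  define x where "x = (1 + l) * q + l"
  have "x\<^sup>2 = - 1 - 2 * l"
  proof -
    have "x\<^sup>2 = (1 + l) * ((1 + l) * (1 + q)\<^sup>2 - 2 * q) - 1 - 2 * l"
      unfolding x_def by (simp add: power2_eq_square algebra_simps)
    then show ?thesis using l1 by simp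
  qed
  then have "x\<^sup>2 = (csqrt (- 1 - 2 * l))\<^sup>2" by simp
  then have "x = csqrt (- 1 - 2 * l) \<or> x = - csqrt (- 1 - 2 * l)" by (rule power2_eq_iff[THEN iffD1])
  then have "q = (- l + csqrt (- 1 - 2 * l)) / (1 + l) \<or> q = (- l - csqrt (- 1 - 2 * l)) / (1 + l)"
  proof -
    have "q = (- l + y) / (1 + l)" if "x = y" for y
      unfolding that[symmetric] x_def using lm by (simp add: eq_divide_eq algebra_simps)
    from this[of "csqrt (- 1 - 2 * l)"] this[of "- csqrt (- 1 - 2 * l)"] show ?thesis
      using \<open>x = _ \<or> _\<close> by (auto simp only: diff_conv_add_uminus)
  qed
  then show False using generic[OF k, of l "int j"] lm' unfolding l_def by blast
qed

text \<open>Independent of \<open>i\<close>: the powers of \<open>q\<close> in the form and in the two lengths cancel.\<close>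

lemma consecutive_product:
  assumes i: "1 \<le> i" "i < n - 1"
  shows "(ip C (w i) (w (Suc i)))\<^sup>2 = q / (1 + q)\<^sup>2"
proof -
  have ii: "i \<in> {1..<n}" "i + 1 \<in> {1..<n}" using i by auto
  have "(ip C (w i) (w (i + 1)))\<^sup>2 = (q ^ (i + 1))\<^sup>2 / ((s i * s i) * (s (i + 1) * s (i + 1)))"
    unfolding ip_w[OF ii] form_vv_next[OF ii] by (simp add: power2_eq_square)
  also have "\<dots> = q / (1 + q)\<^sup>2"
    unfolding s2 using q0 q1' by (simp add: power2_eq_square power_add)
  finally show ?thesis by (simp only: Suc_eq_plus1)
qed

text \<open>With \<open>c\<close> the inner product of two consecutive unit roots, the rotation has eigenvalue
  \<open>\<xi>\<^sup>2\<close> where \<open>\<xi> + inverse \<xi> = 2 * c\<close>, so \<open>\<xi>\<^sup>2 +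
  inverse (\<xi>\<^sup>2) = 4 * c\<^sup>2 - 2\<close>; genericity of \<open>q\<close> excludes roots of unity
  here, and with them the degenerate case \<open>c\<^sup>2 = 1\<close>.\<close>

lemma reflections_generate:
  assumes A: "mat_algebra ({1..r} \<rightarrow>\<^sub>E C) A"
    and refl: "\<And>i. i \<in> {1..<n} \<Longrightarrow> tens_mat {1..r} C (\<lambda>_. refl_mat C (w i)) \<in> A"
  shows "a \<in> {1..<n} \<Longrightarrow> b \<in> {1..<n} \<Longrightarrow> deriv_mat {1..r} C (wedge C (delta a) (delta b)) \<in> A"
    "a \<in> {1..<n} \<Longrightarrow> tens_mat {1..r} C (\<lambda>_. refl_mat C (delta a)) \<in> A"
proof -
  have eq: "{1..n - 1} = {1..<n}" using n2 by auto
  have step: "deriv_mat {1..r} C (wedge C (w i) (w (Suc i))) \<in> A" if i: "1 \<le> i" "i < n - 1" for i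
  proof -
    let ?c = "ip C (w i) (w (Suc i))"
    have ii: "i \<in> {1..<n}" "Suc i \<in> {1..<n}" using i by auto
    have c2: "?c\<^sup>2 = q / (1 + q)\<^sup>2" by (rule consecutive_product[OF i])
    have cn: "?c\<^sup>2 \<noteq> 1" using root_of_unity_excluded[OF c2, of 1 1] by auto
    obtain \<xi> where \<xi>: "\<xi> \<noteq> 0" "\<xi> + inverse \<xi> = 2 * ?c" by (rule exists_xi)
    have "(\<xi> + inverse \<xi>)\<^sup>2 = \<xi>\<^sup>2 + inverse (\<xi>\<^sup>2) + 2"
      using \<xi>(1) by (simp add: power2_eq_square algebra_simps)
    then have sq: "\<xi>\<^sup>2 + inverse (\<xi>\<^sup>2) = 4 * ?c\<^sup>2 - 2" unfolding \<xi>(2) by (simp add: power_mult_distrib)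
    show ?thesis
    proof (rule rotation_generator_in_algebra[OF A _ _ w_unit[OF ii(1)] w_unit[OF ii(2)] cn \<xi>])
      show "(\<xi>\<^sup>2) ^ k \<noteq> 1" if "k \<ge> 1" for k using root_of_unity_excluded[OF c2 that _ sq] by blast
    qed (use refl ii in auto)
  qed
  note og = orthogonal_group_in_algebra[where m = "n - 1" and w = w and B = "{1..<n}" and C = C and J = "{1..r}" and A = A, unfolded eq]
  show "a \<in> {1..<n} \<Longrightarrow> b \<in> {1..<n} \<Longrightarrow> deriv_mat {1..r} C (wedge C (delta a) (delta b)) \<in> A"
    by (rule og(1)[OF A]) (use n2 w_unit w_supported refl step w_span in auto)
  show "a \<in> {1..<n} \<Longrightarrow> tens_mat {1..r} C (\<lambda>_. refl_mat C (delta a)) \<in> A"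
    by (rule og(2)[OF A]) (use n2 w_unit w_supported refl step w_span in auto)
qed

end

section \<open>The tensor power\<close>

context twin_setting
begin

abbreviation "K \<equiv> {1..r} \<rightarrow>\<^sub>E {0..<n}"

lemma ptens_Tens: "ptens n r x \<in> supported ({1..r} \<rightarrow>\<^sub>E {1..n})"
  by (auto simp: ptens_def supported_def)

lemma ptens_pairing:
  "(\<Sum>k\<in>{1..r} \<rightarrow>\<^sub>E {1..n}. ptens n r x k * ptens n r y k * (\<Prod>j\<in>{1..r}. q ^ (k j - 1))) =
    (\<Prod>j\<in>{1..r}. form n q (x j) (y j))"
proof -
  have "(\<Sum>k\<in>{1..r} \<rightarrow>\<^sub>E {1..n}. ptens n r x k * ptens n r y k * (\<Prod>j\<in>{1..r}. q ^ (k j - 1))) =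
    (\<Sum>k\<in>{1..r} \<rightarrow>\<^sub>E {1..n}. \<Prod>j\<in>{1..r}. x j (k j) * y j (k j) * q ^ (k j - 1))"
    by (intro sum.cong HOL.refl) (simp add: ptens_def prod.distrib)
  also have "\<dots> = (\<Prod>j\<in>{1..r}. form n q (x j) (y j))"
    unfolding form_def by (rule prod_sum_PiE[symmetric]) auto
  finally show ?thesis .
qed

sublocale T: orthonormal "{1..r} \<rightarrow>\<^sub>E {1..n}" "\<lambda>k. \<Prod>j\<in>{1..r}. q ^ (k j - 1)" "{1..r} \<rightarrow>\<^sub>E {0..<n}" "utens n r u"
proof
  fix k l assume kl: "k \<in> K" "l \<in> K"
  have "(\<Prod>j\<in>{1..r}. form n q (u (k j)) (u (l j))) = (\<Prod>j\<in>{1..r}. if k j = l j then 1 else 0)"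
  proof (intro prod.cong HOL.refl)
    fix j assume "j \<in> {1..r}"
    then have "k j \<in> C" "l j \<in> C" using kl by auto
    then show "form n q (u (k j)) (u (l j)) = (if k j = l j then 1 else 0)"
      using E.co_b by (simp only: E_co)
  qed
  also have "\<dots> = (if k = l then 1 else 0)"
  proof (cases "k = l")
    case False
    then obtain j where "j \<in> {1..r}" "k j \<noteq> l j" using kl by (meson PiE_ext)
    then show ?thesis using False by (auto simp: prod_zero_iff)
  qed simp
  finally show "(\<Sum>x\<in>{1..r} \<rightarrow>\<^sub>E {1..n}. utens n r u k x * utens n r u l x * (\<Prod>j\<in>{1..r}. q ^ (x j - 1))) = (if k = l then 1 else 0)"
    unfolding utens_def ptens_pairing .
qed (auto simp: card_PiE utens_def finite_PiE intro: ptens_Tens)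

lemma Tens_V: "Tens n r = supported ({1..r} \<rightarrow>\<^sub>E {1..n})"
  by (simp add: Tens_def)

lemma T_co: "T.co (ptens n r x) l = (\<Prod>j\<in>{1..r}. form n q (x j) (u (l j)))"
  unfolding T.co_def utens_def by (rule ptens_pairing)

lemma ptens_expand:
  "ptens n r (\<lambda>j. \<Sum>a\<in>C. c j a *\<^sub>v u a) = (\<Sum>k\<in>K. (\<Prod>j\<in>{1..r}. c j (k j)) *\<^sub>v utens n r u k)"
proof
  fix x
  show "ptens n r (\<lambda>j. \<Sum>a\<in>C. c j a *\<^sub>v u a) x = (\<Sum>k\<in>K. (\<Prod>j\<in>{1..r}. c j (k j)) *\<^sub>v utens n r u k) x"
  proof (cases "x \<in> {1..r} \<rightarrow>\<^sub>E {1..n}")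
    case True
    have "ptens n r (\<lambda>j. \<Sum>a\<in>C. c j a *\<^sub>v u a) x = (\<Prod>j\<in>{1..r}. \<Sum>a\<in>C. c j a * u a (x j))"
      using True by (simp add: ptens_def sum_apply vscale_apply)
    also have "\<dots> = (\<Sum>k\<in>K. \<Prod>j\<in>{1..r}. c j (k j) * u (k j) (x j))"
      by (rule prod_sum_PiE) auto
    also have "\<dots> = (\<Sum>k\<in>K. (\<Prod>j\<in>{1..r}. c j (k j)) *\<^sub>v utens n r u k) x"
      unfolding sum_apply using True by (intro sum.cong HOL.refl) (simp add: vscale_apply utens_def ptens_def prod.distrib)
    finally show ?thesis .
  qed (auto simp: ptens_def utens_def sum_apply vscale_apply)
qed

lemma ptens_cong: "(\<And>j. j \<in> {1..r} \<Longrightarrow> x j = y j) \<Longrightarrow> ptens n r x = ptens n r y"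
  by (auto simp: ptens_def fun_eq_iff intro!: prod.cong)

text \<open>Both sides expand in the basis of pure tensors of the \<open>u a\<close>, where a tensor product of matrices
  acts factor by factor.\<close>

lemma mat_op_tens_mat_ptens:
  assumes Q: "Q \<in> endo (sp_E n)" and x: "\<And>j. j \<in> {1..r} \<Longrightarrow> x j \<in> sp_E n"
  shows "T.mat_op (tens_mat {1..r} C (\<lambda>_. E.mtx Q)) (ptens n r x) = ptens n r (\<lambda>j. Q (x j))"
proof -
  let ?M = "E.mtx Q"
  have "T.mat_op (tens_mat {1..r} C (\<lambda>_. ?M)) (ptens n r x) =
    (\<Sum>k\<in>K. (\<Sum>l\<in>K. tens_mat {1..r} C (\<lambda>_. ?M) (k, l) * T.co (ptens n r x) l) *\<^sub>v utens n r u k)"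
    unfolding T.mat_op_def using ptens_Tens by simp
  also have "\<dots> = (\<Sum>k\<in>K. (\<Prod>j\<in>{1..r}. \<Sum>b\<in>C. ?M (k j, b) * form n q (x j) (u b)) *\<^sub>v utens n r u k)"
  proof (intro sum.cong HOL.refl arg_cong2[of _ _ _ _ "(*\<^sub>v)"])
    fix k assume k: "k \<in> K"
    have "(\<Sum>l\<in>K. tens_mat {1..r} C (\<lambda>_. ?M) (k, l) * T.co (ptens n r x) l) =
      (\<Sum>l\<in>K. \<Prod>j\<in>{1..r}. ?M (k j, l j) * form n q (x j) (u (l j)))"
      using k by (intro sum.cong HOL.refl) (simp add: tens_mat_apply T_co prod.distrib)
    also have "\<dots> = (\<Prod>j\<in>{1..r}. \<Sum>b\<in>C. ?M (k j, b) * form n q (x j) (u b))"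
      by (rule prod_sum_PiE[symmetric]) auto
    finally show "(\<Sum>l\<in>K. tens_mat {1..r} C (\<lambda>_. ?M) (k, l) * T.co (ptens n r x) l) =
      (\<Prod>j\<in>{1..r}. \<Sum>b\<in>C. ?M (k j, b) * form n q (x j) (u b))" .
  qed
  also have "\<dots> = ptens n r (\<lambda>j. \<Sum>a\<in>C. (\<Sum>b\<in>C. ?M (a, b) * form n q (x j) (u b)) *\<^sub>v u a)"
    by (rule ptens_expand[symmetric])
  also have "\<dots> = ptens n r (\<lambda>j. Q (x j))"
  proof (rule ptens_cong)
    fix j assume j: "j \<in> {1..r}"
    have "E.mat_op ?M (x j) = (\<Sum>a\<in>C. (\<Sum>b\<in>C. ?M (a, b) * form n q (x j) (u b)) *\<^sub>v u a)"
      unfolding E.mat_op_def using x[OF j] by (simp add: sp_E_V E_co)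
    moreover have "E.mat_op ?M = Q" using Q by (intro E.mat_op_mtx) (simp add: sp_E_V)
    ultimately show "(\<Sum>a\<in>C. (\<Sum>b\<in>C. ?M (a, b) * form n q (x j) (u b)) *\<^sub>v u a) = Q (x j)" by simp
  qed
  finally show ?thesis .
qed

lemma ptens_delta: "k \<in> {1..r} \<rightarrow>\<^sub>E {1..n} \<Longrightarrow> ptens n r (\<lambda>j. delta (k j)) = delta k"
proof
  fix x assume k: "k \<in> {1..r} \<rightarrow>\<^sub>E {1..n}"
  show "ptens n r (\<lambda>j. delta (k j)) x = delta k x"
  proof (cases "x \<in> {1..r} \<rightarrow>\<^sub>E {1..n} \<and> x \<noteq> k")
    case True
    then obtain j where "j \<in> {1..r}" "x j \<noteq> k j" using k by (meson PiE_ext)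
    then show ?thesis using True by (auto simp: ptens_def delta_def prod_zero_iff)
  next
    case False
    then show ?thesis using k by (cases "x = k") (auto simp: ptens_def delta_def)
  qed
qed

text \<open>The operator is prescribed on the pure tensors of the standard basis, and a product operator acts on all
  pure tensors at once.\<close>

lemma tens_op_matrix:
  assumes Q: "Q \<in> endo (sp_E n)"
  shows "tens_op n r Q = T.mat_op (tens_mat {1..r} C (\<lambda>_. E.mtx Q))"
proof -
  let ?P = "{1..r} \<rightarrow>\<^sub>E {1..n}"
  interpret TD: orthonormal ?P "\<lambda>_. 1" ?P "\<lambda>k. ptens n r (\<lambda>j. delta (k j))"
  proof
    fix k l assume kl: "k \<in> ?P" "l \<in> ?P"
    have "(\<Sum>x\<in>?P. ptens n r (\<lambda>j. delta (k j)) x * ptens n r (\<lambda>j. delta (l j)) x * 1) =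
      (\<Sum>x\<in>?P. if x = k then if k = l then 1 else 0 else 0)"
      unfolding ptens_delta[OF kl(1)] ptens_delta[OF kl(2)] by (intro sum.cong HOL.refl) (auto simp: delta_def)
    then show "(\<Sum>x\<in>?P. ptens n r (\<lambda>j. delta (k j)) x * ptens n r (\<lambda>j. delta (l j)) x * 1) = (if k = l then 1 else 0)"
      using kl by (simp add: finite_PiE)
  qed (auto simp: finite_PiE intro: ptens_Tens)
  show ?thesis
    unfolding tens_op_def Tens_V
  proof (rule TD.endo_eqI)
    show "lin_ext (supported ?P) ?P (\<lambda>k. ptens n r (\<lambda>j. delta (k j))) (\<lambda>k. ptens n r (\<lambda>j. Q (delta (k j)))) \<in> endo (supported ?P)"
      by (rule lin_ext(1)[OF TD.basis ptens_Tens])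
    show "T.mat_op (tens_mat {1..r} C (\<lambda>_. E.mtx Q)) \<in> endo (supported ?P)" by simp
    fix k assume k: "k \<in> ?P"
    have "delta (k j) \<in> sp_E n" if "j \<in> {1..r}" for j
    proof -
      have "k j \<in> {1..n}" using k that by auto
      then show ?thesis by (auto simp: sp_E_def supported_def delta_def)
    qed
    then show "lin_ext (supported ?P) ?P (\<lambda>k. ptens n r (\<lambda>j. delta (k j))) (\<lambda>k. ptens n r (\<lambda>j. Q (delta (k j)))) (ptens n r (\<lambda>j. delta (k j))) =
      T.mat_op (tens_mat {1..r} C (\<lambda>_. E.mtx Q)) (ptens n r (\<lambda>j. delta (k j)))"
      unfolding lin_ext(2)[OF TD.basis ptens_Tens k] by (subst mat_op_tens_mat_ptens[OF Q]) auto
  qed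
qed

section \<open>The matrices of the generators\<close>

lemma n_single_gens:
  "n_single (perm_diag r \<sigma>) = 0" "k \<noteq> l \<Longrightarrow> n_single (arc_diag r k l) = 0" "n_single (p_diag r j) = 2" "n_single (strands {1..r}) = 0"
proof -
  have "{x. {x} \<in> perm_diag r \<sigma>} = {}" by (auto simp: perm_diag_def)
  then show "n_single (perm_diag r \<sigma>) = 0" by (simp only: n_single_def card.empty)
  have "{x. {x} \<in> strands {1..r}} = {}" by (auto simp: strands_def)
  then show "n_single (strands {1..r}) = 0" by (simp only: n_single_def card.empty)
  show "n_single (arc_diag r k l) = 0" if "k \<noteq> l"
  proof -
    have "{x. {x} \<in> arc_diag r k l} = {}" using that by (auto simp: arc_diag_def strands_def)
    then show ?thesis by (simp only: n_single_def card.empty)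
  qed
  have "{x. {x} \<in> p_diag r j} = {Inl j, Inr j}" by (auto simp: p_diag_def strands_def)
  then show "n_single (p_diag r j) = 2" by (simp add: n_single_def)
qed

lemma diag_mat_one: "diag_mat r n t (strands {1..r}) = mone K"
proof (rule mats_eqI[of _ K])
  fix k l assume kl: "k \<in> K" "l \<in> K"
  have "(\<forall>i\<in>{1..r}. l i = k i) \<longleftrightarrow> k = l"
  proof
    assume "\<forall>i\<in>{1..r}. l i = k i"
    then show "k = l" by (intro PiE_ext[OF kl]) simp
  qed simp
  then show "diag_mat r n t (strands {1..r}) (k, l) = mone K (k, l)"
    using kl by (simp add: diag_mat_def compat_strands n_single_gens mone_apply)
qed simp_all

text \<open>The sum collapses to the one row in which a column of a permutation-like matrix is nonzero.\<close>

lemma sum_select: "x \<in> K \<Longrightarrow> (\<Sum>k\<in>K. (if k = x then c else 0) *\<^sub>v F k) = c *\<^sub>v F x" for F :: "(nat \<Rightarrow> nat) \<Rightarrow> 'a \<Rightarrow> complex"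
proof -
  assume x: "x \<in> K"
  have "(\<Sum>k\<in>K. (if k = x then c else 0) *\<^sub>v F k) = (\<Sum>k\<in>K. if k = x then c *\<^sub>v F x else 0)"
  proof (rule sum.cong[OF HOL.refl])
    show "(if k = x then c else 0) *\<^sub>v F k = (if k = x then c *\<^sub>v F x else 0)" for k
      by (cases "k = x") simp_all
  qed
  then show ?thesis using x by (simp add: finite_PiE)
qed

lemma sbar_matrix: "i \<in> {1..<r} \<Longrightarrow> sbar n r u i = T.mat_op (diag_mat r n t (s_diag r i))"
  unfolding sbar_def Tens_V
proof (rule T.lin_ext_mat_op)
  fix l assume i: "i \<in> {1..<r}" and l: "l \<in> K"
  let ?t = "transpose i (i + 1)"
  have tp: "?t permutes {1..r}" using i by (intro transpose_permutes) auto
  have tin: "?t j \<in> {1..r} \<longleftrightarrow> j \<in> {1..r}" for j using tp by (rule permutes_in_image)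
  have lt: "l \<circ> ?t \<in> K"
  proof (rule PiE_I)
    show "(l \<circ> ?t) j \<in> {0..<n}" if "j \<in> {1..r}" for j using PiE_mem[OF l, of "?t j"] tin that by simp
    show "(l \<circ> ?t) j = undefined" if "j \<notin> {1..r}" for j
    proof -
      have "?t j \<notin> {1..r}" unfolding tin using that .
      then show ?thesis unfolding o_apply by (rule PiE_arb[OF l])
    qed
  qed
  have "diag_mat r n t (s_diag r i) (k, l) = (if k = l \<circ> ?t then 1 else 0)" if k: "k \<in> K" for k
  proof -
    have "(\<forall>j\<in>{1..r}. l j = k (?t j)) \<longleftrightarrow> k = l \<circ> ?t"
    proof
      assume h: "\<forall>j\<in>{1..r}. l j = k (?t j)"
      have "k j = (l \<circ> ?t) j" if "j \<in> {1..r}" for j using h tin[of j] that by simp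
      then show "k = l \<circ> ?t" by (rule PiE_ext[OF k lt])
    qed simp
    then show ?thesis using k l i by (simp add: diag_mat_def s_diag_perm_diag compat_perm_diag n_single_gens)
  qed
  then have "(\<Sum>k\<in>K. diag_mat r n t (s_diag r i) (k, l) *\<^sub>v utens n r u k) = (\<Sum>k\<in>K. (if k = l \<circ> ?t then 1 else 0) *\<^sub>v utens n r u k)"
    by (intro sum.cong HOL.refl) simp
  then show "utens n r u (l \<circ> ?t) = (\<Sum>k\<in>K. diag_mat r n t (s_diag r i) (k, l) *\<^sub>v utens n r u k)"
    unfolding sum_select[OF lt] by simp
qed

lemma ebar_matrix: "i \<in> {1..<r} \<Longrightarrow> ebar n r u i = T.mat_op (diag_mat r n t (e_diag r i))"
  unfolding ebar_def Tens_V
proof (rule T.lin_ext_mat_op)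
  fix l assume i: "i \<in> {1..<r}" and l: "l \<in> K"
  have ii: "i \<in> {1..r}" "i + 1 \<in> {1..r}" "i \<noteq> i + 1" using i by auto
  let ?k = "\<lambda>m. l(i := m, i + 1 := m)"
  have kK: "?k m \<in> K" if "m \<in> C" for m using l ii that by (intro upd_in_PiE) auto
  have M: "diag_mat r n t (e_diag r i) (k, l) = (if l i = l (i + 1) then if k = ?k (k i) then 1 else 0 else 0)" if k: "k \<in> K" for k
  proof -
    have "k i = k (i + 1) \<and> (\<forall>j\<in>{1..r} - {i, i + 1}. l j = k j) \<longleftrightarrow> k = ?k (k i)"
    proof
      assume h: "k i = k (i + 1) \<and> (\<forall>j\<in>{1..r} - {i, i + 1}. l j = k j)"
      have ki: "k i \<in> C" using k ii by auto
      show "k = ?k (k i)" by (rule PiE_ext[OF k kK[OF ki]]) (use h in auto)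
    next
      assume h: "k = ?k (k i)"
      show "k i = k (i + 1) \<and> (\<forall>j\<in>{1..r} - {i, i + 1}. l j = k j)"
      proof (intro conjI ballI)
        have "k j = ?k (k i) j" for j using h by (rule fun_cong)
        from this[of "i + 1"] show "k i = k (i + 1)" by simp
        show "l j = k j" if "j \<in> {1..r} - {i, i + 1}" for j
          using \<open>\<And>j. k j = ?k (k i) j\<close>[of j] that by simp
      qed
    qed
    then show ?thesis using k l ii by (simp add: diag_mat_def e_diag_arc_diag compat_arc_diag n_single_gens)
  qed
  show "(if l i = l (i + 1) then 1 else 0) *\<^sub>v (\<Sum>m=0..<n. utens n r u (?k m)) =
    (\<Sum>k\<in>K. diag_mat r n t (e_diag r i) (k, l) *\<^sub>v utens n r u k)"
  proof (cases "l i = l (i + 1)")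
    case True
    have inj: "inj_on ?k C"
    proof (rule inj_onI)
      fix a b assume "?k a = ?k b"
      then have "?k a (i + 1) = ?k b (i + 1)" by (rule fun_cong)
      then show "a = b" by simp
    qed
    have "(\<Sum>k\<in>K. diag_mat r n t (e_diag r i) (k, l) *\<^sub>v utens n r u k) = (\<Sum>k\<in>?k ` C. diag_mat r n t (e_diag r i) (k, l) *\<^sub>v utens n r u k)"
    proof (rule sum.mono_neutral_right)
      show "\<forall>k\<in>K - ?k ` C. diag_mat r n t (e_diag r i) (k, l) *\<^sub>v utens n r u k = 0"
      proof
        fix k assume k: "k \<in> K - ?k ` C"
        then have "k i \<in> C" using ii by auto
        then have "k \<noteq> ?k (k i)" using k by blast
        then show "diag_mat r n t (e_diag r i) (k, l) *\<^sub>v utens n r u k = 0" using M[of k] k by simp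
      qed
      show "finite K" by (simp add: finite_PiE)
      show "?k ` C \<subseteq> K" by (rule image_subsetI) (rule kK)
    qed
    also have "\<dots> = (\<Sum>m\<in>C. diag_mat r n t (e_diag r i) (?k m, l) *\<^sub>v utens n r u (?k m))"
      using inj by (simp add: sum.reindex)
    also have "\<dots> = (\<Sum>m=0..<n. utens n r u (?k m))"
    proof (rule sum.cong[OF HOL.refl])
      fix m assume m: "m \<in> C"
      have "diag_mat r n t (e_diag r i) (?k m, l) = 1" unfolding M[OF kK[OF m]] using True ii by simp
      then show "diag_mat r n t (e_diag r i) (?k m, l) *\<^sub>v utens n r u (?k m) = utens n r u (?k m)" by (simp only: cfun.scale_one)
    qed
    finally show ?thesis using True by simp
  next
    case False
    then have "(\<Sum>k\<in>K. diag_mat r n t (e_diag r i) (k, l) *\<^sub>v utens n r u k) = (\<Sum>k\<in>K. 0)"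
      by (intro sum.cong HOL.refl) (simp add: M)
    then show ?thesis using False by simp
  qed
qed

lemma proj_char: "proj n q x = (form n q x (ell0 n) / qint q n) *\<^sub>v ell0 n"
  unfolding proj_def
proof (rule the_equality)
  let ?c = "form n q x (ell0 n) / qint q n"
  have L: "y \<in> sp_L n \<longleftrightarrow> (\<exists>c. y = c *\<^sub>v ell0 n)" for y
    unfolding sp_L_def using cfun.span_singleton[of "ell0 n"] by auto
  show "?c *\<^sub>v ell0 n \<in> sp_L n \<and> (\<forall>z\<in>sp_L n. form n q (x - ?c *\<^sub>v ell0 n) z = 0)"
    unfolding L using qn by (auto simp: L form_linear form_ell0(2))
  fix y assume y: "y \<in> sp_L n \<and> (\<forall>z\<in>sp_L n. form n q (x - y) z = 0)"
  then obtain c where c: "y = c *\<^sub>v ell0 n" unfolding L by blast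
  have "ell0 n \<in> sp_L n" unfolding L by (rule exI[of _ 1]) simp
  then have "form n q (x - y) (ell0 n) = 0" using y by blast
  then have "form n q x (ell0 n) = c * qint q n" by (simp add: c form_linear form_ell0(2))
  then show "y = ?c *\<^sub>v ell0 n" using qn by (simp add: c)
qed

lemma proj_u: "proj n q (u 0) = u 0" "a \<in> {1..<n} \<Longrightarrow> proj n q (u a) = 0"
proof -
  have e: "ell0 n = root_n *\<^sub>v u 0" unfolding u0 using root0 by (simp add: cfun.scale_scale)
  have 0: "0 \<in> C" using n2 by simp
  have f: "form n q (u a) (ell0 n) = root_n * (if a = 0 then 1 else 0)" if "a \<in> C" for a
    unfolding e form_linear using E.co_b[OF that 0] by (simp add: E_co)
  have q2: "root_n * root_n = qint q n" using root by (simp add: power2_eq_square)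
  show "proj n q (u 0) = u 0" unfolding proj_char f[OF 0] using root0 by (simp add: e cfun.scale_scale flip: q2)
  show "proj n q (u a) = 0" if "a \<in> {1..<n}"
  proof -
    have "form n q (u a) (ell0 n) = 0" using f[of a] that by simp
    then show ?thesis unfolding proj_char by simp
  qed
qed

text \<open>The diagram has two isolated vertices, each of weight \<open>t\<close>, which accounts for the factor
  \<open>\<delta>'\<close>.\<close>

lemma pbar_matrix:
  assumes j: "j \<in> {1..r}" and t: "t\<^sup>2 = \<delta>'"
  shows "(\<lambda>x\<in>Tens n r. \<delta>' *\<^sub>v pbar n q r u j x) = T.mat_op (diag_mat r n t (p_diag r j))"
proof -
  define M :: "(nat \<Rightarrow> nat) \<times> (nat \<Rightarrow> nat) \<Rightarrow> complex" where "M = (\<lambda>(k, l). if k = l \<and> l j = 0 then 1 else (0::complex))"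
  have p: "pbar n q r u j = T.mat_op M"
    unfolding pbar_def Tens_V
  proof (rule T.lin_ext_mat_op)
    fix l assume l: "l \<in> K"
    have lj: "l j \<in> C" using l j by auto
    have "(\<Sum>k\<in>K. M (k, l) *\<^sub>v utens n r u k) = (\<Sum>k\<in>K. (if k = l then if l j = 0 then 1 else 0 else 0) *\<^sub>v utens n r u k)"
      by (intro sum.cong HOL.refl) (simp add: M_def)
    also have "\<dots> = (if l j = 0 then 1 else 0) *\<^sub>v utens n r u l" by (rule sum_select[OF l])
    also have "\<dots> = ptens n r ((\<lambda>a. u (l a))(j := proj n q (u (l j))))"
    proof (cases "l j = 0")
      case True
      then have "(\<lambda>a. u (l a))(j := proj n q (u (l j))) = (\<lambda>a. u (l a))" by (auto simp: proj_u)
      then show ?thesis using True by (simp add: utens_def)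
    next
      case False
      then have "l j \<in> {1..<n}" using lj by auto
      then have "proj n q (u (l j)) = 0" by (rule proj_u(2))
      then have "(\<Prod>i\<in>{1..r}. ((\<lambda>a. u (l a))(j := proj n q (u (l j)))) i (x i)) = 0" for x
        using j by (auto simp: prod_zero_iff intro!: bexI[of _ j])
      then have "ptens n r ((\<lambda>a. u (l a))(j := proj n q (u (l j)))) = 0"
        unfolding ptens_def by (simp only: if_cancel) (simp only: zero_fun_def)
      then show ?thesis using False by (simp only: if_False cfun.scale_zero_left)
    qed
    finally show "ptens n r ((\<lambda>a. u (l a))(j := proj n q (u (l j)))) = (\<Sum>k\<in>K. M (k, l) *\<^sub>v utens n r u k)" ..
  qed
  have "T.mat_op (diag_mat r n t (p_diag r j)) = T.mat_op (\<delta>' *\<^sub>v M)"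
  proof -
    have e: "diag_mat r n t (p_diag r j) (k, l) = (\<delta>' *\<^sub>v M) (k, l)" if kl: "k \<in> K" "l \<in> K" for k l
    proof -
      have "l j = 0 \<and> k j = 0 \<and> (\<forall>i\<in>{1..r} - {j}. l i = k i) \<longleftrightarrow> k = l \<and> l j = 0"
      proof
        assume h: "l j = 0 \<and> k j = 0 \<and> (\<forall>i\<in>{1..r} - {j}. l i = k i)"
        have "k i = l i" if "i \<in> {1..r}" for i using h that by (cases "i = j") auto
        then have "k = l" by (rule PiE_ext[OF kl])
        then show "k = l \<and> l j = 0" using h by simp
      qed auto
      then show ?thesis using kl t by (auto simp: diag_mat_def compat_p_diag n_single_gens M_def vscale_apply)
    qed
    show ?thesis unfolding T.mat_op_def by (intro restrict_ext sum.cong HOL.refl arg_cong2[of _ _ _ _ "(*\<^sub>v)"] arg_cong2[of _ _ _ _ "(*)"] e)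
  qed
  also have "\<dots> = (\<lambda>x\<in>Tens n r. \<delta>' *\<^sub>v pbar n q r u j x)"
  proof
    fix x show "T.mat_op (\<delta>' *\<^sub>v M) x = (\<lambda>x\<in>Tens n r. \<delta>' *\<^sub>v pbar n q r u j x) x"
      by (cases "x \<in> Tens n r") (simp_all add: Tens_V T.mat_op_linear p, simp add: T.mat_op_def)
  qed
  finally show ?thesis ..
qed

end

section \<open>Images and centralizers in terms of matrices\<close>

context orthonormal
begin

lemma mat_op_sum: "x \<in> V \<Longrightarrow> mat_op (\<Sum>i\<in>S. c i *\<^sub>v F i) x = (\<Sum>i\<in>S. c i *\<^sub>v mat_op (F i) x)"
proof (induction S rule: infinite_finite_induct)
  case (insert i S)
  then show ?case by (simp only: sum.insert[OF insert.hyps] mat_op_linear[OF insert.prems])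
qed (simp_all add: mat_op_def)

lemma mat_op_lin: "x \<in> V \<Longrightarrow> mat_op (lin F a) x = (\<Sum>i | a i \<noteq> 0. a i *\<^sub>v mat_op (F i) x)"
  unfolding lin_def by (rule mat_op_sum)

lemma mat_op_outside: "x \<notin> V \<Longrightarrow> mat_op M x = undefined"
  by (rule endo_linear(4)[OF mat_op_endo])

text \<open>Centralizers can be computed with matrices, as the dictionary between operators and matrices is
  multiplicative and injective.\<close>

lemma centralizer_mat_op:
  assumes Y: "Y \<subseteq> mats J"
  shows "centralizer V (mat_op ` Y) = mat_op ` {M \<in> mats J. \<forall>N\<in>Y. mm J M N = mm J N M}"
proof -
  have comm: "compose V (mat_op M) (mat_op N) = compose V (mat_op N) (mat_op M) \<longleftrightarrow> mm J M N = mm J N M" for M N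
    unfolding mat_op_mm[symmetric] by (intro mat_op_cong[symmetric] mm_mats)
  show ?thesis
  proof (intro equalityI subsetI)
    fix T assume T: "T \<in> centralizer V (mat_op ` Y)"
    then have e: "mat_op (mtx T) = T" by (intro mat_op_mtx) (simp add: centralizer_def)
    have "mm J (mtx T) N = mm J N (mtx T)" if "N \<in> Y" for N
      using T that unfolding comm[symmetric] e centralizer_def by blast
    then show "T \<in> mat_op ` {M \<in> mats J. \<forall>N\<in>Y. mm J M N = mm J N M}"
      using e by (intro image_eqI[of _ _ "mtx T"]) simp_all
  next
    fix T assume "T \<in> mat_op ` {M \<in> mats J. \<forall>N\<in>Y. mm J M N = mm J N M}"
    then obtain M where M: "T = mat_op M" "\<And>N. N \<in> Y \<Longrightarrow> mm J M N = mm J N M" by blast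
    show "T \<in> centralizer V (mat_op ` Y)"
      unfolding centralizer_def M(1) using M(2) by (auto simp: comm)
  qed
qed

end

lemma lin_commute:
  assumes "\<And>x y. x \<in> B \<Longrightarrow> y \<in> B' \<Longrightarrow> mm J (F x) (H y) = mm J (H y) (F x)" "a \<in> fin_supp B" "b \<in> fin_supp B'"
  shows "mm J (lin F a) (lin H b) = mm J (lin H b) (lin F a)"
proof -
  have aB: "x \<in> B" if "a x \<noteq> 0" for x using that assms(2) by (auto simp: fin_supp_def supported_def)
  have bB: "x \<in> B'" if "b x \<noteq> 0" for x using that assms(3) by (auto simp: fin_supp_def supported_def)
  have "mm J (lin F a) (lin H b) = (\<Sum>y | b y \<noteq> 0. \<Sum>x | a x \<noteq> 0. b y *\<^sub>v a x *\<^sub>v mm J (F x) (H y))"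
    unfolding lin_def mm_sum mm_linear(5,6) by (simp only: cfun.scale_sum_right)
  also have "\<dots> = (\<Sum>y | b y \<noteq> 0. \<Sum>x | a x \<noteq> 0. a x *\<^sub>v b y *\<^sub>v mm J (H y) (F x))"
  proof (intro sum.cong HOL.refl)
    fix x y assume "x \<in> {x. a x \<noteq> 0}" "y \<in> {y. b y \<noteq> 0}"
    then have "mm J (F x) (H y) = mm J (H y) (F x)" using aB bB by (intro assms(1)) simp_all
    then show "b y *\<^sub>v a x *\<^sub>v mm J (F x) (H y) = a x *\<^sub>v b y *\<^sub>v mm J (H y) (F x)"
      by (simp add: cfun.scale_scale mult.commute)
  qed
  also have "\<dots> = (\<Sum>x | a x \<noteq> 0. \<Sum>y | b y \<noteq> 0. a x *\<^sub>v b y *\<^sub>v mm J (H y) (F x))" by (rule sum.swap)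
  also have "\<dots> = mm J (lin H b) (lin F a)"
    unfolding lin_def mm_sum mm_linear(5,6) by (simp only: cfun.scale_sum_right)
  finally show ?thesis .
qed

lemma delta_mult:
  "(\<Sum>x | delta d1 x \<noteq> 0. \<Sum>y | delta d2 y \<noteq> 0. (delta d1 x * delta d2 y * c x y) *\<^sub>v delta (m x y)) = c d1 d2 *\<^sub>v delta (m d1 d2)"
proof -
  have "{x. delta d x \<noteq> 0} = {d}" for d :: 'a by (auto simp: delta_def)
  then show ?thesis by (simp add: delta_def)
qed

text \<open>A linear action of an algebra is determined by the basis elements.\<close>

lemma linear_action_lin:
  assumes \<phi>: "linear_action (basis_algebra B c m e) V \<phi>" and a: "a \<in> fin_supp B" and v: "v \<in> V"
  shows "\<phi> a v = (\<Sum>x | a x \<noteq> 0. a x *\<^sub>v \<phi> (delta x) v)"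
proof -
  have add: "\<phi> (x + y) v = \<phi> x v + \<phi> y v" if "x \<in> fin_supp B" "y \<in> fin_supp B" for x y
    using \<phi> that v unfolding linear_action_def basis_algebra_simps by blast
  have scale: "\<phi> (s *\<^sub>v x) v = s *\<^sub>v \<phi> x v" if "x \<in> fin_supp B" for s x
    using \<phi> that v unfolding linear_action_def basis_algebra_simps by blast
  have 0: "\<phi> 0 v = 0"
    using scale[OF cfun.subspace_0[OF fin_supp_subspace], of 0] by (simp only: cfun.scale_zero_left)
  have dB: "delta x \<in> fin_supp B" if "a x \<noteq> 0" for x
    using that a by (intro delta_fin_supp) (auto simp: fin_supp_def supported_def)
  have "\<phi> (\<Sum>x\<in>S. a x *\<^sub>v delta x) v = (\<Sum>x\<in>S. a x *\<^sub>v \<phi> (delta x) v)" if "finite S" "S \<subseteq> {x. a x \<noteq> 0}" for S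
    using that
  proof (induction S rule: finite_induct)
    case (insert x S)
    have x: "a x *\<^sub>v delta x \<in> fin_supp B" using insert.prems by (intro cfun.subspace_scale[OF fin_supp_subspace] dB) simp
    have S: "(\<Sum>x\<in>S. a x *\<^sub>v delta x) \<in> fin_supp B"
      using insert.prems by (intro cfun.subspace_sum[OF fin_supp_subspace] cfun.subspace_scale[OF fin_supp_subspace] dB) auto
    have "\<phi> (\<Sum>x\<in>S. a x *\<^sub>v delta x) v = (\<Sum>x\<in>S. a x *\<^sub>v \<phi> (delta x) v)" using insert by simp
    moreover have "\<phi> (a x *\<^sub>v delta x) v = a x *\<^sub>v \<phi> (delta x) v" using insert.prems by (intro scale dB) simp
    ultimately show ?case by (simp only: sum.insert[OF insert.hyps] add[OF x S])
  qed (simp only: sum.empty 0)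
  from this[of "{x. a x \<noteq> 0}"] show ?thesis
    using fin_supp_expand[OF a] a by (simp add: fin_supp_def)
qed

lemma pb_comp_closed: "d \<in> pb_diagrams r \<Longrightarrow> d' \<in> pb_diagrams r \<Longrightarrow> pb_comp r d d' \<in> pb_diagrams r"
proof -
  assume "d \<in> pb_diagrams r" "d' \<in> pb_diagrams r"
  then interpret stack r d d' by unfold_locales
  show ?thesis by (rule pb_comp_diagram)
qed

lemma gen_diagrams_pb: "d \<in> gen_diagrams r \<Longrightarrow> d \<in> pb_diagrams r"
proof (induction rule: gen_diagrams.induct)
  case one
  show ?case unfolding strands_perm_diag by (rule perm_diag_diagram[OF permutes_id])
next
  case (s i)
  then have "transpose i (i + 1) permutes {1..r}" by (intro transpose_permutes) auto
  then show ?case unfolding s_diag_perm_diag[OF s] by (rule perm_diag_diagram)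
next
  case (e i)
  then show ?case unfolding e_diag_arc_diag by (intro arc_diag_diagram) auto
next
  case (p j)
  then show ?case by (rule p_diag_diagram)
next
  case (comp d d')
  show ?case by (rule pb_comp_closed) (fact comp.IH)+
qed

lemma star_tens_mat: "star (tens_mat J C g) = tens_mat J C (\<lambda>j. star (g j))"
  by (auto simp: star_def tens_mat_def fun_eq_iff)

lemma star_sum: "star (\<Sum>i\<in>S. M i) = (\<Sum>i\<in>S. star (M i))"
  by (simp add: star_def fun_eq_iff sum_apply)

lemma star_mone: "star (mone C) = mone C"
  by (auto simp: star_def mone_def fun_eq_iff)

lemma star_deriv_mat: "star (deriv_mat J C x) = deriv_mat J C (star x)"
  unfolding deriv_mat_def star_sum star_tens_mat
proof (intro sum.cong HOL.refl arg_cong[of _ _ "tens_mat J C"])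
  show "(\<lambda>i. star (((\<lambda>_. mone C)(j := x)) i)) = (\<lambda>_. mone C)(j := star x)" for j
    by (auto simp: star_mone)
qed

lemma star_minus: "star (M - N) = star M - star N"
  by (simp add: star_def fun_eq_iff)

lemma star_outer1_delta: "star (outer1 C (delta a) (delta b)) = outer1 C (delta b) (delta a)"
proof
  show "star (outer1 C (delta a) (delta b)) p = outer1 C (delta b) (delta a) p" for p
    by (cases p) (simp add: star_def outer1_def delta_def)
qed

lemma star_wedge_delta: "star (wedge C (delta a) (delta b)) = wedge C (delta b) (delta a)"
  by (simp only: wedge_def star_minus star_outer1_delta)

lemma star_refl_mat_delta: "star (refl_mat C (delta a)) = refl_mat C (delta a)"
proof -
  have "star (2 *\<^sub>v M) = 2 *\<^sub>v star M" for M :: "'a \<times> 'a \<Rightarrow> complex"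
    by (simp add: star_def vscale_def fun_eq_iff)
  then show ?thesis by (simp only: refl_mat_def star_minus star_mone star_outer1_delta)
qed

section \<open>The double centralizer\<close>

context twin_setting
begin

text \<open>The matrix of a group element on the tensor power.\<close>

definition group_mat :: "(nat word set \<Rightarrow> (nat \<Rightarrow> complex) \<Rightarrow> nat \<Rightarrow> complex) \<Rightarrow> nat word set \<Rightarrow> (nat \<Rightarrow> nat) \<times> (nat \<Rightarrow> nat) \<Rightarrow> complex" where
  "group_mat \<tau> g = tens_mat {1..r} C (\<lambda>_. E.mtx (\<tau> g))"

text \<open>The image of the group algebra.\<close>

definition group_mats where
  "group_mats \<tau> = cfun.span (group_mat \<tau> ` carrier (TW n))"

text \<open>Generators for the orthogonal Lie algebra and the reflections in the basis vectors. Unlike the image of the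
  group they are visibly closed under the conjugate transpose, because their entries are real in the chosen
  basis.\<close>

definition invariance_tests :: "((nat \<Rightarrow> nat) \<times> (nat \<Rightarrow> nat) \<Rightarrow> complex) set" where
  "invariance_tests = {deriv_mat {1..r} C (wedge C (delta a) (delta b)) | a b. a \<in> {1..<n} \<and> b \<in> {1..<n}} \<union>
     {tens_mat {1..r} C (\<lambda>_. refl_mat C (delta a)) | a. a \<in> {1..<n}}"

lemma finK: "finite K" and finr: "finite {1..r}" and finC: "finite C"
  by (simp_all add: finite_PiE)

lemma n1: "n \<ge> 1" using n2 by simp

lemma group_TW: "group (TW n)"
  unfolding TW_def by (rule group_presented_group)

lemma mtx_id: "E.mtx (\<lambda>x\<in>sp_E n. x) = mone C"
proof (rule mats_eqI[of _ C])
  fix a b assume ab: "a \<in> C" "b \<in> C"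
  have "u b \<in> sp_E n" using E.b_in[OF ab(2)] by (simp add: sp_E_V)
  then show "E.mtx (\<lambda>x\<in>sp_E n. x) (a, b) = mone C (a, b)"
    using ab E.co_b[OF ab(2,1)] by (simp add: E.mtx_def mone_apply)
qed simp_all

lemma tens_mat_mtx_compose:
  assumes "S \<in> endo (sp_E n)" "T \<in> endo (sp_E n)"
  shows "tens_mat {1..r} C (\<lambda>_. E.mtx (compose (sp_E n) S T)) =
    mm K (tens_mat {1..r} C (\<lambda>_. E.mtx S)) (tens_mat {1..r} C (\<lambda>_. E.mtx T))"
  using assms unfolding tens_mat_mm[OF finr finC] sp_E_V by (simp only: E.mtx_compose)

lemma tens_mat_mtx_id: "tens_mat {1..r} C (\<lambda>_. E.mtx (\<lambda>x\<in>sp_E n. x)) = mone K"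
  unfolding mtx_id by (rule tens_mat_one[OF finr])

lemma tw_gen_carrier: "i \<in> {1..<n} \<Longrightarrow> tw_gen n i \<in> carrier (TW n)"
  by (auto simp: tw_gen_def TW_def presented_group_def words_def intro!: quotientI)

lemma word_class:
  assumes "g \<in> carrier (TW n)" obtains v where "v \<in> words {1..<n}" "g = pres_rel {1..<n} (twin_rels n) `` {v}"
  using assms by (auto simp: TW_def presented_group_def quotient_def)

lemma diag_mat_group_algebra_mult:
  assumes "a \<in> fin_supp (pb_diagrams r)" "b \<in> fin_supp (pb_diagrams r)" and t: "t\<^sup>2 = \<delta>'"
  shows "lin (diag_mat r n t) (a \<otimes>\<^bsub>PB r (of_nat n) \<delta>'\<^esub> b) = mm K (lin (diag_mat r n t) b) (lin (diag_mat r n t) a)"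
  unfolding PB_def basis_algebra_simps
proof (rule lin_mult[where P = "\<lambda>M N. mm K N M" and B = "pb_diagrams r"])
  show "pb_comp r d d' \<in> pb_diagrams r" if "d \<in> pb_diagrams r" "d' \<in> pb_diagrams r" for d d'
    using that by (rule pb_comp_closed)
  show "mm K (diag_mat r n t y) (diag_mat r n t x) = (of_nat n ^ n_loops r x y * \<delta>' ^ n_nonloops r x y) *\<^sub>v diag_mat r n t (pb_comp r x y)"
    if "x \<in> pb_diagrams r" "y \<in> pb_diagrams r" for x y
    using diag_mat_mult[OF that n1, of t] unfolding t .
qed (simp_all only: assms mm_sum mm_linear)

lemma strands_diagram: "strands {1..r} \<in> pb_diagrams r"
  by (rule gen_diagrams_pb[OF gen_diagrams.one])

context
  fixes \<tau> assumes \<tau>: "tw_rep n q \<tau>"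
begin

lemma \<tau>_endo: "g \<in> carrier (TW n) \<Longrightarrow> \<tau> g \<in> endo (sp_E n)"
  using \<tau> GL_hom_properties(1) by (auto simp: tw_rep_def)

lemma group_mat_mult: "g \<in> carrier (TW n) \<Longrightarrow> h \<in> carrier (TW n) \<Longrightarrow> group_mat \<tau> (g \<otimes>\<^bsub>TW n\<^esub> h) = mm K (group_mat \<tau> g) (group_mat \<tau> h)"
proof -
  assume gh: "g \<in> carrier (TW n)" "h \<in> carrier (TW n)"
  have "\<tau> (g \<otimes>\<^bsub>TW n\<^esub> h) = compose (sp_E n) (\<tau> g) (\<tau> h)"
    using \<tau> gh by (intro GL_hom_properties(3)) (simp_all add: tw_rep_def)
  then show ?thesis unfolding group_mat_def by (simp only: tens_mat_mtx_compose \<tau>_endo gh)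
qed

lemma group_mat_one: "group_mat \<tau> \<one>\<^bsub>TW n\<^esub> = mone K"
proof -
  have "\<tau> \<one>\<^bsub>TW n\<^esub> = (\<lambda>x\<in>sp_E n. x)" using \<tau> by (intro GL_hom_one group_TW) (simp add: tw_rep_def)
  then show ?thesis unfolding group_mat_def by (simp only: tens_mat_mtx_id)
qed

lemma tw_diag_matrix: "g \<in> carrier (TW n) \<Longrightarrow> tw_diag n r \<tau> g = T.mat_op (group_mat \<tau> g)"
  unfolding tw_diag_def group_mat_def by (intro tens_op_matrix \<tau>_endo)

lemma tw_act_matrix:
  assumes a: "a \<in> fin_supp (carrier (TW n))"
  shows "tw_algebra_act n r \<tau> a = T.mat_op (lin (group_mat \<tau>) a)"
proof
  fix x
  have aB: "g \<in> carrier (TW n)" if "a g \<noteq> 0" for g using that a by (auto simp: fin_supp_def supported_def)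
  show "tw_algebra_act n r \<tau> a x = T.mat_op (lin (group_mat \<tau>) a) x"
  proof (cases "x \<in> Tens n r")
    case True
    have "(\<Sum>g | a g \<noteq> 0. a g *\<^sub>v tw_diag n r \<tau> g x) = (\<Sum>g | a g \<noteq> 0. a g *\<^sub>v T.mat_op (group_mat \<tau> g) x)"
      using aB by (intro sum.cong HOL.refl) (simp add: tw_diag_matrix)
    then show ?thesis using True by (simp add: tw_algebra_act_def extend_action_def T.mat_op_lin Tens_V)
  next
    case False
    then show ?thesis by (simp add: tw_algebra_act_def extend_action_def T.mat_op_outside Tens_V)
  qed
qed

lemma group_algebra_mult:
  assumes "a \<in> fin_supp (carrier (TW n))" "b \<in> fin_supp (carrier (TW n))"
  shows "lin (group_mat \<tau>) (a \<otimes>\<^bsub>group_algebra (TW n)\<^esub> b) = mm K (lin (group_mat \<tau>) a) (lin (group_mat \<tau>) b)"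
  unfolding group_algebra_def basis_algebra_simps
proof (rule lin_mult[where P = "mm K" and B = "carrier (TW n)"])
  interpret group "TW n" by (rule group_TW)
  show "g \<otimes>\<^bsub>TW n\<^esub> h \<in> carrier (TW n)" if "g \<in> carrier (TW n)" "h \<in> carrier (TW n)" for g h
    using that by (rule m_closed)
  show "mm K (group_mat \<tau> g) (group_mat \<tau> h) = 1 *\<^sub>v group_mat \<tau> (g \<otimes>\<^bsub>TW n\<^esub> h)"
    if "g \<in> carrier (TW n)" "h \<in> carrier (TW n)" for g h
    by (simp only: group_mat_mult[OF that] cfun.scale_one)
qed (simp_all only: assms mm_sum mm_linear)

lemma group_algebra_mult_closed:
  assumes "a \<in> fin_supp (carrier (TW n))" "b \<in> fin_supp (carrier (TW n))"
  shows "a \<otimes>\<^bsub>group_algebra (TW n)\<^esub> b \<in> fin_supp (carrier (TW n))"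
proof -
  interpret group "TW n" by (rule group_TW)
  show ?thesis unfolding group_algebra_def basis_algebra_simps using assms by (intro mult_closed) simp_all
qed

lemma group_mats_lin: "group_mats \<tau> = lin (group_mat \<tau>) ` fin_supp (carrier (TW n))"
  unfolding group_mats_def lin_image ..

lemma group_mats_algebra: "mat_algebra K (group_mats \<tau>)"
  unfolding mat_algebra_def
proof (intro conjI ballI)
  show "cfun.subspace (group_mats \<tau>)" unfolding group_mats_def by (rule cfun.subspace_span)
  show "group_mats \<tau> \<subseteq> mats K"
    unfolding group_mats_def by (intro cfun.span_minimal mats_subspace) (auto simp: group_mat_def)
  interpret group "TW n" by (rule group_TW)
  show "mone K \<in> group_mats \<tau>" unfolding group_mats_def
    by (intro cfun.span_base image_eqI[of _ _ "\<one>\<^bsub>TW n\<^esub>"]) (simp_all add: group_mat_one)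
  fix M N assume "M \<in> group_mats \<tau>" "N \<in> group_mats \<tau>"
  then obtain a b where ab: "a \<in> fin_supp (carrier (TW n))" "b \<in> fin_supp (carrier (TW n))"
    and e: "M = lin (group_mat \<tau>) a" "N = lin (group_mat \<tau>) b" unfolding group_mats_lin by blast
  show "mm K M N \<in> group_mats \<tau>"
    unfolding e group_algebra_mult[OF ab, symmetric] group_mats_lin
    by (rule imageI) (rule group_algebra_mult_closed[OF ab])
qed

text \<open>The bridge between the twin group and the orthogonal group.\<close>

lemma tests_group_mats: "invariance_tests \<subseteq> group_mats \<tau>"
proof -
  have refl: "tens_mat {1..r} C (\<lambda>_. refl_mat C (w i)) \<in> group_mats \<tau>" if i: "i \<in> {1..<n}" for i
  proof -
    have "group_mat \<tau> (tw_gen n i) = tens_mat {1..r} C (\<lambda>_. refl_mat C (w i))"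
      using \<tau> i by (simp add: group_mat_def tw_rep_def mtx_Sbar)
    then show ?thesis unfolding group_mats_def by (metis cfun.span_base imageI tw_gen_carrier[OF i])
  qed
  note g = reflections_generate[OF group_mats_algebra refl]
  show ?thesis unfolding invariance_tests_def using g by auto
qed

end

lemma star_tests: "x \<in> invariance_tests \<Longrightarrow> star x \<in> invariance_tests"
  unfolding invariance_tests_def
proof (elim UnE CollectE exE conjE)
  fix a b assume x: "x = deriv_mat {1..r} C (wedge C (delta a) (delta b))" "a \<in> {1..<n}" "b \<in> {1..<n}"
  have "star x = deriv_mat {1..r} C (wedge C (delta b) (delta a))" unfolding x star_deriv_mat star_wedge_delta ..
  then show "star x \<in> {deriv_mat {1..r} C (wedge C (delta a) (delta b)) | a b. a \<in> {1..<n} \<and> b \<in> {1..<n}} \<union>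
     {tens_mat {1..r} C (\<lambda>_. refl_mat C (delta a)) | a. a \<in> {1..<n}}" using x by blast
next
  fix a assume x: "x = tens_mat {1..r} C (\<lambda>_. refl_mat C (delta a))" "a \<in> {1..<n}"
  have "star x = x" unfolding x star_tens_mat star_refl_mat_delta ..
  then show "star x \<in> {deriv_mat {1..r} C (wedge C (delta a) (delta b)) | a b. a \<in> {1..<n} \<and> b \<in> {1..<n}} \<union>
     {tens_mat {1..r} C (\<lambda>_. refl_mat C (delta a)) | a. a \<in> {1..<n}}" using x by auto
qed

text \<open>The generators of the group are involutions subject to far commutation, so they extend to the presented
  group; the diagrams act by their matrices. The two actions commute because every group element is a product
  of reflections that fix \<open>u 0\<close>.\<close>

lemma bimodule_exists:
  assumes t: "t\<^sup>2 = \<delta>'"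
  shows "\<exists>\<tau> \<rho>. tw_pb_bimodule n q r \<delta>' u \<tau> \<rho>"
proof -
  let ?id = "\<lambda>x\<in>sp_E n. x"
  define ev where "ev = (\<lambda>w::nat word. foldr (\<lambda>(x, s). compose (sp_E n) (Sbar n q x)) w ?id)"
  have ev_Cons: "ev ((i, s) # w) = compose (sp_E n) (Sbar n q i) (ev w)" and ev_Nil: "ev [] = ?id" for i s w
    by (simp_all add: ev_def)
  have id: "?id \<in> endo (sp_E n)"
    by (auto simp: endo_def sp_E_V cfun.subspace_add[OF supported_subspace] cfun.subspace_scale[OF supported_subspace])
  have comp_id: "compose (sp_E n) T ?id = T" if T: "T \<in> endo (sp_E n)" for T
  proof
    show "compose (sp_E n) T ?id x = T x" for x
      using endo_linear(4)[OF T] by (cases "x \<in> sp_E n") (simp_all add: compose_def)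
  qed
  have ev1: "ev [(i, s)] = Sbar n q i" if "i \<in> {1..<n}" for i s
    unfolding ev_Cons ev_Nil using that by (intro comp_id Sbar_endo)
  obtain \<tau> where \<tau>: "\<tau> \<in> hom (presented_group {1..<n} (twin_rels n)) (GL (sp_E n))"
    and cls: "\<And>w. w \<in> words {1..<n} \<Longrightarrow> \<tau> (pres_rel {1..<n} (twin_rels n) `` {w}) = ev w"
  proof (rule presented_group_hom[of "sp_E n" "{1..<n}" "Sbar n q" ev "twin_rels n"])
    show "cfun.subspace (sp_E n)" unfolding sp_E_V by (rule supported_subspace)
    show "ev v = ev w" if "(v, w) \<in> twin_rels n" for v w
      using that unfolding twin_rels_def
    proof (elim UnE CollectE exE conjE)
      fix i assume h: "(v, w) = ([(i, True), (i, True)], [])" and i: "i \<in> {1..<n}"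
      have "ev [(i, True), (i, True)] = ev []" unfolding ev_Cons[of _ _ "[(i, True)]"] ev1[OF i] ev_Nil by (rule Sbar_involution[OF i])
      then show "ev v = ev w" using h by simp
    next
      fix i j assume h: "(v, w) = ([(i, True), (j, True)], [(j, True), (i, True)])" and ij: "i \<in> {1..<n}" "j \<in> {1..<n}" "1 < \<bar>int i - int j\<bar>"
      have "ev [(i, True), (j, True)] = ev [(j, True), (i, True)]"
        unfolding ev_Cons[of _ _ "[(j, True)]"] ev_Cons[of _ _ "[(i, True)]"] ev1[OF ij(1)] ev1[OF ij(2)] by (rule Sbar_far_commute[OF ij])
      then show "ev v = ev w" using h by simp
    qed
  qed (use Sbar_endo Sbar_involution ev_def in auto)
  have rep: "tw_rep n q \<tau>"
    unfolding tw_rep_def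
  proof (intro conjI ballI)
    show "\<tau> \<in> hom (TW n) (GL (sp_E n))" unfolding TW_def by (rule \<tau>)
    fix i assume i: "i \<in> {1..<n}"
    then have "[(i, True)] \<in> words {1..<n}" by (simp add: words_def)
    then show "\<tau> (tw_gen n i) = Sbar n q i" unfolding tw_gen_def by (simp only: cls ev1[OF i])
  qed
  have ev_comm: "ev w \<in> endo (sp_E n) \<and> mm K (tens_mat {1..r} C (\<lambda>_. E.mtx (ev w))) (diag_mat r n t d) = mm K (diag_mat r n t d) (tens_mat {1..r} C (\<lambda>_. E.mtx (ev w)))"
    if "w \<in> words {1..<n}" and d: "d \<in> pb_diagrams r" for w d
    using that(1)
  proof (induction w)
    case Nil
    show ?case unfolding ev_Nil tens_mat_mtx_id using id by (simp only: mm_one[OF finK diag_mat_mats] simp_thms)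
  next
    case (Cons p x)
    obtain i s where p: "p = (i, s)" by (cases p)
    have i: "i \<in> {1..<n}" and x: "x \<in> words {1..<n}" using Cons.prems p by (auto simp: words_def)
    note IH = Cons.IH[OF x]
    let ?S = "tens_mat {1..r} C (\<lambda>_. E.mtx (Sbar n q i))" and ?T = "tens_mat {1..r} C (\<lambda>_. E.mtx (ev x))" and ?D = "diag_mat r n t d"
    have S: "mm K ?S ?D = mm K ?D ?S"
      unfolding mtx_Sbar[OF i] by (rule reflection_commutes_diagram[OF n1 w_unit[OF i] w_supported(2) d])
    have "mm K (mm K ?S ?T) ?D = mm K ?S (mm K ?T ?D)" by (rule mm_assoc)
    also have "\<dots> = mm K ?S (mm K ?D ?T)" using IH by simp
    also have "\<dots> = mm K (mm K ?S ?D) ?T" by (rule mm_assoc[symmetric])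
    also have "\<dots> = mm K ?D (mm K ?S ?T)" unfolding S by (rule mm_assoc)
    finally have "mm K (mm K ?S ?T) ?D = mm K ?D (mm K ?S ?T)" .
    moreover have "ev (p # x) \<in> endo (sp_E n)"
      unfolding p ev_Cons using E.compose_endo Sbar_endo[OF i] IH by (simp add: sp_E_V)
    moreover have "tens_mat {1..r} C (\<lambda>_. E.mtx (ev (p # x))) = mm K ?S ?T"
      unfolding p ev_Cons using IH by (intro tens_mat_mtx_compose Sbar_endo[OF i]) simp
    ultimately show ?case by (simp only: simp_thms)
  qed
  have comm: "mm K (diag_mat r n t d) (group_mat \<tau> g) = mm K (group_mat \<tau> g) (diag_mat r n t d)"
    if "d \<in> pb_diagrams r" "g \<in> carrier (TW n)" for d g
  proof -
    note dg = that
    obtain x where x: "x \<in> words {1..<n}" "g = pres_rel {1..<n} (twin_rels n) `` {x}" by (rule word_class[OF dg(2)])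
    show ?thesis unfolding group_mat_def x(2) cls[OF x(1)] using ev_comm[OF x(1) dg(1)] by simp
  qed
  define \<rho> where "\<rho> = (\<lambda>a. T.mat_op (lin (diag_mat r n t) a))"
  let ?A = "group_algebra (TW n)" and ?B = "PB r (of_nat n) \<delta>'"
  have carA: "carrier ?A = fin_supp (carrier (TW n))" and carB: "carrier ?B = fin_supp (pb_diagrams r)"
    by (simp_all add: group_algebra_def PB_def basis_algebra_simps)
  interpret G: group "TW n" by (rule group_TW)
  have mmv: "T.mat_op (mm K M N) v = T.mat_op M (T.mat_op N v)" if "v \<in> Tens n r" for M N v
    using that by (simp add: T.mat_op_mm Tens_V compose_def)
  have bim: "bimodule ?A ?B (Tens n r) (tw_algebra_act n r \<tau>) \<rho>"
    unfolding bimodule_def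
  proof (intro conjI ballI)
    show "linear_action ?A (Tens n r) (tw_algebra_act n r \<tau>)"
      unfolding group_algebra_def Tens_V
      by (rule T.linear_action_mat_op[where F = "group_mat \<tau>"])
        (simp_all add: group_mat_one[OF rep] tw_act_matrix[OF rep])
    show "linear_action ?B (Tens n r) \<rho>"
      unfolding PB_def Tens_V
    proof (rule T.linear_action_mat_op[where F = "diag_mat r n t"])
      show "pb_comp r d d' \<in> pb_diagrams r" if "d \<in> pb_diagrams r" "d' \<in> pb_diagrams r" for d d'
        using that by (rule pb_comp_closed)
    qed (simp_all add: strands_diagram diag_mat_one \<rho>_def)
    show "tw_algebra_act n r \<tau> (a \<otimes>\<^bsub>?A\<^esub> a') v = tw_algebra_act n r \<tau> a (tw_algebra_act n r \<tau> a' v)"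
      if "a \<in> carrier ?A" "a' \<in> carrier ?A" "v \<in> Tens n r" for a a' v
      using that unfolding carA
      by (simp only: tw_act_matrix[OF rep] group_algebra_mult_closed[OF rep] group_algebra_mult[OF rep] mmv)
    show "\<rho> (b \<otimes>\<^bsub>?B\<^esub> b') v = \<rho> b' (\<rho> b v)"
      if "b \<in> carrier ?B" "b' \<in> carrier ?B" "v \<in> Tens n r" for b b' v
      using that unfolding carB \<rho>_def by (simp only: diag_mat_group_algebra_mult[OF _ _ t] mmv)
    show "\<rho> b (tw_algebra_act n r \<tau> a v) = tw_algebra_act n r \<tau> a (\<rho> b v)"
      if "a \<in> carrier ?A" "b \<in> carrier ?B" "v \<in> Tens n r" for a b v
    proof -
      have "mm K (lin (diag_mat r n t) b) (lin (group_mat \<tau>) a) = mm K (lin (group_mat \<tau>) a) (lin (diag_mat r n t) b)"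
        using that by (intro lin_commute[OF comm]) (simp_all add: carA carB)
      then show ?thesis using that unfolding carA \<rho>_def by (simp only: tw_act_matrix[OF rep] mmv[symmetric])
    qed
  qed
  have "pb_generators_act n q r \<delta>' u \<rho>"
    unfolding pb_generators_act_def \<rho>_def lin_delta
    by (intro conjI ballI; simp only: sbar_matrix[where t = t] ebar_matrix[where t = t] pbar_matrix[OF _ t])
  then have "tw_pb_bimodule n q r \<delta>' u \<tau> \<rho>" unfolding tw_pb_bimodule_def using rep bim by blast
  then show ?thesis by blast
qed

text \<open>All diagrams are products of the generators up to scalars, which are nonzero because \<open>n\<close> and
  \<open>\<delta>'\<close> are. Hence a right action with the prescribed generators sends every diagram to its
  matrix.\<close>

lemma bimodule_matrix:
  assumes bim: "tw_pb_bimodule n q r \<delta>' u \<tau> \<rho>" and t: "t\<^sup>2 = \<delta>'" "t \<noteq> 0"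
  shows "a \<in> fin_supp (pb_diagrams r) \<Longrightarrow> \<rho> a = T.mat_op (lin (diag_mat r n t) a)"
proof -
  let ?B = "PB r (of_nat n) \<delta>'"
  have carB: "carrier ?B = fin_supp (pb_diagrams r)" by (simp add: PB_def basis_algebra_simps)
  have act: "linear_action ?B (Tens n r) \<rho>"
    and mult: "\<And>b b' v. b \<in> fin_supp (pb_diagrams r) \<Longrightarrow> b' \<in> fin_supp (pb_diagrams r) \<Longrightarrow> v \<in> Tens n r \<Longrightarrow>
      \<rho> (b \<otimes>\<^bsub>?B\<^esub> b') v = \<rho> b' (\<rho> b v)"
    using bim unfolding tw_pb_bimodule_def bimodule_def carB by blast+
  have endo: "\<rho> b \<in> endo (Tens n r)" if "b \<in> fin_supp (pb_diagrams r)" for b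
    using act that unfolding linear_action_def carB by blast
  have scale: "\<rho> (c *\<^sub>v b) v = c *\<^sub>v \<rho> b v" if "b \<in> fin_supp (pb_diagrams r)" "v \<in> Tens n r" for b c v
    using act that unfolding linear_action_def PB_def basis_algebra_simps by blast
  have extI: "\<rho> b = T.mat_op M" if "b \<in> fin_supp (pb_diagrams r)" "\<And>v. v \<in> Tens n r \<Longrightarrow> \<rho> b v = T.mat_op M v" for b M
  proof
    show "\<rho> b v = T.mat_op M v" for v
      using that(2)[of v] endo_linear(4)[OF endo[OF that(1)], of v] T.mat_op_outside[of v M]
      by (cases "v \<in> Tens n r") (simp_all add: Tens_V)
  qed
  have gens: "\<And>i. i \<in> {1..<r} \<Longrightarrow> \<rho> (delta (s_diag r i)) = sbar n r u i"
    "\<And>i. i \<in> {1..<r} \<Longrightarrow> \<rho> (delta (e_diag r i)) = ebar n r u i"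
    "\<And>j. j \<in> {1..r} \<Longrightarrow> \<rho> (delta (p_diag r j)) = (\<lambda>x\<in>Tens n r. \<delta>' *\<^sub>v pbar n q r u j x)"
    using bim unfolding tw_pb_bimodule_def pb_generators_act_def by blast+
  have diag: "\<rho> (delta d) = T.mat_op (diag_mat r n t d)" if "d \<in> gen_diagrams r" for d
    using that
  proof induction
    case one
    show ?case
    proof (rule extI)
      show "delta (strands {1..r}) \<in> fin_supp (pb_diagrams r)" by (intro delta_fin_supp strands_diagram)
      fix v assume v: "v \<in> Tens n r"
      have "\<rho> (delta (strands {1..r})) v = v"
        using act v unfolding linear_action_def PB_def basis_algebra_simps by blast
      then show "\<rho> (delta (strands {1..r})) v = T.mat_op (diag_mat r n t (strands {1..r})) v"
        using v by (simp add: diag_mat_one T.mat_op_mone Tens_V)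
    qed
  next
    case (s i)
    then show ?case using gens(1) sbar_matrix by simp
  next
    case (e i)
    then show ?case using gens(2) ebar_matrix by simp
  next
    case (p j)
    then show ?case using gens(3) pbar_matrix[OF p t(1)] by simp
  next
    case (comp d d')
    note dd = comp.hyps[THEN gen_diagrams_pb]
    let ?c = "of_nat n ^ n_loops r d d' * \<delta>' ^ n_nonloops r d d'" and ?e = "pb_comp r d d'"
    have e: "?e \<in> pb_diagrams r" by (rule pb_comp_closed[OF dd])
    have c: "?c \<noteq> 0" using n1 t by auto
    show ?case
    proof (rule extI)
      show "delta ?e \<in> fin_supp (pb_diagrams r)" using e by (rule delta_fin_supp)
      fix v assume v: "v \<in> Tens n r"
      have prod: "delta d \<otimes>\<^bsub>?B\<^esub> delta d' = ?c *\<^sub>v delta ?e"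
        unfolding PB_def basis_algebra_simps delta_mult ..
      have "?c *\<^sub>v \<rho> (delta ?e) v = \<rho> (delta d \<otimes>\<^bsub>?B\<^esub> delta d') v"
        unfolding prod using v by (intro scale[symmetric] delta_fin_supp[OF e])
      also have "\<dots> = T.mat_op (diag_mat r n t d') (T.mat_op (diag_mat r n t d) v)"
        using mult[OF delta_fin_supp[OF dd(1)] delta_fin_supp[OF dd(2)] v] comp.IH by simp
      also have "\<dots> = T.mat_op (mm K (diag_mat r n t d') (diag_mat r n t d)) v"
        using v by (simp add: T.mat_op_mm Tens_V compose_def)
      also have "\<dots> = ?c *\<^sub>v T.mat_op (diag_mat r n t ?e) v"
        unfolding diag_mat_mult[OF dd n1] t(1) using v by (intro T.mat_op_linear(2)) (simp add: Tens_V)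
      finally show "\<rho> (delta ?e) v = T.mat_op (diag_mat r n t ?e) v" using c by (rule cfun.scale_left_imp_eq[rotated])
    qed
  qed
  assume a: "a \<in> fin_supp (pb_diagrams r)"
  show ?thesis
  proof (rule extI[OF a])
    fix v assume v: "v \<in> Tens n r"
    have "\<rho> a v = (\<Sum>d | a d \<noteq> 0. a d *\<^sub>v \<rho> (delta d) v)"
      using act a v unfolding PB_def by (rule linear_action_lin)
    also have "\<dots> = (\<Sum>d | a d \<noteq> 0. a d *\<^sub>v T.mat_op (diag_mat r n t d) v)"
    proof (intro sum.cong HOL.refl)
      fix d assume "d \<in> {d. a d \<noteq> 0}"
      then have "d \<in> pb_diagrams r" using a by (auto simp: fin_supp_def supported_def)
      then show "a d *\<^sub>v \<rho> (delta d) v = a d *\<^sub>v T.mat_op (diag_mat r n t d) v" by (simp only: diag[OF all_generated])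
    qed
    also have "\<dots> = T.mat_op (lin (diag_mat r n t) a) v" using v by (intro T.mat_op_lin[symmetric]) (simp add: Tens_V)
    finally show "\<rho> a v = T.mat_op (lin (diag_mat r n t) a) v" .
  qed
qed

text \<open>Let \<open>M\<close> be the image of the group algebra and \<open>S\<close> the span of the diagram
  matrices. They commute, and what commutes with the Lie algebra elements and reflections in \<open>M\<close>
  is in \<open>S\<close>; this makes \<open>S\<close> the commutant of \<open>M\<close>. Conversely a matrix
  that commutes with \<open>S\<close> commutes with the whole commutant of those elements of \<open>M\<close>,
  and the double commutant theorem puts it in \<open>M\<close>.\<close>

lemma duality:
  assumes bim: "tw_pb_bimodule n q r \<delta>' u \<tau> \<rho>" and t: "t\<^sup>2 = \<delta>'" "t \<noteq> 0"
  shows "tw_algebra_act n r \<tau> ` carrier (group_algebra (TW n)) =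
      centralizer (Tens n r) (\<rho> ` carrier (PB r (of_nat n) \<delta>'))" (is "?i = ?ii")
    and "\<rho> ` carrier (PB r (of_nat n) \<delta>') = centralizer (Tens n r) (tw_diag n r \<tau> ` carrier (TW n))" (is "?iii = ?iv")
    and "inj_on \<rho> (carrier (PB r (of_nat n) \<delta>')) \<longleftrightarrow> n > r"
proof -
  let ?A = "group_algebra (TW n)" and ?B = "PB r (of_nat n) \<delta>'" and ?D = "diag_mat r n t"
  let ?S = "cfun.span (?D ` pb_diagrams r)" and ?M = "group_mats \<tau>"
  have rep: "tw_rep n q \<tau>" using bim by (simp add: tw_pb_bimodule_def)
  have carA: "carrier ?A = fin_supp (carrier (TW n))" and carB: "carrier ?B = fin_supp (pb_diagrams r)"
    by (simp_all add: group_algebra_def PB_def basis_algebra_simps)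
  note \<rho> = bimodule_matrix[OF bim t]
  have imA: "?i = T.mat_op ` ?M"
    unfolding carA group_mats_lin[OF rep] image_image by (intro image_cong HOL.refl tw_act_matrix[OF rep])
  have imB: "?iii = T.mat_op ` ?S"
    unfolding carB lin_image[symmetric] image_image by (intro image_cong HOL.refl \<rho>)
  have imG: "tw_diag n r \<tau> ` carrier (TW n) = T.mat_op ` group_mat \<tau> ` carrier (TW n)"
    unfolding image_image by (intro image_cong HOL.refl tw_diag_matrix[OF rep])
  have MK: "?M \<subseteq> mats K" and Mone: "mone K \<in> ?M" and Mmult: "\<And>M N. M \<in> ?M \<Longrightarrow> N \<in> ?M \<Longrightarrow> mm K M N \<in> ?M" and Msub: "cfun.subspace ?M"
    using group_mats_algebra[OF rep] by (auto simp: mat_algebra_def)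
  have SK: "?S \<subseteq> mats K" by (intro cfun.span_minimal mats_subspace) auto
  have GK: "group_mat \<tau> ` carrier (TW n) \<subseteq> mats K" by (auto simp: group_mat_def)
  have GM: "group_mat \<tau> ` carrier (TW n) \<subseteq> ?M" unfolding group_mats_def by (auto intro: cfun.span_base)
  note XM = tests_group_mats[OF rep]
  have comm: "mm K M N = mm K N M" if M: "M \<in> ?M" and N: "N \<in> ?S" for M N
  proof -
    obtain a where a: "a \<in> fin_supp (carrier (TW n))" "M = lin (group_mat \<tau>) a" using M unfolding group_mats_lin[OF rep] by blast
    obtain b where b: "b \<in> fin_supp (pb_diagrams r)" "N = lin ?D b" using N unfolding lin_image[symmetric] by blast
    have "\<rho> b (tw_algebra_act n r \<tau> a v) = tw_algebra_act n r \<tau> a (\<rho> b v)" if "v \<in> Tens n r" for v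
      using bim that a(1) b(1) unfolding tw_pb_bimodule_def bimodule_def carA carB by blast
    then have "T.mat_op N (T.mat_op M v) = T.mat_op M (T.mat_op N v)" if "v \<in> T.V" for v
      using that by (simp only: \<rho>[OF b(1)] tw_act_matrix[OF rep a(1)] a(2) b(2) Tens_V)
    then have "T.mat_op (mm K N M) = T.mat_op (mm K M N)" unfolding T.mat_op_mm by (auto simp: compose_def)
    then show ?thesis by (subst T.mat_op_cong) simp_all
  qed
  have span: "N \<in> ?S" if "N \<in> mats K" "\<And>x. x \<in> invariance_tests \<Longrightarrow> mm K x N = mm K N x" for N
  proof (rule commutant_in_diagram_span[OF n1 t(2) that(1) invariance_tests_def that(2)])
    show "mm K x (?D d) = mm K (?D d) x" if "x \<in> invariance_tests" "d \<in> pb_diagrams r" for x d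
      using that XM by (intro comm) (auto intro: cfun.span_base)
  qed
  have "?M = {M \<in> mats K. \<forall>N\<in>?S. mm K M N = mm K N M}"
  proof (intro equalityI subsetI)
    fix T assume "T \<in> {M \<in> mats K. \<forall>N\<in>?S. mm K M N = mm K N M}"
    then have T: "T \<in> mats K" "\<And>N. N \<in> ?S \<Longrightarrow> mm K T N = mm K N T" by auto
    show "T \<in> ?M"
    proof (rule double_commutant[OF finK Msub MK Mone, of invariance_tests])
      show "invariance_tests \<subseteq> mats K" using XM MK by blast
      show "mm K x a \<in> ?M" if "x \<in> invariance_tests" "a \<in> ?M" for x a
        using that XM by (intro Mmult) blast+
      show "mm K (star x) a \<in> ?M" if "x \<in> invariance_tests" "a \<in> ?M" for x a
        using star_tests[OF that(1)] that(2) XM by (intro Mmult) blast+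
      show "T \<in> mats K" by (rule T)
      show "mm K T N = mm K N T" if "N \<in> mats K" "\<And>x. x \<in> invariance_tests \<Longrightarrow> mm K x N = mm K N x" for N
        using that by (intro T(2) span)
    qed
  qed (use MK comm in blast)
  then show "?i = ?ii" unfolding imA imB Tens_V T.centralizer_mat_op[OF SK] by simp
  have "?S = {M \<in> mats K. \<forall>N\<in>group_mat \<tau> ` carrier (TW n). mm K M N = mm K N M}"
  proof (intro equalityI subsetI)
    fix N assume N: "N \<in> {M \<in> mats K. \<forall>N\<in>group_mat \<tau> ` carrier (TW n). mm K M N = mm K N M}"
    have "mm K x N = mm K N x" if "x \<in> ?M" for x
      using that unfolding group_mats_def
    proof (induction rule: cfun.span_induct_alt)
      case (step c x y)
      then have "mm K x N = mm K N x" using N by auto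
      then show ?case using step.IH by (simp only: mm_linear)
    qed (simp only: mm_linear)
    then show "N \<in> ?S" using N XM by (intro span) auto
  next
    fix N assume "N \<in> ?S"
    then show "N \<in> {M \<in> mats K. \<forall>N\<in>group_mat \<tau> ` carrier (TW n). mm K M N = mm K N M}"
      using SK GM comm by auto
  qed
  then show "?iii = ?iv" unfolding imB imG Tens_V T.centralizer_mat_op[OF GK] by simp
  have finB: "fin_supp (pb_diagrams r) = supported (pb_diagrams r)"
    by (auto simp: fin_supp_def supported_def intro: finite_subset[OF _ finite_pb_diagrams])
  have lin: "lin ?D a = (\<Sum>d\<in>pb_diagrams r. a d *\<^sub>v ?D d)" if "a \<in> supported (pb_diagrams r)" for a
    using that by (intro lin_superset finite_pb_diagrams) (auto simp: supported_def)
  have eq: "\<rho> a = \<rho> b \<longleftrightarrow> lin ?D a = lin ?D b" if "a \<in> fin_supp (pb_diagrams r)" "b \<in> fin_supp (pb_diagrams r)" for a b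
  proof -
    have "lin ?D a \<in> mats K" "lin ?D b \<in> mats K" using that SK unfolding lin_image[symmetric] by blast+
    then show ?thesis unfolding \<rho>[OF that(1)] \<rho>[OF that(2)] by (rule T.mat_op_cong[symmetric])
  qed
  show "inj_on \<rho> (carrier ?B) \<longleftrightarrow> n > r"
  proof
    assume nr: "n > r"
    show "inj_on \<rho> (carrier ?B)" unfolding carB
    proof (rule inj_onI)
      fix a b assume ab: "a \<in> fin_supp (pb_diagrams r)" "b \<in> fin_supp (pb_diagrams r)" "\<rho> a = \<rho> b"
      have "(\<Sum>d\<in>pb_diagrams r. (a d - b d) *\<^sub>v ?D d) = lin ?D a - lin ?D b"
        using ab(1,2) unfolding finB by (simp only: lin cfun.scale_left_diff_distrib sum_subtractf)
      also have "\<dots> = 0" using ab(3) unfolding eq[OF ab(1,2)] by simp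
      finally have z: "(\<Sum>d\<in>pb_diagrams r. (a d - b d) *\<^sub>v ?D d) = 0" .
      have "a d = b d" if "d \<in> pb_diagrams r" for d
        using diag_mat_independent[OF nr t(2) z that] by simp
      then show "a = b" using ab(1,2) unfolding finB supported_def by fastforce
    qed
  next
    assume inj: "inj_on \<rho> (carrier ?B)"
    show "n > r"
    proof (rule ccontr)
      assume "\<not> n > r"
      then have nr: "n \<le> r" by simp
      obtain a where a: "(\<Sum>d\<in>pb_diagrams r. a d *\<^sub>v ?D d) = 0" "a (strands {1..r}) = 1"
        by (rule diag_mat_dependent[OF n1 nr t(2)])
      define b where "b d = (if d \<in> pb_diagrams r then a d else 0)" for d
      have b: "b \<in> fin_supp (pb_diagrams r)" unfolding finB by (simp add: supported_def b_def)
      have z: "0 \<in> fin_supp (pb_diagrams r)" by (rule cfun.subspace_0[OF fin_supp_subspace])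
      have "lin ?D b = (\<Sum>d\<in>pb_diagrams r. a d *\<^sub>v ?D d)"
        unfolding lin[OF b[unfolded finB]] by (intro sum.cong HOL.refl) (simp add: b_def)
      then have "lin ?D b = lin ?D 0" by (simp add: a lin_def)
      then have "\<rho> b = \<rho> 0" unfolding eq[OF b z] .
      then have "b = 0" using inj b z unfolding carB by (auto dest: inj_onD)
      then have "b (strands {1..r}) = 0" by simp
      then show False using a(2) strands_diagram by (simp add: b_def)
    qed
  qed
qed

end

theorem theorem8p6:
  fixes n r :: nat and q \<delta>' root_n :: complex and u :: "nat \<Rightarrow> nat \<Rightarrow> complex"
  assumes "n \<ge> 2" and "r \<ge> 1"
    and "q \<noteq> 0" and "q \<noteq> -1"
    and "qint q n \<noteq> 0" and "qfact q (n - 2) \<noteq> 0"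
    and "\<And>(k::int) (m::nat) l. m \<ge> 1 \<Longrightarrow> l = complex_of_real (cos (2 * of_int k * pi / of_nat m)) \<Longrightarrow>
           l \<noteq> -1 \<Longrightarrow>
           q \<noteq> (- l + csqrt (- 1 - 2 * l)) / (1 + l) \<and>
           q \<noteq> (- l - csqrt (- 1 - 2 * l)) / (1 + l)"
    and "\<delta>' \<noteq> 0"
    and "root_n ^ 2 = qint q n" and "u 0 = inverse root_n *\<^sub>v ell0 n"
    and "orthonormal_basis n q (sp_F n q) {1..<n} u"
  shows "(\<exists>\<tau> \<rho>. tw_pb_bimodule n q r \<delta>' u \<tau> \<rho>) \<and>
    (\<forall>\<tau> \<rho>. tw_pb_bimodule n q r \<delta>' u \<tau> \<rho> \<longrightarrow>
       tw_algebra_act n r \<tau> ` carrier (group_algebra (TW n)) =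
         centralizer (Tens n r) (\<rho> ` carrier (PB r (of_nat n) \<delta>')) \<and>
       \<rho> ` carrier (PB r (of_nat n) \<delta>') =
         centralizer (Tens n r) (tw_diag n r \<tau> ` carrier (TW n)) \<and>
       (inj_on \<rho> (carrier (PB r (of_nat n) \<delta>')) \<longleftrightarrow> n > r))"
proof -
  interpret twin_setting n r q root_n u
    by (unfold_locales; fact assms)
  \<comment> \<open>Either square root of \<open>\<delta>'\<close> serves as the weight of an isolated vertex.\<close>
  have t: "(csqrt \<delta>')\<^sup>2 = \<delta>'" "csqrt \<delta>' \<noteq> 0" using \<open>\<delta>' \<noteq> 0\<close> by simp_all
  show ?thesis
  proof (intro conjI allI impI)
    show "\<exists>\<tau> \<rho>. tw_pb_bimodule n q r \<delta>' u \<tau> \<rho>" by (rule bimodule_exists[OF t(1)])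
  qed (rule duality[OF _ t], assumption)+
qed

end
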